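(* Let $K$ be an algebraically closed field of arbitrary characteristic. Let $\widetilde{X}=S(a_1,\dots,a_n) \subseteq \mathbb{P}^{r+1}_K$ be a smooth rational normal scroll of codimension at least $2$, with $1\le a_1\le\dots\le a_n$, and let $S(\underline{1})$ and $\bigtriangleup$ be the subvarieties associated with $\widetilde{X}$ as described in the context. Let $$A := \langle S(\underline{1}) \rangle,\qquad B := \mathrm{Join}(S(\underline{1}),\widetilde{X}),\qquad U := \mathrm{Join}(A,\bigtriangleup).$$ Then $\widetilde{X} \subseteq B$, $A \subseteq B \cap U$, $B\cup U \subseteq \mathrm{Tan}(\widetilde{X})$ and (a) $SL^{\emptyset}(\widetilde{X}) = \mathbb{P}^{r+1}_K \setminus \mathrm{Sec}(\widetilde{X})$; (b) $SL^{q_1,q_2}(\widetilde{X}) = \mathrm{Sec}(\widetilde{X}) \setminus \mathrm{Tan}(\widetilde{X})$; (c) $SL^{2q}(\widetilde{X}) = \mathrm{Tan}(\widetilde{X}) \setminus (B \cup U)$; (d) $SL^{L_1\cup L_2}(\widetilde{X}) = B \setminus (A \cup \widetilde{X})$; (e) $SL^{C}(\widetilde{X}) = U \setminus B$; (f) $SL^{Q}(\widetilde{X}) = A \setminus \widetilde{X}$.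
   Context: Smooth rational normal scroll: given integers $1\le a_1\le\dots\le a_n$ ($n\ge1$), choose complementary linear subspaces $\Lambda_i\cong\mathbb{P}^{a_i}_K$ spanning $\mathbb{P}^{r+1}_K$, $r+1=a_1+\dots+a_n+n-1$, and embeddings $\phi_i:\mathbb{P}^1_K\to\Lambda_i$ as rational normal curves of degree $a_i$. Then $S(a_1,\dots,a_n)=\bigcup_{x\in\mathbb{P}^1_K}\langle\phi_1(x),\dots,\phi_n(x)\rangle$. Here $\langle\cdot\rangle$ denotes linear span. Codimension at least $2$ means $a_1+\dots+a_n\ge3$. Let $k$ be the number of indices $i$ with $a_i=1$ and let $m$ be the number of indices $i$ with $a_i\le2$, so $a_1=\dots=a_k=1$, $a_{k+1}=\dots=a_m=2$ and $a_i\ge3$ for $i>m$. Let $S(\underline{1})=\bigcup_x\langle\phi_1(x),\dots,\phi_k(x)\rangle\subset\mathbb{P}^{2k-1}_K$ and $S(\underline{2})=\bigcup_x\langle\phi_{k+1}(x),\dots,\phi_m(x)\rangle\subset\mathbb{P}^{3(m-k)-1}_K$ (possibly empty) be the corresponding subscrolls of $\widetilde{X}$. One has $S(\underline{2})\cong C\times\mathbb{P}^{m-k-1}_K$ for a smooth plane conic $C\subset\mathbb{P}^2_K$; for $\beta\in\mathbb{P}^{m-k-1}_K$ let $C_\beta$ be the smooth plane conic $C\times\{\beta\}\subset S(\underline{2})$. Explicitly, choosing coordinates on each $\Lambda_j\cong\mathbb{P}^2_K$ ($k<j\le m$) in which $\phi_j(s:t)=(s^2:st:t^2)$, $C_\beta$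 is the image of $(s:t)\mapsto(\beta_{j}\,(s^2,st,t^2))_{k<j\le m}$. Set $\bigtriangleup=\bigcup_{\beta\in\mathbb{P}^{m-k-1}_K}\langle C_\beta\rangle\cong\mathbb{P}^2_K\times\mathbb{P}^{m-k-1}_K\subset\mathbb{P}^{3(m-k)-1}_K$, a Segre variety (empty if $m=k$). $\mathrm{Join}(Y,Z)$ is the embedded join, i.e. the closure of the union of the lines $\langle y,z\rangle$ with $y\in Y$, $z\in Z$, $y\ne z$; if one of $Y,Z$ is empty, the join is the other one. $\mathrm{Sec}(\widetilde{X})$ is the closure of the union of chords joining pairs of distinct points of $\widetilde{X}$, and $\mathrm{Tan}(\widetilde{X})$ is the closure of the union of the (embedded projective) tangent spaces of $\widetilde{X}$. For a closed point $p\in\mathbb{P}^{r+1}_K\setminus\widetilde{X}$, the secant cone is $\mathrm{Sec}_p(\widetilde{X})=\bigcup_{q\in\widetilde{X},\ \mathrm{length}(\widetilde{X}\cap\langle p,q\rangle)\ge 2}\langle p,q\rangle$, with the convention $\mathrm{Sec}_p(\widetilde{X})=\{p\}$ if there is no such $q$. The secant locus $\Sigma_p(\widetilde{X})$ is the scheme-theoretic intersection of $\widetilde{X}$ and $\mathrm{Sec}_p(\widetilde{X})$. The strata are the following sets of closed points $p\in\mathbb{P}^{r+1}_K\setminus\widetilde{X}$: $SL^{\emptyset}(\widetilde{X})$: $\Sigma_p(\widetilde{X})=\emptyset$; $SL^{q_1,q_2}(\widetilde{X})$: $\Sigma_p(\widetilde{X})$ consists of two simple points; $SL^{2q}(\widetilde{X})$: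 $\Sigma_p(\widetilde{X})$ is a double point in some straight line $\mathbb{P}^1_K\subseteq\mathbb{P}^{r+1}_K$; $SL^{L_1\cup L_2}(\widetilde{X})$: $\Sigma_p(\widetilde{X})$ is the union of two distinct coplanar simple lines; $SL^{C}(\widetilde{X})$: $\Sigma_p(\widetilde{X})$ is a smooth plane conic; $SL^{Q}(\widetilde{X})$: $\Sigma_p(\widetilde{X})$ is a smooth quadric in a $3$-space. *)

theory Defs
  imports
    "HOL-Analysis.Cartesian_Space"
    "HOL-Library.Poly_Mapping"
    "HOL-Library.Extended_Nat"
    "HOL-Library.Liminf_Limsup"
    "HOL-Computational_Algebra.Polynomial"
begin

section \<open>Polynomials in the coordinates of \<open>K\<^sup>V\<close>\<close>

text \<open>
  The homogeneous coordinate ring of \<open>\<PP>(K\<^sup>V)\<close>: polynomials over \<open>'k\<close> with one variable for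
  each element of the finite type \<open>'v\<close>; the ring operations are those of \<^theory>\<open>HOL-Library.Poly_Mapping\<close>.
\<close>

type_synonym ('v, 'k) mpoly = "('v \<Rightarrow>\<^sub>0 nat) \<Rightarrow>\<^sub>0 'k"

definition mscale :: "'k::field \<Rightarrow> ('v, 'k) mpoly \<Rightarrow> ('v, 'k) mpoly" where
  "mscale c F = Poly_Mapping.map ((*) c) F"

lemma lookup_mscale: "Poly_Mapping.lookup (mscale c F) m = c * Poly_Mapping.lookup F m"
  by (simp add: mscale_def Poly_Mapping.map.rep_eq when_def)

interpretation mpoly: vector_space mscale
  by unfold_locales
    (auto intro!: poly_mapping_eqI simp: lookup_mscale lookup_add algebra_simps)

definition meval :: "('v::finite, 'k::field) mpoly \<Rightarrow> 'k ^ 'v \<Rightarrow> 'k" where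
  "meval F v = (\<Sum>m\<in>Poly_Mapping.keys F.
     Poly_Mapping.lookup F m * (\<Prod>i\<in>UNIV. (v $ i) ^ Poly_Mapping.lookup m i))"

definition homogeneous :: "nat \<Rightarrow> ('v::finite, 'k::field) mpoly \<Rightarrow> bool" where
  "homogeneous d F \<longleftrightarrow> (\<forall>m\<in>Poly_Mapping.keys F. (\<Sum>i\<in>UNIV. Poly_Mapping.lookup m i) = d)"

definition mpderiv :: "'v \<Rightarrow> ('v::finite, 'k::field) mpoly \<Rightarrow> ('v, 'k) mpoly" where
  "mpderiv i F = (\<Sum>m\<in>Poly_Mapping.keys F.
     Poly_Mapping.single (m - Poly_Mapping.single i 1)
       (of_nat (Poly_Mapping.lookup m i) * Poly_Mapping.lookup F m))"

definition dir_deriv :: "('v::finite, 'k::field) mpoly \<Rightarrow> 'k ^ 'v \<Rightarrow> 'k ^ 'v \<Rightarrow> 'k" where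
  "dir_deriv F v w = (\<Sum>i\<in>UNIV. meval (mpderiv i F) v * w $ i)"


section \<open>Projective space\<close>

text \<open>
  A (closed) point of \<open>\<PP>(K\<^sup>V)\<close> is a one-dimensional linear subspace of \<open>K\<^sup>V\<close>, so that
  \<open>\<PP>(K\<^sup>V)\<close> has dimension \<open>CARD('v) - 1\<close>.
\<close>

definition pt :: "'k::field ^ 'v::finite \<Rightarrow> ('k ^ 'v) set" where
  "pt v = vec.span {v}"

definition points :: "('k::field ^ 'v::finite) set set" where
  "points = {pt v | v. v \<noteq> 0}"

definition proj :: "('k::field ^ 'v::finite) set \<Rightarrow> ('k ^ 'v) set set" where
  "proj W = {q \<in> points. q \<subseteq> W}"

definition lin_hull :: "('k::field ^ 'v::finite) set set \<Rightarrow> ('k ^ 'v) set set" where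
  "lin_hull Y = proj (vec.span (\<Union>Y))"

text \<open>
  For an infinite field this is the homogeneous ideal generated by the forms vanishing on \<open>Y\<close>;
  for \<open>Y = {}\<close> it is the unit ideal.
\<close>

definition vanishing_ideal :: "('k::field ^ 'v::finite) set set \<Rightarrow> ('v, 'k) mpoly set" where
  "vanishing_ideal Y = {F. \<forall>q\<in>Y. \<forall>v\<in>q. meval F v = 0}"

definition zero_locus :: "('v::finite, 'k::field) mpoly set \<Rightarrow> ('k ^ 'v) set set" where
  "zero_locus J = {q \<in> points. \<forall>F\<in>J. \<forall>v\<in>q. meval F v = 0}"

definition zclosure :: "('k::field ^ 'v::finite) set set \<Rightarrow> ('k ^ 'v) set set" where
  "zclosure Y = zero_locus (vanishing_ideal Y)"

definition join :: "('k::field ^ 'v::finite) set set \<Rightarrow> ('k ^ 'v) set set \<Rightarrow> ('k ^ 'v) set set" where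
  "join Y Z = (if Y = {} then Z else if Z = {} then Y
     else zclosure (\<Union>{lin_hull {y, z} | y z. y \<in> Y \<and> z \<in> Z \<and> y \<noteq> z}))"

definition Sec :: "('k::field ^ 'v::finite) set set \<Rightarrow> ('k ^ 'v) set set" where
  "Sec X = zclosure (\<Union>{lin_hull {x, y} | x y. x \<in> X \<and> y \<in> X \<and> x \<noteq> y})"

definition tangent_space ::
  "('k::field ^ 'v::finite) set set \<Rightarrow> ('k ^ 'v) set \<Rightarrow> ('k ^ 'v) set set" where
  "tangent_space X q =
     proj {w. \<forall>F\<in>vanishing_ideal X. \<forall>v\<in>q. v \<noteq> 0 \<longrightarrow> dir_deriv F v w = 0}"

definition Tan :: "('k::field ^ 'v::finite) set set \<Rightarrow> ('k ^ 'v) set set" where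
  "Tan X = zclosure (\<Union>q\<in>X. tangent_space X q)"


section \<open>Closed subschemes\<close>

text \<open>
  A closed subscheme of \<open>\<PP>(K\<^sup>V)\<close> is represented by a homogeneous ideal \<open>J\<close> defining it. Two
  homogeneous ideals define the same subscheme iff they agree in all large degrees. A closed set
  \<open>Y\<close> with its reduced structure is represented by \<open>vanishing_ideal Y\<close>, and scheme-theoretic
  intersection by the sum of ideals.
\<close>

definition subscheme :: "('v::finite, 'k::field) mpoly set \<Rightarrow> ('v, 'k) mpoly set \<Rightarrow> bool" where
  "subscheme I J \<longleftrightarrow> (\<exists>d0. \<forall>d\<ge>d0. \<forall>F. homogeneous d F \<and> F \<in> J \<longrightarrow> F \<in> I)"

definition same_scheme :: "('v::finite, 'k::field) mpoly set \<Rightarrow> ('v, 'k) mpoly set \<Rightarrow> bool" where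
  "same_scheme I J \<longleftrightarrow> subscheme I J \<and> subscheme J I"

definition scheme_inter ::
  "('v::finite, 'k::field) mpoly set \<Rightarrow> ('v, 'k) mpoly set \<Rightarrow> ('v, 'k) mpoly set" where
  "scheme_inter I J = {F + G | F G. F \<in> I \<and> G \<in> J}"

text \<open>
  \<open>hilbert_function J d\<close> is the dimension of the degree \<open>d\<close> part of the quotient by \<open>J\<close>.
  For a finite scheme \<open>Z\<close> it is equal to \<open>dim H\<^sup>0(Z, O\<^sub>Z)\<close>, the length of \<open>Z\<close>, for all large \<open>d\<close>;
  for a scheme of positive dimension it tends to \<open>\<infinity>\<close>.
\<close>

definition hilbert_function :: "('v::finite, 'k::field) mpoly set \<Rightarrow> nat \<Rightarrow> nat" where
  "hilbert_function J d =
     mpoly.dim {F :: ('v, 'k) mpoly. homogeneous d F} - mpoly.dim {F \<in> J. homogeneous d F}"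

definition scheme_length :: "('v::finite, 'k::field) mpoly set \<Rightarrow> enat" where
  "scheme_length J = liminf (\<lambda>d. enat (hilbert_function J d))"

text \<open>
  \<open>J\<close> defines a smooth quadric hypersurface of the projective space \<open>\<PP>(W)\<close>: its ideal is that of
  \<open>\<PP>(W)\<close> together with a quadratic form \<open>F\<close>, and the restriction of \<open>F\<close> to \<open>W\<close> satisfies the
  Jacobian criterion at each of its zeros (in characteristic \<open>2\<close>, singular points have to be
  required to lie on the quadric).
\<close>

definition smooth_quadric_in ::
  "('k::field ^ 'v::finite) set \<Rightarrow> ('v, 'k) mpoly set \<Rightarrow> bool" where
  "smooth_quadric_in W J \<longleftrightarrow> (\<exists>F. homogeneous 2 F \<and>
     same_scheme J {G + H * F | G H. G \<in> vanishing_ideal (proj W)} \<and>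
     (\<forall>v\<in>W. v \<noteq> 0 \<and> meval F v = 0 \<longrightarrow> (\<exists>w\<in>W. dir_deriv F v w \<noteq> 0)))"


section \<open>Rational normal scrolls\<close>

text \<open>
  \<open>\<phi> : \<PP>\<^sup>1 \<rightarrow> \<PP>(\<Lambda>)\<close> is an embedding as a rational normal curve of degree \<open>d\<close>, and \<open>b 0, \<dots>, b d\<close> is a
  basis of \<open>\<Lambda>\<close> in which \<open>\<phi>(s:t) = (s\<^sup>d : s\<^sup>d\<^sup>-\<^sup>1t : \<dots> : t\<^sup>d)\<close>.
\<close>

definition rational_normal_curve ::
  "nat \<Rightarrow> ('k::field ^ 'v::finite) set \<Rightarrow> (nat \<Rightarrow> 'k ^ 'v) \<Rightarrow> (('k ^ 2) set \<Rightarrow> ('k ^ 'v) set) \<Rightarrow> bool"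
  where
  "rational_normal_curve d \<Lambda> b \<phi> \<longleftrightarrow>
     inj_on b {..d} \<and> vec.independent (b ` {..d}) \<and> vec.span (b ` {..d}) = \<Lambda> \<and>
     (\<forall>u. u \<noteq> 0 \<longrightarrow> \<phi> (pt u) = pt (\<Sum>l\<le>d. ((u $ 1) ^ (d - l) * (u $ 2) ^ l) *s b l))"

definition scroll ::
  "nat set \<Rightarrow> (nat \<Rightarrow> ('k::field ^ 2) set \<Rightarrow> ('k ^ 'v::finite) set) \<Rightarrow> ('k ^ 'v) set set" where
  "scroll I \<phi> = (\<Union>x\<in>points. lin_hull ((\<lambda>i. \<phi> i x) ` I))"

text \<open>The conic \<open>C\<^sub>\<beta>\<close>, where \<open>(\<beta>\<^sub>j)\<close>, \<open>j \<in> I\<close>, are homogeneous coordinates of \<open>\<beta>\<close>.\<close>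

definition conic ::
  "nat set \<Rightarrow> (nat \<Rightarrow> nat \<Rightarrow> 'k::field ^ 'v::finite) \<Rightarrow> (nat \<Rightarrow> 'k) \<Rightarrow> ('k ^ 'v) set set" where
  "conic I b \<beta> = {pt (\<Sum>j\<in>I. \<beta> j *s (s\<^sup>2 *s b j 0 + (s * t) *s b j 1 + t\<^sup>2 *s b j 2))
     | s t. (s, t) \<noteq> (0, 0)}"

definition conic_planes ::
  "nat set \<Rightarrow> (nat \<Rightarrow> nat \<Rightarrow> 'k::field ^ 'v::finite) \<Rightarrow> ('k ^ 'v) set set" where
  "conic_planes I b = \<Union>{lin_hull (conic I b \<beta>) | \<beta>. \<exists>j\<in>I. \<beta> j \<noteq> 0}"


section \<open>Secant loci and their stratification\<close>

definition secant_points ::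
  "('k::field ^ 'v::finite) set set \<Rightarrow> ('k ^ 'v) set \<Rightarrow> ('k ^ 'v) set set" where
  "secant_points X p = {q \<in> X.
     scheme_length (scheme_inter (vanishing_ideal X) (vanishing_ideal (lin_hull {p, q}))) \<ge> 2}"

definition secant_cone ::
  "('k::field ^ 'v::finite) set set \<Rightarrow> ('k ^ 'v) set \<Rightarrow> ('k ^ 'v) set set" where
  "secant_cone X p = (if secant_points X p = {} then {p}
     else (\<Union>q\<in>secant_points X p. lin_hull {p, q}))"

definition secant_locus ::
  "('k::field ^ 'v::finite) set set \<Rightarrow> ('k ^ 'v) set \<Rightarrow> ('v, 'k) mpoly set" where
  "secant_locus X p = scheme_inter (vanishing_ideal X) (vanishing_ideal (secant_cone X p))"

definition SL_empty :: "('k::field ^ 'v::finite) set set \<Rightarrow> ('k ^ 'v) set set" where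
  "SL_empty X = {p \<in> points - X. same_scheme (secant_locus X p) (vanishing_ideal {})}"

definition SL_two_points :: "('k::field ^ 'v::finite) set set \<Rightarrow> ('k ^ 'v) set set" where
  "SL_two_points X = {p \<in> points - X. \<exists>q1\<in>points. \<exists>q2\<in>points. q1 \<noteq> q2 \<and>
     same_scheme (secant_locus X p) (vanishing_ideal {q1, q2})}"

definition SL_double_point :: "('k::field ^ 'v::finite) set set \<Rightarrow> ('k ^ 'v) set set" where
  "SL_double_point X = {p \<in> points - X. \<exists>W q. vec.subspace W \<and> vec.dim W = 2 \<and>
     subscheme (secant_locus X p) (vanishing_ideal (proj W)) \<and>
     zero_locus (secant_locus X p) = {q} \<and> scheme_length (secant_locus X p) = 2}"

definition SL_line_pair :: "('k::field ^ 'v::finite) set set \<Rightarrow> ('k ^ 'v) set set" where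
  "SL_line_pair X = {p \<in> points - X. \<exists>W1 W2 E.
     vec.subspace W1 \<and> vec.dim W1 = 2 \<and> vec.subspace W2 \<and> vec.dim W2 = 2 \<and> W1 \<noteq> W2 \<and>
     vec.subspace E \<and> vec.dim E = 3 \<and> W1 \<subseteq> E \<and> W2 \<subseteq> E \<and>
     same_scheme (secant_locus X p) (vanishing_ideal (proj W1 \<union> proj W2))}"

definition SL_conic :: "('k::field ^ 'v::finite) set set \<Rightarrow> ('k ^ 'v) set set" where
  "SL_conic X = {p \<in> points - X. \<exists>W. vec.subspace W \<and> vec.dim W = 3 \<and>
     smooth_quadric_in W (secant_locus X p)}"

definition SL_quadric :: "('k::field ^ 'v::finite) set set \<Rightarrow> ('k ^ 'v) set set" where
  "SL_quadric X = {p \<in> points - X. \<exists>W. vec.subspace W \<and> vec.dim W = 4 \<and>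
     smooth_quadric_in W (secant_locus X p)}"

end

theory Submission
  imports Defs
begin

text \<open>
  Each block \<open>\<Lambda>\<^sub>i\<close> is the dual of the space of binary forms of degree
  \<open>a\<^sub>i\<close>, so that binary forms act on the vectors \<open>v\<close> of
  \<open>K\<^sup>V\<close> by contraction. The cone over \<open>X\<close> consists of the vectors that are
  annihilated by a nonzero linear form, and the two-by-two minors of the matrix with columns \<open>(x i l v,
  x i (l + 1) v)\<close> cut it out. A point \<open>p = pt v\<close> lies on a chord joining the fibres of
  \<open>X\<close> over two points of \<open>\<PP>\<^sup>1\<close> if and only if the product of the linear
  forms vanishing at these points annihilates \<open>v\<close>, and on a tangent space if and only if the
  square of a linear form does. Thus \<open>Sec X\<close> is the set of points with a nonzero annihilating
  quadratic form (\<open>Sec_eq\<close>), and \<open>Tan X\<close> that of the points annihilated by a square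
  (\<open>Tan_eq\<close>). Determinants and resultants show that these sets are closed.

  If there are two independent annihilating forms, then all triples of consecutive coordinates of
  \<open>v\<close> are multiples of one triple (\<open>two_annihilators\<close>), and either the blocks of
  degree at least \<open>2\<close> lie over one point, which means \<open>p \<in> B\<close>, or those of
  degree at least \<open>3\<close> vanish and those of degree \<open>2\<close> are proportional, which means
  \<open>p \<in> U\<close>. All quadratic forms annihilate \<open>v\<close> if and only if \<open>p \<in>
  A\<close>. Off \<open>B \<union> U\<close> the annihilating form is unique up to a factor if it exists, and
  it has two zeros or is a square. A secant point of \<open>p\<close> over \<open>u\<close> is determined by
  the contraction of \<open>v\<close> with the other factor of the annihilating form
  (\<open>secant_point_conjugate\<close>). As \<open>u\<close> varies, these points fill two points, one
  point, two lines, a conic or a quadric surface, and they always lie in a linear space \<open>W\<close>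
  through \<open>p\<close>, of dimension \<open>1\<close>, \<open>1\<close>, \<open>2\<close>,
  \<open>2\<close> or \<open>3\<close>.

  The scheme structure can be found without generators of the ideal of \<open>X\<close>. Some quadric
  \<open>Q\<close> through \<open>X\<close> does not contain \<open>p\<close>, and it vanishes on the secant
  points. In \<open>W\<close> these form a quadric hypersurface, which is therefore \<open>Q = 0\<close>. As
  every polynomial that vanishes on \<open>X\<close> is divisible by \<open>Q\<close> on \<open>W\<close>, the
  secant cone is \<open>W\<close> and the secant locus is the subscheme \<open>Q = 0\<close> of
  \<open>W\<close>: this is the locale \<open>quadric_section\<close>. The divisibility follows from
  \<open>divisible_by_product\<close> and \<open>divisible_by_quadric\<close> for reduced quadrics, and from
  tangency for double points.

  The strata on the right-hand sides are disjoint and exhaust the points off \<open>X\<close>. Since a point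
  of each of them has the asserted type, it remains to see that the types exclude each other. They differ in
  the dimension of the span of the secant locus, except for line pairs and conics, and a smooth conic contains
  no line.
\<close>

section \<open>Polynomial functions\<close>

lemma infinite_UNIV_alg_closed: "infinite (UNIV :: 'k::alg_closed_field set)"
proof
  assume fin: "finite (UNIV :: 'k set)"
  define P :: "'k poly" where "P = (\<Prod>c\<in>UNIV. [:- c, 1:]) + 1"
  have "poly P c = 1" for c
    using fin by (simp add: P_def poly_prod prod_zero_iff)
  moreover have "degree P > 0"
  proof -
    have d: "degree (\<Prod>c\<in>(UNIV::'k set). [:- c, 1:]) = card (UNIV :: 'k set)"
      by (subst degree_prod_eq_sum_degree) auto
    have "card (UNIV :: 'k set) > 0"
      using fin by (simp add: card_gt_0_iff)
    then show ?thesis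
      using d by (simp add: P_def degree_add_eq_left)
  qed
  ultimately show False
    using alg_closed_imp_poly_has_root[of P] by (metis zero_neq_one)
qed

lemma poly_zero_if_zero_off_0:
  fixes p :: "'k::alg_closed_field poly"
  assumes "\<And>e. e \<noteq> 0 \<Longrightarrow> poly p e = 0"
  shows "p = 0"
proof (rule ccontr)
  assume "p \<noteq> 0"
  then have "finite {e. poly p e = 0}" by (rule poly_roots_finite)
  moreover have "UNIV - {0} \<subseteq> {e. poly p e = 0}" using assms by auto
  ultimately have "finite (UNIV - {0 :: 'k})" by (rule rev_finite_subset)
  then show False by (simp add: infinite_UNIV_alg_closed)
qed

lemma quadratic_root:
  fixes A B C :: "'k::alg_closed_field"
  assumes "A \<noteq> 0"
  shows "\<exists>z. A * z\<^sup>2 + B * z + C = 0"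
proof -
  have "degree [:C, B, A:] > 0" using assms by simp
  then obtain z where "poly [:C, B, A:] z = 0"
    using alg_closed_imp_poly_has_root by blast
  then show ?thesis
    by (intro exI[of _ z]) (simp add: algebra_simps power2_eq_square)
qed

text \<open>
  Divisions are carried out on polynomial functions, where restricting to a linear space means
  composing with a projection. As \<open>K\<close> is infinite, nothing is lost: \<open>polyfun_imp_meval\<close> leads back
  to polynomials.
\<close>

inductive polyfun :: "('k::field ^ 'v::finite \<Rightarrow> 'k) \<Rightarrow> bool" where
  const: "polyfun (\<lambda>v. c)"
| coord: "polyfun (\<lambda>v. v $ i)"
| add: "polyfun f \<Longrightarrow> polyfun g \<Longrightarrow> polyfun (\<lambda>v. f v + g v)"
| mult: "polyfun f \<Longrightarrow> polyfun g \<Longrightarrow> polyfun (\<lambda>v. f v * g v)"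

lemma polyfun_minus: "polyfun f \<Longrightarrow> polyfun (\<lambda>v. - f v)"
  using polyfun.mult[OF polyfun.const[of "-1"], of f] by simp

lemma polyfun_diff: "polyfun f \<Longrightarrow> polyfun g \<Longrightarrow> polyfun (\<lambda>v. f v - g v)"
  using polyfun.add[OF _ polyfun_minus, of f g] by simp

lemma polyfun_power: "polyfun f \<Longrightarrow> polyfun (\<lambda>v. f v ^ n)"
  by (induction n) (auto intro: polyfun.intros)

lemma polyfun_sum: "(\<And>i. i \<in> I \<Longrightarrow> polyfun (f i)) \<Longrightarrow> polyfun (\<lambda>v. \<Sum>i\<in>I. f i v)"
  by (induction I rule: infinite_finite_induct) (auto intro: polyfun.intros)

lemma polyfun_prod: "(\<And>i. i \<in> I \<Longrightarrow> polyfun (f i)) \<Longrightarrow> polyfun (\<lambda>v. \<Prod>i\<in>I. f i v)"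
  by (induction I rule: infinite_finite_induct) (auto intro: polyfun.intros)

lemma polyfun_compose:
  assumes "polyfun f" "\<And>i. polyfun (\<lambda>v. g v $ i)"
  shows "polyfun (\<lambda>v. f (g v))"
  using assms by induction (auto intro: polyfun.intros)

lemma polyfun_along_curve:
  fixes f :: "'k::field ^ 'v::finite \<Rightarrow> 'k"
  assumes "polyfun f"
  shows "\<exists>P. \<forall>e. poly P e = f (\<chi> i. poly (x i) e)"
  using assms
proof induction
  case (const c)
  then show ?case by (intro exI[of _ "[:c:]"]) simp
next
  case (coord i)
  then show ?case by (intro exI[of _ "x i"]) simp
next
  case (add f g)
  then obtain P Q where "\<forall>e. poly P e = f (\<chi> i. poly (x i) e)" "\<forall>e. poly Q e = g (\<chi> i. poly (x i) e)"
    by blast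
  then show ?case by (intro exI[of _ "P + Q"]) simp
next
  case (mult f g)
  then obtain P Q where "\<forall>e. poly P e = f (\<chi> i. poly (x i) e)" "\<forall>e. poly Q e = g (\<chi> i. poly (x i) e)"
    by blast
  then show ?case by (intro exI[of _ "P * Q"]) simp
qed

lemma polyfun_along_line:
  fixes f :: "'k::field ^ 'v::finite \<Rightarrow> 'k"
  assumes "polyfun f"
  shows "\<exists>P. \<forall>e. poly P e = f (v + e *s w)"
proof -
  obtain P where "\<forall>e. poly P e = f (\<chi> i. poly [:v $ i, w $ i:] e)"
    using polyfun_along_curve[OF assms, of "\<lambda>i. [:v $ i, w $ i:]"] by blast
  moreover have "(\<chi> i. poly [:v $ i, w $ i:] e) = v + e *s w" for e
    by (simp add: vec_eq_iff)
  ultimately show ?thesis by auto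
qed

text \<open>
  The substitute for limits: in any characteristic, a polynomial function that vanishes on a line
  except perhaps at one point vanishes at this point, too.
\<close>

lemma polyfun_zero_limit:
  fixes f :: "'k::alg_closed_field ^ 'v::finite \<Rightarrow> 'k"
  assumes "polyfun f" "\<And>e. e \<noteq> 0 \<Longrightarrow> f (v + e *s w) = 0"
  shows "f v = 0"
proof -
  obtain P where P: "\<forall>e. poly P e = f (v + e *s w)"
    using polyfun_along_line[OF assms(1)] by blast
  then have "P = 0" using assms(2) by (intro poly_zero_if_zero_off_0) auto
  then show ?thesis using spec[OF P, of 0] by simp
qed

text \<open>
  Restricted to the line through \<open>v\<close> and \<open>v0\<close>, the product is zero in the integral domain \<open>K[e]\<close>.
\<close>

lemma polyfun_cancel:
  fixes f g :: "'k::alg_closed_field ^ 'v::finite \<Rightarrow> 'k"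
  assumes "polyfun f" "polyfun g" "\<And>v. f v * g v = 0" "g v0 \<noteq> 0"
  shows "f v = 0"
proof -
  obtain P where P: "\<forall>e. poly P e = f (v + e *s (v0 - v))"
    using polyfun_along_line[OF assms(1)] by blast
  obtain Q where Q: "\<forall>e. poly Q e = g (v + e *s (v0 - v))"
    using polyfun_along_line[OF assms(2)] by blast
  have "poly (P * Q) e = 0" for e using P Q assms(3) by simp
  then have "P * Q = 0" by (intro poly_zero_if_zero_off_0)
  moreover have "poly Q 1 \<noteq> 0" using Q assms(4) by simp
  then have "Q \<noteq> 0" by auto
  ultimately have "P = 0" by simp
  then show ?thesis using spec[OF P, of 0] by simp
qed


section \<open>Linear forms\<close>

definition linear_form :: "('k::field ^ 'v::finite \<Rightarrow> 'k) \<Rightarrow> bool" where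
  "linear_form y \<longleftrightarrow> (\<forall>v w. y (v + w) = y v + y w) \<and> (\<forall>c v. y (c *s v) = c * y v)"

lemma linear_form_add: "linear_form y \<Longrightarrow> y (v + w) = y v + y w"
  and linear_form_scale: "linear_form y \<Longrightarrow> y (c *s v) = c * y v"
  by (simp_all add: linear_form_def)

lemma linear_form_0: "linear_form y \<Longrightarrow> y 0 = 0"
  using linear_form_scale[of y 0 0] by simp

lemma linear_form_diff: "linear_form y \<Longrightarrow> y (v - w) = y v - y w"
  using linear_form_add[of y v "(-1) *s w"] linear_form_scale[of y "-1" w] by simp

lemma linear_form_sum: "linear_form y \<Longrightarrow> y (\<Sum>i\<in>I. f i) = (\<Sum>i\<in>I. y (f i))"
  by (induction I rule: infinite_finite_induct) (auto simp: linear_form_0 linear_form_add)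

lemmas linear_form_simps = linear_form_add linear_form_scale linear_form_diff linear_form_0

lemma linear_form_plus: "linear_form y \<Longrightarrow> linear_form z \<Longrightarrow> linear_form (\<lambda>v. y v + z v)"
  by (simp add: linear_form_def algebra_simps)

lemma linear_form_times: "linear_form y \<Longrightarrow> linear_form (\<lambda>v. c * y v)"
  by (simp add: linear_form_def algebra_simps)

lemma linear_form_expand:
  assumes "linear_form y"
  shows "y v = (\<Sum>i\<in>UNIV. v $ i * y (axis i 1))"
proof -
  have "y v = y (\<Sum>i\<in>UNIV. v $ i *s axis i 1)" by (simp add: basis_expansion)
  also have "\<dots> = (\<Sum>i\<in>UNIV. v $ i * y (axis i 1))"
    using assms by (simp add: linear_form_sum linear_form_scale)
  finally show ?thesis .
qed

lemma polyfun_linear_form: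
  assumes "linear_form y"
  shows "polyfun y"
proof -
  have "polyfun (\<lambda>v. \<Sum>i\<in>UNIV. v $ i * y (axis i 1))"
    by (intro polyfun_sum polyfun.intros)
  then show ?thesis using linear_form_expand[OF assms] by (metis (no_types, lifting) ext)
qed

lemma dual_linear_form:
  fixes S :: "('k::field ^ 'v::finite) set"
  assumes "vec.independent S" "e \<in> S"
  shows "\<exists>y. linear_form y \<and> (\<forall>w\<in>S. y w = (if w = e then 1 else 0))"
proof -
  define Bs where "Bs = vec.extend_basis S"
  have ind: "vec.independent Bs" and sp: "vec.span Bs = UNIV" and sub: "S \<subseteq> Bs"
    using assms by (simp_all add: Bs_def vec.independent_extend_basis vec.extend_basis_superset)
  have "linear_form (\<lambda>v. vec.representation Bs v e)"
    using ind sp by (simp add: linear_form_def vec.representation_add vec.representation_scale)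
  moreover have "vec.representation Bs w e = (if w = e then 1 else 0)" if "w \<in> S" for w
    using vec.representation_basis[OF ind, of w] that sub by auto
  ultimately show ?thesis by blast
qed

lemma separating_linear_form:
  fixes S :: "('k::field ^ 'v::finite) set"
  assumes "v \<notin> vec.span S"
  shows "\<exists>y. linear_form y \<and> y v = 1 \<and> (\<forall>w\<in>vec.span S. y w = 0)"
proof -
  obtain T where T: "T \<subseteq> S" "vec.independent T" "S \<subseteq> vec.span T"
    using vec.maximal_independent_subset by blast
  have sp: "vec.span T = vec.span S"
    using T by (metis vec.span_mono vec.span_span subset_antisym)
  have "vec.independent (insert v T)"
    using T sp assms vec.independent_insert by metis
  then obtain y where y: "linear_form y" "\<forall>w\<in>insert v T. y w = (if w = v then 1 else 0)"
    using dual_linear_form[of "insert v T" v] by blast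
  have v: "v \<notin> T" using assms sp vec.span_base by blast
  have "y w = 0" if "w \<in> vec.span T" for w
    using that
  proof (induction rule: vec.span_induct_alt)
    case base
    then show ?case using y by (simp add: linear_form_0)
  next
    case (step c x w)
    then show ?case using y v by (auto simp: linear_form_simps)
  qed
  then show ?thesis using y sp by auto
qed

lemma polyfun_project:
  assumes "polyfun f" "linear_form y"
  shows "polyfun (\<lambda>v. f (v - y v *s z))"
proof (rule polyfun_compose[OF assms(1)])
  fix i
  have "polyfun (\<lambda>v. v $ i - y v * z $ i)"
    by (rule polyfun_diff[OF polyfun.coord polyfun.mult[OF polyfun_linear_form[OF assms(2)] polyfun.const]])
  then show "polyfun (\<lambda>v. (v - y v *s z) $ i)" by simp
qed

text \<open>
  A difference quotient in direction \<open>z\<close>. It is mostly used with \<open>y z = 1\<close>, when \<open>v - y v *s z\<close> is a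
  projection to the hyperplane \<open>y = 0\<close>: if \<open>f\<close> vanishes there, then \<open>y\<close> divides \<open>f\<close>.
\<close>

lemma polyfun_divide:
  fixes f :: "'k::field ^ 'v::finite \<Rightarrow> 'k"
  assumes "polyfun f" and y: "linear_form y"
  shows "\<exists>h. polyfun h \<and> (\<forall>v. f v = f (v - y v *s z) + y v * h v)"
  using assms(1)
proof induction
  case (const c)
  then show ?case by (intro exI[of _ "\<lambda>v. 0"]) (auto intro: polyfun.intros)
next
  case (coord i)
  then show ?case
    by (intro exI[of _ "\<lambda>v. z $ i"]) (auto intro: polyfun.intros)
next
  case (add f g)
  then obtain h k where hk: "polyfun h" "\<And>v. f v = f (v - y v *s z) + y v * h v"
      "polyfun k" "\<And>v. g v = g (v - y v *s z) + y v * k v" by blast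
  have "f v + g v = f (v - y v *s z) + g (v - y v *s z) + y v * (h v + k v)" for v
    by (subst hk(2), subst hk(4)) (simp only: algebra_simps)
  then show ?case
    by (intro exI[of _ "\<lambda>v. h v + k v"] conjI polyfun.add hk(1,3)) blast
next
  case (mult f g)
  then obtain h k where hk: "polyfun h" "\<And>v. f v = f (v - y v *s z) + y v * h v"
      "polyfun k" "\<And>v. g v = g (v - y v *s z) + y v * k v" by blast
  have pf: "polyfun (\<lambda>v. f (v - y v *s z))"
    by (rule polyfun_project[OF mult(1) y])
  have "f v * g v = f (v - y v *s z) * g (v - y v *s z)
      + y v * (h v * g v + f (v - y v *s z) * k v)" for v
  proof -
    have "f v * g v = (f (v - y v *s z) + y v * h v) * g v" using hk(2)[of v] by simp
    also have "\<dots> = f (v - y v *s z) * (g (v - y v *s z) + y v * k v) + y v * h v * g v"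
      using hk(4)[of v] by (simp add: algebra_simps)
    finally show ?thesis by (simp add: algebra_simps)
  qed
  moreover have "polyfun (\<lambda>v. h v * g v + f (v - y v *s z) * k v)"
    by (intro polyfun.add polyfun.mult hk(1,3) mult(1,2) pf)
  ultimately show ?case by blast
qed

section \<open>Evaluation of polynomials\<close>

lemma meval_superset:
  assumes "finite S" "Poly_Mapping.keys F \<subseteq> S"
  shows "meval F v = (\<Sum>m\<in>S. Poly_Mapping.lookup F m * (\<Prod>i\<in>UNIV. (v $ i) ^ Poly_Mapping.lookup m i))"
  unfolding meval_def using assms by (intro sum.mono_neutral_left) (auto simp: in_keys_iff)

lemma meval_zero [simp]: "meval 0 v = 0"
  by (simp add: meval_def)

lemma meval_add [simp]: "meval (F + G) v = meval F v + meval G v"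
proof -
  let ?S = "Poly_Mapping.keys F \<union> Poly_Mapping.keys G"
  have "meval (F + G) v = (\<Sum>m\<in>?S. Poly_Mapping.lookup (F + G) m * (\<Prod>i\<in>UNIV. (v $ i) ^ Poly_Mapping.lookup m i))"
    using keys_add[of F G] by (intro meval_superset) auto
  moreover have "meval F v = (\<Sum>m\<in>?S. Poly_Mapping.lookup F m * (\<Prod>i\<in>UNIV. (v $ i) ^ Poly_Mapping.lookup m i))"
    and "meval G v = (\<Sum>m\<in>?S. Poly_Mapping.lookup G m * (\<Prod>i\<in>UNIV. (v $ i) ^ Poly_Mapping.lookup m i))"
    by (intro meval_superset; auto)+
  ultimately show ?thesis by (simp add: lookup_add algebra_simps sum.distrib)
qed

lemma meval_sum [simp]: "meval (\<Sum>i\<in>I. F i) v = (\<Sum>i\<in>I. meval (F i) v)"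
  by (induction I rule: infinite_finite_induct) auto

lemma meval_single:
  "meval (Poly_Mapping.single m c) v = c * (\<Prod>i\<in>UNIV. (v $ i) ^ Poly_Mapping.lookup m i)"
  using meval_superset[of "{m}" "Poly_Mapping.single m c" v] by simp

lemma sum_monomials: "(\<Sum>m\<in>Poly_Mapping.keys F. Poly_Mapping.single m (Poly_Mapping.lookup F m)) = F"
  by (rule poly_mapping_eqI) (auto simp: lookup_sum lookup_single when_def in_keys_iff)

lemma meval_mult [simp]: "meval (F * G) v = meval F v * meval G v"
proof -
  have single: "meval (Poly_Mapping.single m c * Poly_Mapping.single k d) v =
      meval (Poly_Mapping.single m c) v * meval (Poly_Mapping.single k d) v" for m k c d
    by (simp add: mult_single meval_single lookup_add power_add prod.distrib algebra_simps)
  have "F * G = (\<Sum>m\<in>Poly_Mapping.keys F. Poly_Mapping.single m (Poly_Mapping.lookup F m))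
      * (\<Sum>m\<in>Poly_Mapping.keys G. Poly_Mapping.single m (Poly_Mapping.lookup G m))"
    by (simp add: sum_monomials)
  also have "meval \<dots> v = meval (\<Sum>m\<in>Poly_Mapping.keys F. Poly_Mapping.single m (Poly_Mapping.lookup F m)) v
      * meval (\<Sum>m\<in>Poly_Mapping.keys G. Poly_Mapping.single m (Poly_Mapping.lookup G m)) v"
    by (simp add: sum_product single)
  finally show ?thesis by (simp only: sum_monomials)
qed

lemma meval_uminus [simp]: "meval (- F) v = - meval F v"
  using meval_add[of F "- F" v] by (simp add: eq_neg_iff_add_eq_0 add.commute)

lemma meval_diff [simp]: "meval (F - G) v = meval F v - meval G v"
  using meval_add[of F "- G" v] by simp

lemma meval_mscale [simp]: "meval (mscale c F) v = c * meval F v"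
proof -
  have "meval (mscale c F) v = (\<Sum>m\<in>Poly_Mapping.keys F. Poly_Mapping.lookup (mscale c F) m * (\<Prod>i\<in>UNIV. (v $ i) ^ Poly_Mapping.lookup m i))"
    by (intro meval_superset) (auto simp: in_keys_iff lookup_mscale)
  then show ?thesis by (simp add: lookup_mscale meval_def sum_distrib_left mult.assoc)
qed

lemma polyfun_meval: "polyfun (meval F)"
proof -
  have "polyfun (\<lambda>v. \<Sum>m\<in>Poly_Mapping.keys F. Poly_Mapping.lookup F m * (\<Prod>i\<in>UNIV. (v $ i) ^ Poly_Mapping.lookup m i))"
    by (intro polyfun_sum polyfun_prod polyfun_power polyfun.mult polyfun.const polyfun.coord)
  then show ?thesis by (simp add: meval_def[abs_def])
qed

lemma polyfun_imp_meval:
  fixes f :: "'k::field ^ 'v::finite \<Rightarrow> 'k"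
  assumes "polyfun f"
  shows "\<exists>F. \<forall>v. meval F v = f v"
  using assms
proof induction
  case (const c)
  then show ?case by (intro exI[of _ "Poly_Mapping.single 0 c"]) (simp add: meval_single)
next
  case (coord i)
  have "(\<Prod>j\<in>UNIV. v $ j ^ (1 when i = j)) = v $ i" for v :: "'k ^ 'v"
    by (subst prod.remove[of _ i]) (auto simp: when_def intro!: prod.neutral)
  then show ?case
    by (intro exI[of _ "Poly_Mapping.single (Poly_Mapping.single i 1) 1"])
      (simp add: meval_single lookup_single)
next
  case (add f g)
  then show ?case by (metis meval_add)
next
  case (mult f g)
  then show ?case by (metis meval_mult)
qed


subsection \<open>Homogeneous polynomials\<close>

lemma homogeneous_add: "homogeneous d F \<Longrightarrow> homogeneous d G \<Longrightarrow> homogeneous d (F + G)"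
  using keys_add[of F G] by (auto simp: homogeneous_def)

lemma homogeneous_0 [simp]: "homogeneous d 0"
  by (simp add: homogeneous_def)

lemma homogeneous_sum: "(\<And>i. i \<in> I \<Longrightarrow> homogeneous d (F i)) \<Longrightarrow> homogeneous d (\<Sum>i\<in>I. F i)"
  by (induction I rule: infinite_finite_induct) (auto intro: homogeneous_add)

lemma homogeneous_uminus: "homogeneous d F \<Longrightarrow> homogeneous d (- F)"
  by (simp add: homogeneous_def in_keys_iff)

lemma homogeneous_diff: "homogeneous d F \<Longrightarrow> homogeneous d G \<Longrightarrow> homogeneous d (F - G)"
  using homogeneous_add[of d F "- G"] homogeneous_uminus[of d G] by simp

lemma homogeneous_mult:
  assumes "homogeneous d F" "homogeneous e G"
  shows "homogeneous (d + e) (F * G)"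
  unfolding homogeneous_def
proof
  fix m assume "m \<in> Poly_Mapping.keys (F * G)"
  then obtain k l where "m = k + l" "k \<in> Poly_Mapping.keys F" "l \<in> Poly_Mapping.keys G"
    using keys_mult[of F G] by auto
  then show "(\<Sum>i\<in>UNIV. Poly_Mapping.lookup m i) = d + e"
    using assms by (auto simp: homogeneous_def lookup_add sum.distrib)
qed

lemma homogeneous_mscale: "homogeneous d F \<Longrightarrow> homogeneous d (mscale c F)"
  by (auto simp: homogeneous_def in_keys_iff lookup_mscale)

lemma homogeneous_1: "homogeneous 0 1"
  by (simp add: homogeneous_def)

lemma homogeneous_power: "homogeneous d F \<Longrightarrow> homogeneous (n * d) (F ^ n)"
  by (induction n) (auto intro: homogeneous_mult homogeneous_1)

lemma meval_1 [simp]: "meval 1 v = 1"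
  using meval_single[of 0 1 v] by simp

lemma meval_power [simp]: "meval (F ^ n) v = meval F v ^ n"
  by (induction n) auto

lemma homogeneous_meval_scale:
  assumes "homogeneous d F"
  shows "meval F (c *s v) = c ^ d * meval F v"
proof -
  have "(\<Prod>i\<in>UNIV. (c * v $ i) ^ Poly_Mapping.lookup m i) = c ^ d * (\<Prod>i\<in>UNIV. (v $ i) ^ Poly_Mapping.lookup m i)"
    if "m \<in> Poly_Mapping.keys F" for m
    using that assms by (auto simp: homogeneous_def power_mult_distrib prod.distrib power_sum[symmetric])
  then show ?thesis by (simp add: meval_def sum_distrib_left algebra_simps)
qed

lemma homogeneous_meval_0: "homogeneous d F \<Longrightarrow> d > 0 \<Longrightarrow> meval F 0 = 0"
  using homogeneous_meval_scale[of d F 0 0] by (auto simp: power_0_left)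

definition lin_mpoly :: "('k::field ^ 'v::finite \<Rightarrow> 'k) \<Rightarrow> ('v, 'k) mpoly" where
  "lin_mpoly y = (\<Sum>i\<in>UNIV. Poly_Mapping.single (Poly_Mapping.single i 1) (y (axis i 1)))"

lemma meval_lin_mpoly [simp]:
  assumes "linear_form y"
  shows "meval (lin_mpoly y) v = y v"
proof -
  have "(\<Prod>j\<in>UNIV. v $ j ^ (1 when i = j)) = v $ i" for i
    by (subst prod.remove[of _ i]) (auto simp: when_def intro!: prod.neutral)
  then have "meval (lin_mpoly y) v = (\<Sum>i\<in>UNIV. v $ i * y (axis i 1))"
    by (simp add: lin_mpoly_def meval_single lookup_single mult.commute)
  then show ?thesis using linear_form_expand[OF assms, of v] by simp
qed

lemma homogeneous_lin_mpoly: "homogeneous 1 (lin_mpoly y)"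
  unfolding lin_mpoly_def
  by (rule homogeneous_sum) (simp add: homogeneous_def lookup_single when_def)

lemma homogeneous_lin_mpoly_mult: "homogeneous 2 (lin_mpoly y * lin_mpoly z)"
  using homogeneous_mult[OF homogeneous_lin_mpoly homogeneous_lin_mpoly, of y z]
  by (simp add: numeral_2_eq_2)


subsection \<open>Derivatives along curves\<close>

lemma meval_mpderiv:
  "meval (mpderiv i F) v = (\<Sum>m\<in>Poly_Mapping.keys F. of_nat (Poly_Mapping.lookup m i) * Poly_Mapping.lookup F m *
     ((v $ i) ^ (Poly_Mapping.lookup m i - 1) * (\<Prod>j\<in>UNIV - {i}. (v $ j) ^ Poly_Mapping.lookup m j)))"
proof -
  have "(\<Prod>j\<in>UNIV. (v $ j) ^ Poly_Mapping.lookup (m - Poly_Mapping.single i 1) j) =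
      (v $ i) ^ (Poly_Mapping.lookup m i - 1) * (\<Prod>j\<in>UNIV - {i}. (v $ j) ^ Poly_Mapping.lookup m j)" for m
    by (subst prod.remove[of _ i]) (auto simp: lookup_minus lookup_single when_def intro!: prod.cong)
  then show ?thesis by (simp add: mpderiv_def meval_single)
qed

text \<open>
  The chain rule for a curve with polynomial entries \<open>x i\<close>; all derivatives are formal ones, so
  that it holds in every characteristic.
\<close>

lemma meval_along_curve:
  fixes F :: "('v::finite, 'k::field) mpoly"
  shows "\<exists>P. (\<forall>e. poly P e = meval F (\<chi> i. poly (x i) e)) \<and>
     (\<forall>e. poly (pderiv P) e = dir_deriv F (\<chi> i. poly (x i) e) (\<chi> i. poly (pderiv (x i)) e)) \<and>
     (\<forall>d. homogeneous d F \<and> (\<forall>i. degree (x i) \<le> 1) \<longrightarrow> degree P \<le> d)"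
proof -
  let ?lk = "Poly_Mapping.lookup"
  let ?K = "Poly_Mapping.keys F"
  define P where "P = (\<Sum>m\<in>?K. smult (?lk F m) (\<Prod>i\<in>UNIV. x i ^ ?lk m i))"
  have "poly P e = meval F (\<chi> i. poly (x i) e)" for e
    by (simp add: P_def poly_sum poly_prod meval_def)
  moreover have "poly (pderiv P) e = dir_deriv F (\<chi> i. poly (x i) e) (\<chi> i. poly (pderiv (x i)) e)" for e
  proof -
    have pd: "pderiv (x i ^ k) = smult (of_nat k) (x i ^ (k - 1)) * pderiv (x i)" for i k
      by (simp add: pderiv_power)
    have pdsum: "pderiv (\<Sum>m\<in>S. g m) = (\<Sum>m\<in>S. pderiv (g m))" for S and g :: "('v \<Rightarrow>\<^sub>0 nat) \<Rightarrow> 'k poly"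
      by (induction S rule: infinite_finite_induct) (auto simp: pderiv_add)
    have "poly (pderiv P) e = (\<Sum>m\<in>?K. ?lk F m * (\<Sum>i\<in>UNIV. (\<Prod>j\<in>UNIV - {i}. poly (x j) e ^ ?lk m j) *
        (of_nat (?lk m i) * poly (x i) e ^ (?lk m i - 1) * poly (pderiv (x i)) e)))"
      by (simp add: P_def pdsum pderiv_smult pderiv_prod poly_sum poly_prod pd mult_ac)
    also have "\<dots> = (\<Sum>i\<in>UNIV. \<Sum>m\<in>?K. ?lk F m * ((\<Prod>j\<in>UNIV - {i}. poly (x j) e ^ ?lk m j) *
        (of_nat (?lk m i) * poly (x i) e ^ (?lk m i - 1) * poly (pderiv (x i)) e)))"
      unfolding sum_distrib_left by (rule sum.swap)
    also have "\<dots> = dir_deriv F (\<chi> i. poly (x i) e) (\<chi> i. poly (pderiv (x i)) e)"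
      unfolding dir_deriv_def meval_mpderiv sum_distrib_right
      by (intro sum.cong refl) (simp add: mult_ac)
    finally show ?thesis .
  qed
  moreover have "degree P \<le> d" if "homogeneous d F" "\<forall>i. degree (x i) \<le> 1" for d
    unfolding P_def
  proof (rule degree_sum_le)
    fix m assume m: "m \<in> ?K"
    have "degree (\<Prod>i\<in>UNIV. x i ^ ?lk m i) \<le> (\<Sum>i\<in>UNIV. degree (x i ^ ?lk m i))"
      by (simp add: degree_prod_sum_le[unfolded comp_def])
    also have "\<dots> \<le> (\<Sum>i\<in>UNIV. ?lk m i)"
      using that(2) by (intro sum_mono order.trans[OF degree_power_le])
        (metis mult.commute mult.right_neutral mult_le_mono2)
    also have "\<dots> = d" using that(1) m by (simp add: homogeneous_def)
    finally show "degree (smult (?lk F m) (\<Prod>i\<in>UNIV. x i ^ ?lk m i)) \<le> d"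
      by (meson degree_smult_le order.trans)
  qed simp
  ultimately show ?thesis by blast
qed

lemma meval_along_line:
  fixes F :: "('v::finite, 'k::field) mpoly"
  shows "\<exists>P. (\<forall>e. poly P e = meval F (v + e *s w)) \<and> coeff P 0 = meval F v \<and>
     coeff P 1 = dir_deriv F v w \<and> (\<forall>d. homogeneous d F \<longrightarrow> degree P \<le> d)"
proof -
  obtain P where P: "\<forall>e. poly P e = meval F (\<chi> i. poly [:v $ i, w $ i:] e)"
    "\<forall>e. poly (pderiv P) e = dir_deriv F (\<chi> i. poly [:v $ i, w $ i:] e) (\<chi> i. poly (pderiv [:v $ i, w $ i:]) e)"
    "\<forall>d. homogeneous d F \<and> (\<forall>i. degree [:v $ i, w $ i:] \<le> 1) \<longrightarrow> degree P \<le> d"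
    using meval_along_curve[of F "\<lambda>i. [:v $ i, w $ i:]"] by blast
  have line: "(\<chi> i. poly [:v $ i, w $ i:] e) = v + e *s w" for e
    by (simp add: vec_eq_iff)
  have dw: "(\<chi> i. poly (pderiv [:v $ i, w $ i:]) e) = w" for e
    by (simp add: vec_eq_iff pderiv_pCons)
  have "coeff P 1 = poly (pderiv P) 0" by (simp add: poly_0_coeff_0 coeff_pderiv)
  also have "\<dots> = dir_deriv F v w" using P(2) line[of 0] dw by simp
  finally have "coeff P 1 = dir_deriv F v w" .
  moreover have "coeff P 0 = meval F v"
    using P(1) line by (simp add: poly_0_coeff_0[symmetric])
  ultimately show ?thesis using P(1,3) line by auto
qed

lemma dir_deriv_eqI:
  fixes F :: "('v::finite, 'k::alg_closed_field) mpoly"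
  assumes "\<And>e. meval F (v + e *s w) = poly P e"
  shows "dir_deriv F v w = coeff P 1"
proof -
  obtain Q where Q: "\<forall>e. poly Q e = meval F (v + e *s w)" "coeff Q 1 = dir_deriv F v w"
    using meval_along_line by blast
  then have "Q - P = 0" using assms by (intro poly_zero_if_zero_off_0) auto
  then show ?thesis using Q(2) by simp
qed

lemma linear_form_dir_deriv: "linear_form (dir_deriv F v)"
  by (simp add: linear_form_def dir_deriv_def algebra_simps sum.distrib sum_distrib_left)

lemma poly_deg2:
  fixes P :: "'k::field poly"
  assumes "degree P \<le> 2"
  shows "poly P e = coeff P 0 + coeff P 1 * e + coeff P 2 * e\<^sup>2"
proof -
  have "P = [:coeff P 0, coeff P 1, coeff P 2:]"
    using assms by (intro poly_eqI) (auto simp: coeff_pCons numeral_2_eq_2 coeff_eq_0 split: nat.split)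
  then have "poly P e = poly [:coeff P 0, coeff P 1, coeff P 2:] e" by simp
  then show ?thesis unfolding power2_eq_square by (simp add: algebra_simps)
qed

text \<open>
  The constant and linear coefficients are the value and the derivative at \<open>v\<close>. The coefficient of
  \<open>e\<^sup>2\<close> is found at infinity: it is the constant coefficient of \<open>meval F (w + inverse e *s v)\<close>.
\<close>

lemma quadratic_form_expand:
  fixes F :: "('v::finite, 'k::alg_closed_field) mpoly"
  assumes F: "homogeneous 2 F"
  shows "meval F (v + e *s w) = meval F v + e * dir_deriv F v w + e\<^sup>2 * meval F w"
proof -
  obtain P where P: "\<forall>e. poly P e = meval F (v + e *s w)" "coeff P 0 = meval F v"
     "coeff P 1 = dir_deriv F v w" "degree P \<le> 2"
    using meval_along_line[of F v w] F by blast
  obtain R where R: "\<forall>e. poly R e = meval F (w + e *s v)" "coeff R 0 = meval F w" "degree R \<le> 2"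
    using meval_along_line[of F w v] F by blast
  have "[:coeff P 0 - coeff R 2, coeff P 1 - coeff R 1, coeff P 2 - coeff R 0:] = 0"
  proof (rule poly_zero_if_zero_off_0)
    fix e :: 'k assume e: "e \<noteq> 0"
    have "v + e *s w = e *s (w + inverse e *s v)"
      using e by (simp add: vec.scale_right_distrib)
    then have "meval F (v + e *s w) = e\<^sup>2 * meval F (w + inverse e *s v)"
      using F by (simp add: homogeneous_meval_scale)
    then have "poly P e = e\<^sup>2 * poly R (inverse e)" using P R by simp
    moreover have "e\<^sup>2 * poly R (inverse e) = coeff R 0 * e\<^sup>2 + coeff R 1 * e + coeff R 2"
      using e unfolding poly_deg2[OF R(3)] by (simp add: field_simps power2_eq_square)
    ultimately show "poly [:coeff P 0 - coeff R 2, coeff P 1 - coeff R 1, coeff P 2 - coeff R 0:] e = 0"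
      unfolding poly_deg2[OF P(4)] by (simp add: algebra_simps power2_eq_square)
  qed
  then have "coeff P 2 = meval F w" using R by simp
  then show ?thesis using P(1-3) poly_deg2[OF P(4), of e] by (simp add: algebra_simps)
qed

lemma dir_deriv_scale_point:
  fixes F :: "('v::finite, 'k::field) mpoly"
  assumes F: "homogeneous d F"
  shows "dir_deriv F (c *s v) w = c ^ (d - 1) * dir_deriv F v w"
proof -
  let ?lk = "Poly_Mapping.lookup"
  have "meval (mpderiv i F) (c *s v) = c ^ (d - 1) * meval (mpderiv i F) v" for i
  proof -
    have "of_nat (?lk m i) * ?lk F m * ((c * v $ i) ^ (?lk m i - 1) * (\<Prod>j\<in>UNIV - {i}. (c * v $ j) ^ ?lk m j)) =
      c ^ (d - 1) * (of_nat (?lk m i) * ?lk F m * ((v $ i) ^ (?lk m i - 1) * (\<Prod>j\<in>UNIV - {i}. (v $ j) ^ ?lk m j)))"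
      if m: "m \<in> Poly_Mapping.keys F" for m
    proof (cases "?lk m i = 0")
      case False
      have "d = ?lk m i + (\<Sum>j\<in>UNIV - {i}. ?lk m j)"
        using F m sum.remove[of UNIV i "?lk m"] by (auto simp: homogeneous_def)
      then have "d - 1 = (?lk m i - 1) + (\<Sum>j\<in>UNIV - {i}. ?lk m j)" using False by simp
      then have "c ^ (d - 1) = c ^ (?lk m i - 1) * (\<Prod>j\<in>UNIV - {i}. c ^ ?lk m j)"
        by (simp add: power_add power_sum)
      then show ?thesis by (simp add: power_mult_distrib prod.distrib mult_ac)
    qed simp
    then show ?thesis unfolding meval_mpderiv sum_distrib_left by (intro sum.cong) auto
  qed
  then show ?thesis by (simp add: dir_deriv_def sum_distrib_left mult_ac)
qed


section \<open>Cones and projective sets\<close>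

definition cone :: "('k::field ^ 'v::finite) set \<Rightarrow> bool" where
  "cone C \<longleftrightarrow> (\<forall>v\<in>C. \<forall>c. c *s v \<in> C)"

text \<open>All sets of points considered here are given by cones of representatives.\<close>

definition cpts :: "('k::field ^ 'v::finite) set \<Rightarrow> ('k ^ 'v) set set" where
  "cpts C = {pt v | v. v \<noteq> 0 \<and> v \<in> C}"

lemma pt_eq: "pt v = {c *s v | c. True}"
  by (auto simp: pt_def vec.span_singleton)

lemma in_ptI [simp]: "c *s v \<in> pt v" "v \<in> pt v"
  by (auto simp: pt_eq) (metis vec.scale_one)

lemma pt_eq_iff:
  assumes "v \<noteq> 0"
  shows "pt v = pt w \<longleftrightarrow> (\<exists>c. c \<noteq> 0 \<and> w = c *s v)"
proof
  assume eq: "pt v = pt w"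
  then have "w \<in> pt v" by simp
  then obtain c where c: "w = c *s v" by (auto simp: pt_eq)
  have "c \<noteq> 0"
  proof
    assume "c = 0"
    then have "pt w = {0}" using c by (auto simp: pt_eq)
    then show False using eq assms in_ptI(2)[of v] by simp
  qed
  then show "\<exists>c. c \<noteq> 0 \<and> w = c *s v" using c by blast
next
  assume "\<exists>c. c \<noteq> 0 \<and> w = c *s v"
  then obtain c where c: "c \<noteq> 0" "w = c *s v" by blast
  then have "v = inverse c *s w" by simp
  then show "pt v = pt w"
    unfolding pt_eq using c(2) by (metis (no_types, opaque_lifting) vec.scale_scale)
qed

lemma pointsE:
  assumes "q \<in> points" obtains v where "v \<noteq> 0" "q = pt v"
  using assms by (auto simp: points_def)

lemma pt_in_points [simp]: "v \<noteq> 0 \<Longrightarrow> pt v \<in> points"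
  by (auto simp: points_def)

lemma coneD: "cone C \<Longrightarrow> v \<in> C \<Longrightarrow> c *s v \<in> C"
  by (simp add: cone_def)

lemma pt_in_cpts_iff:
  assumes "cone C" "v \<noteq> 0"
  shows "pt v \<in> cpts C \<longleftrightarrow> v \<in> C"
proof
  assume "pt v \<in> cpts C"
  then obtain w where w: "w \<in> C" "w \<noteq> 0" "pt w = pt v" by (auto simp: cpts_def)
  then obtain c where "v = c *s w" using pt_eq_iff[of w v] by blast
  then show "v \<in> C" using w(1) assms(1) by (simp add: coneD)
qed (use assms(2) in \<open>auto simp: cpts_def\<close>)

lemma cpts_points: "cpts C \<subseteq> points"
  by (auto simp: cpts_def)

lemma cpts_eqI:
  assumes "Y \<subseteq> points" "\<And>v. v \<noteq> 0 \<Longrightarrow> pt v \<in> Y \<longleftrightarrow> v \<in> C"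
  shows "Y = cpts C"
  using assms by (auto simp: cpts_def points_def)

lemma cone_subspace: "vec.subspace W \<Longrightarrow> cone W"
  by (simp add: cone_def vec.subspace_scale)

lemma proj_eq_cpts:
  assumes "vec.subspace W"
  shows "proj W = cpts W"
proof (rule cpts_eqI)
  fix v :: "'a ^ 'b" assume "v \<noteq> 0"
  then show "pt v \<in> proj W \<longleftrightarrow> v \<in> W"
    using assms in_ptI(2)[of v] vec.subspace_scale[OF assms, of v]
    by (auto simp del: in_ptI simp: proj_def) (auto simp: pt_eq)
qed (auto simp: proj_def)

lemma lin_hull_pt: "lin_hull (pt ` S) = cpts (vec.span S)"
proof -
  have "vec.span (\<Union>(pt ` S)) = vec.span S"
  proof
    show "vec.span (\<Union>(pt ` S)) \<subseteq> vec.span S"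
      by (rule vec.span_minimal) (auto simp: pt_eq vec.span_base vec.span_scale)
    show "vec.span S \<subseteq> vec.span (\<Union>(pt ` S))"
      by (rule vec.span_mono) auto
  qed
  then show ?thesis by (simp add: lin_hull_def proj_eq_cpts)
qed

lemma lin_hull_pair: "lin_hull {pt v, pt w} = cpts (vec.span {v, w})"
  using lin_hull_pt[of "{v, w}"] by simp

lemma span_pair: "vec.span {v, w} = {s *s v + t *s w | s t. True}"
  unfolding vec.span_insert[of v "{w}"] vec.span_singleton
proof (safe, goal_cases)
  case (1 x k c)
  then have "x = k *s v + c *s w" by (simp add: algebra_simps)
  then show ?case by blast
next
  case (2 x s t)
  then show ?case by (intro exI[of _ s]) auto
qed

lemma vanishing_ideal_cpts:
  assumes "cone C"
  shows "F \<in> vanishing_ideal (cpts C) \<longleftrightarrow> (C \<subseteq> {0} \<or> (\<forall>v\<in>C. meval F v = 0))"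
proof
  assume F: "F \<in> vanishing_ideal (cpts C)"
  have nz: "meval F (c *s v) = 0" if "v \<noteq> 0" "v \<in> C" for v c
    using F that by (auto simp: vanishing_ideal_def cpts_def)
  show "C \<subseteq> {0} \<or> (\<forall>v\<in>C. meval F v = 0)"
  proof (cases "C \<subseteq> {0}")
    case False
    then obtain v where "v \<in> C" "v \<noteq> 0" by auto
    then have "meval F 0 = 0" using nz[of v 0] by simp
    then show ?thesis using nz[of _ 1] by (metis vec.scale_one)
  qed simp
next
  assume "C \<subseteq> {0} \<or> (\<forall>v\<in>C. meval F v = 0)"
  then show "F \<in> vanishing_ideal (cpts C)"
    using assms by (auto simp: vanishing_ideal_def cpts_def pt_eq cone_def)
qed

lemma vanishing_ideal_cptsI:
  assumes "cone C" "\<And>v. v \<in> C \<Longrightarrow> meval F v = 0"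
  shows "F \<in> vanishing_ideal (cpts C)"
  using assms vanishing_ideal_cpts[OF assms(1)] by blast

lemma zclosure_subset: "Y \<subseteq> points \<Longrightarrow> Y \<subseteq> zclosure Y"
  by (auto simp: zclosure_def zero_locus_def vanishing_ideal_def)

lemma zclosure_points: "zclosure Y \<subseteq> points"
  by (auto simp: zclosure_def zero_locus_def)

lemma pt_in_zclosureI:
  assumes "v \<noteq> 0"
    "\<And>f w. polyfun f \<Longrightarrow> (\<And>q u. q \<in> Y \<Longrightarrow> u \<in> q \<Longrightarrow> f u = 0) \<Longrightarrow> w \<in> pt v \<Longrightarrow> f w = 0"
  shows "pt v \<in> zclosure Y"
  using assms polyfun_meval by (force simp: zclosure_def zero_locus_def vanishing_ideal_def)

text \<open>
  For the closures below, \<open>closed\<close> is an elimination problem, solved by explicit minors, determinants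
  and resultants, and \<open>dense\<close> says that limits of points of \<open>Y\<close> exhaust \<open>C\<close>.
\<close>

lemma zclosure_eq_cpts:
  assumes C: "cone C" and Y: "Y \<subseteq> cpts C"
    and closed: "\<And>v. v \<notin> C \<Longrightarrow> \<exists>f. polyfun f \<and> f v \<noteq> 0 \<and> (\<forall>w\<in>C. f w = 0)"
    and dense: "\<And>v. v \<in> C \<Longrightarrow> v \<noteq> 0 \<Longrightarrow> pt v \<in> zclosure Y"
  shows "zclosure Y = cpts C"
proof (rule cpts_eqI[OF zclosure_points])
  fix v :: "'a ^ 'b" assume v: "v \<noteq> 0"
  show "pt v \<in> zclosure Y \<longleftrightarrow> v \<in> C"
  proof
    assume cl: "pt v \<in> zclosure Y"
    show "v \<in> C"
    proof (rule ccontr)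
      assume "v \<notin> C"
      then obtain f where f: "polyfun f" "f v \<noteq> 0" "\<forall>w\<in>C. f w = 0" using closed by blast
      obtain F where F: "\<forall>v. meval F v = f v" using polyfun_imp_meval[OF f(1)] by blast
      have "F \<in> vanishing_ideal (cpts C)"
        using F f(3) by (intro vanishing_ideal_cptsI[OF C]) simp
      then have "F \<in> vanishing_ideal Y"
        using Y by (auto simp: vanishing_ideal_def)
      then have "meval F v = 0"
        using cl by (auto simp: zclosure_def zero_locus_def)
      then show False using F f(2) by simp
    qed
  qed (use dense v in blast)
qed

section \<open>Hilbert functions and lengths\<close>

lemma mpoly_subspaceI:
  assumes "0 \<in> J" "\<And>F G. F \<in> J \<Longrightarrow> G \<in> J \<Longrightarrow> F + G \<in> J" "\<And>c F. F \<in> J \<Longrightarrow> mscale c F \<in> J"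
  shows "mpoly.subspace J"
  using assms by (auto simp: mpoly.subspace_def)

lemma subspace_homogeneous: "mpoly.subspace {F :: ('v::finite, 'k::field) mpoly. homogeneous d F}"
  by (rule mpoly_subspaceI) (auto intro: homogeneous_add homogeneous_mscale)

text \<open>
  The space of all polynomials is infinite-dimensional, where \<open>mpoly.dim\<close> has no monotonicity; this
  makes it available in each degree.
\<close>

lemma homogeneous_finitely_spanned:
  "\<exists>T. finite T \<and> {F :: ('v::finite, 'k::field) mpoly. homogeneous d F} \<subseteq> mpoly.span T"
proof -
  let ?M = "{m :: 'v \<Rightarrow>\<^sub>0 nat. (\<Sum>i\<in>UNIV. Poly_Mapping.lookup m i) = d}"
  let ?T = "(\<lambda>m. Poly_Mapping.single m (1 :: 'k)) ` ?M"
  have "finite (Poly_Mapping.lookup ` ?M)"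
  proof (rule finite_subset)
    show "Poly_Mapping.lookup ` ?M \<subseteq> {f. \<forall>i. f i \<in> {..d} \<and> (i \<notin> UNIV \<longrightarrow> f i = 0)}"
    proof clarify
      fix m :: "'v \<Rightarrow>\<^sub>0 nat" and i assume "d = (\<Sum>i\<in>UNIV. Poly_Mapping.lookup m i)"
      then show "Poly_Mapping.lookup m i \<in> {..\<Sum>i\<in>UNIV. Poly_Mapping.lookup m i} \<and>
          (i \<notin> UNIV \<longrightarrow> Poly_Mapping.lookup m i = 0)"
        using member_le_sum[of i UNIV "Poly_Mapping.lookup m"] by simp
    qed
    show "finite {f :: 'v \<Rightarrow> nat. \<forall>i. f i \<in> {..d} \<and> (i \<notin> UNIV \<longrightarrow> f i = 0)}"
      using finite_set_of_finite_funs[of "UNIV :: 'v set" "{..d}" 0] by simp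
  qed
  moreover have "inj_on Poly_Mapping.lookup ?M"
    by (auto simp: inj_on_def intro: poly_mapping_eqI)
  ultimately have "finite ?M" by (rule finite_imageD)
  then have "finite ?T" by simp
  moreover have "F \<in> mpoly.span ?T" if "homogeneous d F" for F :: "('v, 'k) mpoly"
  proof -
    have "mscale (Poly_Mapping.lookup F m) (Poly_Mapping.single m 1) =
        Poly_Mapping.single m (Poly_Mapping.lookup F m)" for m
      by (rule poly_mapping_eqI) (simp add: lookup_mscale lookup_single when_def)
    then have "F = (\<Sum>m\<in>Poly_Mapping.keys F. mscale (Poly_Mapping.lookup F m) (Poly_Mapping.single m 1))"
      by (simp add: sum_monomials)
    also have "\<dots> \<in> mpoly.span ?T"
      using that by (intro mpoly.span_sum mpoly.span_scale mpoly.span_base) (auto simp: homogeneous_def)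
    finally show ?thesis .
  qed
  ultimately show ?thesis by blast
qed

lemma mpoly_dim_mono:
  assumes "finite T" "B \<subseteq> mpoly.span T" "A \<subseteq> mpoly.span B"
  shows "mpoly.dim A \<le> mpoly.dim B"
proof -
  obtain A' where A': "A' \<subseteq> A" "mpoly.independent A'" "A \<subseteq> mpoly.span A'" "card A' = mpoly.dim A"
    using mpoly.basis_exists by blast
  obtain B' where B': "B' \<subseteq> B" "mpoly.independent B'" "B \<subseteq> mpoly.span B'" "card B' = mpoly.dim B"
    using mpoly.basis_exists by blast
  have "finite B'" using mpoly.independent_span_bound[of T B'] assms B' by blast
  moreover have "A' \<subseteq> mpoly.span B'"
    using A'(1) assms(3) B'(3) mpoly.span_mono[of B "mpoly.span B'"] mpoly.span_span by blast
  ultimately have "card A' \<le> card B'"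
    using mpoly.independent_span_bound[of B' A'] A'(2) by blast
  then show ?thesis using A' B' by simp
qed

lemma mpoly_dim_insert:
  assumes "finite T" "S \<subseteq> mpoly.span T"
  shows "mpoly.dim (insert F S) = mpoly.dim S + (if F \<in> mpoly.span S then 0 else 1)"
proof -
  obtain B where B: "B \<subseteq> S" "mpoly.independent B" "S \<subseteq> mpoly.span B" "card B = mpoly.dim S"
    using mpoly.basis_exists by blast
  have sp: "mpoly.span B = mpoly.span S"
    using B by (metis mpoly.span_mono mpoly.span_span subset_antisym)
  show ?thesis
  proof (cases "F \<in> mpoly.span S")
    case True
    then have "mpoly.span B = mpoly.span (insert F S)"
      using sp mpoly.span_redundant by metis
    then show ?thesis using mpoly.dim_eq_card[of B "insert F S"] B True by simp
  next
    case False
    have fin: "finite B" using mpoly.independent_span_bound[of T B] assms B by blast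
    have "F \<notin> B" using False B(1) mpoly.span_base by blast
    moreover have "mpoly.independent (insert F B)"
      using B(2) False sp by (simp add: mpoly.independent_insert)
    moreover have "mpoly.span (insert F B) = mpoly.span (insert F S)"
      using sp by (simp add: mpoly.span_insert)
    ultimately have "mpoly.dim (insert F S) = card (insert F B)"
      by (metis mpoly.dim_eq_card)
    then show ?thesis using False fin \<open>F \<notin> B\<close> B(4) by simp
  qed
qed

text \<open>
  The assumptions say that \<open>F\<close> and \<open>G\<close> are linearly independent modulo \<open>J\<close>.
\<close>

lemma hilbert_function_ge_2:
  fixes J :: "('v::finite, 'k::field) mpoly set"
  assumes J: "mpoly.subspace J" and hom: "homogeneous d F" "homogeneous d G"
    and F: "F \<notin> J" and G: "\<And>c. G - mscale c F \<notin> J"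
  shows "2 \<le> hilbert_function J d"
proof -
  let ?V = "{F :: ('v, 'k) mpoly. homogeneous d F}"
  let ?S = "{F \<in> J. homogeneous d F}"
  obtain T where T: "finite T" "?V \<subseteq> mpoly.span T" using homogeneous_finitely_spanned by blast
  have "?S = J \<inter> ?V" by auto
  then have sub: "mpoly.subspace ?S"
    using mpoly.subspace_inter[OF J subspace_homogeneous] by simp
  have sp: "mpoly.span ?S = ?S" using sub by (simp only: mpoly.span_eq_iff)
  have nF: "F \<notin> mpoly.span ?S" using F unfolding sp by simp
  have nG: "G \<notin> mpoly.span (insert F ?S)"
    using G unfolding mpoly.span_insert sp by simp
  have "mpoly.dim (insert G (insert F ?S)) = mpoly.dim ?S + 2"
    using T hom nF nG by (subst mpoly_dim_insert[of T], simp, force, subst mpoly_dim_insert[of T]) auto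
  moreover have "mpoly.dim (insert G (insert F ?S)) \<le> mpoly.dim ?V"
    using T hom by (intro mpoly_dim_mono[OF T]) (auto intro: mpoly.span_base)
  ultimately show ?thesis by (simp add: hilbert_function_def)
qed

lemma hilbert_function_le_1:
  fixes J :: "('v::finite, 'k::field) mpoly set"
  assumes "homogeneous d F" and span: "\<And>G. homogeneous d G \<Longrightarrow> \<exists>c. G - mscale c F \<in> J"
  shows "hilbert_function J d \<le> 1"
proof -
  let ?V = "{F :: ('v, 'k) mpoly. homogeneous d F}"
  let ?S = "{F \<in> J. homogeneous d F}"
  obtain T where T: "finite T" "?V \<subseteq> mpoly.span T" using homogeneous_finitely_spanned by blast
  have "?V \<subseteq> mpoly.span (insert F ?S)"
  proof clarify
    fix G :: "('v, 'k) mpoly" assume G: "homogeneous d G"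
    then obtain c where "G - mscale c F \<in> J" using span by blast
    then have "G - mscale c F \<in> ?S"
      using G assms(1) by (auto intro: homogeneous_diff homogeneous_mscale)
    then show "G \<in> mpoly.span (insert F ?S)"
      by (auto simp: mpoly.span_insert intro: mpoly.span_base)
  qed
  then have "mpoly.dim ?V \<le> mpoly.dim (insert F ?S)"
    using T assms(1) by (intro mpoly_dim_mono[OF T(1)]) auto
  also have "\<dots> \<le> mpoly.dim ?S + 1"
    using T by (subst mpoly_dim_insert[of T]) auto
  finally show ?thesis by (simp add: hilbert_function_def)
qed

lemma hilbert_function_le_2:
  fixes J :: "('v::finite, 'k::field) mpoly set"
  assumes "homogeneous d F1" "homogeneous d F2"
    and span: "\<And>G. homogeneous d G \<Longrightarrow> \<exists>c1 c2. G - mscale c1 F1 - mscale c2 F2 \<in> J"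
  shows "hilbert_function J d \<le> 2"
proof -
  let ?V = "{F :: ('v, 'k) mpoly. homogeneous d F}"
  let ?S = "{F \<in> J. homogeneous d F}"
  obtain T where T: "finite T" "?V \<subseteq> mpoly.span T" using homogeneous_finitely_spanned by blast
  have "?V \<subseteq> mpoly.span (insert F1 (insert F2 ?S))"
  proof clarify
    fix G :: "('v, 'k) mpoly" assume G: "homogeneous d G"
    then obtain c1 c2 where "G - mscale c1 F1 - mscale c2 F2 \<in> J" using span by blast
    then have "G - mscale c1 F1 - mscale c2 F2 \<in> ?S"
      using G assms(1,2) by (auto intro: homogeneous_diff homogeneous_mscale)
    then show "G \<in> mpoly.span (insert F1 (insert F2 ?S))"
      unfolding mpoly.span_insert[of F1] mpoly.span_insert[of F2] by (blast intro: mpoly.span_base)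
  qed
  then have "mpoly.dim ?V \<le> mpoly.dim (insert F1 (insert F2 ?S))"
    using T assms(1,2) by (intro mpoly_dim_mono[OF T(1)]) auto
  also have "\<dots> \<le> mpoly.dim (insert F2 ?S) + 1"
    using T assms(2) by (subst mpoly_dim_insert[of T]) auto
  also have "\<dots> \<le> mpoly.dim ?S + 1 + 1"
    using T by (subst mpoly_dim_insert[of T]) auto
  finally show ?thesis by (simp add: hilbert_function_def)
qed

lemma scheme_length_ge_2:
  assumes "\<And>d. d \<ge> d0 \<Longrightarrow> 2 \<le> hilbert_function J d"
  shows "2 \<le> scheme_length J"
  unfolding scheme_length_def
proof (rule Liminf_bounded)
  show "\<forall>\<^sub>F d in sequentially. 2 \<le> enat (hilbert_function J d)"
    unfolding eventually_sequentially numeral_eq_enat using assms by auto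
qed

lemma scheme_length_le:
  assumes "\<And>d. d \<ge> d0 \<Longrightarrow> hilbert_function J d \<le> n"
  shows "scheme_length J \<le> enat n"
proof -
  have "liminf (\<lambda>d. enat (hilbert_function J d)) \<le> liminf (\<lambda>d. enat n)"
    by (rule Liminf_mono) (use assms in \<open>auto simp: eventually_sequentially\<close>)
  then show ?thesis by (simp add: scheme_length_def Liminf_const)
qed


section \<open>Ideals and their zeros\<close>

lemma vanishing_ideal_add: "F \<in> vanishing_ideal Y \<Longrightarrow> G \<in> vanishing_ideal Y \<Longrightarrow> F + G \<in> vanishing_ideal Y"
  and vanishing_ideal_mult: "F \<in> vanishing_ideal Y \<Longrightarrow> H * F \<in> vanishing_ideal Y"
  and vanishing_ideal_mscale: "F \<in> vanishing_ideal Y \<Longrightarrow> mscale c F \<in> vanishing_ideal Y"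
  and vanishing_ideal_0: "0 \<in> vanishing_ideal Y"
  by (auto simp: vanishing_ideal_def)

lemma mscale_add_right: "mscale c (F + G) = mscale c F + mscale c G"
  by (rule mpoly.scale_right_distrib)

lemma scheme_inter_subspace:
  "mpoly.subspace (scheme_inter (vanishing_ideal Y) (vanishing_ideal Z))"
proof (rule mpoly_subspaceI)
  show "0 \<in> scheme_inter (vanishing_ideal Y) (vanishing_ideal Z)"
    unfolding scheme_inter_def using vanishing_ideal_0[of Y] vanishing_ideal_0[of Z] by force
next
  fix F G assume "F \<in> scheme_inter (vanishing_ideal Y) (vanishing_ideal Z)"
    "G \<in> scheme_inter (vanishing_ideal Y) (vanishing_ideal Z)"
  then obtain F1 F2 G1 G2 where "F = F1 + F2" "G = G1 + G2"
    "F1 \<in> vanishing_ideal Y" "G1 \<in> vanishing_ideal Y" "F2 \<in> vanishing_ideal Z" "G2 \<in> vanishing_ideal Z"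
    by (auto simp: scheme_inter_def)
  moreover from this have "F + G = (F1 + G1) + (F2 + G2)" by (simp add: algebra_simps)
  ultimately show "F + G \<in> scheme_inter (vanishing_ideal Y) (vanishing_ideal Z)"
    unfolding scheme_inter_def by (blast intro: vanishing_ideal_add)
next
  fix c F assume "F \<in> scheme_inter (vanishing_ideal Y) (vanishing_ideal Z)"
  then show "mscale c F \<in> scheme_inter (vanishing_ideal Y) (vanishing_ideal Z)"
    unfolding scheme_inter_def by (force simp: mscale_add_right intro: vanishing_ideal_mscale)
qed

lemma scheme_interI: "F \<in> I \<Longrightarrow> G \<in> J \<Longrightarrow> F + G \<in> scheme_inter I J"
  by (auto simp: scheme_inter_def)

text \<open>
  The zeros of the forms of large degree in an ideal. In contrast to \<open>zero_locus\<close>, this set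
  visibly depends only on the subscheme that the ideal defines.
\<close>

definition support :: "('v::finite, 'k::field) mpoly set \<Rightarrow> ('k ^ 'v) set set" where
  "support J = {q \<in> points. \<exists>d0. \<forall>d\<ge>d0. \<forall>F\<in>J. homogeneous d F \<longrightarrow> (\<forall>u\<in>q. meval F u = 0)}"

lemma support_subscheme:
  assumes "subscheme I J"
  shows "support I \<subseteq> support J"
proof
  fix q assume "q \<in> support I"
  then obtain d0 where q: "q \<in> points" and
    d0: "\<forall>d\<ge>d0. \<forall>F\<in>I. homogeneous d F \<longrightarrow> (\<forall>u\<in>q. meval F u = 0)"
    by (auto simp: support_def)
  obtain d1 where "\<forall>d\<ge>d1. \<forall>F. homogeneous d F \<and> F \<in> J \<longrightarrow> F \<in> I"
    using assms by (auto simp: subscheme_def)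
  then have "\<forall>d\<ge>max d0 d1. \<forall>F\<in>J. homogeneous d F \<longrightarrow> (\<forall>u\<in>q. meval F u = 0)"
    using d0 by auto
  then show "q \<in> support J" using q unfolding support_def by blast
qed

lemma support_same_scheme: "same_scheme I J \<Longrightarrow> support I = support J"
  using support_subscheme by (fastforce simp: same_scheme_def)

lemma zero_locus_subset_support: "zero_locus J \<subseteq> support J"
  by (auto simp: zero_locus_def support_def)

lemma exists_linear_form_1:
  assumes "v \<noteq> 0" shows "\<exists>y. linear_form y \<and> y v = 1"
  using separating_linear_form[of v "{}"] assms by auto

text \<open>
  Multiplication by powers of a linear form that is nonzero at \<open>u\<close> produces forms of all larger
  degrees that do not vanish at \<open>u\<close>.
\<close>

lemma not_in_support:
  assumes "F \<in> J" "homogeneous e F" "meval F u \<noteq> 0" "u \<noteq> 0" "\<And>H F. F \<in> J \<Longrightarrow> H * F \<in> J"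
  shows "pt u \<notin> support J"
proof
  assume "pt u \<in> support J"
  then obtain d0 where d0: "\<forall>d\<ge>d0. \<forall>F\<in>J. homogeneous d F \<longrightarrow> meval F u = 0"
    unfolding support_def using in_ptI(2)[of u] by blast
  obtain y where y: "linear_form y" "y u = 1" using exists_linear_form_1[OF assms(4)] by blast
  have "homogeneous (d0 * 1 + e) (lin_mpoly y ^ d0 * F)"
    by (intro homogeneous_mult homogeneous_power homogeneous_lin_mpoly assms(2))
  moreover have "lin_mpoly y ^ d0 * F \<in> J" using assms(1,5) by blast
  moreover have "d0 * 1 + e \<ge> d0" by simp
  ultimately have "meval (lin_mpoly y ^ d0 * F) u = 0"
    using d0 by blast
  then show False using y assms(3) by simp
qed

lemma support_linear_spaces:
  assumes "vec.subspace W1" "vec.subspace W2"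
  shows "support (vanishing_ideal (cpts W1 \<union> cpts W2)) = cpts (W1 \<union> W2)"
proof (rule cpts_eqI)
  fix u assume u: "(u :: 'a ^ 'b) \<noteq> 0"
  show "pt u \<in> support (vanishing_ideal (cpts W1 \<union> cpts W2)) \<longleftrightarrow> u \<in> W1 \<union> W2"
  proof
    assume s: "pt u \<in> support (vanishing_ideal (cpts W1 \<union> cpts W2))"
    show "u \<in> W1 \<union> W2"
    proof (rule ccontr)
      assume "u \<notin> W1 \<union> W2"
      then have n: "u \<notin> vec.span W1" "u \<notin> vec.span W2"
        using assms by (metis Un_iff vec.span_eq_iff)+
      obtain y where y: "linear_form y" "y u = 1" "\<forall>w\<in>vec.span W1. y w = 0"
        using separating_linear_form[OF n(1)] by blast
      obtain z where z: "linear_form z" "z u = 1" "\<forall>w\<in>vec.span W2. z w = 0"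
        using separating_linear_form[OF n(2)] by blast
      let ?F = "lin_mpoly y * lin_mpoly z"
      have "?F \<in> vanishing_ideal (cpts W1 \<union> cpts W2)"
        using y z by (auto simp: vanishing_ideal_def cpts_def pt_eq linear_form_scale vec.span_base)
      then have "pt u \<notin> support (vanishing_ideal (cpts W1 \<union> cpts W2))"
        using y z u by (intro not_in_support[of ?F _ 2])
          (auto simp: homogeneous_lin_mpoly_mult vanishing_ideal_mult)
      then show False using s by blast
    qed
  next
    assume "u \<in> W1 \<union> W2"
    then have "pt u \<in> cpts W1 \<union> cpts W2" using u by (auto simp: cpts_def)
    then have "pt u \<in> zero_locus (vanishing_ideal (cpts W1 \<union> cpts W2))"
      using u by (auto simp: zero_locus_def vanishing_ideal_def)
    then show "pt u \<in> support (vanishing_ideal (cpts W1 \<union> cpts W2))"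
      using zero_locus_subset_support by blast
  qed
qed (auto simp: support_def)

lemma support_quadric:
  fixes F :: "('v::finite, 'k::field) mpoly"
  assumes W: "vec.subspace W" and F: "homogeneous 2 F"
  shows "support {G + H * F | G H. G \<in> vanishing_ideal (proj W)} = cpts {w \<in> W. meval F w = 0}"
    (is "support ?J = _")
proof (rule cpts_eqI)
  fix u :: "'k ^ 'v" assume u: "u \<noteq> 0"
  have mult: "H * G \<in> ?J" if G: "G \<in> ?J" for H G
  proof -
    obtain G1 H1 where "G = G1 + H1 * F" "G1 \<in> vanishing_ideal (proj W)" using G by auto
    then have "H * G = (H * G1) + (H * H1) * F" "H * G1 \<in> vanishing_ideal (proj W)"
      by (simp_all add: vanishing_ideal_mult distrib_left mult.assoc)
    then show ?thesis by blast
  qed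
  show "pt u \<in> support ?J \<longleftrightarrow> u \<in> {w \<in> W. meval F w = 0}"
  proof
    assume s: "pt u \<in> support ?J"
    have "u \<in> W"
    proof (rule ccontr)
      assume "u \<notin> W"
      then have "u \<notin> vec.span W" using W by (metis vec.span_eq_iff)
      then obtain y where y: "linear_form y" "y u = 1" "\<forall>w\<in>vec.span W. y w = 0"
        using separating_linear_form by blast
      have "lin_mpoly y \<in> vanishing_ideal (proj W)"
        unfolding proj_eq_cpts[OF W]
        using y by (intro vanishing_ideal_cptsI cone_subspace W) (simp add: vec.span_base)
      then have "lin_mpoly y + 0 * F \<in> ?J" by blast
      then have J1: "lin_mpoly y \<in> ?J" by (simp only: mult_zero_left add_0_right)
      have "pt u \<notin> support ?J"
        by (rule not_in_support[OF J1 homogeneous_lin_mpoly _ u mult]) (simp_all add: y(1,2))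
      then show False using s by blast
    qed
    moreover have "meval F u = 0"
    proof (rule ccontr)
      assume n: "meval F u \<noteq> 0"
      have "0 + 1 * F \<in> ?J" using vanishing_ideal_0 by blast
      then have "pt u \<notin> support ?J"
        using u mult n F by (intro not_in_support[of F _ 2]) auto
      then show False using s by blast
    qed
    ultimately show "u \<in> {w \<in> W. meval F w = 0}" by simp
  next
    assume uW: "u \<in> {w \<in> W. meval F w = 0}"
    have "meval G (c *s u) = 0" if G: "G \<in> ?J" for G c
    proof -
      obtain G1 H where GH: "G = G1 + H * F" "G1 \<in> vanishing_ideal (cpts W)"
        using G by (auto simp: proj_eq_cpts[OF W])
      have "pt u \<in> cpts W" using u uW by (auto simp: cpts_def)
      then have "meval G1 (c *s u) = 0" using GH(2) by (simp add: vanishing_ideal_def)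
      then show ?thesis using GH(1) uW by (simp add: homogeneous_meval_scale[OF F])
    qed
    then have "pt u \<in> zero_locus ?J"
      using pt_in_points[OF u] unfolding zero_locus_def pt_eq by blast
    then show "pt u \<in> support ?J" using zero_locus_subset_support by blast
  qed
qed (auto simp: support_def)

text \<open>
  If all zeros lay in a hyperplane \<open>y = 0\<close> of \<open>W\<close>, then \<open>F\<close> would be a multiple of \<open>y\<^sup>2\<close> on \<open>W\<close>: on the
  line through \<open>w\<close> with \<open>y w = 0\<close> in a direction \<open>v\<close> with \<open>y v \<noteq> 0\<close>, a quadratic polynomial without
  zeros outside \<open>0\<close> is a multiple of \<open>e\<^sup>2\<close>. Then \<open>F\<close> would be singular along the hyperplane.
\<close>

lemma smooth_quadric_spans:
  fixes F :: "('v::finite, 'k::alg_closed_field) mpoly"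
  assumes W: "vec.subspace W" "vec.dim W \<ge> 2" and F: "homogeneous 2 F"
    and smooth: "\<forall>v\<in>W. v \<noteq> 0 \<and> meval F v = 0 \<longrightarrow> (\<exists>w\<in>W. dir_deriv F v w \<noteq> 0)"
  shows "vec.span {w \<in> W. meval F w = 0} = W"
proof (rule ccontr)
  let ?Z = "{w \<in> W. meval F w = 0}"
  assume ne: "vec.span ?Z \<noteq> W"
  have "vec.span ?Z \<subseteq> W" using W(1) by (intro vec.span_minimal) auto
  then obtain v where v: "v \<in> W" "v \<notin> vec.span ?Z" using ne by blast
  then obtain y where y: "linear_form y" "y v = 1" "\<forall>w\<in>vec.span ?Z. y w = 0"
    using separating_linear_form by blast
  have nz: "meval F w \<noteq> 0" if "w \<in> W" "y w \<noteq> 0" for w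
    using that y(3) vec.span_base[of w ?Z] by auto
  have key: "meval F w = 0 \<and> dir_deriv F w v = 0" if w: "w \<in> W" "y w = 0" for w
  proof -
    have e: "meval F w + e * dir_deriv F w v + e\<^sup>2 * meval F v \<noteq> 0" if "e \<noteq> 0" for e
    proof -
      have "w + e *s v \<in> W" using W(1) w v by (simp add: vec.subspace_add vec.subspace_scale)
      moreover have "y (w + e *s v) \<noteq> 0" using y(1,2) w that by (simp add: linear_form_simps)
      ultimately show ?thesis using nz quadratic_form_expand[OF F] by metis
    qed
    have Fv: "meval F v \<noteq> 0" using nz v y by simp
    obtain e where "meval F v * e\<^sup>2 + dir_deriv F w v * e + meval F w = 0"
      using quadratic_root[OF Fv] by blast
    then have e0: "e = 0 \<and> meval F w = 0" using e[of e] by (cases "e = 0") (auto simp: algebra_simps)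
    moreover have "dir_deriv F w v = 0"
    proof (rule ccontr)
      assume "dir_deriv F w v \<noteq> 0"
      then have "- dir_deriv F w v / meval F v \<noteq> 0" using Fv by simp
      from e[OF this] show False using e0 Fv by (simp add: field_simps power2_eq_square)
    qed
    ultimately show ?thesis by simp
  qed
  have "\<exists>w0\<in>W. w0 \<noteq> 0 \<and> y w0 = 0"
  proof (rule ccontr)
    assume c: "\<not> ?thesis"
    have "W \<subseteq> vec.span {v}"
    proof
      fix w assume w: "w \<in> W"
      have "w - y w *s v \<in> W" using W(1) w v by (simp add: vec.subspace_diff vec.subspace_scale)
      moreover have "y (w - y w *s v) = 0" using y(1,2) by (simp add: linear_form_simps)
      ultimately have "w - y w *s v = 0" using c by blast
      then have "w = y w *s v" by simp
      then show "w \<in> vec.span {v}" by (metis vec.span_base vec.span_scale singletonI)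
    qed
    then have "vec.dim W \<le> card {v}" by (intro vec.dim_le_card) auto
    then show False using W(2) by simp
  qed
  then obtain w0 where w0: "w0 \<in> W" "w0 \<noteq> 0" "y w0 = 0" by blast
  have "dir_deriv F w0 w = 0" if w: "w \<in> W" for w
  proof -
    let ?u = "w - y w *s v"
    have u: "?u \<in> W" "y ?u = 0"
      using W(1) w v y(1,2) by (simp_all add: vec.subspace_diff vec.subspace_scale linear_form_simps)
    have "meval F (w0 + 1 *s ?u) = 0"
      using key w0 u y(1) W(1) by (simp add: vec.subspace_add linear_form_simps)
    then have "dir_deriv F w0 ?u = 0"
      unfolding quadratic_form_expand[OF F] using key w0 u by simp
    then have "dir_deriv F w0 w - y w * dir_deriv F w0 v = 0"
      using linear_form_dir_deriv[of F w0] by (simp add: linear_form_simps)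
    then show ?thesis using key w0 by simp
  qed
  then show False using smooth key w0 by blast
qed

text \<open>Two lines in a plane meet, and a quadric containing both is singular where they meet.\<close>

lemma smooth_conic_contains_no_line_pair:
  fixes F :: "('v::finite, 'k::alg_closed_field) mpoly"
  assumes W: "vec.subspace W" "vec.dim W = 3" and F: "homogeneous 2 F"
    and smooth: "\<forall>v\<in>W. v \<noteq> 0 \<and> meval F v = 0 \<longrightarrow> (\<exists>w\<in>W. dir_deriv F v w \<noteq> 0)"
    and W1: "vec.subspace W1" "vec.dim W1 = 2" and W2: "vec.subspace W2" "vec.dim W2 = 2"
    and Z: "{w \<in> W. meval F w = 0} = W1 \<union> W2"
  shows False
proof -
  have span: "vec.span (W1 \<union> W2) = W"
    using smooth_quadric_spans[OF W(1) _ F smooth] W(2) Z by simp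
  have "vec.dim {x + y |x y. x \<in> W1 \<and> y \<in> W2} \<le> vec.dim W"
    using W1(1) W2(1) Z W(1) by (intro vec.dim_subset) (auto intro: vec.subspace_add)
  then have "vec.dim (W1 \<inter> W2) \<noteq> 0"
    using vec.dim_sums_Int[OF W1(1) W2(1)] W1(2) W2(2) W(2) by linarith
  then obtain u where u: "u \<in> W1" "u \<in> W2" "u \<noteq> 0" by (auto simp: vec.dim_eq_0)
  have d0: "dir_deriv F u w = 0" if "w \<in> W1 \<union> W2" for w
  proof -
    have "u + 1 *s w \<in> W1 \<union> W2" using that u W1(1) W2(1) by (auto intro: vec.subspace_add)
    then have "meval F (u + 1 *s w) = 0" "meval F u = 0" "meval F w = 0" using Z that u by auto
    then show ?thesis unfolding quadratic_form_expand[OF F] by simp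
  qed
  have "dir_deriv F u w = 0" if "w \<in> vec.span (W1 \<union> W2)" for w
    using that
  proof (induction rule: vec.span_induct_alt)
    case base
    then show ?case by (simp add: linear_form_0[OF linear_form_dir_deriv])
  next
    case (step c x w)
    then show ?case using d0[of x]
      by (simp add: linear_form_add[OF linear_form_dir_deriv] linear_form_scale[OF linear_form_dir_deriv])
  qed
  then have "\<forall>w\<in>W. dir_deriv F u w = 0" using span by blast
  moreover have "u \<in> W" "meval F u = 0" using u Z by auto
  ultimately show False using smooth u(3) by blast
qed

section \<open>Secant cones that are linear spaces\<close>

lemma lin_hull_pair_ideal:
  "vanishing_ideal (lin_hull {pt v, pt w}) = {F. v = 0 \<and> w = 0 \<or> (\<forall>s t. meval F (s *s v + t *s w) = 0)}"
proof -
  have "F \<in> vanishing_ideal (lin_hull {pt v, pt w}) \<longleftrightarrow>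
      vec.span {v, w} \<subseteq> {0} \<or> (\<forall>u\<in>vec.span {v, w}. meval F u = 0)" for F
    unfolding lin_hull_pair by (rule vanishing_ideal_cpts) (simp add: cone_subspace)
  moreover have "vec.span {v, w} \<subseteq> {0} \<longleftrightarrow> v = 0 \<and> w = 0"
  proof
    assume "vec.span {v, w} \<subseteq> {0}"
    then have "{v, w} \<subseteq> {0}" using vec.span_superset[of "{v, w}"] by blast
    then show "v = 0 \<and> w = 0" by simp
  next
    assume "v = 0 \<and> w = 0"
    then show "vec.span {v, w} \<subseteq> {0}" by simp
  qed
  ultimately show ?thesis by (auto simp: span_pair)
qed

lemma coordinates_on_line:
  fixes v w :: "'k::field ^ 'v::finite"
  assumes "w \<noteq> 0" "v \<notin> vec.span {w}"
  shows "\<exists>y z. linear_form y \<and> linear_form z \<and> y w = 1 \<and> y v = 0 \<and> z w = 0 \<and> z v = 1"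
proof -
  have ind: "vec.independent {v, w}"
    using assms vec.independent_insert[of v "{w}"] by (auto simp: vec.dependent_single)
  have ne: "v \<noteq> w" using assms vec.span_base by auto
  obtain y where "linear_form y" "\<forall>u\<in>{v, w}. y u = (if u = w then 1 else 0)"
    using dual_linear_form[OF ind, of w] by auto
  moreover obtain z where "linear_form z" "\<forall>u\<in>{v, w}. z u = (if u = v then 1 else 0)"
    using dual_linear_form[OF ind, of v] by auto
  ultimately show ?thesis using ne by fastforce
qed

lemma polyfun_linear_comb:
  assumes "linear_form y" "linear_form z"
  shows "polyfun (\<lambda>u. (y u *s v + z u *s w) $ i)"
  using assms by (simp add: polyfun.add polyfun.mult polyfun_linear_form polyfun.const)

text \<open>
  Here \<open>C\<close> is the cone over a projective set, \<open>p = pt v\<close> a point off it, and \<open>W\<close> a linear space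
  containing all secants through \<open>p\<close>. If the quadric \<open>Q = 0\<close> cuts out the intersection with \<open>W\<close>, both
  pointwise and in the sense that \<open>Q\<close> divides the restriction to \<open>W\<close> of every polynomial vanishing
  on \<open>C\<close>, then the secant cone is all of \<open>W\<close>, since the line from \<open>p\<close> to any point of \<open>W\<close> meets the
  quadric. Therefore the secant locus is the quadric \<open>Q = 0\<close> in \<open>W\<close>.
\<close>

locale quadric_section =
  fixes C W :: "('k::alg_closed_field ^ 'v::finite) set" and Q :: "('v, 'k) mpoly" and v :: "'k ^ 'v"
  assumes cone_C: "cone C" and W: "vec.subspace W" "vec.dim W \<ge> 2"
    and v: "v \<in> W" "meval Q v \<noteq> 0"
    and Q: "homogeneous 2 Q" and Q_C: "\<And>w. w \<in> C \<Longrightarrow> meval Q w = 0"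
    and C_Q: "\<And>w. w \<in> W \<Longrightarrow> meval Q w = 0 \<Longrightarrow> w \<in> C"
    and divides: "\<And>F. (\<And>w. w \<in> C \<Longrightarrow> meval F w = 0) \<Longrightarrow> \<exists>h. polyfun h \<and> (\<forall>w\<in>W. meval F w = meval Q w * h w)"
    and secants: "secant_points (cpts C) (pt v) \<subseteq> cpts W"
begin

abbreviation "Z \<equiv> {w \<in> W. meval Q w = 0}"

lemma v_nz: "v \<noteq> 0" and v_notin: "v \<notin> C"
  using v homogeneous_meval_0[OF Q] Q_C by auto

lemma span_v: "u \<in> vec.span {v, w} \<Longrightarrow> w \<in> W \<Longrightarrow> u \<in> W"
  using W(1) v(1) by (auto simp: span_pair vec.subspace_add vec.subspace_scale)

lemma zero_independent:
  assumes "w \<in> Z" "w \<noteq> 0" shows "v \<notin> vec.span {w}"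
proof
  assume "v \<in> vec.span {w}"
  then obtain c where "v = c *s w" by (auto simp: vec.span_singleton)
  then have "meval Q v = c\<^sup>2 * meval Q w" using Q by (simp add: homogeneous_meval_scale)
  then show False using assms v(2) by simp
qed

text \<open>
  Every form in the ideal of \<open>X \<inter> \<langle>p, q\<rangle>\<close> is divisible by \<open>Q\<close> on that line. This gives two linear
  conditions: its vanishing at both zeros of \<open>Q\<close> or, if \<open>Q\<close> has a double zero at \<open>q\<close>, its vanishing
  to second order at \<open>q\<close>.
\<close>

lemma zero_is_secant:
  assumes w: "w \<in> Z" "w \<noteq> 0"
  shows "pt w \<in> secant_points (cpts C) (pt v)"
proof -
  let ?J = "scheme_inter (vanishing_ideal (cpts C)) (vanishing_ideal (lin_hull {pt v, pt w}))"
  obtain y z where yz: "linear_form y" "linear_form z" "y w = 1" "y v = 0" "z w = 0" "z v = 1"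
    using coordinates_on_line[OF w(2) zero_independent[OF w]] by blast
  define b where "b = dir_deriv Q w v"
  have Qline: "meval Q (w + e *s v) = e * (b + e * meval Q v)" for e
    using quadratic_form_expand[OF Q, of w e v] w by (simp add: b_def algebra_simps power2_eq_square)
  have div: "\<exists>h. polyfun h \<and> (\<forall>e. meval F (w + e *s v) = meval Q (w + e *s v) * h (w + e *s v))"
    if F: "F \<in> ?J" for F
  proof -
    obtain F1 F2 where F12: "F = F1 + F2" "F1 \<in> vanishing_ideal (cpts C)"
      "F2 \<in> vanishing_ideal (lin_hull {pt v, pt w})" using F by (auto simp: scheme_inter_def)
    have wC: "w \<in> C" using w C_Q by simp
    have "meval F1 u = 0" if "u \<in> C" for u
      using F12(2) that wC w(2) vanishing_ideal_cpts[OF cone_C] by blast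
    then obtain h where h: "polyfun h" "\<forall>u\<in>W. meval F1 u = meval Q u * h u" using divides by blast
    have "meval F2 (e *s v + 1 *s w) = 0" for e using F12(3) w(2) unfolding lin_hull_pair_ideal by blast
    then have "meval F2 (w + e *s v) = 0" for e by (simp add: add.commute)
    moreover have "w + e *s v \<in> W" for e
      using W(1) v(1) w by (simp add: vec.subspace_add vec.subspace_scale)
    ultimately show ?thesis using h F12(1) by auto
  qed
  have "2 \<le> hilbert_function ?J d" if d: "d \<ge> 1" for d
  proof (cases "b = 0")
    case True
    let ?F = "lin_mpoly y ^ d" and ?G = "lin_mpoly y ^ (d - 1) * lin_mpoly z"
    have double: "meval F w = 0 \<and> dir_deriv F w v = 0" if F: "F \<in> ?J" for F
    proof -
      obtain h where h: "polyfun h" "\<forall>e. meval F (w + e *s v) = meval Q (w + e *s v) * h (w + e *s v)"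
        using div[OF F] by blast
      obtain P where P: "\<forall>e. poly P e = h (w + e *s v)" using polyfun_along_line[OF h(1)] by blast
      have "meval F (w + e *s v) = poly ([:0, 0, meval Q v:] * P) e" for e
        using h(2) P Qline True by (simp add: algebra_simps)
      then have "dir_deriv F w v = coeff ([:0, 0, meval Q v:] * P) 1"
        by (rule dir_deriv_eqI)
      then have "dir_deriv F w v = 0" by (simp add: mult_pCons_left coeff_pCons)
      moreover have "meval F w = 0" using spec[OF h(2), of 0] w by simp
      ultimately show ?thesis by blast
    qed
    show ?thesis
    proof (rule hilbert_function_ge_2[OF scheme_inter_subspace, of d ?F ?G])
      show "homogeneous d ?F" using homogeneous_power[OF homogeneous_lin_mpoly, of d] by simp
      show "homogeneous d ?G"
        using homogeneous_mult[OF homogeneous_power[OF homogeneous_lin_mpoly, of "d - 1"] homogeneous_lin_mpoly] d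
        by simp
      show "?F \<notin> ?J" using double[of ?F] yz by auto
      show "?G - mscale c ?F \<notin> ?J" for c
      proof
        assume J: "?G - mscale c ?F \<in> ?J"
        have "c = 0" using double[OF J] yz by simp
        then have "meval (?G - mscale c ?F) (w + e *s v) = poly [:0, 1:] e" for e
          using yz by (simp add: linear_form_simps)
        then have "dir_deriv (?G - mscale c ?F) w v = coeff [:0, 1:] 1" by (rule dir_deriv_eqI)
        then show False using double[OF J] by simp
      qed
    qed
  next
    case False
    define e where "e = - b / meval Q v"
    have e: "e \<noteq> 0" "meval Q (w + e *s v) = 0" using False v(2) Qline[of e] by (auto simp: e_def)
    let ?z = "\<lambda>u. inverse e * z u" and ?y = "\<lambda>u. y u + (- inverse e) * z u"
    let ?F = "lin_mpoly ?y ^ d" and ?G = "lin_mpoly ?z ^ d"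
    have lf: "linear_form ?z" "linear_form ?y"
      by (rule linear_form_times[OF yz(2)], rule linear_form_plus[OF yz(1) linear_form_times[OF yz(2)]])
    have two: "meval F w = 0 \<and> meval F (w + e *s v) = 0" if F: "F \<in> ?J" for F
    proof -
      obtain h where h: "\<forall>e. meval F (w + e *s v) = meval Q (w + e *s v) * h (w + e *s v)"
        using div[OF F] by blast
      show ?thesis using spec[OF h, of 0] spec[OF h, of e] e w by simp
    qed
    show ?thesis
    proof (rule hilbert_function_ge_2[OF scheme_inter_subspace, of d ?F ?G])
      show "homogeneous d ?F" "homogeneous d ?G"
        using homogeneous_power[OF homogeneous_lin_mpoly, of d] by simp_all
      show "?F \<notin> ?J" using two[of ?F] lf yz by auto
      show "?G - mscale c ?F \<notin> ?J" for c
        using two[of "?G - mscale c ?F"] lf yz e d by (auto simp: linear_form_simps power_0_left)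
    qed
  qed
  then have "2 \<le> scheme_length ?J" by (rule scheme_length_ge_2)
  moreover have "pt w \<in> cpts C" using w C_Q by (auto simp: cpts_def)
  ultimately show ?thesis by (simp add: secant_points_def)
qed

lemma cone_Z: "cone Z"
  using W(1) Q by (auto simp: cone_def homogeneous_meval_scale vec.subspace_scale)

lemma secant_points_eq: "secant_points (cpts C) (pt v) = cpts Z"
proof
  show "cpts Z \<subseteq> secant_points (cpts C) (pt v)"
    using zero_is_secant by (auto simp: cpts_def)
  show "secant_points (cpts C) (pt v) \<subseteq> cpts Z"
  proof
    fix q assume q: "q \<in> secant_points (cpts C) (pt v)"
    then have "q \<in> cpts C" "q \<in> cpts W" using secants by (auto simp: secant_points_def)
    then obtain w where w: "w \<noteq> 0" "w \<in> C" "q = pt w" "pt w \<in> cpts W" by (auto simp: cpts_def)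
    then have "w \<in> W" using pt_in_cpts_iff[OF cone_subspace[OF W(1)]] by simp
    then show "q \<in> cpts Z" using w Q_C by (auto simp: cpts_def)
  qed
qed

lemma line_meets_Z:
  assumes "x \<in> W" shows "\<exists>w c. w \<in> Z \<and> x = w + c *s v"
proof -
  obtain c where "meval Q v * c\<^sup>2 + dir_deriv Q x v * c + meval Q x = 0"
    using quadratic_root[OF v(2)] by blast
  then have "meval Q (x + c *s v) = 0" unfolding quadratic_form_expand[OF Q] by (simp add: algebra_simps)
  then have "x + c *s v \<in> Z" using assms v W(1) by (simp add: vec.subspace_add vec.subspace_scale)
  moreover have "x = (x + c *s v) + (- c) *s v" by simp
  ultimately show ?thesis by blast
qed

lemma exists_zero: "\<exists>w\<in>Z. w \<noteq> 0"
proof (rule ccontr)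
  assume c: "\<not> ?thesis"
  have "W \<subseteq> vec.span {v}"
  proof
    fix x assume "x \<in> W"
    then obtain w c where "w \<in> Z" "x = w + c *s v" using line_meets_Z by blast
    then have "x = c *s v" using c by auto
    then show "x \<in> vec.span {v}" by (auto simp: vec.span_singleton)
  qed
  then have "vec.dim W \<le> card {v}" by (intro vec.dim_le_card) auto
  then show False using W(2) by simp
qed

lemma secant_cone_eq: "secant_cone (cpts C) (pt v) = cpts W"
proof -
  have ne: "cpts Z \<noteq> {}" using exists_zero by (auto simp: cpts_def)
  have "(\<Union>q\<in>cpts Z. lin_hull {pt v, q}) = cpts W"
  proof
    show "(\<Union>q\<in>cpts Z. lin_hull {pt v, q}) \<subseteq> cpts W"
    proof clarify
      fix q r assume "q \<in> cpts Z" "r \<in> lin_hull {pt v, q}"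
      then obtain w where w: "w \<in> Z" "q = pt w" by (auto simp: cpts_def)
      then have "r \<in> cpts (vec.span {v, w})"
        using \<open>r \<in> lin_hull {pt v, q}\<close> lin_hull_pair by metis
      then show "r \<in> cpts W" using span_v w by (auto simp: cpts_def)
    qed
    show "cpts W \<subseteq> (\<Union>q\<in>cpts Z. lin_hull {pt v, q})"
    proof
      fix r assume "r \<in> cpts W"
      then obtain x where x: "x \<noteq> 0" "x \<in> W" "r = pt x" by (auto simp: cpts_def)
      obtain w0 c where w0: "w0 \<in> Z" "x = w0 + c *s v" using line_meets_Z[OF x(2)] by blast
      obtain w1 where w1: "w1 \<in> Z" "w1 \<noteq> 0" using exists_zero by blast
      obtain w where w: "w \<in> Z" "w \<noteq> 0" "x \<in> vec.span {v, w}"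
      proof (cases "w0 = 0")
        case True
        then have "x = c *s v + 0 *s w1" using w0 by simp
        then have "x \<in> vec.span {v, w1}" unfolding span_pair by blast
        then show thesis using that w1 by blast
      next
        case False
        have "x = c *s v + 1 *s w0" using w0 by (simp add: add.commute)
        then have "x \<in> vec.span {v, w0}" unfolding span_pair by blast
        then show thesis using that w0 False by blast
      qed
      then have "r \<in> lin_hull {pt v, pt w}" using x unfolding lin_hull_pair by (auto simp: cpts_def)
      then show "r \<in> (\<Union>q\<in>cpts Z. lin_hull {pt v, q})" using w by (auto simp: cpts_def)
    qed
  qed
  then show ?thesis using ne by (simp add: secant_cone_def secant_points_eq)
qed

lemma C_nontrivial: "\<exists>w\<in>C. w \<noteq> 0"
  using exists_zero C_Q by blast

lemma vanishing_on_C: "F \<in> vanishing_ideal (cpts C) \<longleftrightarrow> (\<forall>w\<in>C. meval F w = 0)"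
  using vanishing_ideal_cpts[OF cone_C] C_nontrivial by auto

lemma vanishing_on_W: "F \<in> vanishing_ideal (cpts W) \<longleftrightarrow> (\<forall>w\<in>W. meval F w = 0)"
  using vanishing_ideal_cpts[OF cone_subspace[OF W(1)]] v(1) v_nz by blast

lemma secant_locus_eq:
  "secant_locus (cpts C) (pt v) = {F. \<exists>h. polyfun h \<and> (\<forall>w\<in>W. meval F w = meval Q w * h w)}"
  and secant_locus_eq':
  "secant_locus (cpts C) (pt v) = {G + H * Q | G H. G \<in> vanishing_ideal (proj W)}"
proof -
  let ?K1 = "{F. \<exists>h. polyfun h \<and> (\<forall>w\<in>W. meval F w = meval Q w * h w)}"
  let ?K2 = "{G + H * Q | G H. G \<in> vanishing_ideal (proj W)}"
  have "secant_locus (cpts C) (pt v) \<subseteq> ?K1"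
  proof
    fix F assume "F \<in> secant_locus (cpts C) (pt v)"
    then obtain F1 F2 where F12: "F = F1 + F2" "\<forall>w\<in>C. meval F1 w = 0" "\<forall>w\<in>W. meval F2 w = 0"
      by (auto simp: secant_locus_def secant_cone_eq scheme_inter_def vanishing_on_C vanishing_on_W)
    obtain h where "polyfun h" "\<forall>u\<in>W. meval F1 u = meval Q u * h u" using divides F12(2) by blast
    then show "F \<in> ?K1" using F12 by auto
  qed
  moreover have "?K1 \<subseteq> ?K2"
  proof
    fix F assume "F \<in> ?K1"
    then obtain h where h: "polyfun h" "\<forall>w\<in>W. meval F w = meval Q w * h w" by blast
    obtain H where H: "\<forall>v. meval H v = h v" using polyfun_imp_meval[OF h(1)] by blast
    have "F - H * Q \<in> vanishing_ideal (proj W)"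
      using h H by (simp add: proj_eq_cpts[OF W(1)] vanishing_on_W)
    moreover have "F = (F - H * Q) + H * Q" by simp
    ultimately show "F \<in> ?K2" by blast
  qed
  moreover have "?K2 \<subseteq> secant_locus (cpts C) (pt v)"
  proof
    fix F assume "F \<in> ?K2"
    then obtain G H where GH: "F = H * Q + G" "G \<in> vanishing_ideal (cpts W)"
      by (auto simp: proj_eq_cpts[OF W(1)] add.commute)
    moreover have "H * Q \<in> vanishing_ideal (cpts C)" using Q_C by (simp add: vanishing_on_C)
    ultimately show "F \<in> secant_locus (cpts C) (pt v)"
      unfolding secant_locus_def secant_cone_eq by (auto intro: scheme_interI)
  qed
  ultimately show "secant_locus (cpts C) (pt v) = ?K1" "secant_locus (cpts C) (pt v) = ?K2" by blast+
qed

lemma support_secant_locus: "support (secant_locus (cpts C) (pt v)) = cpts Z"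
  unfolding secant_locus_eq' by (rule support_quadric[OF W(1) Q])

lemma zero_locus_secant_locus: "zero_locus (secant_locus (cpts C) (pt v)) = cpts Z"
proof
  show "zero_locus (secant_locus (cpts C) (pt v)) \<subseteq> cpts Z"
    using zero_locus_subset_support support_secant_locus by blast
  show "cpts Z \<subseteq> zero_locus (secant_locus (cpts C) (pt v))"
  proof
    fix q assume "q \<in> cpts Z"
    then obtain w where w: "w \<noteq> 0" "w \<in> Z" "q = pt w" by (auto simp: cpts_def)
    have "meval F (c *s w) = 0" if "F \<in> secant_locus (cpts C) (pt v)" for F c
    proof -
      have "c *s w \<in> Z" using coneD[OF cone_Z] w by blast
      then show ?thesis using that unfolding secant_locus_eq by auto
    qed
    then show "q \<in> zero_locus (secant_locus (cpts C) (pt v))"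
      using w pt_in_points[OF w(1)] by (auto simp: zero_locus_def pt_eq)
  qed
qed

lemma secant_locus_reduced:
  assumes "\<And>F. (\<And>w. w \<in> Z \<Longrightarrow> meval F w = 0) \<Longrightarrow> \<exists>h. polyfun h \<and> (\<forall>w\<in>W. meval F w = meval Q w * h w)"
  shows "secant_locus (cpts C) (pt v) = vanishing_ideal (cpts Z)"
proof -
  have "F \<in> vanishing_ideal (cpts Z) \<longleftrightarrow> (\<forall>w\<in>Z. meval F w = 0)" for F
    using vanishing_ideal_cpts[OF cone_Z] exists_zero by blast
  then show ?thesis unfolding secant_locus_eq using assms by auto
qed

lemma smooth_quadric_secant_locus:
  assumes "\<And>w. w \<in> W \<Longrightarrow> w \<noteq> 0 \<Longrightarrow> meval Q w = 0 \<Longrightarrow> \<exists>u\<in>W. dir_deriv Q w u \<noteq> 0"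
  shows "smooth_quadric_in W (secant_locus (cpts C) (pt v))"
  unfolding smooth_quadric_in_def
  using Q assms secant_locus_eq' by (intro exI[of _ Q]) (auto simp: same_scheme_def subscheme_def)

end

section \<open>The types of secant loci exclude each other\<close>

lemma span_Union_cpts:
  assumes "cone C" shows "vec.span (\<Union>(cpts C)) = vec.span C"
proof
  show "vec.span (\<Union>(cpts C)) \<subseteq> vec.span C"
    by (rule vec.span_minimal) (auto simp: cpts_def pt_eq vec.span_base vec.span_scale)
  show "vec.span C \<subseteq> vec.span (\<Union>(cpts C))"
  proof (rule vec.span_minimal)
    show "C \<subseteq> vec.span (\<Union>(cpts C))"
    proof
      fix w assume "w \<in> C"
      then show "w \<in> vec.span (\<Union>(cpts C))"
        by (cases "w = 0") (auto simp: cpts_def vec.span_zero intro!: vec.span_base exI[of _ "pt w"])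
    qed
  qed simp
qed

text \<open>
  This number is \<open>0\<close>, \<open>2\<close>, \<open>1\<close>, \<open>3\<close>, \<open>3\<close> and \<open>4\<close> for the six types, so that only line pairs and
  conics remain to be distinguished.
\<close>

definition support_rank :: "('v::finite, 'k::field) mpoly set \<Rightarrow> nat" where
  "support_rank J = vec.dim (\<Union>(support J))"

lemma support_rank_cpts: "support J = cpts C \<Longrightarrow> cone C \<Longrightarrow> support_rank J = vec.dim (vec.span C)"
  unfolding support_rank_def by (metis span_Union_cpts vec.dim_span)

lemma cone_Un: "cone C \<Longrightarrow> cone D \<Longrightarrow> cone (C \<union> D)"
  by (auto simp: cone_def)

lemma SL_empty_rank:
  fixes X :: "('k::field ^ 'v::finite) set set"
  assumes "p \<in> SL_empty X" shows "support_rank (secant_locus X p) = 0"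
proof -
  have "support (vanishing_ideal {}) = ({} :: ('k ^ 'v) set set)"
  proof -
    have "q \<notin> support (vanishing_ideal {})" for q :: "('k ^ 'v) set"
    proof
      assume q: "q \<in> support (vanishing_ideal {})"
      then obtain u where u: "u \<noteq> 0" "q = pt u" by (auto simp: support_def elim: pointsE)
      have "pt u \<notin> support (vanishing_ideal {})"
        by (rule not_in_support[of 1 _ 0]) (auto simp: vanishing_ideal_def homogeneous_1 u)
      then show False using q u by simp
    qed
    then show ?thesis by blast
  qed
  then have "support (secant_locus X p) = {}"
    using assms support_same_scheme by (auto simp: SL_empty_def)
  then show ?thesis by (simp add: support_rank_def)
qed

lemma cpts_span_single: "x \<noteq> 0 \<Longrightarrow> cpts (vec.span {x}) = {pt x}"
proof -
  assume x: "x \<noteq> 0"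
  have "{pt x} = cpts (vec.span {x})"
  proof (rule cpts_eqI)
    fix v :: "'a ^ 'b" assume v: "v \<noteq> 0"
    have "pt x = pt v \<longleftrightarrow> v \<in> vec.span {x}"
      unfolding pt_eq_iff[OF x] vec.span_singleton using v by auto
    then show "pt v \<in> {pt x} \<longleftrightarrow> v \<in> vec.span {x}" by auto
  qed (use x in simp)
  then show ?thesis by simp
qed

lemma SL_two_points_rank:
  fixes X :: "('k::field ^ 'v::finite) set set"
  assumes "p \<in> SL_two_points X" shows "support_rank (secant_locus X p) = 2"
proof -
  obtain q1 q2 where q: "q1 \<in> points" "q2 \<in> points" "q1 \<noteq> q2"
    "same_scheme (secant_locus X p) (vanishing_ideal {q1, q2})"
    using assms by (auto simp: SL_two_points_def)
  obtain x where x: "x \<noteq> 0" "q1 = pt x" using q(1) by (rule pointsE)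
  obtain y where y: "y \<noteq> 0" "q2 = pt y" using q(2) by (rule pointsE)
  have "{q1, q2} = cpts (vec.span {x}) \<union> cpts (vec.span {y})"
    using x y by (simp add: cpts_span_single insert_commute)
  then have "support (secant_locus X p) = cpts (vec.span {x} \<union> vec.span {y})"
    using support_same_scheme[OF q(4)] support_linear_spaces[of "vec.span {x}" "vec.span {y}"] by simp
  then have "support_rank (secant_locus X p) = vec.dim (vec.span (vec.span {x} \<union> vec.span {y}))"
    by (intro support_rank_cpts cone_Un cone_subspace) auto
  also have "vec.span (vec.span {x} \<union> vec.span {y}) = vec.span {x, y}"
  proof
    show "vec.span (vec.span {x} \<union> vec.span {y}) \<subseteq> vec.span {x, y}"
      by (rule vec.span_minimal) (simp_all add: vec.span_mono)
    show "vec.span {x, y} \<subseteq> vec.span (vec.span {x} \<union> vec.span {y})"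
      by (rule vec.span_mono) (simp add: vec.span_base)
  qed
  also have "vec.dim (vec.span {x, y}) = 2"
  proof -
    have ne: "y \<notin> vec.span {x}"
      using pt_eq_iff[OF x(1), of y] q(3) x y by (auto simp: vec.span_singleton)
    then have "vec.independent {y, x}" "y \<noteq> x"
      using x vec.independent_insert[of y "{x}"] by (auto simp: vec.dependent_single vec.span_base)
    then show ?thesis using vec.dim_eq_card_independent[of "{y, x}"] by (simp add: insert_commute)
  qed
  finally show ?thesis .
qed

text \<open>
  This type prescribes the zeros of the ideal instead of a subscheme, whence the second assumption;
  a general ideal may have fewer zeros than its forms of large degree.
\<close>

lemma SL_double_point_rank:
  fixes X :: "('k::field ^ 'v::finite) set set"
  assumes "p \<in> SL_double_point X" "support (secant_locus X p) = zero_locus (secant_locus X p)"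
  shows "support_rank (secant_locus X p) = 1"
proof -
  obtain q where q: "zero_locus (secant_locus X p) = {q}"
    using assms by (auto simp: SL_double_point_def)
  then have "q \<in> points" by (auto simp: zero_locus_def)
  then obtain x where x: "x \<noteq> 0" "q = pt x" by (rule pointsE)
  have "support (secant_locus X p) = cpts (vec.span {x})"
    using q x assms(2) by (simp add: cpts_span_single)
  then show ?thesis using support_rank_cpts[OF _ cone_subspace[of "vec.span {x}"]] x by simp
qed

lemma SL_line_pair_rank:
  fixes X :: "('k::field ^ 'v::finite) set set"
  assumes "p \<in> SL_line_pair X" shows "support_rank (secant_locus X p) = 3"
proof -
  obtain W1 W2 E where W: "vec.subspace W1" "vec.dim W1 = 2" "vec.subspace W2" "vec.dim W2 = 2" "W1 \<noteq> W2"
     "vec.subspace E" "vec.dim E = 3" "W1 \<subseteq> E" "W2 \<subseteq> E"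
     "same_scheme (secant_locus X p) (vanishing_ideal (proj W1 \<union> proj W2))"
    using assms by (auto simp: SL_line_pair_def)
  have "support (secant_locus X p) = cpts (W1 \<union> W2)"
    using support_same_scheme[OF W(10)] support_linear_spaces[of W1 W2] W by (simp add: proj_eq_cpts)
  then have "support_rank (secant_locus X p) = vec.dim (vec.span (W1 \<union> W2))"
    by (intro support_rank_cpts cone_Un cone_subspace W)
  also have "\<dots> = 3"
  proof -
    have le: "vec.dim (vec.span (W1 \<union> W2)) \<le> 3"
      using W vec.dim_subset[of "vec.span (W1 \<union> W2)" E] by (simp add: vec.span_minimal)
    have "vec.dim (vec.span (W1 \<union> W2)) \<noteq> 2"
    proof
      assume d: "vec.dim (vec.span (W1 \<union> W2)) = 2"
      have "W1 = vec.span (W1 \<union> W2)"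
        by (rule vec.subspace_dim_equal) (use W d in \<open>auto intro: vec.span_base\<close>)
      moreover have "W2 = vec.span (W1 \<union> W2)"
        by (rule vec.subspace_dim_equal) (use W d in \<open>auto intro: vec.span_base\<close>)
      ultimately show False using W(5) by simp
    qed
    moreover have "vec.dim W1 \<le> vec.dim (vec.span (W1 \<union> W2))"
      by (rule vec.dim_subset) (auto intro: vec.span_base)
    ultimately show ?thesis using W(2) le by linarith
  qed
  finally show ?thesis .
qed

lemma smooth_quadric_rank:
  fixes J :: "('v::finite, 'k::alg_closed_field) mpoly set"
  assumes "smooth_quadric_in W J" "vec.subspace W" "vec.dim W \<ge> 2"
  shows "support_rank J = vec.dim W"
proof -
  obtain F where F: "homogeneous 2 F" "same_scheme J {G + H * F | G H. G \<in> vanishing_ideal (proj W)}"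
    "\<forall>v\<in>W. v \<noteq> 0 \<and> meval F v = 0 \<longrightarrow> (\<exists>w\<in>W. dir_deriv F v w \<noteq> 0)"
    using assms(1) by (auto simp: smooth_quadric_in_def)
  have "support J = cpts {w \<in> W. meval F w = 0}"
    using support_same_scheme[OF F(2)] support_quadric[OF assms(2) F(1)] by simp
  moreover have "cone {w \<in> W. meval F w = 0}"
    using assms(2) F(1) by (auto simp: cone_def vec.subspace_scale homogeneous_meval_scale)
  ultimately show ?thesis
    using support_rank_cpts smooth_quadric_spans[OF assms(2,3) F(1,3)] by metis
qed

lemma SL_conic_rank:
  fixes X :: "('k::alg_closed_field ^ 'v::finite) set set"
  assumes "p \<in> SL_conic X" shows "support_rank (secant_locus X p) = 3"
  using assms smooth_quadric_rank by (fastforce simp: SL_conic_def)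

lemma SL_quadric_rank:
  fixes X :: "('k::alg_closed_field ^ 'v::finite) set set"
  assumes "p \<in> SL_quadric X" shows "support_rank (secant_locus X p) = 4"
  using assms smooth_quadric_rank by (fastforce simp: SL_quadric_def)

lemma cpts_inject:
  assumes "cone C" "cone D" "0 \<in> C" "0 \<in> D" "cpts C = cpts D"
  shows "C = D"
proof -
  have "v \<in> C \<longleftrightarrow> v \<in> D" for v
    using assms pt_in_cpts_iff[OF assms(1), of v] pt_in_cpts_iff[OF assms(2), of v] by (cases "v = 0") auto
  then show ?thesis by blast
qed

lemma SL_line_pair_not_conic:
  fixes X :: "('k::alg_closed_field ^ 'v::finite) set set"
  assumes "p \<in> SL_line_pair X" "p \<in> SL_conic X" shows False
proof -
  obtain W1 W2 where W12: "vec.subspace W1" "vec.dim W1 = 2" "vec.subspace W2" "vec.dim W2 = 2"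
     "same_scheme (secant_locus X p) (vanishing_ideal (proj W1 \<union> proj W2))"
    using assms(1) by (auto simp: SL_line_pair_def)
  obtain W where W: "vec.subspace W" "vec.dim W = 3" "smooth_quadric_in W (secant_locus X p)"
    using assms(2) by (auto simp: SL_conic_def)
  then obtain F where F: "homogeneous 2 F"
    "same_scheme (secant_locus X p) {G + H * F | G H. G \<in> vanishing_ideal (proj W)}"
    "\<forall>v\<in>W. v \<noteq> 0 \<and> meval F v = 0 \<longrightarrow> (\<exists>w\<in>W. dir_deriv F v w \<noteq> 0)"
    by (auto simp: smooth_quadric_in_def)
  have "cpts {w \<in> W. meval F w = 0} = cpts (W1 \<union> W2)"
    using support_same_scheme[OF F(2)] support_quadric[OF W(1) F(1)]
      support_same_scheme[OF W12(5)] support_linear_spaces[of W1 W2] W12 by (simp add: proj_eq_cpts)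
  moreover have "cone {w \<in> W. meval F w = 0}"
    using W(1) F(1) by (auto simp: cone_def vec.subspace_scale homogeneous_meval_scale)
  moreover have "cone (W1 \<union> W2)" by (intro cone_Un cone_subspace W12)
  moreover have "0 \<in> {w \<in> W. meval F w = 0}" "0 \<in> W1 \<union> W2"
    using W(1) W12(1) homogeneous_meval_0[OF F(1)] by (auto simp: vec.subspace_0)
  ultimately have "{w \<in> W. meval F w = 0} = W1 \<union> W2" using cpts_inject by blast
  then show False
    using smooth_conic_contains_no_line_pair[OF W(1,2) F(1,3) W12(1-4)] by blast
qed

text \<open>
  Without secant points the secant cone is the point \<open>p\<close> itself. As some quadric through \<open>X\<close> does not
  vanish there, the ideal of the secant locus contains all forms of degree at least \<open>2\<close>.
\<close>

lemma no_secants: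
  fixes C :: "('k::field ^ 'v::finite) set"
  assumes C: "cone C" and v: "v \<notin> C" "v \<noteq> 0" and Q: "homogeneous 2 Q" "\<And>w. w \<in> C \<Longrightarrow> meval Q w = 0" "meval Q v \<noteq> 0"
    and empty: "secant_points (cpts C) (pt v) = {}"
  shows "pt v \<in> SL_empty (cpts C)"
    and "support (secant_locus (cpts C) (pt v)) = zero_locus (secant_locus (cpts C) (pt v))"
proof -
  let ?J = "secant_locus (cpts C) (pt v)"
  have J: "?J = scheme_inter (vanishing_ideal (cpts C)) (vanishing_ideal {pt v})"
    by (simp add: secant_locus_def secant_cone_def empty)
  have QI: "H * Q \<in> vanishing_ideal (cpts C)" for H
    by (intro vanishing_ideal_mult vanishing_ideal_cptsI C Q)
  have "F \<in> ?J" if F: "homogeneous d F" "d \<ge> 2" for F d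
  proof -
    obtain y where y: "linear_form y" "y v = 1" using exists_linear_form_1[OF v(2)] by blast
    let ?H = "mscale (meval F v / meval Q v) (lin_mpoly y ^ (d - 2))"
    have "homogeneous ((d - 2) * 1 + 2) (?H * Q)"
      by (intro homogeneous_mult homogeneous_mscale homogeneous_power homogeneous_lin_mpoly Q)
    moreover have "(d - 2) * 1 + 2 = d" using F(2) by simp
    ultimately have "homogeneous d (F - ?H * Q)" using F(1) homogeneous_diff by metis
    moreover have "meval (F - ?H * Q) v = 0" using Q(3) y by simp
    ultimately have "F - ?H * Q \<in> vanishing_ideal {pt v}"
      by (auto simp only: vanishing_ideal_def pt_eq mem_Collect_eq homogeneous_meval_scale) simp
    then have "?H * Q + (F - ?H * Q) \<in> ?J" unfolding J by (intro scheme_interI QI)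
    then show ?thesis by simp
  qed
  then have ss: "same_scheme ?J (vanishing_ideal {})"
    by (auto simp: same_scheme_def subscheme_def vanishing_ideal_def)
  moreover have "pt v \<notin> cpts C" using v pt_in_cpts_iff[OF C] by blast
  ultimately show SL: "pt v \<in> SL_empty (cpts C)" using v by (simp add: SL_empty_def)
  have "support ?J = {}"
  proof -
    have "q \<notin> support ?J" for q
    proof
      assume q: "q \<in> support ?J"
      then obtain u where u: "u \<noteq> 0" "q = pt u" by (auto simp: support_def elim: pointsE)
      have "pt u \<in> support (vanishing_ideal {})" using q u support_same_scheme[OF ss] by simp
      moreover have "pt u \<notin> support (vanishing_ideal {})"
        by (rule not_in_support[of 1 _ 0]) (auto simp: vanishing_ideal_def homogeneous_1 u)
      ultimately show False by simp
    qed
    then show ?thesis by blast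
  qed
  then show "support ?J = zero_locus ?J" using zero_locus_subset_support by blast
qed


section \<open>Divisibility by quadratic forms\<close>

text \<open>
  The second division is in a direction \<open>z1\<close> inside the hyperplane \<open>y0 = 0\<close> and does not disturb the
  factor \<open>y0\<close> found by the first one.
\<close>

lemma divisible_by_product:
  fixes f :: "'k::alg_closed_field ^ 'v::finite \<Rightarrow> 'k"
  assumes f: "polyfun f" and y0: "linear_form y0" "y0 z0 = 1" "y0 z1 = 0"
    and y1: "linear_form y1" "y1 z1 = 1"
    and zero: "\<And>v. y0 v * y1 v = 0 \<Longrightarrow> f v = 0"
  shows "\<exists>h. polyfun h \<and> (\<forall>v. f v = y0 v * y1 v * h v)"
proof -
  obtain h where h: "polyfun h" "\<And>v. f v = f (v - y0 v *s z0) + y0 v * h v"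
    using polyfun_divide[OF f y0(1)] by blast
  obtain k where k: "polyfun k" "\<And>v. h v = h (v - y1 v *s z1) + y1 v * k v"
    using polyfun_divide[OF h(1) y1(1)] by blast
  have fh: "f v = y0 v * h v" for v
    using h(2)[of v] zero[of "v - y0 v *s z0"] y0 by (simp add: linear_form_simps)
  have "f v = y0 v * y1 v * k v" for v
  proof -
    let ?u = "v - y1 v *s z1"
    have "y0 v * h ?u = f ?u" using fh[of ?u] y0 by (simp add: linear_form_simps)
    also have "\<dots> = 0" using y1 by (intro zero) (simp add: linear_form_simps)
    finally show ?thesis using fh[of v] k(2)[of v] by (simp add: algebra_simps)
  qed
  then show ?thesis using k(1) by blast
qed

text \<open>
  For \<open>D = y0 y1 - R\<close> with \<open>R\<close> free of the coordinates \<open>y0\<close> and \<open>y1\<close>, the zeros with \<open>y0 \<noteq> 0\<close> form the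
  graph of \<open>y1 = R / y0\<close>. Pseudo-division by \<open>D\<close> with respect to \<open>y1\<close> gives \<open>y0\<^sup>N f = D h + r\<close> with
  \<open>r\<close> free of \<open>y1\<close>, and \<open>r\<close> vanishes because \<open>f\<close> does on the graph. Finally \<open>y0\<close> can be cancelled, as
  it does not divide \<open>D\<close>.
\<close>

lemma pseudo_division:
  fixes f :: "'k::field ^ 'v::finite \<Rightarrow> 'k"
  assumes f: "polyfun f" and y0: "linear_form y0" "y0 z1 = 0" and y1: "linear_form y1" "y1 z1 = 1"
    and R: "polyfun R" "\<And>v c. R (v + c *s z1) = R v"
  shows "\<exists>N h r. polyfun h \<and> polyfun r \<and> (\<forall>v c. r (v + c *s z1) = r v) \<and>
     (\<forall>v. y0 v ^ N * f v = (y0 v * y1 v - R v) * h v + r v)"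
  using f
proof induction
  case (const c)
  show ?case
    by (intro exI[of _ 0] exI[of _ "\<lambda>v. 0"] exI[of _ "\<lambda>v. c"]) (auto intro: polyfun.const)
next
  case (coord i)
  let ?r = "\<lambda>v. y0 v * (v $ i - y1 v * z1 $ i) + z1 $ i * R v"
  have "polyfun ?r"
    by (intro polyfun.add polyfun.mult polyfun_diff polyfun.coord polyfun.const R
        polyfun_linear_form y0 y1)
  moreover have "?r (v + c *s z1) = ?r v" for v c
    using y0 y1 R(2) by (simp add: linear_form_simps algebra_simps)
  moreover have "y0 v ^ 1 * v $ i = (y0 v * y1 v - R v) * z1 $ i + ?r v" for v
    by (simp add: algebra_simps)
  moreover have "polyfun (\<lambda>v :: 'k ^ 'v. z1 $ i)" by (rule polyfun.const)
  ultimately show ?case by blast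
next
  case (add f g)
  then obtain N h r M k s where 1: "polyfun h" "polyfun r" "\<And>v c. r (v + c *s z1) = r v"
     "\<And>v. y0 v ^ N * f v = (y0 v * y1 v - R v) * h v + r v" "polyfun k" "polyfun s"
     "\<And>v c. s (v + c *s z1) = s v" "\<And>v. y0 v ^ M * g v = (y0 v * y1 v - R v) * k v + s v"
    by metis
  let ?h = "\<lambda>v. y0 v ^ M * h v + y0 v ^ N * k v" and ?r = "\<lambda>v. y0 v ^ M * r v + y0 v ^ N * s v"
  have "polyfun ?h" "polyfun ?r"
    by (intro polyfun.add polyfun.mult polyfun_power polyfun_linear_form y0 1)+
  moreover have "?r (v + c *s z1) = ?r v" for v c
    using y0 1(3,7) by (simp add: linear_form_simps)
  moreover have "y0 v ^ (N + M) * (f v + g v) = (y0 v * y1 v - R v) * ?h v + ?r v" for v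
  proof -
    have "y0 v ^ (N + M) * (f v + g v) = y0 v ^ M * (y0 v ^ N * f v) + y0 v ^ N * (y0 v ^ M * g v)"
      by (simp add: power_add algebra_simps)
    then show ?thesis unfolding 1(4) 1(8) by (simp add: algebra_simps)
  qed
  ultimately show ?case by blast
next
  case (mult f g)
  then obtain N h r M k s where 1: "polyfun h" "polyfun r" "\<And>v c. r (v + c *s z1) = r v"
     "\<And>v. y0 v ^ N * f v = (y0 v * y1 v - R v) * h v + r v" "polyfun k" "polyfun s"
     "\<And>v c. s (v + c *s z1) = s v" "\<And>v. y0 v ^ M * g v = (y0 v * y1 v - R v) * k v + s v"
    by metis
  let ?h = "\<lambda>v. (y0 v * y1 v - R v) * h v * k v + h v * s v + r v * k v" and ?r = "\<lambda>v. r v * s v"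
  have "polyfun ?h" "polyfun ?r"
    by (intro polyfun.add polyfun.mult polyfun_diff polyfun_linear_form y0 y1 R 1)+
  moreover have "?r (v + c *s z1) = ?r v" for v c using 1(3,7) by simp
  moreover have "y0 v ^ (N + M) * (f v * g v) = (y0 v * y1 v - R v) * ?h v + ?r v" for v
  proof -
    have "y0 v ^ (N + M) * (f v * g v) = (y0 v ^ N * f v) * (y0 v ^ M * g v)"
      by (simp add: power_add algebra_simps)
    then show ?thesis unfolding 1(4) 1(8) by (simp add: algebra_simps)
  qed
  ultimately show ?case by blast
qed

lemma divisible_by_quadric:
  fixes f :: "'k::alg_closed_field ^ 'v::finite \<Rightarrow> 'k"
  assumes f: "polyfun f" and y0: "linear_form y0" "y0 z0 = 1" "y0 z1 = 0"
    and y1: "linear_form y1" "y1 z1 = 1" "y1 z0 = 0"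
    and R: "polyfun R" "\<And>v c. R (v + c *s z1) = R v" "\<And>v c. R (v + c *s z0) = R v" "R v0 \<noteq> 0"
    and zero: "\<And>v. y0 v * y1 v = R v \<Longrightarrow> f v = 0"
  shows "\<exists>h. polyfun h \<and> (\<forall>v. f v = (y0 v * y1 v - R v) * h v)"
proof -
  let ?D = "\<lambda>v. y0 v * y1 v - R v"
  note pf = polyfun_linear_form[OF y0(1)] polyfun_linear_form[OF y1(1)]
  obtain N h r where hr: "polyfun h" "polyfun r" "\<And>v c. r (v + c *s z1) = r v"
    "\<And>v. y0 v ^ N * f v = ?D v * h v + r v"
    using pseudo_division[OF f y0(1,3) y1(1,2) R(1,2)] by metis
  have "r v = 0" for v
  proof (rule polyfun_cancel[OF hr(2) pf(1)])
    show "r v * y0 v = 0" for v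
    proof (cases "y0 v = 0")
      case False
      let ?u = "v + (R v / y0 v - y1 v) *s z1"
      have "y0 ?u * y1 ?u = R ?u" using False y0 y1 R(2) by (simp add: linear_form_simps)
      then have "r ?u = 0" using hr(4)[of ?u] zero[of ?u] by simp
      then show ?thesis using hr(3) by simp
    qed simp
    show "y0 z0 \<noteq> 0" using y0 by simp
  qed
  then have eq: "y0 v ^ N * f v = ?D v * h v" for v using hr(4) by simp
  have "\<exists>h. polyfun h \<and> (\<forall>v. f v = ?D v * h v)"
    if "polyfun h" "\<And>v. y0 v ^ N * f v = ?D v * h v" for h N
    using that
  proof (induction N arbitrary: h)
    case 0
    then show ?case by auto
  next
    case (Suc N)
    obtain k where k: "polyfun k" "\<And>v. h v = h (v - y0 v *s z0) + y0 v * k v"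
      using polyfun_divide[OF Suc.prems(1) y0(1)] by blast
    have "h (v - y0 v *s z0) = 0" for v
    proof (rule polyfun_cancel[OF polyfun_project[OF Suc.prems(1) y0(1)] R(1) _ R(4)])
      fix v
      let ?u = "v - y0 v *s z0"
      have "y0 ?u = 0" using y0 by (simp add: linear_form_simps)
      then have "?D ?u * h ?u = 0" using Suc.prems(2)[of ?u] by simp
      moreover have "R ?u = R v" using R(3)[of v "- y0 v"] by simp
      ultimately show "h (v - y0 v *s z0) * R v = 0" using \<open>y0 ?u = 0\<close> by auto
    qed
    then have hk: "h v = y0 v * k v" for v using k(2)[of v] by simp
    have "y0 v ^ N * f v - ?D v * k v = 0" for v
    proof (rule polyfun_cancel[where g = y0 and ?v0.0 = z0])
      show "polyfun (\<lambda>v. y0 v ^ N * f v - ?D v * k v)"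
        by (intro polyfun_diff polyfun.mult polyfun_power pf f k R)
      show "(y0 v ^ N * f v - ?D v * k v) * y0 v = 0" for v
        using Suc.prems(2)[of v] hk[of v] by (simp add: algebra_simps)
    qed (use pf y0 in auto)
    then show ?case using Suc.IH[OF k(1)] by simp
  qed
  then show ?thesis using hr(1) eq by blast
qed

text \<open>By homogeneity the quotient is constant on the lines through \<open>0\<close> on which \<open>D\<close> is nonzero.\<close>

lemma quadratic_quotient_constant:
  fixes Q :: "('v::finite, 'k::alg_closed_field) mpoly"
  assumes W: "vec.subspace W" and Q: "homogeneous 2 Q" and D: "\<And>c w. D (c *s w) = c\<^sup>2 * D w"
    and h: "polyfun h" "\<And>w. w \<in> W \<Longrightarrow> meval Q w = D w * h w"
  shows "w \<in> W \<Longrightarrow> meval Q w = h 0 * D w"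
proof (cases "D w = 0")
  case False
  assume w: "w \<in> W"
  have pd: "polyfun (\<lambda>u. h u - h w)" by (intro polyfun_diff h polyfun.const)
  have "h 0 - h w = 0"
  proof (rule polyfun_zero_limit[OF pd, of 0 w])
    fix e :: 'k assume e: "e \<noteq> 0"
    have "e\<^sup>2 * (D w * h w) = e\<^sup>2 * (D w * h (e *s w))"
      using h(2)[of "e *s w"] h(2)[OF w] w W Q D
      by (simp add: vec.subspace_scale homogeneous_meval_scale)
    then show "h (0 + e *s w) - h w = 0" using e False by simp
  qed
  then show ?thesis using h(2)[OF w] by simp
qed (use h(2) in simp)


section \<open>Coordinates on a linear subspace\<close>

definition lincomb :: "nat \<Rightarrow> (nat \<Rightarrow> 'k::field ^ 'v::finite) \<Rightarrow> (nat \<Rightarrow> 'k) \<Rightarrow> 'k ^ 'v" where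
  "lincomb r e c = (\<Sum>i<r. c i *s e i)"

locale subspace_basis =
  fixes r :: nat and e :: "nat \<Rightarrow> 'k::alg_closed_field ^ 'v::finite"
  assumes independent: "\<And>c. lincomb r e c = 0 \<Longrightarrow> \<forall>i<r. c i = 0"
begin

definition "W = range (lincomb r e)"

lemma lincomb_diff: "lincomb r e c - lincomb r e d = lincomb r e (\<lambda>i. c i - d i)"
  by (simp add: lincomb_def sum_subtractf vec.scale_left_diff_distrib)

lemma lincomb_add: "lincomb r e c + lincomb r e d = lincomb r e (\<lambda>i. c i + d i)"
  by (simp add: lincomb_def sum.distrib vec.scale_left_distrib)

lemma lincomb_scale: "a *s lincomb r e c = lincomb r e (\<lambda>i. a * c i)"
  by (simp add: lincomb_def vec.scale_sum_right)

lemma lincomb_delta: "j < r \<Longrightarrow> lincomb r e (\<lambda>i. if i = j then 1 else 0) = e j"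
  by (simp add: lincomb_def if_distrib[of "\<lambda>c. c *s _"] cong: if_cong)

lemma lincomb_inj: "lincomb r e c = lincomb r e d \<Longrightarrow> i < r \<Longrightarrow> c i = d i"
  using independent[of "\<lambda>i. c i - d i"] lincomb_diff[of c d] by simp

lemma inj_e: "inj_on e {..<r}"
proof
  fix i j assume "i \<in> {..<r}" "j \<in> {..<r}" "e i = e j"
  then show "i = j"
    using lincomb_inj[of "\<lambda>k. if k = i then 1 else 0" "\<lambda>k. if k = j then 1 else 0" i] lincomb_delta
    by (auto split: if_splits)
qed

lemma independent_e: "vec.independent (e ` {..<r})"
proof
  assume "vec.dependent (e ` {..<r})"
  then obtain u w where u: "(\<Sum>w\<in>e ` {..<r}. u w *s w) = 0" "w \<in> e ` {..<r}" "u w \<noteq> 0"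
    using vec.dependent_finite[of "e ` {..<r}"] by auto
  then have "lincomb r e (\<lambda>i. u (e i)) = 0"
    using inj_e by (simp add: lincomb_def sum.reindex)
  then show False using independent u by fastforce
qed

lemma span_e: "vec.span (e ` {..<r}) = W"
proof
  show "vec.span (e ` {..<r}) \<subseteq> W"
  proof (rule vec.span_minimal)
    show "e ` {..<r} \<subseteq> W" using lincomb_delta by (auto simp: W_def) (metis rangeI)
    show "vec.subspace W"
      unfolding vec.subspace_def W_def
      by (auto simp: lincomb_add lincomb_scale) (auto simp: lincomb_def intro!: image_eqI[of _ _ "\<lambda>i. 0"])
  qed
  show "W \<subseteq> vec.span (e ` {..<r})"
    unfolding W_def lincomb_def by (clarify, intro vec.span_sum vec.span_scale vec.span_base) simp
qed

lemma subspace_W: "vec.subspace W"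
  using span_e vec.subspace_span by metis

lemma dim_W: "vec.dim W = r"
proof -
  have "vec.dim W = card (e ` {..<r})"
    using vec.dim_span_eq_card_independent[OF independent_e] span_e by simp
  then show ?thesis using inj_e by (simp add: card_image)
qed

definition "y i = (SOME y. linear_form y \<and> (\<forall>j<r. y (e j) = (if i = j then 1 else 0)))"

lemma y: "i < r \<Longrightarrow> linear_form (y i)" "i < r \<Longrightarrow> j < r \<Longrightarrow> y i (e j) = (if i = j then 1 else 0)"
proof -
  assume i: "i < r"
  obtain z where z: "linear_form z" "\<forall>w\<in>e ` {..<r}. z w = (if w = e i then 1 else 0)"
    using dual_linear_form[OF independent_e, of "e i"] i by blast
  have zj: "z (e j) = (if i = j then 1 else 0)" if "j < r" for j
    using z(2) that i inj_on_eq_iff[OF inj_e, of i j] by auto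
  have "linear_form z \<and> (\<forall>j<r. z (e j) = (if i = j then 1 else 0))" using z(1) zj by blast
  then have *: "linear_form (y i) \<and> (\<forall>j<r. y i (e j) = (if i = j then 1 else 0))"
    unfolding y_def
    by (rule someI[where P = "\<lambda>y. linear_form y \<and> (\<forall>j<r. y (e j) = (if i = j then 1 else 0))"])
  show "linear_form (y i)" using * by blast
  show "j < r \<Longrightarrow> y i (e j) = (if i = j then 1 else 0)" using * by blast
qed

lemma y_lincomb: "i < r \<Longrightarrow> y i (lincomb r e c) = c i"
  by (simp add: lincomb_def linear_form_sum linear_form_scale y if_distrib[of "\<lambda>x. _ * x"] cong: if_cong)

text \<open>Composition with this projection to \<open>W\<close> extends functions on \<open>W\<close> to the whole space.\<close>

definition "\<pi> u = lincomb r e (\<lambda>i. y i u)"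

lemma polyfun_\<pi>: "polyfun f \<Longrightarrow> polyfun (\<lambda>u. f (\<pi> u))"
proof (rule polyfun_compose)
  fix j
  have "polyfun (\<lambda>u. \<Sum>i<r. y i u * e i $ j)"
    by (intro polyfun_sum polyfun.mult polyfun.const polyfun_linear_form y) simp
  then show "polyfun (\<lambda>u. \<pi> u $ j)" by (simp add: \<pi>_def lincomb_def)
qed

lemma \<pi>_lincomb: "\<pi> (lincomb r e c) = lincomb r e c"
  unfolding \<pi>_def lincomb_def[of r e "\<lambda>i. y i (lincomb r e c)"]
  by (simp add: y_lincomb) (simp add: lincomb_def)

end

section \<open>Quadrics as secant loci\<close>

definition cut_out_by_quadrics :: "('k::field ^ 'v::finite) set \<Rightarrow> bool" where
  "cut_out_by_quadrics C \<longleftrightarrow>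
     (\<forall>u. u \<notin> C \<longrightarrow> (\<exists>Q. homogeneous 2 Q \<and> (\<forall>w\<in>C. meval Q w = 0) \<and> meval Q u \<noteq> 0))"

text \<open>
  Ideals in general need not have this property, as they may contain polynomials that are not sums
  of forms in the ideal. It is established for every secant locus together with its type.
\<close>

abbreviation support_is_zero_locus :: "('v::finite, 'k::field) mpoly set \<Rightarrow> bool" where
  "support_is_zero_locus J \<equiv> support J = zero_locus J"

context subspace_basis
begin

lemma y_\<pi>: "i < r \<Longrightarrow> y i (\<pi> u) = y i u"
  by (simp add: \<pi>_def y_lincomb)

lemma \<pi>_in_W: "\<pi> u \<in> W"
  by (simp add: \<pi>_def W_def)

lemma \<pi>_W: "w \<in> W \<Longrightarrow> \<pi> w = w"
  by (auto simp: W_def \<pi>_lincomb)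

lemma W_lincomb: "w \<in> W \<Longrightarrow> w = lincomb r e (\<lambda>i. y i w)"
  using \<pi>_W[of w] by (simp add: \<pi>_def)

lemma lincomb_W: "lincomb r e c \<in> W"
  by (simp add: W_def)

end

locale linear_secant_cone = subspace_basis r e
  for r and e :: "nat \<Rightarrow> 'k::alg_closed_field ^ 'v::finite" +
  fixes C :: "('k ^ 'v) set" and v :: "'k ^ 'v"
  assumes r_ge: "r \<ge> 2" and C: "cone C" "cut_out_by_quadrics C" and v: "v \<in> W" "v \<notin> C"
    and secants: "secant_points (cpts C) (pt v) \<subseteq> cpts W"
begin

lemma v_nonzero: "v \<noteq> 0"
proof
  assume "v = 0"
  obtain Q where "homogeneous 2 Q" "meval Q v \<noteq> 0" using C(2) v(2) unfolding cut_out_by_quadrics_def by blast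
  then show False using homogeneous_meval_0[of 2 Q] \<open>v = 0\<close> by simp
qed

lemma pt_v: "pt v \<in> points - cpts C"
  using v v_nonzero pt_in_cpts_iff[OF C(1) v_nonzero] by simp

text \<open>
  One of the quadrics through \<open>X\<close> does not vanish at \<open>p\<close>. On \<open>W\<close> it vanishes where the quadratic form
  \<open>D\<close> does, so that it is a multiple of \<open>D\<close>.
\<close>

lemma reduced_section:
  assumes D: "\<And>c w. D (c *s w) = c\<^sup>2 * D w"
    and div: "\<And>f. polyfun f \<Longrightarrow> (\<And>w. w \<in> W \<Longrightarrow> D w = 0 \<Longrightarrow> f w = 0) \<Longrightarrow>
        \<exists>h. polyfun h \<and> (\<forall>w\<in>W. f w = D w * h w)"
    and zeros: "\<And>w. w \<in> W \<Longrightarrow> D w = 0 \<Longrightarrow> w \<in> C"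
  obtains Q k where "quadric_section C W Q v" "k \<noteq> 0" "\<And>w. w \<in> W \<Longrightarrow> meval Q w = k * D w"
    "secant_locus (cpts C) (pt v) = vanishing_ideal (cpts {w \<in> W. D w = 0})"
    "support_is_zero_locus (secant_locus (cpts C) (pt v))"
proof -
  obtain Q where Q: "homogeneous 2 Q" "\<forall>w\<in>C. meval Q w = 0" "meval Q v \<noteq> 0"
    using C(2) v(2) by (auto simp: cut_out_by_quadrics_def)
  obtain h where h: "polyfun h" "\<forall>w\<in>W. meval Q w = D w * h w"
    using div[OF polyfun_meval, of Q] zeros Q(2) by blast
  define k where "k = h 0"
  have QD: "meval Q w = k * D w" if "w \<in> W" for w
    unfolding k_def using quadratic_quotient_constant[OF subspace_W Q(1) D h(1)] h(2) that by blast
  have k: "k \<noteq> 0" using QD[OF v(1)] Q(3) by auto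
  have divQ: "\<exists>h. polyfun h \<and> (\<forall>w\<in>W. meval F w = meval Q w * h w)"
    if F: "\<And>w. w \<in> W \<Longrightarrow> D w = 0 \<Longrightarrow> meval F w = 0" for F
  proof -
    obtain h where h: "polyfun h" "\<forall>w\<in>W. meval F w = D w * h w"
      using div[OF polyfun_meval, of F] F by blast
    have "polyfun (\<lambda>w. inverse k * h w)" by (intro polyfun.mult polyfun.const h)
    moreover have "\<forall>w\<in>W. meval F w = meval Q w * (inverse k * h w)" using h(2) QD k by simp
    ultimately show ?thesis by blast
  qed
  interpret qs: quadric_section C W Q v
  proof
    show "vec.dim W \<ge> 2" using dim_W r_ge by simp
    show "\<exists>h. polyfun h \<and> (\<forall>w\<in>W. meval F w = meval Q w * h w)"
      if "\<And>w. w \<in> C \<Longrightarrow> meval F w = 0" for F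
      using divQ that zeros by blast
    show "w \<in> C" if "w \<in> W" "meval Q w = 0" for w using QD[OF that(1)] that k zeros by auto
  qed (use C v Q secants subspace_W in auto)
  have Z: "qs.Z = {w \<in> W. D w = 0}" using QD k by auto
  have red: "secant_locus (cpts C) (pt v) = vanishing_ideal (cpts {w \<in> W. D w = 0})"
    using qs.secant_locus_reduced divQ Z QD k by (metis (mono_tags, lifting) mem_Collect_eq)
  show thesis
    using that[OF qs.quadric_section_axioms k QD red] qs.support_secant_locus qs.zero_locus_secant_locus
    by simp
qed

lemma product_divides:
  assumes f: "polyfun f" and y0: "linear_form y0" "y0 z0 = 1" "y0 z1 = 0"
    and y1: "linear_form y1" "y1 z1 = 1" and inv: "\<And>u. y0 (\<pi> u) = y0 u" "\<And>u. y1 (\<pi> u) = y1 u"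
    and zero: "\<And>w. w \<in> W \<Longrightarrow> y0 w * y1 w = 0 \<Longrightarrow> f w = 0"
  shows "\<exists>h. polyfun h \<and> (\<forall>w\<in>W. f w = y0 w * y1 w * h w)"
proof -
  have "\<exists>h. polyfun h \<and> (\<forall>u. f (\<pi> u) = y0 u * y1 u * h u)"
  proof (rule divisible_by_product[OF polyfun_\<pi>[OF f] y0 y1])
    fix u assume "y0 u * y1 u = 0"
    then show "f (\<pi> u) = 0" using zero[OF \<pi>_in_W, of u] inv by simp
  qed
  then show ?thesis using \<pi>_W by metis
qed

lemma quadric_divides:
  assumes f: "polyfun f" and i: "i0 < r" "i1 < r" "i0 \<noteq> i1"
    and R: "polyfun R" "\<And>u c. R (u + c *s e i1) = R u" "\<And>u c. R (u + c *s e i0) = R u" "R v0 \<noteq> 0"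
    "\<And>u. R (\<pi> u) = R u"
    and zero: "\<And>w. w \<in> W \<Longrightarrow> y i0 w * y i1 w - R w = 0 \<Longrightarrow> f w = 0"
  shows "\<exists>h. polyfun h \<and> (\<forall>w\<in>W. f w = (y i0 w * y i1 w - R w) * h w)"
proof -
  have "\<exists>h. polyfun h \<and> (\<forall>u. f (\<pi> u) = (y i0 u * y i1 u - R u) * h u)"
  proof (rule divisible_by_quadric[OF polyfun_\<pi>[OF f], where ?z0.0 = "e i0" and ?z1.0 = "e i1"])
    fix u assume "y i0 u * y i1 u = R u"
    then show "f (\<pi> u) = 0" using zero[OF \<pi>_in_W, of u] R(5) i by (simp add: y_\<pi>)
  qed (use i y R in auto)
  then show ?thesis using \<pi>_W by metis
qed

text \<open>
  With \<open>y 0\<close>, \<open>y 1\<close>, \<open>y 2\<close> the coordinates on \<open>W\<close>, the lines are \<open>y 0 = 0\<close> and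
  \<open>y 0 + \<alpha> y 1 + \<beta> y 2 = 0\<close>; they are distinct because \<open>(\<alpha>, \<beta>) \<noteq> (0, 0)\<close>.
\<close>

lemma line_pair_section:
  assumes r: "r = 3" and ab: "(\<alpha>, \<beta>) \<noteq> (0, 0)"
    and zeros: "\<And>c. c 0 * (c 0 + \<alpha> * c 1 + \<beta> * c 2) = 0 \<Longrightarrow> lincomb r e c \<in> C"
  shows "pt v \<in> SL_line_pair (cpts C)" and "support_is_zero_locus (secant_locus (cpts C) (pt v))"
proof -
  have lt: "0 < r" "1 < r" "2 < r" using r by auto
  define y1 where "y1 = (\<lambda>w. y 0 w + (\<alpha> * y 1 w + \<beta> * y 2 w))"
  note [simp del] = One_nat_def
  note lf = y(1)[OF lt(1)] y(1)[OF lt(2)] y(1)[OF lt(3)]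
  have y1: "linear_form y1"
    unfolding y1_def by (intro linear_form_plus linear_form_times lf)
  define z1 where "z1 = (if \<alpha> \<noteq> 0 then inverse \<alpha> *s e 1 else inverse \<beta> *s e 2)"
  have z1: "y 0 z1 = 0" "y1 z1 = 1"
    using ab lt by (auto simp: z1_def y1_def linear_form_scale[OF lf(1)] linear_form_scale[OF lf(2)]
      linear_form_scale[OF lf(3)] y(2))
  have zC: "w \<in> C" if "w \<in> W" "y 0 w * y1 w = 0" for w
    using zeros[of "\<lambda>i. y i w"] W_lincomb[OF that(1)] that(2) by (simp add: y1_def add.assoc)
  obtain Q and k :: 'k where Q: "quadric_section C W Q v" "k \<noteq> 0"
     "secant_locus (cpts C) (pt v) = vanishing_ideal (cpts {w \<in> W. y 0 w * y1 w = 0})"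
     "support_is_zero_locus (secant_locus (cpts C) (pt v))"
  proof (rule reduced_section[where D = "\<lambda>w. y 0 w * y1 w"])
    show "y 0 (c *s w) * y1 (c *s w) = c\<^sup>2 * (y 0 w * y1 w)" for c w
      using lf y1 by (simp add: linear_form_scale power2_eq_square)
    show "\<exists>h. polyfun h \<and> (\<forall>w\<in>W. f w = y 0 w * y1 w * h w)"
      if "polyfun f" "\<And>w. w \<in> W \<Longrightarrow> y 0 w * y1 w = 0 \<Longrightarrow> f w = 0" for f
    proof (rule product_divides[OF that(1) lf(1) _ z1(1) y1 z1(2) _ _ that(2)])
      show "y 0 (e 0) = 1" using lt by (simp add: y(2))
      show "y 0 (\<pi> u) = y 0 u" "y1 (\<pi> u) = y1 u" for u using lt by (simp_all add: y_\<pi> y1_def)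
    qed
  qed (use zC in auto)
  define W1 where "W1 = {w \<in> W. y 0 w = 0}"
  define W2 where "W2 = {w \<in> W. y1 w = 0}"
  have sub: "vec.subspace {w \<in> W. z w = 0}" if "linear_form z" for z
    using subspace_W that by (auto simp: vec.subspace_def linear_form_simps)
  have dim: "vec.dim {w \<in> W. z w = 0} = 2" if z: "linear_form z" "u \<in> W" "z u = 1" for z u
  proof -
    let ?H = "{w \<in> W. z w = 0}"
    have sH: "vec.span ?H = ?H" using sub[OF z(1)] vec.span_eq_iff[of ?H] by blast
    have "vec.dim W = vec.dim (insert u ?H)"
    proof (rule vec.span_eq_dim, rule subset_antisym)
      show "vec.span W \<subseteq> vec.span (insert u ?H)"
      proof (rule vec.span_minimal)
        show "W \<subseteq> vec.span (insert u ?H)"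
        proof
          fix w assume "w \<in> W"
          then have "w - z w *s u \<in> ?H"
            using z subspace_W by (simp add: vec.subspace_diff vec.subspace_scale linear_form_simps)
          then show "w \<in> vec.span (insert u ?H)"
            unfolding vec.span_insert by (blast intro: vec.span_base)
        qed
      qed simp
      show "vec.span (insert u ?H) \<subseteq> vec.span W" using z(2) by (intro vec.span_mono) auto
    qed
    also have "\<dots> = vec.dim ?H + 1"
    proof -
      have "u \<notin> vec.span ?H" unfolding sH using z(3) by simp
      then show ?thesis by (simp add: vec.dim_insert)
    qed
    finally show ?thesis using dim_W r by simp
  qed
  have e0: "e 0 \<in> W" "z1 \<in> W"
    using lt subspace_W span_e vec.span_base[of _ "e ` {..<r}"]
    by (auto simp: z1_def vec.subspace_scale)
  have y1e: "y1 (e 0) = 1" "y 0 (e 0) = 1" using lt by (simp_all add: y1_def y(2))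
  have ne: "W1 \<noteq> W2"
  proof
    assume eq: "W1 = W2"
    have "z1 \<in> W1" using z1 e0 by (simp add: W1_def)
    then show False using eq z1 by (simp add: W2_def)
  qed
  have W12: "vec.subspace W1" "vec.dim W1 = 2" "vec.subspace W2" "vec.dim W2 = 2" "W1 \<subseteq> W" "W2 \<subseteq> W"
    unfolding W1_def W2_def
    using sub[OF lf(1)] sub[OF y1] dim[OF lf(1) e0(1) y1e(2)] dim[OF y1 e0(1) y1e(1)] by blast+
  have "cpts {w \<in> W. y 0 w * y1 w = 0} = proj W1 \<union> proj W2"
    unfolding proj_eq_cpts[OF W12(1)] proj_eq_cpts[OF W12(3)]
    by (auto simp: W1_def W2_def cpts_def)
  then have "same_scheme (secant_locus (cpts C) (pt v)) (vanishing_ideal (proj W1 \<union> proj W2))"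
    using Q(3) by (simp add: same_scheme_def subscheme_def)
  moreover have "vec.dim W = 3" using dim_W r by simp
  ultimately show "pt v \<in> SL_line_pair (cpts C)"
    unfolding SL_line_pair_def using pt_v ne W12 subspace_W by blast
  show "support_is_zero_locus (secant_locus (cpts C) (pt v))" by (rule Q(4))
qed

lemma two_points_section:
  assumes r: "r = 2" and zeros: "e 0 \<in> C" "e 1 \<in> C"
  shows "pt v \<in> SL_two_points (cpts C)" and "support_is_zero_locus (secant_locus (cpts C) (pt v))"
proof -
  have lt: "0 < r" "1 < r" using r by auto
  note [simp del] = One_nat_def
  note lf = y(1)[OF lt(1)] y(1)[OF lt(2)]
  have lc: "w = y 0 w *s e 0 + y 1 w *s e 1" if "w \<in> W" for w
    using W_lincomb[OF that] r by (simp add: lincomb_def numeral_2_eq_2 One_nat_def)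
  have zC: "w \<in> C" if "w \<in> W" "y 0 w * y 1 w = 0" for w
    using lc[OF that(1)] that(2) zeros C(1) by (metis add_0 add_0_right coneD mult_eq_0_iff vec.scale_zero_left)
  obtain Q and k :: 'k where Q: "quadric_section C W Q v" "k \<noteq> 0"
     "secant_locus (cpts C) (pt v) = vanishing_ideal (cpts {w \<in> W. y 0 w * y 1 w = 0})"
     "support_is_zero_locus (secant_locus (cpts C) (pt v))"
  proof (rule reduced_section[where D = "\<lambda>w. y 0 w * y 1 w"])
    show "y 0 (c *s w) * y 1 (c *s w) = c\<^sup>2 * (y 0 w * y 1 w)" for c w
      using lf by (simp add: linear_form_scale power2_eq_square)
    show "\<exists>h. polyfun h \<and> (\<forall>w\<in>W. f w = y 0 w * y 1 w * h w)"
      if "polyfun f" "\<And>w. w \<in> W \<Longrightarrow> y 0 w * y 1 w = 0 \<Longrightarrow> f w = 0" for f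
      by (rule product_divides[OF that(1) lf(1) _ _ lf(2) _ _ _ that(2), of "e 0" "e 1"])
        (use lt in \<open>auto simp: y(2) y_\<pi>\<close>)
  qed (use zC in auto)
  have eW: "e 0 \<in> W" "e 1 \<in> W" using lt span_e vec.span_base[of _ "e ` {..<r}"] by auto
  have e: "e 0 \<noteq> 0" "e 1 \<noteq> 0" "pt (e 0) \<noteq> pt (e 1)"
  proof -
    show "e 0 \<noteq> 0" using y(2)[of 0 0] linear_form_0[OF lf(1)] lt by auto
    then show "pt (e 0) \<noteq> pt (e 1)"
      using y(2)[of 1 0] y(2)[of 1 1] linear_form_scale[OF lf(2)] lt by (auto simp: pt_eq_iff)
    show "e 1 \<noteq> 0" using y(2)[of 1 1] linear_form_0[OF lf(2)] lt by auto
  qed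
  have "cpts {w \<in> W. y 0 w * y 1 w = 0} = cpts (vec.span {e 0}) \<union> cpts (vec.span {e 1})"
  proof -
    have "{w \<in> W. y 0 w * y 1 w = 0} = vec.span {e 0} \<union> vec.span {e 1}"
    proof (intro subset_antisym subsetI)
      fix w assume w: "w \<in> {w \<in> W. y 0 w * y 1 w = 0}"
      then have "w = y 0 w *s e 0 \<or> w = y 1 w *s e 1" using lc[of w] by auto
      then show "w \<in> vec.span {e 0} \<union> vec.span {e 1}" by (auto simp: vec.span_singleton)
    next
      fix w assume "w \<in> vec.span {e 0} \<union> vec.span {e 1}"
      then show "w \<in> {w \<in> W. y 0 w * y 1 w = 0}"
        using lt eW subspace_W
        by (auto simp: vec.span_singleton vec.subspace_scale linear_form_scale[OF lf(1)]
            linear_form_scale[OF lf(2)] y(2))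
    qed
    then show ?thesis by (auto simp: cpts_def)
  qed
  also have "\<dots> = {pt (e 0), pt (e 1)}" using e by (auto simp: cpts_span_single)
  finally have "secant_locus (cpts C) (pt v) = vanishing_ideal {pt (e 0), pt (e 1)}" using Q(3) by simp
  then show "pt v \<in> SL_two_points (cpts C)"
    unfolding SL_two_points_def using pt_v e
    by (intro CollectI conjI bexI[of _ "pt (e 0)"] bexI[of _ "pt (e 1)"])
      (auto simp: same_scheme_def subscheme_def)
  show "support_is_zero_locus (secant_locus (cpts C) (pt v))" by (rule Q(4))
qed

text \<open>
  At a singular point of \<open>y\<^sub>0 y\<^sub>2 - y\<^sub>1\<^sup>2\<close> the derivatives in the directions \<open>e 2\<close> and \<open>e 0\<close> give
  \<open>y\<^sub>0 = y\<^sub>2 = 0\<close>. If it lies on the conic, then \<open>y\<^sub>1 = 0\<close> as well, also in characteristic \<open>2\<close>, where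
  all derivatives vanish on the line \<open>y\<^sub>0 = y\<^sub>2 = 0\<close>.
\<close>

lemma conic_section:
  assumes r: "r = 3" and zeros: "\<And>c. c 0 * c 2 = (c 1)\<^sup>2 \<Longrightarrow> lincomb r e c \<in> C"
  shows "pt v \<in> SL_conic (cpts C)" and "support_is_zero_locus (secant_locus (cpts C) (pt v))"
proof -
  have lt: "0 < r" "1 < r" "2 < r" using r by auto
  note [simp del] = One_nat_def
  note lf = y(1)[OF lt(1)] y(1)[OF lt(2)] y(1)[OF lt(3)]
  let ?D = "\<lambda>w. y 0 w * y 2 w - (y 1 w)\<^sup>2"
  have zC: "w \<in> C" if "w \<in> W" "?D w = 0" for w
    using zeros[of "\<lambda>i. y i w"] W_lincomb[OF that(1)] that(2) by simp
  have R: "polyfun (\<lambda>w. (y 1 w)\<^sup>2)" by (intro polyfun_power polyfun_linear_form lf)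
  obtain Q and k :: 'k where Q: "quadric_section C W Q v" "k \<noteq> 0" "\<And>w. w \<in> W \<Longrightarrow> meval Q w = k * ?D w"
     "support_is_zero_locus (secant_locus (cpts C) (pt v))"
  proof (rule reduced_section[where D = ?D])
    show "?D (c *s w) = c\<^sup>2 * ?D w" for c w
      using lf by (simp add: linear_form_scale power2_eq_square algebra_simps)
    show "\<exists>h. polyfun h \<and> (\<forall>w\<in>W. f w = ?D w * h w)"
      if "polyfun f" "\<And>w. w \<in> W \<Longrightarrow> ?D w = 0 \<Longrightarrow> f w = 0" for f
      by (rule quadric_divides[OF that(1) lt(1,3) _ R _ _ _ _ that(2), where ?v0.0 = "e 1"])
        (use lt in \<open>auto simp: y(2) y_\<pi> linear_form_add[OF lf(2)] linear_form_scale[OF lf(2)]\<close>)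
  qed (use zC in auto)
  interpret qs: quadric_section C W Q v by (rule Q(1))
  have B: "dir_deriv Q w u = k * (y 0 w * y 2 u + y 2 w * y 0 u - 2 * y 1 w * y 1 u)"
    if "w \<in> W" "u \<in> W" for w u
  proof -
    have "meval Q (w + t *s u) =
      poly [:k * ?D w, k * (y 0 w * y 2 u + y 2 w * y 0 u - 2 * y 1 w * y 1 u), k * ?D u:] t" for t
    proof -
      have "w + t *s u \<in> W" using that subspace_W by (simp add: vec.subspace_add vec.subspace_scale)
      from Q(3)[OF this] show ?thesis
        using lf by (simp add: linear_form_simps power2_eq_square algebra_simps)
    qed
    from dir_deriv_eqI[OF this] show ?thesis by (simp add: One_nat_def)
  qed
  have eW: "e 0 \<in> W" "e 2 \<in> W" using lt span_e vec.span_base[of _ "e ` {..<r}"] by auto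
  have "smooth_quadric_in W (secant_locus (cpts C) (pt v))"
  proof (rule qs.smooth_quadric_secant_locus)
    fix w assume w: "w \<in> W" "w \<noteq> 0" "meval Q w = 0"
    then have D: "?D w = 0" using Q(2,3) by simp
    have "y 0 w \<noteq> 0 \<or> y 2 w \<noteq> 0"
    proof (rule ccontr)
      assume "\<not> ?thesis"
      then have "w = 0" using D W_lincomb[OF w(1)] r
        by (simp add: lincomb_def numeral_3_eq_3 numeral_2_eq_2 One_nat_def)
      then show False using w by simp
    qed
    then show "\<exists>u\<in>W. dir_deriv Q w u \<noteq> 0"
    proof
      assume "y 0 w \<noteq> 0"
      then have "dir_deriv Q w (e 2) \<noteq> 0" using B[OF w(1) eW(2)] Q(2) lt by (simp add: y(2))
      then show ?thesis using eW by blast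
    next
      assume "y 2 w \<noteq> 0"
      then have "dir_deriv Q w (e 0) \<noteq> 0" using B[OF w(1) eW(1)] Q(2) lt by (simp add: y(2))
      then show ?thesis using eW by blast
    qed
  qed
  then show "pt v \<in> SL_conic (cpts C)"
    unfolding SL_conic_def using pt_v subspace_W dim_W r by blast
  show "support_is_zero_locus (secant_locus (cpts C) (pt v))" by (rule Q(4))
qed

lemma smooth_quadric_section:
  assumes r: "r = 4" and zeros: "\<And>c. c 0 * c 3 = c 1 * c 2 \<Longrightarrow> lincomb r e c \<in> C"
  shows "pt v \<in> SL_quadric (cpts C)" and "support_is_zero_locus (secant_locus (cpts C) (pt v))"
proof -
  have lt: "0 < r" "1 < r" "2 < r" "3 < r" using r by auto
  note [simp del] = One_nat_def
  note lf = y(1)[OF lt(1)] y(1)[OF lt(2)] y(1)[OF lt(3)] y(1)[OF lt(4)]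
  let ?D = "\<lambda>w. y 0 w * y 3 w - y 1 w * y 2 w"
  have zC: "w \<in> C" if "w \<in> W" "?D w = 0" for w
    using zeros[of "\<lambda>i. y i w"] W_lincomb[OF that(1)] that(2) by simp
  have R: "polyfun (\<lambda>w. y 1 w * y 2 w)" by (intro polyfun.mult polyfun_linear_form lf)
  obtain Q and k :: 'k where Q: "quadric_section C W Q v" "k \<noteq> 0" "\<And>w. w \<in> W \<Longrightarrow> meval Q w = k * ?D w"
     "support_is_zero_locus (secant_locus (cpts C) (pt v))"
  proof (rule reduced_section[where D = ?D])
    show "?D (c *s w) = c\<^sup>2 * ?D w" for c w
      using lf by (simp add: linear_form_scale power2_eq_square algebra_simps)
    show "\<exists>h. polyfun h \<and> (\<forall>w\<in>W. f w = ?D w * h w)"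
      if "polyfun f" "\<And>w. w \<in> W \<Longrightarrow> ?D w = 0 \<Longrightarrow> f w = 0" for f
      by (rule quadric_divides[OF that(1) lt(1,4) _ R _ _ _ _ that(2), where ?v0.0 = "e 1 + e 2"])
        (use lt in \<open>auto simp: y(2) y_\<pi> linear_form_add[OF lf(2)] linear_form_scale[OF lf(2)]
           linear_form_add[OF lf(3)] linear_form_scale[OF lf(3)]\<close>)
  qed (use zC in auto)
  interpret qs: quadric_section C W Q v by (rule Q(1))
  have B: "dir_deriv Q w u = k * (y 0 w * y 3 u + y 3 w * y 0 u - y 1 w * y 2 u - y 2 w * y 1 u)"
    if "w \<in> W" "u \<in> W" for w u
  proof -
    have "meval Q (w + t *s u) =
      poly [:k * ?D w, k * (y 0 w * y 3 u + y 3 w * y 0 u - y 1 w * y 2 u - y 2 w * y 1 u), k * ?D u:] t" for t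
    proof -
      have "w + t *s u \<in> W" using that subspace_W by (simp add: vec.subspace_add vec.subspace_scale)
      from Q(3)[OF this] show ?thesis
        using lf by (simp add: linear_form_simps algebra_simps)
    qed
    from dir_deriv_eqI[OF this] show ?thesis by (simp add: One_nat_def)
  qed
  have eW: "e i \<in> W" if "i < 4" for i using that r span_e vec.span_base[of _ "e ` {..<r}"] by auto
  have "smooth_quadric_in W (secant_locus (cpts C) (pt v))"
  proof (rule qs.smooth_quadric_secant_locus)
    fix w assume w: "w \<in> W" "w \<noteq> 0" "meval Q w = 0"
    have "y 0 w \<noteq> 0 \<or> y 1 w \<noteq> 0 \<or> y 2 w \<noteq> 0 \<or> y 3 w \<noteq> 0"
    proof (rule ccontr)
      assume "\<not> ?thesis"
      then have "w = 0" using W_lincomb[OF w(1)] r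
        by (simp add: lincomb_def eval_nat_numeral One_nat_def)
      then show False using w by simp
    qed
    then have "dir_deriv Q w (e 3) \<noteq> 0 \<or> dir_deriv Q w (e 2) \<noteq> 0 \<or> dir_deriv Q w (e 1) \<noteq> 0 \<or> dir_deriv Q w (e 0) \<noteq> 0"
      using B[OF w(1) eW[of 0]] B[OF w(1) eW[of 1]] B[OF w(1) eW[of 2]] B[OF w(1) eW[of 3]] Q(2) lt
      by (auto simp: y(2))
    then show "\<exists>u\<in>W. dir_deriv Q w u \<noteq> 0" using eW[of 0] eW[of 1] eW[of 2] eW[of 3] by auto
  qed
  then show "pt v \<in> SL_quadric (cpts C)"
    unfolding SL_quadric_def using pt_v subspace_W dim_W r by blast
  show "support_is_zero_locus (secant_locus (cpts C) (pt v))" by (rule Q(4))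
qed

text \<open>
  On the tangent line \<open>W\<close> through \<open>p\<close>, with tangency point \<open>q\<close> given by \<open>e 0\<close>, let \<open>t\<close> be the
  coordinate that vanishes at \<open>q\<close>. Every polynomial in the ideal of \<open>X\<close> is divisible by \<open>t\<^sup>2\<close>
  on \<open>W\<close>, and some quadric through \<open>X\<close> restricts to a nonzero multiple of \<open>t\<^sup>2\<close>.
\<close>

lemma double_point_section:
  assumes r: "r = 2" and e: "e 0 \<in> C" "e 1 = v"
    and tangent: "\<And>F s. (\<And>w. w \<in> C \<Longrightarrow> meval F w = 0) \<Longrightarrow> dir_deriv F (s *s e 0) v = 0"
  shows "pt v \<in> SL_double_point (cpts C)" and "support_is_zero_locus (secant_locus (cpts C) (pt v))"
proof -
  have lt: "0 < r" "1 < r" using r by auto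
  note [simp del] = One_nat_def
  note lf = y(1)[OF lt(1)] y(1)[OF lt(2)]
  have eW: "e 0 \<in> W" "e 1 \<in> W" using lt span_e vec.span_base[of _ "e ` {..<r}"] by auto
  have e0: "e 0 \<noteq> 0" using y(2)[of 0 0] linear_form_0[OF lf(1)] lt by auto
  have lc: "w = y 0 w *s e 0 + y 1 w *s v" if "w \<in> W" for w
    using W_lincomb[OF that] r e(2) by (simp add: lincomb_def numeral_2_eq_2 One_nat_def)
  have ycomb: "y 0 (s *s e 0 + t *s v) = s" "y 1 (s *s e 0 + t *s v) = t" for s t
    using lf lt e(2) by (auto simp: linear_form_simps y(2)[of 0 0] y(2)[of 1 0] y(2)[of 0 1, unfolded e(2)]
      y(2)[of 1 1, unfolded e(2)])
  have onW: "s *s e 0 + t *s v \<in> W" for s t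
    using v(1) eW subspace_W by (simp add: vec.subspace_add vec.subspace_scale)
  obtain Q where Q: "homogeneous 2 Q" "\<forall>w\<in>C. meval Q w = 0" "meval Q v \<noteq> 0"
    using C(2) v(2) by (auto simp: cut_out_by_quadrics_def)
  have QW: "meval Q w = (y 1 w)\<^sup>2 * meval Q v" if "w \<in> W" for w
  proof -
    have "y 0 w *s e 0 \<in> C" using e(1) C(1) by (simp add: coneD)
    then show ?thesis
      by (subst lc[OF that], subst quadratic_form_expand[OF Q(1)]) (use Q(2) tangent in simp)
  qed
  \<comment> \<open>Taylor expansion to second order along the line \<open>y 1 = 0\<close> of \<open>W\<close>.\<close>
  have div2: "\<exists>h. polyfun h \<and> (\<forall>w\<in>W. meval F w = meval F (y 0 w *s e 0)
      + y 1 w * dir_deriv F (y 0 w *s e 0) v + (y 1 w)\<^sup>2 * h w)" for F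
  proof -
    obtain h where h: "polyfun h" "\<And>u. meval F (\<pi> u) = meval F (\<pi> (u - y 1 u *s v)) + y 1 u * h u"
      using polyfun_divide[OF polyfun_\<pi>[OF polyfun_meval[of F]] lf(2), of v] by blast
    obtain k where k: "polyfun k" "\<And>u. h u = h (u - y 1 u *s v) + y 1 u * k u"
      using polyfun_divide[OF h(1) lf(2), of v] by blast
    have "meval F w = meval F (y 0 w *s e 0) + y 1 w * dir_deriv F (y 0 w *s e 0) v + (y 1 w)\<^sup>2 * k w"
      if w: "w \<in> W" for w
    proof -
      let ?x = "y 0 w *s e 0"
      have x: "w - y 1 w *s v = ?x" using lc[OF w] by (metis add_diff_cancel_right')
      have "\<pi> w = w" "\<pi> ?x = ?x" using w eW subspace_W by (simp_all add: \<pi>_W vec.subspace_scale)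
      then have "meval F w = meval F ?x + y 1 w * h w" using h(2)[of w] x by simp
      moreover have "h w = h ?x + y 1 w * k w" using k(2)[of w] x by simp
      moreover have "h ?x = dir_deriv F ?x v"
      proof -
        obtain P where P: "\<forall>t. poly P t = k (?x + t *s v)" using polyfun_along_line[OF k(1)] by blast
        have "meval F (?x + t *s v) = poly ([:meval F ?x, h ?x:] + [:0, 0, 1:] * P) t" for t
        proof -
          let ?u = "?x + t *s v"
          have u: "?u - y 1 ?u *s v = ?x" using ycomb by simp
          have "\<pi> ?u = ?u" using onW by (simp add: \<pi>_W)
          then have "meval F ?u = meval F ?x + t * h ?u" using h(2)[of ?u] u \<open>\<pi> ?x = ?x\<close> ycomb by simp
          moreover have "h ?u = h ?x + t * k ?u" using k(2)[of ?u] u ycomb by simp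
          ultimately show ?thesis using P by (simp add: algebra_simps)
        qed
        then have "dir_deriv F ?x v = coeff ([:meval F ?x, h ?x:] + [:0, 0, 1:] * P) 1"
          by (rule dir_deriv_eqI)
        then show ?thesis by (simp add: mult_pCons_left coeff_pCons One_nat_def)
      qed
      ultimately show ?thesis by (simp add: algebra_simps power2_eq_square)
    qed
    then show ?thesis using k(1) by blast
  qed
  interpret qs: quadric_section C W Q v
  proof
    show "vec.dim W \<ge> 2" using dim_W r_ge by simp
    show "w \<in> C" if "w \<in> W" "meval Q w = 0" for w
    proof -
      have "y 1 w = 0" using QW[OF that(1)] that(2) Q(3) by simp
      then have "w = y 0 w *s e 0" using lc[OF that(1)] by (metis add_0_right vec.scale_zero_left)
      then show ?thesis using e(1) C(1) coneD by metis
    qed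
    show "\<exists>h. polyfun h \<and> (\<forall>w\<in>W. meval F w = meval Q w * h w)"
      if F: "\<And>w. w \<in> C \<Longrightarrow> meval F w = 0" for F
    proof -
      obtain h where h: "polyfun h" "\<forall>w\<in>W. meval F w = meval F (y 0 w *s e 0)
        + y 1 w * dir_deriv F (y 0 w *s e 0) v + (y 1 w)\<^sup>2 * h w" using div2 by blast
      have "polyfun (\<lambda>w. inverse (meval Q v) * h w)" by (intro polyfun.mult polyfun.const h)
      moreover have "meval F w = meval Q w * (inverse (meval Q v) * h w)" if w: "w \<in> W" for w
        using h(2) w F[OF coneD[OF C(1) e(1)]] tangent[OF F] QW[OF w] Q(3) by simp
      ultimately show ?thesis by blast
    qed
  qed (use C v Q secants subspace_W in auto)
  let ?J = "secant_locus (cpts C) (pt v)"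
  have inJ: "F \<in> ?J \<longleftrightarrow> meval F (e 0) = 0 \<and> dir_deriv F (e 0) v = 0"
    if F: "homogeneous d F" "d \<ge> 1" for F d
  proof
    assume "F \<in> ?J"
    then obtain h where h: "polyfun h" "\<forall>w\<in>W. meval F w = meval Q w * h w"
      unfolding qs.secant_locus_eq by blast
    obtain P where P: "\<forall>t. poly P t = h (e 0 + t *s v)" using polyfun_along_line[OF h(1)] by blast
    have "meval F (e 0 + t *s v) = poly ([:0, 0, meval Q v:] * P) t" for t
      using h(2) onW[of 1 t] QW[OF onW[of 1 t]] ycomb[of 1 t] P by (simp add: power2_eq_square algebra_simps)
    then have "dir_deriv F (e 0) v = coeff ([:0, 0, meval Q v:] * P) 1"
      by (rule dir_deriv_eqI)
    then have "dir_deriv F (e 0) v = 0" by (simp add: mult_pCons_left coeff_pCons One_nat_def)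
    moreover have "meval F (e 0) = 0" using h(2) eW(1) Q(2) e(1) by simp
    ultimately show "meval F (e 0) = 0 \<and> dir_deriv F (e 0) v = 0" by simp
  next
    assume a: "meval F (e 0) = 0 \<and> dir_deriv F (e 0) v = 0"
    obtain h where h: "polyfun h" "\<forall>w\<in>W. meval F w = meval F (y 0 w *s e 0)
        + y 1 w * dir_deriv F (y 0 w *s e 0) v + (y 1 w)\<^sup>2 * h w" using div2 by blast
    have "polyfun (\<lambda>w. inverse (meval Q v) * h w)" by (intro polyfun.mult polyfun.const h)
    moreover have "meval F w = meval Q w * (inverse (meval Q v) * h w)" if w: "w \<in> W" for w
      using h(2) w a homogeneous_meval_scale[OF F(1)] dir_deriv_scale_point[OF F(1)] QW[OF w] Q(3) by simp
    ultimately show "F \<in> ?J" unfolding qs.secant_locus_eq by blast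
  qed
  have hf: "hilbert_function ?J d = 2" if d: "d \<ge> 1" for d
  proof -
    let ?F = "lin_mpoly (y 0) ^ d" and ?G = "lin_mpoly (y 0) ^ (d - 1) * lin_mpoly (y 1)"
    have hom: "homogeneous d ?F" "homogeneous d ?G"
      using homogeneous_power[OF homogeneous_lin_mpoly, of d]
        homogeneous_mult[OF homogeneous_power[OF homogeneous_lin_mpoly, of "d - 1"] homogeneous_lin_mpoly] d
      by simp_all
    have ev: "y 0 (e 0) = 1" "y 1 (e 0) = 0" "y 0 v = 0" "y 1 v = 1"
      using ycomb[of 1 0] ycomb[of 0 1] by auto
    have valF: "meval ?F (e 0) = 1" and valG: "meval ?G (e 0) = 0" using lf ev by auto
    have "meval ?G (e 0 + t *s v) = poly [:0, 1:] t" for t using lf ev by (simp add: linear_form_simps)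
    then have dG: "dir_deriv ?G (e 0) v = 1" using dir_deriv_eqI[of ?G "e 0" v "[:0, 1:]"] by (simp add: One_nat_def)
    have "meval ?F (e 0 + t *s v) = poly [:1:] t" for t using lf ev by (simp add: linear_form_simps)
    then have dF: "dir_deriv ?F (e 0) v = 0" using dir_deriv_eqI[of ?F "e 0" v "[:1:]"] by (simp add: One_nat_def)
    have dlin: "dir_deriv (A - mscale c B) u w = dir_deriv A u w - c * dir_deriv B u w"
      for A B :: "('v, 'k) mpoly" and c u w
    proof -
      obtain P where P: "\<forall>t. poly P t = meval A (u + t *s w)" "coeff P 1 = dir_deriv A u w"
        using meval_along_line by blast
      obtain R where R: "\<forall>t. poly R t = meval B (u + t *s w)" "coeff R 1 = dir_deriv B u w"
        using meval_along_line by blast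
      have "meval (A - mscale c B) (u + t *s w) = poly (P - smult c R) t" for t using P R by simp
      from dir_deriv_eqI[OF this] show ?thesis using P R by simp
    qed
    have subJ: "mpoly.subspace ?J" unfolding secant_locus_def by (rule scheme_inter_subspace)
    have "2 \<le> hilbert_function ?J d"
    proof (rule hilbert_function_ge_2[OF subJ hom])
      show "?F \<notin> ?J" using inJ[OF hom(1) d] valF by (simp del: meval_power)
      show "?G - mscale c ?F \<notin> ?J" for c
        using inJ[OF homogeneous_diff[OF hom(2) homogeneous_mscale[OF hom(1)]] d, of c] valF valG dF dG
        by (simp add: dlin del: meval_mult meval_power)
    qed
    moreover have "hilbert_function ?J d \<le> 2"
    proof (rule hilbert_function_le_2[OF hom])
      fix G :: "('v, 'k) mpoly" assume G: "homogeneous d G"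
      let ?a = "meval G (e 0)" and ?b = "dir_deriv G (e 0) v"
      have "homogeneous d (G - mscale ?a ?F - mscale ?b ?G)"
        by (intro homogeneous_diff homogeneous_mscale G hom)
      then have "G - mscale ?a ?F - mscale ?b ?G \<in> ?J"
        using valF valG dF dG by (subst inJ[OF _ d]) (simp_all add: dlin del: meval_mult meval_power)
      then show "\<exists>c1 c2. G - mscale c1 ?F - mscale c2 ?G \<in> ?J" by blast
    qed
    ultimately show ?thesis by simp
  qed
  have "2 \<le> scheme_length ?J" by (rule scheme_length_ge_2[of 1]) (simp add: hf)
  moreover have "scheme_length ?J \<le> enat 2" by (rule scheme_length_le[of 1]) (simp add: hf)
  ultimately have len: "scheme_length ?J = 2" by (simp add: numeral_eq_enat)
  have Z: "qs.Z = vec.span {e 0}"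
  proof (intro subset_antisym subsetI)
    fix w assume w: "w \<in> qs.Z"
    then have "y 1 w = 0" using QW Q(3) by auto
    then have "w = y 0 w *s e 0" using lc[of w] w by (metis (no_types, lifting) add_0_right mem_Collect_eq vec.scale_zero_left)
    then show "w \<in> vec.span {e 0}" by (metis vec.span_base vec.span_scale singletonI)
  next
    fix w assume "w \<in> vec.span {e 0}"
    then obtain c where "w = c *s e 0" by (auto simp: vec.span_singleton)
    then show "w \<in> qs.Z" using eW subspace_W Q(2) coneD[OF C(1) e(1)] by (simp add: vec.subspace_scale)
  qed
  have sub: "subscheme ?J (vanishing_ideal (proj W))"
    unfolding subscheme_def qs.secant_locus_eq'
  proof (intro exI[of _ 0] allI impI, clarify)
    fix F assume "F \<in> vanishing_ideal (proj W)"
    moreover have "F = F + 0 * Q" by simp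
    ultimately show "\<exists>G H. F = G + H * Q \<and> G \<in> vanishing_ideal (proj W)" by blast
  qed
  show "pt v \<in> SL_double_point (cpts C)"
    unfolding SL_double_point_def
    using pt_v subspace_W dim_W r sub qs.zero_locus_secant_locus len e0 unfolding Z
    by (intro CollectI conjI exI[of _ W] exI[of _ "pt (e 0)"]) (auto simp: cpts_span_single)
  show "support_is_zero_locus ?J"
    using qs.zero_locus_secant_locus qs.support_secant_locus by simp
qed

end

section \<open>Scrolls in coordinates\<close>

text \<open>
  In degree \<open>d\<close>, the vectors annihilated by the linear form vanishing at \<open>(s : t)\<close> are the multiples
  of the point \<open>(s\<^sup>d : s\<^sup>d\<^sup>-\<^sup>1 t : \<dots> : t\<^sup>d)\<close> of the rational normal curve.
\<close>

lemma geometric_sequence: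
  fixes y :: "nat \<Rightarrow> 'k::field"
  assumes st: "(s, t) \<noteq> (0, 0)" and rec: "\<And>l. l < d \<Longrightarrow> t * y l = s * y (Suc l)"
  shows "\<exists>\<mu>. \<forall>l\<le>d. y l = \<mu> * s ^ (d - l) * t ^ l"
proof (cases "s = 0")
  case False
  have "y l = y 0 / s ^ d * s ^ (d - l) * t ^ l" if "l \<le> d" for l
    using that
  proof (induction l)
    case (Suc l)
    then have "y (Suc l) = t * y l / s" using rec[of l] False by simp
    moreover have "s ^ (d - l) = s * s ^ (d - Suc l)" using Suc.prems by (metis Suc_diff_Suc Suc_le_lessD power_Suc)
    ultimately show ?case using Suc False by simp
  qed (use False in simp)
  then show ?thesis by blast
next
  case True
  then have t: "t \<noteq> 0" using st by simp
  have "y l = 0" if "l < d" for l using rec[OF that] True t by simp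
  then have "y l = y d / t ^ d * s ^ (d - l) * t ^ l" if "l \<le> d" for l
    using that t True by (cases "l = d") auto
  then show ?thesis by blast
qed

lemma independent_direction:
  fixes s t :: "'k::field"
  assumes "(s, t) \<noteq> (0, 0)"
  shows "\<exists>s1 t1. t1 * s - s1 * t = c"
proof (cases "s = 0")
  case True
  then show ?thesis using assms by (intro exI[of _ "- c / t"] exI[of _ 0]) simp
next
  case False
  then show ?thesis by (intro exI[of _ 0] exI[of _ "c / s"]) simp
qed

text \<open>
  Here \<open>x i l v\<close> are the coordinates of \<open>v\<close> with respect to the basis formed by the vectors
  \<open>b i l\<close>, where \<open>i\<close> is the number of the block \<open>\<Lambda>\<^sub>i\<close> and \<open>l \<le> a i\<close>.
\<close>

locale scroll_coords =
  fixes I :: "nat set" and a :: "nat \<Rightarrow> nat" and b :: "nat \<Rightarrow> nat \<Rightarrow> 'k::alg_closed_field ^ 'v::finite"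
    and x :: "nat \<Rightarrow> nat \<Rightarrow> 'k ^ 'v \<Rightarrow> 'k"
  assumes finI: "finite I" and neI: "I \<noteq> {}" and a_pos: "i \<in> I \<Longrightarrow> 1 \<le> a i"
    and x_lin: "i \<in> I \<Longrightarrow> l \<le> a i \<Longrightarrow> linear_form (x i l)"
    and x_b: "i \<in> I \<Longrightarrow> l \<le> a i \<Longrightarrow> j \<in> I \<Longrightarrow> m \<le> a j \<Longrightarrow> x i l (b j m) = (if i = j \<and> l = m then 1 else 0)"
    and expand: "v = (\<Sum>i\<in>I. \<Sum>l\<le>a i. x i l v *s b i l)"
begin

definition mk :: "(nat \<Rightarrow> nat \<Rightarrow> 'k) \<Rightarrow> 'k ^ 'v" where
  "mk f = (\<Sum>i\<in>I. \<Sum>l\<le>a i. f i l *s b i l)"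

lemma x_mk:
  assumes "i \<in> I" "l \<le> a i"
  shows "x i l (mk f) = f i l"
proof -
  have "x i l (mk f) = (\<Sum>j\<in>I. \<Sum>m\<le>a j. f j m * x i l (b j m))"
    using x_lin[OF assms] by (simp add: mk_def linear_form_sum linear_form_scale)
  also have "\<dots> = (\<Sum>j\<in>I. if j = i then f i l else 0)"
  proof (rule sum.cong[OF refl])
    fix j assume j: "j \<in> I"
    have "(\<Sum>m\<le>a j. f j m * x i l (b j m)) = (\<Sum>m\<le>a j. if m = l then (if j = i then f j m else 0) else 0)"
      using assms j by (intro sum.cong refl) (auto simp: x_b)
    then show "(\<Sum>m\<le>a j. f j m * x i l (b j m)) = (if j = i then f i l else 0)"
      using assms by auto
  qed
  also have "\<dots> = f i l" using assms finI by simp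
  finally show ?thesis .
qed

lemma x_add: "i \<in> I \<Longrightarrow> l \<le> a i \<Longrightarrow> x i l (v + w) = x i l v + x i l w"
  and x_scale: "i \<in> I \<Longrightarrow> l \<le> a i \<Longrightarrow> x i l (c *s v) = c * x i l v"
  and x_diff: "i \<in> I \<Longrightarrow> l \<le> a i \<Longrightarrow> x i l (v - w) = x i l v - x i l w"
  and x_0: "i \<in> I \<Longrightarrow> l \<le> a i \<Longrightarrow> x i l 0 = 0"
  by (simp_all add: linear_form_simps x_lin)

lemmas x_simps = x_add x_scale x_diff x_0 x_mk

lemma vec_eqI:
  assumes "\<And>i l. i \<in> I \<Longrightarrow> l \<le> a i \<Longrightarrow> x i l v = x i l w"
  shows "v = w"
proof -
  have "v = (\<Sum>i\<in>I. \<Sum>l\<le>a i. x i l v *s b i l)" by (rule expand)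
  also have "\<dots> = (\<Sum>i\<in>I. \<Sum>l\<le>a i. x i l w *s b i l)"
    using assms by (intro sum.cong refl) auto
  also have "\<dots> = w" by (rule expand[symmetric])
  finally show ?thesis .
qed

text \<open>
  \<open>ctr s t v\<close> is the contraction of \<open>v\<close> with the linear form vanishing at \<open>(s : t)\<close>: a tuple of
  vectors in the dual spaces of the binary forms of degree \<open>a i - 1\<close>.
\<close>

definition ctr :: "'k \<Rightarrow> 'k \<Rightarrow> 'k ^ 'v \<Rightarrow> nat \<Rightarrow> nat \<Rightarrow> 'k" where
  "ctr s t v i l = t * x i l v - s * x i (Suc l) v"

text \<open>
  For the set \<open>J = I\<close> of all blocks, \<open>fibre I s t\<close> is the linear space \<open>\<langle>\<phi>\<^sub>1(x), \<dots>, \<phi>\<^sub>n(x)\<rangle>\<close> at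
  \<open>x = (s : t)\<close> and \<open>Cone I\<close> is the cone over \<open>X\<close>. The blocks of degree at least \<open>2\<close> will give the
  cone over \<open>B\<close>.
\<close>

definition fibre :: "nat set \<Rightarrow> 'k \<Rightarrow> 'k \<Rightarrow> ('k ^ 'v) set" where
  "fibre J s t = {v. \<forall>i\<in>J. \<forall>l<a i. ctr s t v i l = 0}"

definition Cone :: "nat set \<Rightarrow> ('k ^ 'v) set" where
  "Cone J = {v. \<exists>s t. (s, t) \<noteq> (0, 0) \<and> v \<in> fibre J s t}"

text \<open>The point of \<open>X\<close> over \<open>(s : t)\<close> with coordinates \<open>\<mu>\<close> in its fibre.\<close>

definition rn :: "(nat \<Rightarrow> 'k) \<Rightarrow> 'k \<Rightarrow> 'k \<Rightarrow> 'k ^ 'v" where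
  "rn \<mu> s t = mk (\<lambda>i l. \<mu> i * s ^ (a i - l) * t ^ l)"

lemma ctr_add: "i \<in> I \<Longrightarrow> l < a i \<Longrightarrow> ctr s t (v + w) i l = ctr s t v i l + ctr s t w i l"
  and ctr_diff: "i \<in> I \<Longrightarrow> l < a i \<Longrightarrow> ctr s t (v - w) i l = ctr s t v i l - ctr s t w i l"
  and ctr_scale: "i \<in> I \<Longrightarrow> l < a i \<Longrightarrow> ctr s t (c *s v) i l = c * ctr s t v i l"
  and ctr_0: "i \<in> I \<Longrightarrow> l < a i \<Longrightarrow> ctr s t 0 i l = 0"
  by (simp_all add: ctr_def x_simps algebra_simps)

lemma fibre_subspace: "J \<subseteq> I \<Longrightarrow> vec.subspace (fibre J s t)"
  by (auto simp: vec.subspace_def fibre_def ctr_add ctr_scale ctr_0 subset_iff)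

lemma Cone_cone: "J \<subseteq> I \<Longrightarrow> cone (Cone J)"
  unfolding cone_def Cone_def by (auto intro: vec.subspace_scale[OF fibre_subspace])

lemma zero_in_Cone: "J \<subseteq> I \<Longrightarrow> 0 \<in> Cone J"
  unfolding Cone_def using vec.subspace_0[OF fibre_subspace, of J 1 0]
  by (intro CollectI exI[of _ 1] exI[of _ 0]) simp

lemma fibre_subset_Cone: "(s, t) \<noteq> (0, 0) \<Longrightarrow> fibre J s t \<subseteq> Cone J"
  by (auto simp: Cone_def)

lemma ctr_rn:
  assumes "i \<in> I" "l < a i"
  shows "ctr s' t' (rn \<mu> s t) i l = (t' * s - s' * t) * (\<mu> i * s ^ (a i - 1 - l) * t ^ l)"
proof -
  have d: "a i - l = Suc (a i - 1 - l)" "a i - Suc l = a i - 1 - l" using assms(2) by simp_all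
  define P where "P = s ^ (a i - 1 - l)"
  have P: "s ^ (a i - l) = s * P" "s ^ (a i - Suc l) = P"
    unfolding d P_def by simp_all
  have il: "l \<le> a i" "Suc l \<le> a i" using assms(2) by simp_all
  show ?thesis
    unfolding ctr_def rn_def x_mk[OF assms(1) il(1)] x_mk[OF assms(1) il(2)] P P_def[symmetric]
    by (simp add: algebra_simps)
qed

lemma rn_in_fibre: "J \<subseteq> I \<Longrightarrow> rn \<mu> s t \<in> fibre J s t"
  by (auto simp: fibre_def ctr_rn subset_iff)

lemma fibre_block:
  assumes "(s, t) \<noteq> (0, 0)" "\<And>l. l < a i \<Longrightarrow> ctr s t v i l = 0"
  shows "\<exists>\<mu>. \<forall>l\<le>a i. x i l v = \<mu> * s ^ (a i - l) * t ^ l"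
  by (rule geometric_sequence[OF assms(1)]) (use assms(2) in \<open>simp add: ctr_def\<close>)

lemma fibre_rn:
  assumes "(s, t) \<noteq> (0, 0)" "v \<in> fibre I s t"
  shows "\<exists>\<mu>. v = rn \<mu> s t"
proof -
  have "\<forall>i\<in>I. \<exists>\<mu>. \<forall>l\<le>a i. x i l v = \<mu> * s ^ (a i - l) * t ^ l"
    using assms by (intro ballI fibre_block) (auto simp: fibre_def)
  then obtain \<mu> where "\<forall>i\<in>I. \<forall>l\<le>a i. x i l v = \<mu> i * s ^ (a i - l) * t ^ l" by metis
  then have "v = rn \<mu> s t" by (intro vec_eqI) (simp add: rn_def x_mk)
  then show ?thesis by blast
qed

lemma rn_scale: "rn (\<lambda>i. c * \<mu> i) s t = c *s rn \<mu> s t"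
  by (rule vec_eqI) (simp add: rn_def x_simps)

lemma x_rn: "i \<in> I \<Longrightarrow> l \<le> a i \<Longrightarrow> x i l (rn \<mu> s t) = \<mu> i * s ^ (a i - l) * t ^ l"
  by (simp add: rn_def x_mk)


subsection \<open>Scrolls are cut out by quadrics\<close>

definition minor :: "nat \<Rightarrow> nat \<Rightarrow> nat \<Rightarrow> nat \<Rightarrow> ('v, 'k) mpoly" where
  "minor i l j m = lin_mpoly (x i l) * lin_mpoly (x j (Suc m)) - lin_mpoly (x i (Suc l)) * lin_mpoly (x j m)"

lemma homogeneous_minor: "homogeneous 2 (minor i l j m)"
  unfolding minor_def by (intro homogeneous_diff homogeneous_lin_mpoly_mult)

lemma meval_minor:
  assumes "i \<in> I" "l < a i" "j \<in> I" "m < a j"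
  shows "meval (minor i l j m) v = x i l v * x j (Suc m) v - x i (Suc l) v * x j m v"
  using assms by (simp add: minor_def x_lin)

lemma minor_vanishes:
  assumes "J \<subseteq> I" "v \<in> Cone J" "i \<in> J" "l < a i" "j \<in> J" "m < a j"
  shows "meval (minor i l j m) v = 0"
proof -
  obtain s t where st: "(s, t) \<noteq> (0, 0)" "v \<in> fibre J s t" using assms(2) by (auto simp: Cone_def)
  let ?M = "x i l v * x j (Suc m) v - x i (Suc l) v * x j m v"
  have e: "t * x i l v = s * x i (Suc l) v" "t * x j m v = s * x j (Suc m) v"
    using st assms by (auto simp: fibre_def ctr_def)
  have "t * ?M = (t * x i l v) * x j (Suc m) v - x i (Suc l) v * (t * x j m v)"
    by (simp add: algebra_simps)
  then have "t * ?M = 0" unfolding e by simp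
  moreover have "s * ?M = x i l v * (s * x j (Suc m) v) - (s * x i (Suc l) v) * x j m v"
    by (simp add: algebra_simps)
  then have "s * ?M = 0" unfolding e[symmetric] by simp
  ultimately show ?thesis using st(1) assms by (subst meval_minor) auto
qed

text \<open>
  If the minors vanish, then the columns \<open>(x i l v, x i (Suc l) v)\<close> are proportional, and any nonzero
  one of them gives the base point.
\<close>

lemma minors_cut_out:
  assumes J: "J \<subseteq> I" and zero: "\<And>i l j m. i \<in> J \<Longrightarrow> l < a i \<Longrightarrow> j \<in> J \<Longrightarrow> m < a j \<Longrightarrow> meval (minor i l j m) v = 0"
  shows "v \<in> Cone J"
proof (cases "\<exists>i\<in>J. \<exists>l<a i. (x i l v, x i (Suc l) v) \<noteq> (0, 0)")
  case True
  then obtain i l where il: "i \<in> J" "l < a i" "(x i l v, x i (Suc l) v) \<noteq> (0, 0)" by blast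
  have "v \<in> fibre J (x i l v) (x i (Suc l) v)"
    unfolding fibre_def
  proof (intro CollectI ballI allI impI)
    fix j m assume jm: "j \<in> J" "m < a j"
    then have "meval (minor i l j m) v = 0" using zero il by blast
    then show "ctr (x i l v) (x i (Suc l) v) v j m = 0"
      using il jm J by (subst (asm) meval_minor) (auto simp: ctr_def)
  qed
  then show ?thesis using il(3) unfolding Cone_def by blast
next
  case False
  then have "v \<in> fibre J 1 0" by (auto simp: fibre_def ctr_def)
  then show ?thesis using fibre_subset_Cone[of 1 0 J] by auto
qed

lemma Cone_quadrics:
  assumes "J \<subseteq> I" shows "cut_out_by_quadrics (Cone J)"
  unfolding cut_out_by_quadrics_def
proof (intro allI impI)
  fix u assume "u \<notin> Cone J"
  then obtain i l j m where ij: "i \<in> J" "l < a i" "j \<in> J" "m < a j" "meval (minor i l j m) u \<noteq> 0"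
    using minors_cut_out[OF assms] by blast
  then show "\<exists>Q. homogeneous 2 Q \<and> (\<forall>w\<in>Cone J. meval Q w = 0) \<and> meval Q u \<noteq> 0"
    using homogeneous_minor minor_vanishes[OF assms] by blast
qed

text \<open>
  On the line of the vectors \<open>\<sigma> *s rn \<mu> s t + \<tau> *s v\<close> the minors are \<open>\<tau> (\<sigma> A + \<tau> B)\<close>, with this
  coefficient \<open>A\<close>.
\<close>

definition polar_minor :: "(nat \<Rightarrow> 'k) \<Rightarrow> 'k \<Rightarrow> 'k \<Rightarrow> 'k ^ 'v \<Rightarrow> nat \<Rightarrow> nat \<Rightarrow> nat \<Rightarrow> nat \<Rightarrow> 'k" where
  "polar_minor \<mu> s t v i l j m = \<mu> j * s ^ (a j - 1 - m) * t ^ m * ctr s t v i l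
     - \<mu> i * s ^ (a i - 1 - l) * t ^ l * ctr s t v j m"

lemma minor_on_line:
  assumes "i \<in> I" "l < a i" "j \<in> I" "m < a j"
  shows "meval (minor i l j m) (\<sigma> *s rn \<mu> s t + \<tau> *s v) =
    \<tau> * (\<sigma> * polar_minor \<mu> s t v i l j m + \<tau> * meval (minor i l j m) v)"
proof -
  define p where "p = \<mu> i * s ^ (a i - 1 - l) * t ^ l"
  define q where "q = \<mu> j * s ^ (a j - 1 - m) * t ^ m"
  have d: "a i - l = Suc (a i - 1 - l)" "a j - m = Suc (a j - 1 - m)"
    "a i - Suc l = a i - 1 - l" "a j - Suc m = a j - 1 - m" using assms(2,4) by simp_all
  have le: "l \<le> a i" "Suc l \<le> a i" "m \<le> a j" "Suc m \<le> a j" using assms by simp_all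
  have "x i l (rn \<mu> s t) = s * p" "x i (Suc l) (rn \<mu> s t) = t * p"
     "x j m (rn \<mu> s t) = s * q" "x j (Suc m) (rn \<mu> s t) = t * q"
    unfolding x_rn[OF assms(1) le(1)] x_rn[OF assms(1) le(2)] x_rn[OF assms(3) le(3)] x_rn[OF assms(3) le(4)] d
    by (simp_all add: p_def q_def)
  then show ?thesis
    using assms unfolding meval_minor[OF assms] polar_minor_def p_def[symmetric] q_def[symmetric]
    by (simp add: x_simps ctr_def algebra_simps)
qed

text \<open>\<open>contr s t s' t' \<mu> v\<close>: contracting \<open>v\<close> at \<open>(s' : t')\<close> gives the point over \<open>(s : t)\<close> with weights \<open>\<mu>\<close>.\<close>

definition contr :: "'k \<Rightarrow> 'k \<Rightarrow> 'k \<Rightarrow> 'k \<Rightarrow> (nat \<Rightarrow> 'k) \<Rightarrow> 'k ^ 'v \<Rightarrow> bool" where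
  "contr s t s' t' \<mu> v \<longleftrightarrow> (\<forall>i\<in>I. \<forall>l<a i. ctr s' t' v i l = \<mu> i * s ^ (a i - 1 - l) * t ^ l)"

text \<open>
  The polar minors are the minors of the matrix with rows \<open>ctr s t v i l\<close> and
  \<open>\<mu> i s\<^sup>a\<^sup>-\<^sup>1\<^sup>-\<^sup>l t\<^sup>l\<close>, whose second row is nonzero.
\<close>

lemma polar_minors_zero:
  assumes w: "rn \<mu> s t \<noteq> 0"
    and zero: "\<And>i l j m. i \<in> I \<Longrightarrow> l < a i \<Longrightarrow> j \<in> I \<Longrightarrow> m < a j \<Longrightarrow> polar_minor \<mu> s t v i l j m = 0"
  shows "\<exists>c. contr s t s t (\<lambda>i. c * \<mu> i) v"
proof -
  obtain i where i: "i \<in> I" "\<mu> i \<noteq> 0" "(s, t) \<noteq> (0, 0)"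
  proof (rule ccontr)
    assume n: "\<not> thesis"
    have "rn \<mu> s t = 0"
    proof (rule vec_eqI)
      fix i l assume il: "i \<in> I" "l \<le> a i"
      have "\<mu> i = 0 \<or> s = 0 \<and> t = 0" using n that il(1) by blast
      then show "x i l (rn \<mu> s t) = x i l 0"
        using il a_pos[OF il(1)] by (cases "l = 0") (auto simp: x_rn x_0 power_0_left)
    qed
    then show False using w by simp
  qed
  obtain l where l: "l < a i" "s ^ (a i - 1 - l) * t ^ l \<noteq> 0"
  proof (cases "s = 0")
    case True
    then show thesis using i(3) a_pos[OF i(1)] by (intro that[of "a i - 1"]) auto
  next
    case False
    then show thesis using a_pos[OF i(1)] by (intro that[of 0]) auto
  qed
  define \<kappa> where "\<kappa> = \<mu> i * s ^ (a i - 1 - l) * t ^ l"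
  have \<kappa>: "\<kappa> \<noteq> 0" using i(2) l(2) unfolding \<kappa>_def by (simp only: mult.assoc mult_eq_0_iff) simp
  define c where "c = ctr s t v i l / \<kappa>"
  have "contr s t s t (\<lambda>i. c * \<mu> i) v"
    unfolding contr_def
  proof (intro ballI allI impI)
    fix j m assume jm: "j \<in> I" "m < a j"
    have "polar_minor \<mu> s t v i l j m = 0" using zero i(1) l(1) jm by blast
    then have "\<mu> j * s ^ (a j - 1 - m) * t ^ m * ctr s t v i l = \<kappa> * ctr s t v j m"
      unfolding polar_minor_def \<kappa>_def[symmetric] by simp
    then have "ctr s t v j m = (\<mu> j * s ^ (a j - 1 - m) * t ^ m * ctr s t v i l) / \<kappa>"
      using \<kappa> by (metis nonzero_mult_div_cancel_left)
    then show "ctr s t v j m = c * \<mu> j * s ^ (a j - 1 - m) * t ^ m"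
      unfolding c_def by (simp add: mult_ac)
  qed
  then show ?thesis by blast
qed

end

text \<open>
  If the line through \<open>p = pt v\<close> and \<open>q = pt w\<close> meets \<open>X\<close> in the reduced point \<open>q\<close>, as witnessed
  by the two quadrics restricting to \<open>\<sigma> \<tau>\<close> and \<open>\<tau>\<^sup>2\<close>, then the forms of degree at least \<open>2\<close> in the ideal of the
  intersection are those vanishing at \<open>q\<close>.
\<close>

lemma length_one:
  fixes C :: "('k::alg_closed_field ^ 'v::finite) set"
  assumes C: "cone C" and w: "w \<noteq> 0" "v \<notin> vec.span {w}"
    and Q1: "\<And>u. u \<in> C \<Longrightarrow> meval Q1 u = 0" "\<And>\<sigma> \<tau>. meval Q1 (\<sigma> *s w + \<tau> *s v) = \<sigma> * \<tau>"
    and Q2: "\<And>u. u \<in> C \<Longrightarrow> meval Q2 u = 0" "\<And>\<sigma> \<tau>. meval Q2 (\<sigma> *s w + \<tau> *s v) = \<tau>\<^sup>2"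
  shows "\<not> 2 \<le> scheme_length (scheme_inter (vanishing_ideal (cpts C)) (vanishing_ideal (lin_hull {pt v, pt w})))"
proof -
  let ?J = "scheme_inter (vanishing_ideal (cpts C)) (vanishing_ideal (lin_hull {pt v, pt w}))"
  obtain y z where yz: "linear_form y" "linear_form z" "y w = 1" "y v = 0" "z w = 0" "z v = 1"
    using coordinates_on_line[OF w] by blast
  have ev: "y (\<sigma> *s w + \<tau> *s v) = \<sigma>" "z (\<sigma> *s w + \<tau> *s v) = \<tau>" for \<sigma> \<tau>
    using yz by (simp_all add: linear_form_simps)
  have inJ: "F \<in> ?J" if F: "homogeneous d F" "d \<ge> 2" "meval F w = 0" for F d
  proof -
    let ?\<pi> = "\<lambda>u. y u *s w + z u *s v"
    have pf: "polyfun (\<lambda>u. meval F (?\<pi> u))"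
      by (rule polyfun_compose[OF polyfun_meval polyfun_linear_comb[OF yz(1,2)]])
    obtain h where h: "polyfun h" "\<And>u. meval F (?\<pi> u) = meval F (?\<pi> (u - z u *s v)) + z u * h u"
      using polyfun_divide[OF pf yz(2), of v] by blast
    obtain h1 where h1: "polyfun h1" "\<And>u. h u = h (u - y u *s w) + y u * h1 u"
      using polyfun_divide[OF h(1) yz(1), of w] by blast
    obtain h2 where h2: "polyfun h2" "\<And>u. h u = h (u - z u *s v) + z u * h2 u"
      using polyfun_divide[OF h(1) yz(2), of v] by blast
    have Fh: "meval F (\<sigma> *s w + \<tau> *s v) = \<tau> * h (\<sigma> *s w + \<tau> *s v)" for \<sigma> \<tau>
      using h(2)[of "\<sigma> *s w + \<tau> *s v"] ev F(3)
      by (simp add: linear_form_simps yz homogeneous_meval_scale[OF F(1)])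
    \<comment> \<open>This needs \<open>d \<ge> 2\<close>: the form \<open>\<tau>\<close> vanishes at \<open>w\<close> but is not in the ideal generated by \<open>\<sigma> \<tau>\<close> and \<open>\<tau>\<^sup>2\<close>.\<close>
    have h0: "h 0 = 0"
    proof -
      obtain P where P: "\<forall>e. poly P e = h (0 + e *s v)" using polyfun_along_line[OF h(1)] by blast
      have "P - monom (meval F v) (d - 1) = 0"
      proof (rule poly_zero_if_zero_off_0)
        fix e :: 'k assume e: "e \<noteq> 0"
        have "e * h (e *s v) = e ^ d * meval F v"
          using Fh[of 0 e] by (simp add: homogeneous_meval_scale[OF F(1)])
        also have "e ^ d = e * e ^ (d - 1)" using F(2) by (cases d) auto
        finally show "poly (P - monom (meval F v) (d - 1)) e = 0"
          using P e by (simp add: poly_monom)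
      qed
      then have "P = monom (meval F v) (d - 1)" by simp
      then have "h 0 = poly (monom (meval F v) (d - 1)) 0" using spec[OF P, of 0] by simp
      also have "\<dots> = 0" using F(2) by (simp add: poly_monom)
      finally show ?thesis .
    qed
    obtain H1 where H1: "\<forall>u. meval H1 u = h1 u" using polyfun_imp_meval[OF h1(1)] by blast
    obtain H2 where H2: "\<forall>u. meval H2 u = h2 (u - y u *s w)"
      using polyfun_imp_meval[OF polyfun_project[OF h2(1) yz(1), of w]] by blast
    have "meval (F - (H1 * Q1 + H2 * Q2)) (\<tau> *s v + \<sigma> *s w) = 0" for \<sigma> \<tau>
    proof -
      let ?u = "\<sigma> *s w + \<tau> *s v"
      have "h ?u = h (\<tau> *s v) + \<sigma> * h1 ?u" using h1(2)[of ?u] ev by simp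
      moreover have "h (\<tau> *s v) = \<tau> * h2 (\<tau> *s v)"
        using h2(2)[of "\<tau> *s v"] yz h0 by (simp add: linear_form_simps)
      ultimately have "meval F ?u = \<tau> * (\<tau> * h2 (\<tau> *s v) + \<sigma> * h1 ?u)" using Fh by simp
      then have "meval (F - (H1 * Q1 + H2 * Q2)) ?u = 0"
        using H1 H2 Q1(2) Q2(2) ev by (simp add: algebra_simps power2_eq_square)
      then show ?thesis by (simp add: add.commute)
    qed
    then have "F - (H1 * Q1 + H2 * Q2) \<in> vanishing_ideal (lin_hull {pt v, pt w})"
      unfolding lin_hull_pair_ideal by blast
    moreover have "H1 * Q1 + H2 * Q2 \<in> vanishing_ideal (cpts C)"
      using Q1(1) Q2(1) by (intro vanishing_ideal_cptsI C) simp
    ultimately have "(H1 * Q1 + H2 * Q2) + (F - (H1 * Q1 + H2 * Q2)) \<in> ?J" by (intro scheme_interI)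
    then show ?thesis by simp
  qed
  have "hilbert_function ?J d \<le> 1" if d: "d \<ge> 2" for d
  proof (rule hilbert_function_le_1)
    show hom: "homogeneous d (lin_mpoly y ^ d)" using homogeneous_power[OF homogeneous_lin_mpoly, of d] by simp
    fix G :: "('v, 'k) mpoly" assume G: "homogeneous d G"
    have "G - mscale (meval G w) (lin_mpoly y ^ d) \<in> ?J"
      by (rule inJ[OF homogeneous_diff[OF G homogeneous_mscale[OF hom]] d]) (simp add: yz)
    then show "\<exists>c. G - mscale c (lin_mpoly y ^ d) \<in> ?J" by blast
  qed
  then have "scheme_length ?J \<le> enat 1" by (rule scheme_length_le)
  then show ?thesis by (metis enat_ord_simps(1) not_less_eq_eq numeral_2_eq_2 numeral_eq_enat One_nat_def order.trans le_refl)
qed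

context scroll_coords
begin

text \<open>
  The conjugate point \<open>(s' : t')\<close> is the base point of the other intersection of the line with \<open>X\<close>,
  and is equal to \<open>(s : t)\<close> when the line is tangent. In the remaining case the minors restrict to
  \<open>\<tau> (\<sigma> A + \<tau> B)\<close> where the linear forms \<open>\<sigma> A + \<tau> B\<close> have no common zero, and therefore span all
  linear forms, so that the intersection has length \<open>1\<close>.
\<close>

lemma secant_point_conjugate:
  assumes v: "v \<notin> Cone I" and q: "q \<in> secant_points (cpts (Cone I)) (pt v)"
  shows "\<exists>s t s' t' \<mu>. (s, t) \<noteq> (0, 0) \<and> (s', t') \<noteq> (0, 0) \<and> contr s t s' t' \<mu> v \<and>
     q = pt (rn \<mu> s t) \<and> rn \<mu> s t \<noteq> 0"
proof -
  have "q \<in> cpts (Cone I)" using q by (simp add: secant_points_def)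
  then obtain w where w: "w \<noteq> 0" "w \<in> Cone I" "q = pt w" by (auto simp: cpts_def)
  then obtain s t where st: "(s, t) \<noteq> (0, 0)" "w \<in> fibre I s t" by (auto simp: Cone_def)
  then obtain \<mu> where \<mu>: "w = rn \<mu> s t" using fibre_rn by blast
  have scaled: "pt (rn (\<lambda>i. c * \<mu> i) s t) = q \<and> rn (\<lambda>i. c * \<mu> i) s t \<noteq> 0" if "c \<noteq> 0" for c
    using that w \<mu> pt_eq_iff[OF w(1), of "c *s w"] unfolding rn_scale by auto
  consider (tangent) c where "contr s t s t (\<lambda>i. c * \<mu> i) v"
    | (chord) \<sigma> where "\<sigma> *s w + v \<in> Cone I"
    | (simple) "\<nexists>c. contr s t s t (\<lambda>i. c * \<mu> i) v" "\<And>\<sigma>. \<sigma> *s w + v \<notin> Cone I"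
    by blast
  then show ?thesis
  proof cases
    case tangent
    have "c \<noteq> 0"
    proof
      assume "c = 0"
      then have "v \<in> fibre I s t" using tangent by (auto simp: contr_def fibre_def)
      then show False using v st(1) by (auto simp: Cone_def)
    qed
    then show ?thesis using tangent st(1) scaled by metis
  next
    case chord
    then obtain s' t' where st': "(s', t') \<noteq> (0, 0)" "\<sigma> *s w + v \<in> fibre I s' t'" by (auto simp: Cone_def)
    let ?c = "- \<sigma> * (t' * s - s' * t)"
    have c: "contr s t s' t' (\<lambda>i. ?c * \<mu> i) v"
      unfolding contr_def
    proof (intro ballI allI impI)
      fix i l assume il: "i \<in> I" "l < a i"
      then have "ctr s' t' (\<sigma> *s w + v) i l = 0" using st'(2) by (simp add: fibre_def)
      then have "ctr s' t' v i l = - \<sigma> * ctr s' t' w i l"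
        using il by (simp add: ctr_add ctr_scale eq_neg_iff_add_eq_0 add.commute)
      then show "ctr s' t' v i l = ?c * \<mu> i * s ^ (a i - 1 - l) * t ^ l"
        using il unfolding \<mu> by (simp add: ctr_rn)
    qed
    have "?c \<noteq> 0"
    proof
      assume "?c = 0"
      then have "v \<in> fibre I s' t'" using c unfolding contr_def fibre_def by simp
      then show False using v st'(1) by (auto simp: Cone_def)
    qed
    then show ?thesis using c st(1) st'(1) scaled by metis
  next
    case simple
    obtain i l j m where ij: "i \<in> I" "l < a i" "j \<in> I" "m < a j" and A: "polar_minor \<mu> s t v i l j m \<noteq> 0"
      using polar_minors_zero[of \<mu> s t v] simple(1) w(1) \<mu> by blast
    let ?A = "polar_minor \<mu> s t v i l j m" and ?B = "meval (minor i l j m) v"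
    define \<sigma> where "\<sigma> = - ?B / ?A"
    obtain i' l' j' m' where ij': "i' \<in> I" "l' < a i'" "j' \<in> I" "m' < a j'"
      "meval (minor i' l' j' m') (\<sigma> *s w + v) \<noteq> 0"
      using minors_cut_out[of I] simple(2)[of \<sigma>] by blast
    let ?A' = "polar_minor \<mu> s t v i' l' j' m'" and ?B' = "meval (minor i' l' j' m') v"
    have "\<sigma> * ?A' + ?B' \<noteq> 0" using ij'(5) minor_on_line[OF ij'(1-4), of \<sigma> \<mu> s t 1 v] \<mu> by simp
    then have \<Delta>: "?A * ?B' - ?A' * ?B \<noteq> 0" using A by (simp add: \<sigma>_def field_simps)
    let ?\<Delta> = "?A * ?B' - ?A' * ?B"
    let ?Q1 = "mscale (?B' / ?\<Delta>) (minor i l j m) - mscale (?B / ?\<Delta>) (minor i' l' j' m')"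
    let ?Q2 = "mscale (?A / ?\<Delta>) (minor i' l' j' m') - mscale (?A' / ?\<Delta>) (minor i l j m)"
    have line: "meval (minor i l j m) (\<sigma> *s w + \<tau> *s v) = \<tau> * (\<sigma> * ?A + \<tau> * ?B)"
       "meval (minor i' l' j' m') (\<sigma> *s w + \<tau> *s v) = \<tau> * (\<sigma> * ?A' + \<tau> * ?B')" for \<sigma> \<tau>
      unfolding \<mu> by (rule minor_on_line; fact)+
    have "v \<notin> vec.span {w}"
      using v w(2) coneD[OF Cone_cone[of I]] by (auto simp: vec.span_singleton)
    then have "\<not> 2 \<le> scheme_length (scheme_inter (vanishing_ideal (cpts (Cone I))) (vanishing_ideal (lin_hull {pt v, pt w})))"
    proof (rule length_one[OF Cone_cone[OF subset_refl] w(1), of v ?Q1 ?Q2])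
      show "meval ?Q1 u = 0" "meval ?Q2 u = 0" if "u \<in> Cone I" for u
        using minor_vanishes[OF subset_refl that] ij ij' by simp_all
      show "meval ?Q1 (\<sigma> *s w + \<tau> *s v) = \<sigma> * \<tau>" for \<sigma> \<tau>
      proof -
        have "meval ?Q1 (\<sigma> *s w + \<tau> *s v) = (?B' * (\<tau> * (\<sigma> * ?A + \<tau> * ?B)) - ?B * (\<tau> * (\<sigma> * ?A' + \<tau> * ?B'))) / ?\<Delta>"
          by (simp add: line diff_divide_distrib)
        also have "?B' * (\<tau> * (\<sigma> * ?A + \<tau> * ?B)) - ?B * (\<tau> * (\<sigma> * ?A' + \<tau> * ?B')) = \<sigma> * \<tau> * ?\<Delta>"
          by (simp add: algebra_simps)
        finally show ?thesis using \<Delta> by simp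
      qed
      show "meval ?Q2 (\<sigma> *s w + \<tau> *s v) = \<tau>\<^sup>2" for \<sigma> \<tau>
      proof -
        have "meval ?Q2 (\<sigma> *s w + \<tau> *s v) = (?A * (\<tau> * (\<sigma> * ?A' + \<tau> * ?B')) - ?A' * (\<tau> * (\<sigma> * ?A + \<tau> * ?B))) / ?\<Delta>"
          by (simp add: line diff_divide_distrib)
        also have "?A * (\<tau> * (\<sigma> * ?A' + \<tau> * ?B')) - ?A' * (\<tau> * (\<sigma> * ?A + \<tau> * ?B)) = \<tau>\<^sup>2 * ?\<Delta>"
          by (simp add: algebra_simps power2_eq_square)
        finally show ?thesis using \<Delta> by simp
      qed
    qed
    then show ?thesis using q w(3) by (simp add: secant_points_def)
  qed
qed


subsection \<open>Tangent spaces\<close>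

lemma dir_deriv_in_fibre:
  assumes F: "\<And>w. w \<in> Cone I \<Longrightarrow> meval F w = 0" and st: "(s, t) \<noteq> (0, 0)"
    and w: "w \<in> fibre I s t" "w' \<in> fibre I s t"
  shows "dir_deriv F w w' = 0"
proof -
  have "meval F (w + e *s w') = poly 0 e" for e
  proof -
    have "w + e *s w' \<in> fibre I s t"
      using fibre_subspace[of I s t] w by (simp add: vec.subspace_add vec.subspace_scale)
    then show ?thesis using F st by (auto simp: Cone_def)
  qed
  from dir_deriv_eqI[OF this] show ?thesis by simp
qed

lemma meval_along_mk_curve:
  "\<exists>P. (\<forall>e. poly P e = meval F (mk (\<lambda>i l. poly (c i l) e))) \<and>
     poly (pderiv P) 0 = dir_deriv F (mk (\<lambda>i l. poly (c i l) 0)) (mk (\<lambda>i l. poly (pderiv (c i l)) 0))"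
proof -
  let ?p = "\<lambda>j. \<Sum>i\<in>I. \<Sum>l\<le>a i. smult (b i l $ j) (c i l)"
  obtain P where P: "\<forall>e. poly P e = meval F (\<chi> j. poly (?p j) e)"
    "\<forall>e. poly (pderiv P) e = dir_deriv F (\<chi> j. poly (?p j) e) (\<chi> j. poly (pderiv (?p j)) e)"
    using meval_along_curve[of F ?p] by blast
  have pdsum: "pderiv (\<Sum>m\<in>S. g m) = (\<Sum>m\<in>S. pderiv (g m))" for S :: "nat set" and g :: "nat \<Rightarrow> 'k poly"
    by (induction S rule: infinite_finite_induct) (auto simp: pderiv_add)
  have 1: "(\<chi> j. poly (?p j) e) = mk (\<lambda>i l. poly (c i l) e)" for e
    by (simp add: vec_eq_iff mk_def poly_sum mult.commute)
  have 2: "(\<chi> j. poly (pderiv (?p j)) e) = mk (\<lambda>i l. poly (pderiv (c i l)) e)" for e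
    by (simp add: vec_eq_iff mk_def poly_sum pdsum pderiv_smult mult.commute)
  show ?thesis using P unfolding 1 2 by blast
qed

text \<open>
  Differentiating the relation \<open>t x\<^sub>l = s x\<^sub>l\<^sub>+\<^sub>1\<close> along a curve of points over \<open>(s + e s1 : t + e t1)\<close>.
\<close>

lemma ctr_curve_derivative:
  assumes il: "i \<in> I" "l < a i"
    and c: "c = (\<lambda>i l. smult (\<mu> i) ([:s, s1:] ^ (a i - l) * [:t, t1:] ^ l))"
  shows "ctr s t (mk (\<lambda>i l. poly (pderiv (c i l)) 0)) i l = - ctr s1 t1 (rn \<mu> s t) i l"
proof -
  have "[:s, s1:] ^ (a i - l) = [:s, s1:] * [:s, s1:] ^ (a i - Suc l)"
    using il(2) by (metis Suc_diff_Suc power_Suc)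
  then have "[:t, t1:] * c i l = [:s, s1:] * c i (Suc l)"
    by (simp add: c mult_ac del: mult_pCons_left mult_pCons_right)
  then have "poly (pderiv ([:t, t1:] * c i l)) 0 = poly (pderiv ([:s, s1:] * c i (Suc l))) 0" by simp
  then have "t * poly (pderiv (c i l)) 0 + t1 * poly (c i l) 0
      = s * poly (pderiv (c i (Suc l))) 0 + s1 * poly (c i (Suc l)) 0"
    by (simp add: pderiv_mult pderiv_pCons algebra_simps del: mult_pCons_left mult_pCons_right)
  moreover have "poly (c i l) 0 = x i l (rn \<mu> s t)" "poly (c i (Suc l)) 0 = x i (Suc l) (rn \<mu> s t)"
    using il by (simp_all add: c x_rn)
  ultimately show ?thesis using il by (simp add: ctr_def x_mk algebra_simps)
qed

text \<open>
  For \<open>k \<noteq> 0\<close>, \<open>v\<close> is the velocity of a curve in \<open>X\<close> through \<open>k *s rn \<mu> s t\<close> up to a vector in the fibre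
  over \<open>(s : t)\<close>: both have the same contraction at \<open>(s : t)\<close>. The vertex \<open>k = 0\<close> of the cone is a limit.
\<close>

lemma dir_deriv_tangent:
  assumes F: "\<And>w. w \<in> Cone I \<Longrightarrow> meval F w = 0" and st: "(s, t) \<noteq> (0, 0)" and v: "contr s t s t \<mu> v"
  shows "dir_deriv F (k *s rn \<mu> s t) v = 0"
proof -
  have nz: "dir_deriv F (k *s rn \<mu> s t) v = 0" if k: "k \<noteq> 0" for k
  proof -
    obtain s1 t1 where st1: "t1 * s - s1 * t = - 1 / k" using independent_direction[OF st] by blast
    let ?c = "\<lambda>i l. smult (k * \<mu> i) ([:s, s1:] ^ (a i - l) * [:t, t1:] ^ l)"
    let ?g = "mk (\<lambda>i l. poly (pderiv (?c i l)) 0)"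
    have pt0: "mk (\<lambda>i l. poly (?c i l) 0) = k *s rn \<mu> s t"
      by (rule vec_eqI) (simp add: x_simps rn_def)
    have "dir_deriv F (k *s rn \<mu> s t) ?g = 0"
    proof -
      obtain P where P: "\<forall>e. poly P e = meval F (mk (\<lambda>i l. poly (?c i l) e))"
        "poly (pderiv P) 0 = dir_deriv F (mk (\<lambda>i l. poly (?c i l) 0)) ?g"
        using meval_along_mk_curve[of F ?c] by blast
      have "poly P e = 0" for e
      proof -
        have "mk (\<lambda>i l. poly (?c i l) e) = rn (\<lambda>i. k * \<mu> i) (s + e * s1) (t + e * t1)"
          by (rule vec_eqI) (simp add: x_simps rn_def mult_ac)
        moreover have "(s + e * s1, t + e * t1) \<noteq> (0, 0)"
        proof
          assume "(s + e * s1, t + e * t1) = (0, 0)"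
          then have "s = - e * s1" "t = - e * t1" by (simp_all add: eq_neg_iff_add_eq_0)
          then have "t1 * s - s1 * t = 0" by (simp add: algebra_simps)
          then show False using st1 k by simp
        qed
        ultimately have "mk (\<lambda>i l. poly (?c i l) e) \<in> Cone I"
          using rn_in_fibre[of I] fibre_subset_Cone by (metis subset_iff subset_refl)
        then show ?thesis using F P(1) by simp
      qed
      then have "P = 0" by (intro poly_zero_if_zero_off_0)
      then show ?thesis using P(2) unfolding pt0 by simp
    qed
    moreover have "v - ?g \<in> fibre I s t"
      unfolding fibre_def
    proof (intro CollectI ballI allI impI)
      fix i l assume il: "i \<in> I" "l < a i"
      have "ctr s t ?g i l = - ctr s1 t1 (rn (\<lambda>i. k * \<mu> i) s t) i l"
        by (rule ctr_curve_derivative[OF il]) simp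
      also have "\<dots> = ctr s t v i l"
        using il v st1 k by (simp add: ctr_rn contr_def)
      finally show "ctr s t (v - ?g) i l = 0" using il by (simp add: ctr_diff)
    qed
    then have "dir_deriv F (k *s rn \<mu> s t) (v - ?g) = 0"
      using rn_in_fibre[of I \<mu> s t] fibre_subspace[of I s t]
      by (intro dir_deriv_in_fibre[OF F st]) (simp_all add: vec.subspace_scale)
    ultimately show ?thesis by (simp add: linear_form_diff[OF linear_form_dir_deriv])
  qed
  have pf: "polyfun (\<lambda>u. dir_deriv F u v)"
    unfolding dir_deriv_def by (intro polyfun_sum polyfun.mult polyfun.const polyfun_meval)
  show ?thesis
  proof (cases "k = 0")
    case True
    show ?thesis
      by (rule polyfun_zero_limit[OF pf, where w = "rn \<mu> s t"]) (use nz True in simp)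
  qed (rule nz)
qed

end

section \<open>Secant and tangent variety\<close>

lemma binary_quadratic_factors:
  fixes \<alpha> \<beta> \<gamma> :: "'k::alg_closed_field"
  assumes "(\<alpha>, \<beta>, \<gamma>) \<noteq> (0, 0, 0)"
  shows "\<exists>s t s' t'. (s, t) \<noteq> (0, 0) \<and> (s', t') \<noteq> (0, 0) \<and>
    \<alpha> = t * t' \<and> \<beta> = - (t * s' + s * t') \<and> \<gamma> = s * s'"
proof (cases "\<alpha> = 0")
  case True
  then show ?thesis using assms
    by (intro exI[of _ 1] exI[of _ 0] exI[of _ \<gamma>] exI[of _ "- \<beta>"]) auto
next
  case False
  obtain z where z: "\<alpha> * z\<^sup>2 + \<beta> * z + \<gamma> = 0" using quadratic_root[OF False] by blast
  have "\<gamma> = z * (- (\<beta> + \<alpha> * z))"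
    using z by (simp add: algebra_simps power2_eq_square eq_neg_iff_add_eq_0)
  then show ?thesis using False
    by (intro exI[of _ z] exI[of _ 1] exI[of _ "- (\<beta> + \<alpha> * z)"] exI[of _ \<alpha>]) (auto simp: algebra_simps)
qed

text \<open>
  If the first two columns are independent, then their cross product is the only candidate for a
  vector that annihilates all columns.
\<close>

lemma three_independent_columns:
  fixes p q r :: "'i \<Rightarrow> 'k::field"
  assumes "\<And>\<alpha> \<beta> \<gamma>. (\<alpha>, \<beta>, \<gamma>) \<noteq> (0, 0, 0) \<Longrightarrow> \<exists>n\<in>N. \<alpha> * p n + \<beta> * q n + \<gamma> * r n \<noteq> 0"
  shows "\<exists>n1\<in>N. \<exists>n2\<in>N. \<exists>n3\<in>N.
    (q n1 * r n2 - r n1 * q n2) * p n3 + (r n1 * p n2 - p n1 * r n2) * q n3 + (p n1 * q n2 - q n1 * p n2) * r n3 \<noteq> 0"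
proof -
  obtain n1 where n1: "n1 \<in> N" "p n1 \<noteq> 0" using assms[of 1 0 0] by auto
  obtain n2 where n2: "n2 \<in> N" "p n1 * q n2 - q n1 * p n2 \<noteq> 0"
    using assms[of "- q n1" "p n1" 0] n1 by auto
  show ?thesis
    using assms[of "q n1 * r n2 - r n1 * q n2" "r n1 * p n2 - p n1 * r n2" "p n1 * q n2 - q n1 * p n2"] n1 n2
    by blast
qed

text \<open>The resultant of the forms \<open>A t\<^sup>2 + B s t + C s\<^sup>2\<close> and \<open>A' t\<^sup>2 + B' s t + C' s\<^sup>2\<close>.\<close>

definition resultant2 :: "'k::field \<Rightarrow> 'k \<Rightarrow> 'k \<Rightarrow> 'k \<Rightarrow> 'k \<Rightarrow> 'k \<Rightarrow> 'k" where
  "resultant2 A B C A' B' C' = (A * C' - A' * C)\<^sup>2 - (A * B' - A' * B) * (B * C' - B' * C)"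

lemma resultant2_common_root:
  fixes s t :: "'k::field"
  assumes st: "(s, t) \<noteq> (0, 0)" and 0: "A * t\<^sup>2 + B * (s * t) + C * s\<^sup>2 = 0" "A' * t\<^sup>2 + B' * (s * t) + C' * s\<^sup>2 = 0"
  shows "resultant2 A B C A' B' C' = 0"
proof (cases "s = 0")
  case True
  then show ?thesis using assms by (simp add: resultant2_def)
next
  case False
  define z where "z = t / s"
  have C: "C = - (A * z\<^sup>2 + B * z)" "C' = - (A' * z\<^sup>2 + B' * z)"
    using 0 False by (simp_all add: z_def field_simps power2_eq_square eq_neg_iff_add_eq_0)
  show ?thesis unfolding resultant2_def C by (simp add: algebra_simps power2_eq_square)
qed

lemma resultant2_factors:
  "resultant2 (t0 * t1) (- (t0 * s1 + s0 * t1)) (s0 * s1) A B C =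
    (A * s0\<^sup>2 + B * (t0 * s0) + C * t0\<^sup>2) * (A * s1\<^sup>2 + B * (t1 * s1) + C * t1\<^sup>2)"
  by (simp add: resultant2_def algebra_simps power2_eq_square)

text \<open>
  Binary quadratic forms have a common zero if and only if certain resultants vanish: if a
  member \<open>n1\<close> of the family vanishes at \<open>u\<close> and \<open>w\<close>, and some members do not vanish at \<open>u\<close> and at
  \<open>w\<close>, respectively, then one of them or their sum vanishes at neither.
\<close>

lemma common_root_or_resultant:
  fixes p q r :: "'i \<Rightarrow> 'k::alg_closed_field"
  assumes no_root: "\<And>s t. (s, t) \<noteq> (0, 0) \<Longrightarrow> \<exists>n\<in>N. p n * t\<^sup>2 + q n * (s * t) + r n * s\<^sup>2 \<noteq> 0"
  shows "\<exists>n1\<in>N. \<exists>n2\<in>N. \<exists>n3\<in>N. \<exists>c. resultant2 (p n1) (q n1) (r n1)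
    (p n2 + c * p n3) (q n2 + c * q n3) (r n2 + c * r n3) \<noteq> 0"
proof -
  let ?f = "\<lambda>n s t. p n * t\<^sup>2 + q n * (s * t) + r n * s\<^sup>2"
  obtain n1 where n1: "n1 \<in> N" "(p n1, q n1, r n1) \<noteq> (0, 0, 0)" using no_root[of 1 0] by auto
  then obtain s0 t0 s1 t1 where f: "(s0, t0) \<noteq> (0, 0)" "(s1, t1) \<noteq> (0, 0)"
    "p n1 = t0 * t1" "q n1 = - (t0 * s1 + s0 * t1)" "r n1 = s0 * s1"
    using binary_quadratic_factors[OF n1(2)] by blast
  have R: "resultant2 (p n1) (q n1) (r n1) (p n2 + c * p n3) (q n2 + c * q n3) (r n2 + c * r n3) =
    (?f n2 t0 s0 + c * ?f n3 t0 s0) * (?f n2 t1 s1 + c * ?f n3 t1 s1)" for n2 n3 c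
    unfolding f(3-5) resultant2_factors by (simp add: algebra_simps)
  obtain n2 where n2: "n2 \<in> N" "?f n2 t0 s0 \<noteq> 0" using no_root[of t0 s0] f by auto
  obtain n3 where n3: "n3 \<in> N" "?f n3 t1 s1 \<noteq> 0" using no_root[of t1 s1] f by auto
  have "\<exists>m2\<in>N. \<exists>m3\<in>N. \<exists>c. (?f m2 t0 s0 + c * ?f m3 t0 s0) * (?f m2 t1 s1 + c * ?f m3 t1 s1) \<noteq> 0"
  proof (cases "?f n2 t1 s1 = 0")
    case False
    then show ?thesis using n2 by (intro bexI[of _ n2] exI[of _ 0]) auto
  next
    case u: True
    show ?thesis
    proof (cases "?f n3 t0 s0 = 0")
      case False
      then show ?thesis using n3 by (intro bexI[of _ n3] exI[of _ 0]) auto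
    next
      case True
      then show ?thesis using u n2 n3 by (intro bexI[of _ n2] bexI[of _ n3] exI[of _ 1]) auto
    qed
  qed
  then show ?thesis unfolding R[symmetric] using n1(1) by blast
qed

context scroll_coords
begin

text \<open>\<open>apolar s t s' t' v\<close>: the product of the linear forms vanishing at \<open>(s : t)\<close> and \<open>(s' : t')\<close> annihilates \<open>v\<close>.\<close>

definition apolar :: "'k \<Rightarrow> 'k \<Rightarrow> 'k \<Rightarrow> 'k \<Rightarrow> 'k ^ 'v \<Rightarrow> bool" where
  "apolar s t s' t' v \<longleftrightarrow> (\<forall>i\<in>I. \<forall>l. Suc l < a i \<longrightarrow> t * ctr s' t' v i l = s * ctr s' t' v i (Suc l))"

lemma x_rn_column:
  assumes "i \<in> I" "l < a i"
  shows "x i l (rn \<mu> s t) = s * (\<mu> i * s ^ (a i - 1 - l) * t ^ l)"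
    and "x i (Suc l) (rn \<mu> s t) = t * (\<mu> i * s ^ (a i - 1 - l) * t ^ l)"
proof -
  have d: "a i - l = Suc (a i - 1 - l)" "a i - Suc l = a i - 1 - l" using assms(2) by simp_all
  have le: "l \<le> a i" "Suc l \<le> a i" using assms by simp_all
  show "x i l (rn \<mu> s t) = s * (\<mu> i * s ^ (a i - 1 - l) * t ^ l)"
    and "x i (Suc l) (rn \<mu> s t) = t * (\<mu> i * s ^ (a i - 1 - l) * t ^ l)"
    unfolding x_rn[OF assms(1) le(1)] x_rn[OF assms(1) le(2)] d by simp_all
qed

lemma apolar_contr:
  assumes st: "(s, t) \<noteq> (0, 0)" and c: "apolar s t s' t' v"
  shows "\<exists>\<mu>. contr s t s' t' \<mu> v"
proof -
  have "\<forall>i\<in>I. \<exists>\<mu>. \<forall>l\<le>a i - 1. ctr s' t' v i l = \<mu> * s ^ (a i - 1 - l) * t ^ l"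
    using c by (intro ballI geometric_sequence[OF st]) (auto simp: apolar_def)
  then obtain \<mu> where "\<forall>i\<in>I. \<forall>l\<le>a i - 1. ctr s' t' v i l = \<mu> i * s ^ (a i - 1 - l) * t ^ l" by metis
  then have "contr s t s' t' \<mu> v" by (auto simp: contr_def)
  then show ?thesis by blast
qed

lemma contr_apolar: "contr s t s' t' \<mu> v \<Longrightarrow> apolar s t s' t' v"
  unfolding contr_def apolar_def
proof (intro ballI allI impI)
  fix i l assume c: "\<forall>i\<in>I. \<forall>l<a i. ctr s' t' v i l = \<mu> i * s ^ (a i - 1 - l) * t ^ l"
    and il: "i \<in> I" "Suc l < a i"
  have "a i - 1 - l = Suc (a i - 1 - Suc l)" using il by simp
  then show "t * ctr s' t' v i l = s * ctr s' t' v i (Suc l)" using c il by simp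
qed

lemma apolar_iff:
  "apolar s t s' t' v \<longleftrightarrow> (\<forall>i\<in>I. \<forall>l. Suc l < a i \<longrightarrow>
     t * t' * x i l v + (- (t * s' + s * t')) * x i (Suc l) v + s * s' * x i (Suc (Suc l)) v = 0)"
  by (auto simp: apolar_def ctr_def algebra_simps)

lemma apolar_sym: "apolar s t s' t' v \<longleftrightarrow> apolar s' t' s t v"
  unfolding apolar_iff by (simp add: algebra_simps)

lemma apolar_add: "apolar s t s' t' v \<Longrightarrow> apolar s t s' t' w \<Longrightarrow> apolar s t s' t' (v + w)"
  by (auto simp: apolar_def ctr_add algebra_simps)

lemma fibre_apolar:
  assumes "v \<in> fibre I s' t'" shows "apolar s t s' t' v" "apolar s' t' s t v"
proof -
  show "apolar s t s' t' v" using assms by (auto simp: fibre_def apolar_def)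
  then show "apolar s' t' s t v" using apolar_sym by blast
qed

lemma apolar_scale_point: "c \<noteq> 0 \<Longrightarrow> apolar s t (c * s') (c * t') v \<longleftrightarrow> apolar s t s' t' v"
proof -
  assume c: "c \<noteq> 0"
  have "ctr (c * s') (c * t') v i l = c * ctr s' t' v i l" for i l by (simp add: ctr_def algebra_simps)
  then have "apolar s t (c * s') (c * t') v \<longleftrightarrow>
     (\<forall>i\<in>I. \<forall>l. Suc l < a i \<longrightarrow> c * (t * ctr s' t' v i l) = c * (s * ctr s' t' v i (Suc l)))"
    by (simp add: apolar_def mult.left_commute)
  then show ?thesis using c by (simp add: apolar_def)
qed

definition SecC :: "('k ^ 'v) set" where
  "SecC = {v. \<exists>s t s' t'. (s, t) \<noteq> (0, 0) \<and> (s', t') \<noteq> (0, 0) \<and> apolar s t s' t' v}"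

definition TanC :: "('k ^ 'v) set" where
  "TanC = {v. \<exists>s t. (s, t) \<noteq> (0, 0) \<and> apolar s t s t v}"

lemma apolar_cone: "apolar s t s' t' v \<Longrightarrow> apolar s t s' t' (c *s v)"
  by (auto simp: apolar_def ctr_scale algebra_simps)

lemma SecCI: "(s, t) \<noteq> (0, 0) \<Longrightarrow> (s', t') \<noteq> (0, 0) \<Longrightarrow> apolar s t s' t' v \<Longrightarrow> v \<in> SecC"
  unfolding SecC_def by blast

lemma TanCI: "(s, t) \<noteq> (0, 0) \<Longrightarrow> apolar s t s t v \<Longrightarrow> v \<in> TanC"
  unfolding TanC_def by blast

lemma cone_SecC: "cone SecC"
  unfolding cone_def
proof (intro ballI allI)
  fix v c assume "v \<in> SecC"
  then obtain s t s' t' where st: "(s, t) \<noteq> (0, 0)" "(s', t') \<noteq> (0, 0)" "apolar s t s' t' v"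
    unfolding SecC_def by blast
  show "c *s v \<in> SecC" by (rule SecCI[OF st(1,2) apolar_cone[OF st(3)]])
qed

lemma cone_TanC: "cone TanC"
  unfolding cone_def
proof (intro ballI allI)
  fix v c assume "v \<in> TanC"
  then obtain s t where st: "(s, t) \<noteq> (0, 0)" "apolar s t s t v"
    unfolding TanC_def by blast
  show "c *s v \<in> TanC" by (rule TanCI[OF st(1) apolar_cone[OF st(2)]])
qed

lemma TanC_SecC: "TanC \<subseteq> SecC"
  unfolding TanC_def by (blast intro: SecCI)

lemma annihilated_iff_SecC:
  "(\<exists>\<alpha> \<beta> \<gamma>. (\<alpha>, \<beta>, \<gamma>) \<noteq> (0, 0, 0) \<and> (\<forall>i\<in>I. \<forall>l. Suc l < a i \<longrightarrow>
     \<alpha> * x i l v + \<beta> * x i (Suc l) v + \<gamma> * x i (Suc (Suc l)) v = 0)) \<longleftrightarrow> v \<in> SecC" (is "?L \<longleftrightarrow> _")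
proof
  assume ?L
  then obtain \<alpha> \<beta> \<gamma> where n: "(\<alpha>, \<beta>, \<gamma>) \<noteq> (0, 0, 0)" and
    ann: "\<forall>i\<in>I. \<forall>l. Suc l < a i \<longrightarrow> \<alpha> * x i l v + \<beta> * x i (Suc l) v + \<gamma> * x i (Suc (Suc l)) v = 0"
    by blast
  obtain s t s' t' where "(s, t) \<noteq> (0, 0)" "(s', t') \<noteq> (0, 0)" "\<alpha> = t * t'" "\<beta> = - (t * s' + s * t')" "\<gamma> = s * s'"
    using binary_quadratic_factors[OF n] by blast
  then show "v \<in> SecC" unfolding SecC_def apolar_iff using ann by blast
next
  assume "v \<in> SecC"
  then obtain s t s' t' where st: "(s, t) \<noteq> (0, 0)" "(s', t') \<noteq> (0, 0)" "apolar s t s' t' v"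
    by (auto simp: SecC_def)
  have "(t * t', - (t * s' + s * t'), s * s') \<noteq> (0, 0, 0)" using st(1,2) by auto
  then show ?L using st(3) unfolding apolar_iff by blast
qed

lemma in_lin_hull_pair: "u \<noteq> 0 \<Longrightarrow> u = \<sigma> *s v + \<tau> *s w \<Longrightarrow> pt u \<in> lin_hull {pt v, pt w}"
  unfolding lin_hull_pair span_pair cpts_def by blast

lemma lin_hull_pairE:
  assumes "q \<in> lin_hull {pt v, pt w}" obtains u \<sigma> \<tau> where "q = pt u" "u \<noteq> 0" "u = \<sigma> *s v + \<tau> *s w"
  using assms unfolding lin_hull_pair span_pair cpts_def by blast

lemma b_coords: "i \<in> I \<Longrightarrow> l \<le> a i \<Longrightarrow> b i l \<noteq> 0"
  using x_b[of i l i l] x_0[of i l] by auto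

lemma b_ends_in_Cone:
  assumes "i \<in> I" shows "b i 0 \<in> Cone I" "b i (a i) \<in> Cone I"
proof -
  have "b i 0 \<in> fibre I 1 0" using assms by (auto simp: fibre_def ctr_def x_b)
  then show "b i 0 \<in> Cone I" using fibre_subset_Cone[of 1 0 I] by auto
  have "b i (a i) \<in> fibre I 0 1" using assms by (auto simp: fibre_def ctr_def x_b)
  then show "b i (a i) \<in> Cone I" using fibre_subset_Cone[of 0 1 I] by auto
qed

lemma b_ends_distinct:
  assumes "i \<in> I" shows "pt (b i 0) \<noteq> pt (b i (a i))"
proof
  assume "pt (b i 0) = pt (b i (a i))"
  then obtain c where c: "c \<noteq> 0" "b i (a i) = c *s b i 0" using pt_eq_iff b_coords assms by blast
  have "x i 0 (b i (a i)) = c" unfolding c(2) using assms by (simp add: x_scale x_b)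
  then show False using c(1) assms a_pos[OF assms] by (simp add: x_b)
qed

lemma another_point:
  assumes "i \<in> I" obtains w where "w = b i 0 \<or> w = b i (a i)" "w \<in> Cone I" "w \<noteq> 0" "pt w \<noteq> pt u"
  using b_ends_in_Cone[OF assms] b_ends_distinct[OF assms] b_coords[OF assms] by (metis le0 order_refl)

text \<open>
  A tangent vector \<open>v\<close> is a limit of chords: for \<open>e \<noteq> 0\<close> the difference quotients at \<open>e\<close> of a curve in
  \<open>X\<close> lie on chords, and \<open>v\<close> is the value at \<open>e = 0\<close>, up to a vector over the point of tangency.
\<close>

lemma tangent_is_limit_of_chords:
  assumes st: "(s, t) \<noteq> (0, 0)" and v: "contr s t s t \<mu> v"
  shows "\<exists>c. v = mk (\<lambda>i l. poly (c i l) 0) \<and>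
     (\<forall>e. e \<noteq> 0 \<longrightarrow> (\<exists>w\<in>Cone I. \<exists>w'\<in>Cone I. mk (\<lambda>i l. poly (c i l) e) = w + w'))"
proof -
  obtain s1 t1 where st1: "t1 * s - s1 * t = - 1" using independent_direction[OF st] by blast
  let ?c = "\<lambda>i l. smult (\<mu> i) ([:s, s1:] ^ (a i - l) * [:t, t1:] ^ l)"
  define p where "p = (\<lambda>i l. synthetic_div (?c i l) 0)"
  have pc: "?c i l = pCons (poly (?c i l) 0) (p i l)" for i l
    using synthetic_div_correct[of "?c i l" 0] by (simp only: p_def smult_0_left add_0_right)
  have p0: "poly (p i l) 0 = poly (pderiv (?c i l)) 0" for i l
  proof -
    have "pderiv (?c i l) = pderiv (pCons (poly (?c i l) 0) (p i l))" using pc[of i l] by (rule arg_cong)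
    then show ?thesis by (simp only: pderiv_pCons) simp
  qed
  define g where "g = mk (\<lambda>i l. poly (pderiv (?c i l)) 0)"
  have vg: "v - g \<in> fibre I s t"
    unfolding fibre_def
  proof (intro CollectI ballI allI impI)
    fix i l assume il: "i \<in> I" "l < a i"
    have "ctr s t g i l = - ctr s1 t1 (rn \<mu> s t) i l"
      unfolding g_def by (rule ctr_curve_derivative[OF il]) simp
    also have "\<dots> = ctr s t v i l" using il v st1 by (simp add: ctr_rn contr_def)
    finally show "ctr s t (v - g) i l = 0" using il by (simp add: ctr_diff)
  qed
  define c where "c = (\<lambda>i l. [:x i l (v - g):] + p i l)"
  have "v = mk (\<lambda>i l. poly (c i l) 0)"
    by (rule vec_eqI) (simp add: x_simps c_def p0 g_def)
  moreover have "\<exists>w\<in>Cone I. \<exists>w'\<in>Cone I. mk (\<lambda>i l. poly (c i l) e) = w + w'" if e: "e \<noteq> 0" for e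
  proof -
    have ne: "(s + e * s1, t + e * t1) \<noteq> (0, 0)"
    proof
      assume "(s + e * s1, t + e * t1) = (0, 0)"
      then have "s = - e * s1" "t = - e * t1" by (simp_all add: eq_neg_iff_add_eq_0)
      then have "t1 * s - s1 * t = 0" by (simp add: algebra_simps)
      then show False using st1 by simp
    qed
    let ?w = "(v - g) - inverse e *s rn \<mu> s t" and ?w' = "inverse e *s rn \<mu> (s + e * s1) (t + e * t1)"
    have sub: "vec.subspace (fibre I s t)" "vec.subspace (fibre I (s + e * s1) (t + e * t1))"
      by (simp_all add: fibre_subspace)
    have "?w \<in> fibre I s t" using vg rn_in_fibre[of I \<mu> s t] sub(1)
      by (simp add: vec.subspace_diff vec.subspace_scale)
    then have w: "?w \<in> Cone I" using fibre_subset_Cone[OF st, of I] by blast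
    have "?w' \<in> fibre I (s + e * s1) (t + e * t1)" using rn_in_fibre[of I] sub(2) by (simp add: vec.subspace_scale)
    then have w': "?w' \<in> Cone I" using fibre_subset_Cone[OF ne, of I] by blast
    have "mk (\<lambda>i l. poly (c i l) e) = ?w + ?w'"
    proof (rule vec_eqI)
      fix i l assume il: "i \<in> I" "l \<le> a i"
      have "poly (?c i l) e = poly (?c i l) 0 + e * poly (p i l) e"
        by (subst pc) simp
      moreover have "poly (?c i l) e = x i l (rn \<mu> (s + e * s1) (t + e * t1))"
        "poly (?c i l) 0 = x i l (rn \<mu> s t)" using il by (simp_all add: x_rn)
      ultimately have "x i l (rn \<mu> (s + e * s1) (t + e * t1)) = x i l (rn \<mu> s t) + e * poly (p i l) e"
        by (simp only:)
      then have "poly (p i l) e = inverse e * (x i l (rn \<mu> (s + e * s1) (t + e * t1)) - x i l (rn \<mu> s t))"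
        using e by simp
      then show "x i l (mk (\<lambda>i l. poly (c i l) e)) = x i l (?w + ?w')"
        using il by (simp add: x_simps c_def algebra_simps)
    qed
    then show ?thesis using w w' by blast
  qed
  ultimately show ?thesis by blast
qed

lemma chord_decomposition:
  assumes \<delta>: "t' * s - s' * t \<noteq> 0" and v: "contr s t s' t' \<mu> v"
  shows "v - inverse (t' * s - s' * t) *s rn \<mu> s t \<in> fibre I s' t'"
  unfolding fibre_def
proof (intro CollectI ballI allI impI)
  fix i l assume "i \<in> I" "l < a i"
  then show "ctr s' t' (v - inverse (t' * s - s' * t) *s rn \<mu> s t) i l = 0"
    using v \<delta> by (simp add: ctr_diff ctr_scale ctr_rn contr_def)
qed

lemma proportional:
  fixes s t s' t' :: 'k
  assumes "(s, t) \<noteq> (0, 0)" "(s', t') \<noteq> (0, 0)" "t' * s - s' * t = 0"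
  obtains c where "c \<noteq> 0" "s' = c * s" "t' = c * t"
proof (cases "s = 0")
  case True
  then have "t \<noteq> 0" "s' = 0" using assms by auto
  then show thesis using that[of "t' / t"] assms True by auto
next
  case False
  have "t' = s' / s * t" using assms(3) False by (simp add: field_simps)
  moreover have "s' \<noteq> 0" using assms calculation by auto
  ultimately show thesis using that[of "s' / s"] False by auto
qed

text \<open>
  If \<open>t' s - s' t \<noteq> 0\<close>, then \<open>v\<close> is a sum of vectors in the fibres over \<open>(s : t)\<close> and \<open>(s' : t')\<close>, by
  \<open>chord_decomposition\<close>.
\<close>

lemma SecC_cases:
  assumes "v \<in> SecC"
  obtains w w' where "w \<in> Cone I" "w' \<in> Cone I" "v = w + w'" | s t \<mu> where "(s, t) \<noteq> (0, 0)" "contr s t s t \<mu> v"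
proof -
  obtain s t s' t' where st: "(s, t) \<noteq> (0, 0)" "(s', t') \<noteq> (0, 0)" "apolar s t s' t' v"
    using assms by (auto simp: SecC_def)
  obtain \<mu> where \<mu>: "contr s t s' t' \<mu> v" using apolar_contr[OF st(1,3)] by blast
  show thesis
  proof (cases "t' * s - s' * t = 0")
    case True
    obtain c where c: "c \<noteq> 0" "s' = c * s" "t' = c * t" using proportional[OF st(1,2) True] .
    have "apolar s t s t v" using st(3) apolar_scale_point[OF c(1)] c(2,3) by simp
    then obtain \<mu> where "contr s t s t \<mu> v" using apolar_contr[OF st(1)] by blast
    then show thesis using that(2) st(1) by blast
  next
    case False
    let ?w = "inverse (t' * s - s' * t) *s rn \<mu> s t"
    have "?w \<in> fibre I s t" using rn_in_fibre[of I \<mu> s t] by (simp add: vec.subspace_scale fibre_subspace)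
    then have "?w \<in> Cone I" "v - ?w \<in> Cone I"
      using chord_decomposition[OF False \<mu>] fibre_subset_Cone[OF st(1), of I] fibre_subset_Cone[OF st(2), of I] by blast+
    then show thesis using that(1)[of ?w "v - ?w"] by simp
  qed
qed

text \<open>
  A quadratic form annihilating \<open>v\<close> is a linear relation between the rows of a matrix with three rows,
  whence \<open>SecC\<close> is the zero set of determinants.
\<close>

lemma Sec_eq: "Sec (cpts (Cone I)) = cpts SecC"
  unfolding Sec_def
proof (rule zclosure_eq_cpts[OF cone_SecC])
  let ?Y = "\<Union>{lin_hull {x, y} |x y. x \<in> cpts (Cone I) \<and> y \<in> cpts (Cone I) \<and> x \<noteq> y}"
  show "?Y \<subseteq> cpts SecC"
  proof
    fix q assume "q \<in> ?Y"
    then obtain v w where vw: "v \<in> Cone I" "w \<in> Cone I" "q \<in> lin_hull {pt v, pt w}" by (auto simp: cpts_def)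
    obtain u \<sigma> \<tau> where u: "q = pt u" "u \<noteq> 0" "u = \<sigma> *s v + \<tau> *s w" using vw(3) by (rule lin_hull_pairE)
    obtain s t where st: "(s, t) \<noteq> (0, 0)" "v \<in> fibre I s t" using vw(1) by (auto simp: Cone_def)
    obtain s' t' where st': "(s', t') \<noteq> (0, 0)" "w \<in> fibre I s' t'" using vw(2) by (auto simp: Cone_def)
    have "apolar s t s' t' u"
      unfolding u(3) by (intro apolar_add apolar_cone fibre_apolar st st')
    then have "u \<in> SecC" by (rule SecCI[OF st(1) st'(1)])
    then show "q \<in> cpts SecC" using u by (auto simp: cpts_def)
  qed
  show "\<exists>f. polyfun f \<and> f v \<noteq> 0 \<and> (\<forall>w\<in>SecC. f w = 0)" if v: "v \<notin> SecC" for v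
  proof -
    let ?N = "{(i, l). i \<in> I \<and> Suc l < a i}"
    let ?p = "\<lambda>(i, l) u. x i l u" and ?q = "\<lambda>(i, l) u. x i (Suc l) u" and ?r = "\<lambda>(i, l) u. x i (Suc (Suc l)) u"
    have N: "(\<forall>n\<in>?N. R n) \<longleftrightarrow> (\<forall>i\<in>I. \<forall>l. Suc l < a i \<longrightarrow> R (i, l))" for R by auto
    have ann: "u \<in> SecC \<longleftrightarrow> (\<exists>\<alpha> \<beta> \<gamma>. (\<alpha>, \<beta>, \<gamma>) \<noteq> (0, 0, 0) \<and> (\<forall>n\<in>?N. \<alpha> * ?p n u + \<beta> * ?q n u + \<gamma> * ?r n u = 0))" for u
      unfolding annihilated_iff_SecC[symmetric] N case_prod_conv by (rule refl)
    have "\<exists>n\<in>?N. \<alpha> * ?p n v + \<beta> * ?q n v + \<gamma> * ?r n v \<noteq> 0" if "(\<alpha>, \<beta>, \<gamma>) \<noteq> (0, 0, 0)" for \<alpha> \<beta> \<gamma>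
      using v that unfolding ann by blast
    then obtain n1 n2 n3 where n: "n1 \<in> ?N" "n2 \<in> ?N" "n3 \<in> ?N" and
      d: "(?q n1 v * ?r n2 v - ?r n1 v * ?q n2 v) * ?p n3 v + (?r n1 v * ?p n2 v - ?p n1 v * ?r n2 v) * ?q n3 v
        + (?p n1 v * ?q n2 v - ?q n1 v * ?p n2 v) * ?r n3 v \<noteq> 0"
      using three_independent_columns[of ?N "\<lambda>n. ?p n v" "\<lambda>n. ?q n v" "\<lambda>n. ?r n v"] by blast
    let ?f = "\<lambda>u. (?q n1 u * ?r n2 u - ?r n1 u * ?q n2 u) * ?p n3 u + (?r n1 u * ?p n2 u - ?p n1 u * ?r n2 u) * ?q n3 u
        + (?p n1 u * ?q n2 u - ?q n1 u * ?p n2 u) * ?r n3 u"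
    have pf: "polyfun (?p n)" "polyfun (?q n)" "polyfun (?r n)" if "n \<in> ?N" for n
      using that by (auto intro!: polyfun_linear_form x_lin)
    have "polyfun ?f"
      by (intro polyfun.add polyfun.mult polyfun_diff pf n)
    moreover have "?f w = 0" if w: "w \<in> SecC" for w
    proof -
      obtain \<alpha> \<beta> \<gamma> where 1: "(\<alpha>, \<beta>, \<gamma>) \<noteq> (0, 0, 0)" "\<And>n. n \<in> ?N \<Longrightarrow> \<alpha> * ?p n w + \<beta> * ?q n w + \<gamma> * ?r n w = 0"
        using w unfolding ann by blast
      note e = 1(2)[OF n(1)] 1(2)[OF n(2)] 1(2)[OF n(3)]
      have "\<alpha> * ?f w = 0" "\<beta> * ?f w = 0" "\<gamma> * ?f w = 0" using e by algebra+
      then show ?thesis using 1(1) by auto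
    qed
    ultimately show ?thesis using d by blast
  qed
  show "pt v \<in> zclosure ?Y" if v: "v \<in> SecC" "v \<noteq> 0" for v
  proof (rule pt_in_zclosureI[OF v(2)])
    fix f u assume f: "polyfun f" and u: "u \<in> pt v"
      and f0: "\<And>q u. q \<in> ?Y \<Longrightarrow> u \<in> q \<Longrightarrow> f u = 0"
    have on_line: "f u = 0" if "w \<in> Cone I" "w' \<in> Cone I" "w \<noteq> 0" "w' \<noteq> 0" "pt w \<noteq> pt w'" "u \<noteq> 0" "u = \<sigma> *s w + \<tau> *s w'"
      for u w w' \<sigma> \<tau>
    proof (rule f0)
      have "pt w \<in> cpts (Cone I)" "pt w' \<in> cpts (Cone I)" using that by (auto simp: cpts_def)
      then show "pt u \<in> ?Y" using in_lin_hull_pair[OF that(6,7)] that(5) by blast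
    qed simp
    obtain i where i: "i \<in> I" using neI by blast
    have f00: "f 0 = 0"
    proof -
      have "pt (b i 0) \<in> lin_hull {pt (b i 0), pt (b i (a i))}"
        by (rule in_lin_hull_pair[of _ 1 _ 0]) (use i b_coords in auto)
      moreover have "pt (b i 0) \<in> cpts (Cone I)" "pt (b i (a i)) \<in> cpts (Cone I)"
        using b_ends_in_Cone[OF i] b_coords[OF i] by (auto simp: cpts_def)
      ultimately have "pt (b i 0) \<in> ?Y" using b_ends_distinct[OF i] by blast
      moreover have "0 \<in> pt (b i 0)" using in_ptI(1)[of 0 "b i 0"] by simp
      ultimately show ?thesis using f0 by blast
    qed
    have fC: "f w = 0" if w: "w \<in> Cone I" for w
    proof (cases "w = 0")
      case False
      obtain w' where w': "w' = b i 0 \<or> w' = b i (a i)" "w' \<in> Cone I" "w' \<noteq> 0" "pt w' \<noteq> pt w"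
        by (rule another_point[OF i, of w])
      show ?thesis by (rule on_line[OF w w'(2) False w'(3) w'(4)[symmetric] False, of 1 0]) simp
    qed (use f00 in simp)
    have chord: "f (w + w') = 0" if ww: "w \<in> Cone I" "w' \<in> Cone I" for w w'
    proof (cases "w = 0 \<or> w' = 0 \<or> w + w' = 0 \<or> pt w = pt w'")
      case True
      have "w + w' \<in> Cone I"
      proof (cases "w = 0 \<or> w' = 0 \<or> w + w' = 0")
        case True
        then show ?thesis using ww zero_in_Cone by auto
      next
        case False
        then obtain c where "w' = c *s w" using \<open>w = 0 \<or> w' = 0 \<or> w + w' = 0 \<or> pt w = pt w'\<close> pt_eq_iff[of w w'] by auto
        then have "w + w' = (1 + c) *s w" by (simp add: vec.scale_left_distrib)
        then show ?thesis using coneD[OF Cone_cone[of I] ww(1)] by simp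
      qed
      then show ?thesis by (rule fC)
    next
      case False
      then show ?thesis by (intro on_line[OF ww, of "w + w'" 1 1]) auto
    qed
    obtain c where "u = c *s v" using u by (auto simp: pt_eq)
    then have "u \<in> SecC" using v coneD[OF cone_SecC] by simp
    then show "f u = 0"
    proof (cases rule: SecC_cases)
      case (1 w w')
      then show ?thesis using chord by simp
    next
      case (2 s t \<mu>)
      obtain c where c: "u = mk (\<lambda>i l. poly (c i l) 0)"
        "\<forall>e. e \<noteq> 0 \<longrightarrow> (\<exists>w\<in>Cone I. \<exists>w'\<in>Cone I. mk (\<lambda>i l. poly (c i l) e) = w + w')"
        using tangent_is_limit_of_chords[OF 2] by blast
      obtain F where F: "\<forall>u. meval F u = f u" using polyfun_imp_meval[OF f] by blast
      obtain P where P: "\<forall>e. poly P e = meval F (mk (\<lambda>i l. poly (c i l) e))"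
        using meval_along_mk_curve by blast
      have "P = 0"
      proof (rule poly_zero_if_zero_off_0)
        fix e :: 'k assume "e \<noteq> 0"
        then obtain w w' where "w \<in> Cone I" "w' \<in> Cone I" "mk (\<lambda>i l. poly (c i l) e) = w + w'"
          using c(2) by blast
        then show "poly P e = 0" using P F chord by simp
      qed
      then show ?thesis using spec[OF P, of 0] c(1) F by simp
    qed
  qed
qed

lemma ideal_of_X: "F \<in> vanishing_ideal (cpts (Cone I)) \<longleftrightarrow> (\<forall>w\<in>Cone I. meval F w = 0)"
proof -
  obtain i where i: "i \<in> I" using neI by blast
  have "\<not> Cone I \<subseteq> {0}" using b_ends_in_Cone(1)[OF i] b_coords[OF i, of 0] by auto
  then show ?thesis using vanishing_ideal_cpts[OF Cone_cone[of I]] by simp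
qed

lemma tangent_space_iff:
  assumes "v \<noteq> 0"
  shows "pt v \<in> tangent_space (cpts (Cone I)) q \<longleftrightarrow>
    (\<forall>F. (\<forall>w\<in>Cone I. meval F w = 0) \<longrightarrow> (\<forall>w\<in>q. w \<noteq> 0 \<longrightarrow> dir_deriv F w v = 0))"
proof -
  let ?T = "{v. \<forall>F\<in>vanishing_ideal (cpts (Cone I)). \<forall>w\<in>q. w \<noteq> 0 \<longrightarrow> dir_deriv F w v = 0}"
  have sub: "vec.subspace ?T"
    by (auto simp: vec.subspace_def linear_form_0[OF linear_form_dir_deriv]
        linear_form_add[OF linear_form_dir_deriv] linear_form_scale[OF linear_form_dir_deriv])
  have "pt v \<in> proj ?T \<longleftrightarrow> v \<in> ?T"
    unfolding proj_eq_cpts[OF sub] by (rule pt_in_cpts_iff[OF cone_subspace[OF sub] assms])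
  then show ?thesis unfolding tangent_space_def by (auto simp: ideal_of_X)
qed

text \<open>
  The square of a linear form annihilates \<open>v\<close> if and only if certain binary quadratic forms have a
  common zero, which is expressed by resultants. In characteristic \<open>2\<close> their middle coefficients
  vanish, but the resultants still decide.
\<close>

lemma Tan_eq: "Tan (cpts (Cone I)) = cpts TanC"
  unfolding Tan_def
proof (rule zclosure_eq_cpts[OF cone_TanC])
  let ?Y = "\<Union>q\<in>cpts (Cone I). tangent_space (cpts (Cone I)) q"
  show "?Y \<subseteq> cpts TanC"
  proof clarify
    fix p q assume q: "q \<in> cpts (Cone I)" and p: "p \<in> tangent_space (cpts (Cone I)) q"
    obtain v where v: "v \<noteq> 0" "p = pt v"
      using p by (auto simp: tangent_space_def proj_def elim: pointsE)
    obtain w where w: "w \<noteq> 0" "w \<in> Cone I" "q = pt w" using q by (auto simp: cpts_def)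
    obtain s t where st: "(s, t) \<noteq> (0, 0)" "w \<in> fibre I s t" using w(2) by (auto simp: Cone_def)
    obtain \<mu> where \<mu>: "w = rn \<mu> s t" using fibre_rn[OF st] by blast
    have "polar_minor \<mu> s t v i l j m = 0" if ij: "i \<in> I" "l < a i" "j \<in> I" "m < a j" for i l j m
    proof -
      have "dir_deriv (minor i l j m) w v = 0"
        using p w minor_vanishes[OF subset_refl _ ij] unfolding v(2) tangent_space_iff[OF v(1)] by simp
      moreover have "meval (minor i l j m) (w + e *s v) = poly [:0, polar_minor \<mu> s t v i l j m, meval (minor i l j m) v:] e" for e
        using minor_on_line[OF ij, of 1 \<mu> s t e v] \<mu> by (simp add: algebra_simps)
      ultimately show ?thesis using dir_deriv_eqI by fastforce
    qed
    then obtain c where "contr s t s t (\<lambda>i. c * \<mu> i) v" using polar_minors_zero w(1) \<mu> by blast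
    then have "v \<in> TanC" using contr_apolar TanCI[OF st(1)] by blast
    then show "p \<in> cpts TanC" using v by (auto simp: cpts_def)
  qed
  show "\<exists>f. polyfun f \<and> f v \<noteq> 0 \<and> (\<forall>w\<in>TanC. f w = 0)" if v: "v \<notin> TanC" for v
  proof -
    let ?N = "{(i, l). i \<in> I \<and> Suc l < a i}"
    let ?p = "\<lambda>(i, l) u. x i l u" and ?q = "\<lambda>(i, l) u. - 2 * x i (Suc l) u" and ?r = "\<lambda>(i, l) u. x i (Suc (Suc l)) u"
    have N: "(\<forall>n\<in>?N. R n) \<longleftrightarrow> (\<forall>i\<in>I. \<forall>l. Suc l < a i \<longrightarrow> R (i, l))" for R by auto
    have ann: "u \<in> TanC \<longleftrightarrow> (\<exists>s t. (s, t) \<noteq> (0, 0) \<and> (\<forall>n\<in>?N. ?p n u * t\<^sup>2 + ?q n u * (s * t) + ?r n u * s\<^sup>2 = 0))" for u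
      unfolding TanC_def apolar_iff N case_prod_conv by (simp add: algebra_simps power2_eq_square)
    have "\<exists>n\<in>?N. ?p n v * t\<^sup>2 + ?q n v * (s * t) + ?r n v * s\<^sup>2 \<noteq> 0" if "(s, t) \<noteq> (0, 0)" for s t
      using v that unfolding ann by blast
    then obtain n1 n2 n3 c where n: "n1 \<in> ?N" "n2 \<in> ?N" "n3 \<in> ?N" and
      d: "resultant2 (?p n1 v) (?q n1 v) (?r n1 v) (?p n2 v + c * ?p n3 v) (?q n2 v + c * ?q n3 v) (?r n2 v + c * ?r n3 v) \<noteq> 0"
      using common_root_or_resultant[of ?N "\<lambda>n. ?p n v" "\<lambda>n. ?q n v" "\<lambda>n. ?r n v"] by blast
    let ?f = "\<lambda>u. resultant2 (?p n1 u) (?q n1 u) (?r n1 u) (?p n2 u + c * ?p n3 u) (?q n2 u + c * ?q n3 u) (?r n2 u + c * ?r n3 u)"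
    have pf: "polyfun (?p n)" "polyfun (?q n)" "polyfun (?r n)" if n: "n \<in> ?N" for n
    proof -
      obtain i l where il: "n = (i, l)" "i \<in> I" "Suc l < a i" using n by auto
      show "polyfun (?p n)" "polyfun (?q n)" "polyfun (?r n)"
        unfolding il(1) case_prod_conv using il(2,3)
        by (intro polyfun.mult polyfun.const polyfun_linear_form x_lin; simp)+
    qed
    have "polyfun ?f"
      unfolding resultant2_def
      by (intro polyfun.add polyfun.mult polyfun_diff polyfun_power polyfun.const pf n)
    moreover have "?f w = 0" if w: "w \<in> TanC" for w
    proof -
      obtain s t where st: "(s, t) \<noteq> (0, 0)" "\<And>n. n \<in> ?N \<Longrightarrow> ?p n w * t\<^sup>2 + ?q n w * (s * t) + ?r n w * s\<^sup>2 = 0"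
        using w unfolding ann by blast
      have "(?p n2 w + c * ?p n3 w) * t\<^sup>2 + (?q n2 w + c * ?q n3 w) * (s * t) + (?r n2 w + c * ?r n3 w) * s\<^sup>2
        = (?p n2 w * t\<^sup>2 + ?q n2 w * (s * t) + ?r n2 w * s\<^sup>2) + c * (?p n3 w * t\<^sup>2 + ?q n3 w * (s * t) + ?r n3 w * s\<^sup>2)"
        by (simp only: distrib_left distrib_right mult.assoc) (simp only: ac_simps)
      then show ?thesis
        using resultant2_common_root[OF st(1) st(2)[OF n(1)]] st(2)[OF n(2)] st(2)[OF n(3)] by simp
    qed
    ultimately show ?thesis using d by blast
  qed
  show "pt v \<in> zclosure ?Y" if v: "v \<in> TanC" "v \<noteq> 0" for v
  proof -
    have "?Y \<subseteq> points" by (auto simp: tangent_space_def proj_def)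
    moreover have "pt v \<in> ?Y"
    proof -
      obtain s t where st: "(s, t) \<noteq> (0, 0)" "apolar s t s t v" using v(1) by (auto simp: TanC_def)
      obtain \<mu> where \<mu>: "contr s t s t \<mu> v" using apolar_contr[OF st] by blast
      obtain w where w: "w \<in> fibre I s t" "w \<noteq> 0"
        "\<And>F c. (\<And>u. u \<in> Cone I \<Longrightarrow> meval F u = 0) \<Longrightarrow> dir_deriv F (c *s w) v = 0"
      proof (cases "rn \<mu> s t = 0")
        case False
        then show thesis
          using that[of "rn \<mu> s t"] rn_in_fibre[of I] dir_deriv_tangent[OF _ st(1) \<mu>] by blast
      next
        case True
        have "\<mu> i * s ^ (a i - 1 - l) * t ^ l = 0" if il: "i \<in> I" "l < a i" for i l
        proof -
          have "s * (\<mu> i * s ^ (a i - 1 - l) * t ^ l) = 0" "t * (\<mu> i * s ^ (a i - 1 - l) * t ^ l) = 0"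
            using x_rn_column[OF il, of \<mu> s t] x_0[of i l] x_0[of i "Suc l"] il unfolding True
            by (simp_all del: mult_eq_0_iff)
          then show ?thesis using st(1) by (simp only: mult_eq_0_iff) blast
        qed
        then have "v \<in> fibre I s t" using \<mu> by (simp add: contr_def fibre_def)
        then show thesis
          using that[of v] v(2) dir_deriv_in_fibre[OF _ st(1)] fibre_subspace[of I s t]
          by (simp add: vec.subspace_scale)
      qed
      have "pt w \<in> cpts (Cone I)" using w fibre_subset_Cone[OF st(1), of I] by (auto simp: cpts_def)
      moreover have "pt v \<in> tangent_space (cpts (Cone I)) (pt w)"
        unfolding tangent_space_iff[OF v(2)] using w(3) by (auto simp: pt_eq)
      ultimately show ?thesis by blast
    qed
    ultimately show ?thesis using zclosure_subset by blast
  qed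
qed

end

section \<open>The strata\<close>

lemma cross_product_multiple:
  fixes g0 g1 g2 h0 h1 h2 :: "'k::field"
  assumes "g0 * x0 + g1 * x1 + g2 * x2 = 0" "h0 * x0 + h1 * x1 + h2 * x2 = 0"
    and n: "n0 = g1 * h2 - g2 * h1" "n1 = g2 * h0 - g0 * h2" "n2 = g0 * h1 - g1 * h0"
    and nz: "(n0, n1, n2) \<noteq> (0, 0, 0)"
  shows "\<exists>\<kappa>. x0 = \<kappa> * n0 \<and> x1 = \<kappa> * n1 \<and> x2 = \<kappa> * n2"
proof -
  have c: "x0 * n1 = x1 * n0" "x1 * n2 = x2 * n1" "x0 * n2 = x2 * n0"
    unfolding n using assms(1,2) by algebra+
  show ?thesis
  proof (cases "n0 = 0")
    case n0: False
    then show ?thesis using c by (intro exI[of _ "x0 / n0"]) (simp add: field_simps)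
  next
    case n0: True
    show ?thesis
    proof (cases "n1 = 0")
      case False
      then show ?thesis using c n0 by (intro exI[of _ "x1 / n1"]) (simp add: field_simps)
    next
      case True
      then show ?thesis using c n0 nz by (intro exI[of _ "x2 / n2"]) (simp add: field_simps)
    qed
  qed
qed

lemma conic_parameter:
  fixes y0 y1 y2 :: "'k::field"
  assumes "y0 * y2 = y1\<^sup>2"
  shows "\<exists>s t. (s, t) \<noteq> (0, 0) \<and> t * y0 = s * y1 \<and> t * y1 = s * y2"
proof (cases "y0 = 0")
  case True
  then show ?thesis using assms by (intro exI[of _ 0] exI[of _ 1]) simp
next
  case False
  then show ?thesis using assms by (intro exI[of _ y0] exI[of _ y1]) (simp add: power2_eq_square)
qed

lemma proportional_rows:
  fixes y0 y1 y2 y3 :: "'k::field"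
  assumes "y0 * y3 = y1 * y2"
  shows "\<exists>s t. (s, t) \<noteq> (0, 0) \<and> t * y0 = s * y2 \<and> t * y1 = s * y3"
proof (cases "y0 = 0")
  case False
  then show ?thesis using assms by (intro exI[of _ y0] exI[of _ y2]) (simp add: mult.commute)
next
  case y0: True
  show ?thesis
  proof (cases "y1 = 0")
    case False
    then show ?thesis using assms y0 by (intro exI[of _ y1] exI[of _ y3]) simp
  next
    case True
    then show ?thesis using y0 by (intro exI[of _ 0] exI[of _ 1]) simp
  qed
qed

context scroll_coords
begin

definition "Ione = {i \<in> I. a i = 1}"
definition "Itwo = {i \<in> I. a i = 2}"
definition "Ige2 = {i \<in> I. 2 \<le> a i}"
definition "Ige3 = {i \<in> I. 3 \<le> a i}"

definition A0 :: "('k ^ 'v) set" where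
  "A0 = {v. \<forall>i\<in>Ige2. \<forall>l\<le>a i. x i l v = 0}"

definition U0 :: "('k ^ 'v) set" where
  "U0 = {v. (\<forall>i\<in>Ige3. \<forall>l\<le>a i. x i l v = 0) \<and> (\<exists>\<beta> w. \<forall>i\<in>Itwo. \<forall>l\<le>2. x i l v = \<beta> i * w l)}"

abbreviation "B0 \<equiv> Cone Ige2"

lemma index_sets: "Ione \<subseteq> I" "Itwo \<subseteq> I" "Ige2 \<subseteq> I" "Ige3 \<subseteq> I"
  by (auto simp: Ione_def Itwo_def Ige2_def Ige3_def)

lemma index_cases:
  assumes "i \<in> I" obtains "i \<in> Ione" "a i = 1" | "i \<in> Ige2" "2 \<le> a i"
  using assms a_pos[OF assms] by (fastforce simp: Ione_def Ige2_def)

lemma Ige2_cases: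
  assumes "i \<in> Ige2" obtains "i \<in> Itwo" "a i = 2" | "i \<in> Ige3" "3 \<le> a i"
  using assms by (fastforce simp: Itwo_def Ige2_def Ige3_def)

lemma A0_subspace: "vec.subspace A0"
  using index_sets by (auto simp: vec.subspace_def A0_def x_simps subset_iff)

lemma A0_subset_B0: "A0 \<subseteq> B0"
proof
  fix v assume "v \<in> A0"
  then have "v \<in> fibre Ige2 1 0" by (auto simp: A0_def fibre_def ctr_def)
  then show "v \<in> B0" using fibre_subset_Cone[of 1 0 Ige2] by auto
qed

lemma A0_subset_U0: "A0 \<subseteq> U0"
proof
  fix v assume v: "v \<in> A0"
  have "\<forall>i\<in>Itwo. \<forall>l\<le>2. x i l v = 0 * (\<lambda>l. 0) l" using v by (auto simp: A0_def Itwo_def Ige2_def)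
  then have "\<exists>\<beta> w. \<forall>i\<in>Itwo. \<forall>l\<le>2. x i l v = \<beta> i * w l"
    by (intro exI[of _ "\<lambda>i. 0"] exI[of _ "\<lambda>l. 0"]) simp
  then show "v \<in> U0" using v by (auto simp: U0_def A0_def Ige3_def Ige2_def)
qed

lemma B0_subset_TanC: "B0 \<subseteq> TanC"
proof
  fix v assume "v \<in> B0"
  then obtain s t where st: "(s, t) \<noteq> (0, 0)" "v \<in> fibre Ige2 s t" by (auto simp: Cone_def)
  have "apolar s t s t v" using st(2) by (auto simp: apolar_def fibre_def Ige2_def)
  then show "v \<in> TanC" by (rule TanCI[OF st(1)])
qed

lemma Cone_subset_B0: "Cone I \<subseteq> B0"
proof
  fix v assume "v \<in> Cone I"
  then obtain s t where st: "(s, t) \<noteq> (0, 0)" "v \<in> fibre I s t" by (auto simp: Cone_def)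
  then have "v \<in> fibre Ige2 s t" using index_sets(3) by (auto simp: fibre_def)
  then show "v \<in> B0" using fibre_subset_Cone[OF st(1), of Ige2] by blast
qed

lemma U0_subset_TanC: "U0 \<subseteq> TanC"
proof
  fix v assume v: "v \<in> U0"
  then obtain \<beta> w where w: "\<And>i l. i \<in> Itwo \<Longrightarrow> l \<le> 2 \<Longrightarrow> x i l v = \<beta> i * w l"
    and z: "\<And>i l. i \<in> Ige3 \<Longrightarrow> l \<le> a i \<Longrightarrow> x i l v = 0" by (auto simp: U0_def)
  obtain s t where st: "(s, t) \<noteq> (0, 0)" "t\<^sup>2 * w 0 - 2 * (s * t * w 1) + s\<^sup>2 * w 2 = 0"
  proof (cases "w 0 = 0")
    case True
    then show thesis using that[of 0 1] by simp
  next
    case False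
    obtain z where "w 0 * z\<^sup>2 + (- 2 * w 1) * z + w 2 = 0" using quadratic_root[OF False] by blast
    then show thesis using that[of 1 z] by (simp add: algebra_simps)
  qed
  have "apolar s t s t v"
    unfolding apolar_iff
  proof (intro ballI allI impI)
    fix i l assume il: "i \<in> I" "Suc l < a i"
    then have "i \<in> Ige2" by (auto simp: Ige2_def)
    then show "t * t * x i l v + - (t * s + s * t) * x i (Suc l) v + s * s * x i (Suc (Suc l)) v = 0"
    proof (cases rule: Ige2_cases)
      case 1
      then have l: "l = 0" using il by simp
      have "t * t * x i l v + - (t * s + s * t) * x i (Suc l) v + s * s * x i (Suc (Suc l)) v
        = \<beta> i * (t\<^sup>2 * w 0 - 2 * (s * t * w 1) + s\<^sup>2 * w 2)"
        unfolding l using w[OF 1(1), of 0] w[OF 1(1), of 1] w[OF 1(1), of 2]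
        by (simp add: algebra_simps power2_eq_square numeral_2_eq_2)
      then show ?thesis using st(2) by simp
    next
      case 2
      then show ?thesis using z il by simp
    qed
  qed
  then show "v \<in> TanC" by (rule TanCI[OF st(1)])
qed

text \<open>
  If two independent quadratic forms \<open>g\<close> and \<open>h\<close> annihilate \<open>v\<close>, then all triples of consecutive
  coordinates of \<open>v\<close> are multiples of \<open>n = g \<times> h\<close>. Either \<open>n\<close> lies on the conic, which puts the
  blocks of degree at least \<open>2\<close> into one fibre, or the blocks of degree at least \<open>3\<close> vanish.
\<close>

lemma two_annihilators:
  assumes g: "\<And>i l. i \<in> I \<Longrightarrow> Suc l < a i \<Longrightarrow> g0 * x i l v + g1 * x i (Suc l) v + g2 * x i (Suc (Suc l)) v = 0"
    and h: "\<And>i l. i \<in> I \<Longrightarrow> Suc l < a i \<Longrightarrow> h0 * x i l v + h1 * x i (Suc l) v + h2 * x i (Suc (Suc l)) v = 0"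
    and indep: "(g1 * h2 - g2 * h1, g2 * h0 - g0 * h2, g0 * h1 - g1 * h0) \<noteq> (0, 0, 0)"
  shows "v \<in> B0 \<union> U0"
proof -
  define n0 n1 n2 where n: "n0 = g1 * h2 - g2 * h1" "n1 = g2 * h0 - g0 * h2" "n2 = g0 * h1 - g1 * h0"
  have nz: "(n0, n1, n2) \<noteq> (0, 0, 0)" using indep n by simp
  have "\<exists>\<kappa>. x i l v = \<kappa> * n0 \<and> x i (Suc l) v = \<kappa> * n1 \<and> x i (Suc (Suc l)) v = \<kappa> * n2"
    if "i \<in> I" "Suc l < a i" for i l
    by (rule cross_product_multiple[OF g[OF that] h[OF that] n nz])
  then obtain \<kappa> where \<kappa>: "\<And>i l. i \<in> I \<Longrightarrow> Suc l < a i \<Longrightarrow>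
      x i l v = \<kappa> i l * n0 \<and> x i (Suc l) v = \<kappa> i l * n1 \<and> x i (Suc (Suc l)) v = \<kappa> i l * n2" by metis
  show ?thesis
  proof (cases "n0 * n2 = n1\<^sup>2")
    case True
    then obtain s t where st: "(s, t) \<noteq> (0, 0)" "t * n0 = s * n1" "t * n1 = s * n2"
      using conic_parameter by blast
    have "v \<in> fibre Ige2 s t"
      unfolding fibre_def
    proof (intro CollectI ballI allI impI)
      fix i l assume il: "i \<in> Ige2" "l < a i"
      then have i: "i \<in> I" "2 \<le> a i" by (auto simp: Ige2_def)
      have e: "t * (k * n0) = s * (k * n1)" "t * (k * n1) = s * (k * n2)" for k
        using st(2,3) by (simp_all add: mult.left_commute)
      show "ctr s t v i l = 0"
      proof (cases "Suc l < a i")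
        case True
        then show ?thesis using \<kappa>[OF i(1) True] e by (simp add: ctr_def)
      next
        case False
        then have "l = Suc (l - 1)" "Suc (l - 1) < a i" using il i by simp_all
        then show ?thesis using \<kappa>[OF i(1), of "l - 1"] e by (simp add: ctr_def)
      qed
    qed
    then show ?thesis using fibre_subset_Cone[OF st(1), of Ige2] by blast
  next
    case False
    have "x i l v = 0" if il: "i \<in> Ige3" "l \<le> a i" for i l
    proof -
      have i: "i \<in> I" "3 \<le> a i" using il(1) by (auto simp: Ige3_def)
      have k0: "\<kappa> i l = 0 \<and> \<kappa> i (Suc l) = 0" if l: "Suc (Suc l) < a i" for l
      proof -
        have e: "\<kappa> i l * n1 = \<kappa> i (Suc l) * n0" "\<kappa> i l * n2 = \<kappa> i (Suc l) * n1"
          using \<kappa>[OF i(1), of l] \<kappa>[OF i(1), of "Suc l"] l by simp_all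
        have "\<kappa> i l * (n0 * n2 - n1\<^sup>2) = 0" "\<kappa> i (Suc l) * (n0 * n2 - n1\<^sup>2) = 0"
          unfolding power2_eq_square using e by algebra+
        then show ?thesis using False by simp
      qed
      consider "l = 0" | "l = 1" | "l = 2" | "3 \<le> l" by linarith
      then show ?thesis
      proof cases
        case 1
        then show ?thesis using \<kappa>[OF i(1), of 0] k0[of 0] i by simp
      next
        case 2
        then show ?thesis using \<kappa>[OF i(1), of 0] k0[of 0] i by simp
      next
        case 3
        then show ?thesis using \<kappa>[OF i(1), of 0] k0[of 0] i by (simp add: numeral_2_eq_2)
      next
        case 4
        then obtain m where m: "l = Suc (Suc (Suc m))" using le_Suc_ex[OF 4] by (auto simp: numeral_3_eq_3)
        then show ?thesis using \<kappa>[OF i(1), of "Suc m"] k0[of m] il(2) by simp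
      qed
    qed
    moreover have "\<exists>\<beta> w. \<forall>i\<in>Itwo. \<forall>l\<le>2. x i l v = \<beta> i * w l"
    proof (intro exI ballI allI impI)
      fix i l :: nat assume il: "i \<in> Itwo" "l \<le> 2"
      then have i: "i \<in> I" "Suc 0 < a i" by (auto simp: Itwo_def)
      consider "l = 0" | "l = 1" | "l = 2" using il(2) by linarith
      then show "x i l v = (\<lambda>i. \<kappa> i 0) i * (\<lambda>l. if l = 0 then n0 else if l = 1 then n1 else n2) l"
        using \<kappa>[OF i] by cases (simp_all add: numeral_2_eq_2)
    qed
    ultimately show ?thesis by (simp add: U0_def)
  qed
qed

text \<open>These formulas compute the secant point from \<open>v\<close> and the two base points alone.\<close>

lemma secant_point_coords:
  assumes "contr s t s' t' \<mu> v" "i \<in> I" "l < a i"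
  shows "x i l (rn \<mu> s t) = s * ctr s' t' v i l" "x i (Suc l) (rn \<mu> s t) = t * ctr s' t' v i l"
  using assms x_rn_column[OF assms(2,3), of \<mu> s t] by (simp_all add: contr_def)

lemma secant_point_eqI:
  assumes c: "contr s t s' t' \<mu> v"
    and 0: "\<And>i. i \<in> I \<Longrightarrow> x i 0 w = s * ctr s' t' v i 0"
    and S: "\<And>i l. i \<in> I \<Longrightarrow> l < a i \<Longrightarrow> x i (Suc l) w = t * ctr s' t' v i l"
  shows "rn \<mu> s t = w"
proof (rule vec_eqI)
  fix i l assume il: "i \<in> I" "l \<le> a i"
  show "x i l (rn \<mu> s t) = x i l w"
  proof (cases l)
    case 0
    then show ?thesis using assms(2)[OF il(1)] secant_point_coords(1)[OF c il(1), of 0] a_pos[OF il(1)] by simp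
  next
    case (Suc m)
    then show ?thesis using S[OF il(1), of m] secant_point_coords(2)[OF c il(1), of m] il by simp
  qed
qed

lemma secant_point_zero:
  assumes "contr s t s' t' \<mu> v" "rn \<mu> s t = 0" "(s, t) \<noteq> (0, 0)"
  shows "v \<in> fibre I s' t'"
  unfolding fibre_def
proof (intro CollectI ballI allI impI)
  fix i l assume il: "i \<in> I" "l < a i"
  then show "ctr s' t' v i l = 0"
    using secant_point_coords[OF assms(1) il] assms(2,3) x_0[of i l] x_0[of i "Suc l"] by auto
qed

text \<open>
  By \<open>secant_point_conjugate\<close> the secant points are to be found among the \<open>rn \<mu> s t\<close>.
\<close>

lemma linear_secant_coneI:
  assumes v: "v \<notin> Cone I" "v = lincomb r e cv" and r: "r \<ge> 2"
    and ind: "\<And>c. lincomb r e c = 0 \<Longrightarrow> \<forall>i<r. c i = 0"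
    and W: "\<And>s t s' t' \<mu>. (s, t) \<noteq> (0, 0) \<Longrightarrow> (s', t') \<noteq> (0, 0) \<Longrightarrow> contr s t s' t' \<mu> v \<Longrightarrow>
      apolar s t s' t' v \<Longrightarrow> \<exists>c. rn \<mu> s t = lincomb r e c"
  shows "linear_secant_cone r e (Cone I) v"
proof -
  interpret subspace_basis r e by unfold_locales (rule ind)
  show ?thesis
  proof unfold_locales
    show "v \<in> W" unfolding v(2) by (rule lincomb_W)
    show "secant_points (cpts (Cone I)) (pt v) \<subseteq> cpts W"
    proof
      fix q assume "q \<in> secant_points (cpts (Cone I)) (pt v)"
      then obtain s t s' t' \<mu> where q: "(s, t) \<noteq> (0, 0)" "(s', t') \<noteq> (0, 0)" "contr s t s' t' \<mu> v"
         "q = pt (rn \<mu> s t)" "rn \<mu> s t \<noteq> 0" using secant_point_conjugate[OF v(1)] by metis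
      obtain c where "rn \<mu> s t = lincomb r e c" using W[OF q(1-3) contr_apolar[OF q(3)]] by blast
      then have "rn \<mu> s t \<in> W" by (simp add: lincomb_W)
      then show "q \<in> cpts W" using q(4,5) by (auto simp: cpts_def)
    qed
  qed (use v r in \<open>simp_all add: Cone_cone Cone_quadrics\<close>)
qed

lemma x_lincomb:
  assumes "i \<in> I" "l \<le> a i"
  shows "x i l (lincomb r e c) = (\<Sum>k<r. c k * x i l (e k))"
  by (simp add: lincomb_def linear_form_sum[OF x_lin[OF assms]] linear_form_scale[OF x_lin[OF assms]])

lemma ctr_scale_point: "ctr (c * s) (c * t) v i l = c * ctr s t v i l"
  by (simp add: ctr_def algebra_simps)

lemma fibre_scale_point: "c \<noteq> 0 \<Longrightarrow> fibre J (c * s) (c * t) = fibre J s t"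
  by (simp add: fibre_def ctr_scale_point)

lemma fibres_disjoint:
  assumes \<delta>: "t' * s - s' * t \<noteq> 0" and z: "z \<in> fibre I s t" "z \<in> fibre I s' t'"
  shows "z = 0"
proof (rule vec_eqI)
  have e: "x i l z = 0 \<and> x i (Suc l) z = 0" if "i \<in> I" "l < a i" for i l
  proof -
    have "t * x i l z = s * x i (Suc l) z" "t' * x i l z = s' * x i (Suc l) z"
      using z that by (auto simp: fibre_def ctr_def)
    then have "(t' * s - s' * t) * x i l z = 0" "(t' * s - s' * t) * x i (Suc l) z = 0" by algebra+
    then show ?thesis using \<delta> by simp
  qed
  fix i l assume il: "i \<in> I" "l \<le> a i"
  show "x i l z = x i l 0"
  proof (cases l)
    case 0
    then show ?thesis using e[OF il(1), of 0] a_pos[OF il(1)] il by (simp add: x_0)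
  next
    case (Suc m)
    then show ?thesis using e[OF il(1), of m] il by (simp add: x_0)
  qed
qed

text \<open>Outside \<open>B\<close> and \<open>U\<close> the annihilating quadratic form, if any, is unique.\<close>

lemma unique_annihilator:
  assumes v: "v \<notin> B0 \<union> U0" and 1: "apolar s t s' t' v" and 2: "apolar s1 t1 s1' t1' v"
    and n: "(s1, t1) \<noteq> (0, 0)" "(s1', t1') \<noteq> (0, 0)"
  shows "(t * s1 - s * t1) * (t' * s1 - s' * t1) = 0"
proof -
  let ?g0 = "t * t'" and ?g1 = "- (t * s' + s * t')" and ?g2 = "s * s'"
  let ?h0 = "t1 * t1'" and ?h1 = "- (t1 * s1' + s1 * t1')" and ?h2 = "s1 * s1'"
  have "(?g1 * ?h2 - ?g2 * ?h1, ?g2 * ?h0 - ?g0 * ?h2, ?g0 * ?h1 - ?g1 * ?h0) = (0, 0, 0)"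
    using two_annihilators[of ?g0 v ?g1 ?g2 ?h0 ?h1 ?h2] 1 2 v unfolding apolar_iff by blast
  then have c: "?g1 * ?h2 = ?g2 * ?h1" "?g2 * ?h0 = ?g0 * ?h2" "?g0 * ?h1 = ?g1 * ?h0" by simp_all
  let ?G = "(t * s1 - s * t1) * (t' * s1 - s' * t1)"
  have G: "?G = ?g0 * s1\<^sup>2 + ?g1 * (s1 * t1) + ?g2 * t1\<^sup>2"
    by (simp add: algebra_simps power2_eq_square)
  have H: "?h0 * s1\<^sup>2 + ?h1 * (s1 * t1) + ?h2 * t1\<^sup>2 = 0"
    by (simp add: algebra_simps power2_eq_square)
  have "?h0 * ?G = 0" "?h1 * ?G = 0" "?h2 * ?G = 0"
    unfolding G using c H by algebra+
  moreover have "(?h0, ?h1, ?h2) \<noteq> (0, 0, 0)" using n by auto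
  ultimately show ?thesis by auto
qed

lemma stratum_empty:
  assumes v: "v \<notin> SecC" "v \<noteq> 0"
  shows "pt v \<in> SL_empty (cpts (Cone I))" "support_is_zero_locus (secant_locus (cpts (Cone I)) (pt v))"
proof -
  have vC: "v \<notin> Cone I" using v Cone_subset_B0 B0_subset_TanC TanC_SecC by blast
  then obtain Q where Q: "homogeneous 2 Q" "\<forall>w\<in>Cone I. meval Q w = 0" "meval Q v \<noteq> 0"
    using Cone_quadrics[OF subset_refl] unfolding cut_out_by_quadrics_def by blast
  have "secant_points (cpts (Cone I)) (pt v) = {}"
  proof (rule ccontr)
    assume "secant_points (cpts (Cone I)) (pt v) \<noteq> {}"
    then obtain s t s' t' \<mu> where "(s, t) \<noteq> (0, 0)" "(s', t') \<noteq> (0, 0)" "contr s t s' t' \<mu> v"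
      using secant_point_conjugate[OF vC] by blast
    then show False using v(1) contr_apolar SecCI by blast
  qed
  then show "pt v \<in> SL_empty (cpts (Cone I))" "support_is_zero_locus (secant_locus (cpts (Cone I)) (pt v))"
    using no_secants[OF Cone_cone[OF subset_refl] vC v(2) Q(1) _ Q(3)] Q(2) by blast+
qed

text \<open>
  Write \<open>v = w + w'\<close> with \<open>w\<close>, \<open>w'\<close> over the two zeros of the annihilating form. By its uniqueness every
  secant through \<open>p\<close> decomposes \<open>v\<close> over the same two fibres, which meet only in \<open>0\<close>.
\<close>

lemma stratum_two_points:
  assumes v: "v \<in> SecC" "v \<notin> TanC"
  shows "pt v \<in> SL_two_points (cpts (Cone I))" "support_is_zero_locus (secant_locus (cpts (Cone I)) (pt v))"
proof -
  have vC: "v \<notin> Cone I" using v Cone_subset_B0 B0_subset_TanC by blast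
  obtain w w' where w: "w \<in> Cone I" "w' \<in> Cone I" "v = w + w'"
    using v(1)
  proof (cases rule: SecC_cases)
    case (2 s t \<mu>)
    then show thesis using v(2) TanCI contr_apolar by blast
  qed
  obtain s t where st: "(s, t) \<noteq> (0, 0)" "w \<in> fibre I s t" using w(1) by (auto simp: Cone_def)
  obtain s' t' where st': "(s', t') \<noteq> (0, 0)" "w' \<in> fibre I s' t'" using w(2) by (auto simp: Cone_def)
  have g: "apolar s t s' t' v" unfolding w(3) by (intro apolar_add fibre_apolar st st')
  have nB: "v \<notin> B0 \<union> U0" using v(2) B0_subset_TanC U0_subset_TanC by blast
  have \<delta>: "t' * s - s' * t \<noteq> 0"
  proof
    assume "t' * s - s' * t = 0"
    then obtain c where "c \<noteq> 0" "s' = c * s" "t' = c * t" by (rule proportional[OF st(1) st'(1)])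
    then have "w' \<in> fibre I s t" using st'(2) fibre_scale_point by simp
    then have "v \<in> fibre I s t" using st(2) w(3) by (simp add: vec.subspace_add fibre_subspace)
    then show False using vC fibre_subset_Cone[OF st(1), of I] by blast
  qed
  let ?e = "\<lambda>k::nat. if k = 0 then w else w'"
  have lc: "lincomb 2 ?e c = c 0 *s w + c 1 *s w'" for c by (simp add: lincomb_def numeral_2_eq_2)
  interpret linear_secant_cone 2 ?e "Cone I" v
  proof (rule linear_secant_coneI[OF vC])
    show "v = lincomb 2 ?e (\<lambda>k. 1)" by (simp add: lc w(3))
    fix c assume l0: "lincomb 2 ?e c = 0"
    have f: "c 0 *s w \<in> fibre I s t" "c 1 *s w' \<in> fibre I s' t'"
      using st st' by (simp_all add: vec.subspace_scale fibre_subspace)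
    have "c 0 *s w = (- 1) *s (c 1 *s w')" using l0 by (simp add: lc eq_neg_iff_add_eq_0)
    then have "c 0 *s w \<in> fibre I s' t'" using vec.subspace_scale[OF fibre_subspace[of I s' t'] f(2), of "- 1"] by simp
    then have "c 0 *s w = 0" using fibres_disjoint[OF \<delta> f(1)] by blast
    moreover have "c 1 *s w' = 0" using l0 calculation by (simp add: lc)
    moreover have "w \<noteq> 0" "w' \<noteq> 0" using w vC by auto
    ultimately show "\<forall>i<2. c i = 0" by (auto simp: less_2_cases_iff)
  next
    fix s1 t1 s1' t1' \<mu> assume 1: "(s1, t1) \<noteq> (0, 0)" "(s1', t1') \<noteq> (0, 0)" "contr s1 t1 s1' t1' \<mu> v" "apolar s1 t1 s1' t1' v"
    have \<delta>1: "t1' * s1 - s1' * t1 \<noteq> 0"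
    proof
      assume "t1' * s1 - s1' * t1 = 0"
      then obtain c where c: "c \<noteq> 0" "s1' = c * s1" "t1' = c * t1" by (rule proportional[OF 1(1,2)])
      then have "apolar s1 t1 s1 t1 v" using 1(4) apolar_scale_point by simp
      then show False using v(2) TanCI[OF 1(1)] by blast
    qed
    let ?w = "inverse (t1' * s1 - s1' * t1) *s rn \<mu> s1 t1"
    have w1: "?w \<in> fibre I s1 t1" using rn_in_fibre[of I \<mu> s1 t1] by (simp add: vec.subspace_scale fibre_subspace)
    have w1': "v - ?w \<in> fibre I s1' t1'" by (rule chord_decomposition[OF \<delta>1 1(3)])
    have r1: "(t * s1 - s * t1) * (t' * s1 - s' * t1) = 0"
      by (rule unique_annihilator[OF nB g 1(4,1,2)])
    have r2: "(t * s1' - s * t1') * (t' * s1' - s' * t1') = 0"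
      by (rule unique_annihilator[OF nB g _ 1(2,1)]) (use 1(4) apolar_sym in blast)
    have par: "fibre I p q = fibre I s t" if pq: "t * p - s * q = 0" "(p, q) \<noteq> (0, 0)" for p q
    proof -
      have "q * s - p * t = 0" using pq(1) by (simp add: algebra_simps)
      then obtain c where "c \<noteq> 0" "p = c * s" "q = c * t" by (rule proportional[OF st(1) pq(2)])
      then show ?thesis using fibre_scale_point by simp
    qed
    have par': "fibre I p q = fibre I s' t'" if pq: "t' * p - s' * q = 0" "(p, q) \<noteq> (0, 0)" for p q
    proof -
      have "q * s' - p * t' = 0" using pq(1) by (simp add: algebra_simps)
      then obtain c where "c \<noteq> 0" "p = c * s'" "q = c * t'" by (rule proportional[OF st'(1) pq(2)])
      then show ?thesis using fibre_scale_point by simp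
    qed
    have opposite: "fibre I s1 t1 \<noteq> fibre I s1' t1'"
    proof
      assume "fibre I s1 t1 = fibre I s1' t1'"
      then have "?w + (v - ?w) \<in> fibre I s1 t1" using w1 w1' by (intro vec.subspace_add fibre_subspace) auto
      then show False using vC fibre_subset_Cone[OF 1(1), of I] by auto
    qed
    have "?w = w \<or> ?w = w'"
    proof (cases "t * s1 - s * t1 = 0")
      case True
      then have f: "fibre I s1 t1 = fibre I s t" using par 1(1) by blast
      then have f': "fibre I s1' t1' = fibre I s' t'" using r2 par par' 1(2) opposite by auto
      have "w - ?w \<in> fibre I s t" using st(2) w1 f by (simp add: vec.subspace_diff fibre_subspace)
      moreover have "w - ?w = (v - ?w) - w'" using w(3) by simp
      then have "w - ?w \<in> fibre I s' t'" using st'(2) w1' f' by (simp only: vec.subspace_diff[OF fibre_subspace[OF subset_refl]])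
      ultimately show ?thesis using fibres_disjoint[OF \<delta>] by fastforce
    next
      case False
      then have f: "fibre I s1 t1 = fibre I s' t'" using r1 par' 1(1) by auto
      then have f': "fibre I s1' t1' = fibre I s t" using r2 par par' 1(2) opposite by auto
      have "w' - ?w \<in> fibre I s' t'" using st'(2) w1 f by (simp add: vec.subspace_diff fibre_subspace)
      moreover have "w' - ?w = (v - ?w) - w" using w(3) by simp
      then have "w' - ?w \<in> fibre I s t" using st(2) w1' f' by (simp only: vec.subspace_diff[OF fibre_subspace[OF subset_refl]])
      ultimately show ?thesis using fibres_disjoint[OF \<delta>] by fastforce
    qed
    moreover have "rn \<mu> s1 t1 = (t1' * s1 - s1' * t1) *s ?w" using \<delta>1 by simp
    ultimately have "rn \<mu> s1 t1 = lincomb 2 ?e (\<lambda>k. if k = 0 then t1' * s1 - s1' * t1 else 0)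
        \<or> rn \<mu> s1 t1 = lincomb 2 ?e (\<lambda>k. if k = 0 then 0 else t1' * s1 - s1' * t1)"
      unfolding lc by auto
    then show "\<exists>c. rn \<mu> s1 t1 = lincomb 2 ?e c" by blast
  qed simp
  show "pt v \<in> SL_two_points (cpts (Cone I))" "support_is_zero_locus (secant_locus (cpts (Cone I)) (pt v))"
    by (rule two_points_section; use w in simp)+
qed

text \<open>
  The annihilating form is the square of the linear form vanishing at \<open>(s : t)\<close>, and is unique. Thus
  every secant through \<open>p\<close> is a tangent over \<open>(s : t)\<close>, and the contraction of \<open>v\<close> determines the point
  of tangency.
\<close>

lemma stratum_double_point:
  assumes v: "v \<in> TanC" "v \<notin> B0 \<union> U0"
  shows "pt v \<in> SL_double_point (cpts (Cone I))" "support_is_zero_locus (secant_locus (cpts (Cone I)) (pt v))"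
proof -
  have vC: "v \<notin> Cone I" using v Cone_subset_B0 by blast
  obtain s t where st: "(s, t) \<noteq> (0, 0)" "apolar s t s t v" using v(1) by (auto simp: TanC_def)
  obtain \<mu> where \<mu>: "contr s t s t \<mu> v" using apolar_contr[OF st] by blast
  let ?q = "rn \<mu> s t"
  have q: "?q \<in> Cone I" using rn_in_fibre[of I] fibre_subset_Cone[OF st(1), of I] by blast
  have q0: "?q \<noteq> 0" using secant_point_zero[OF \<mu> _ st(1)] vC fibre_subset_Cone[OF st(1), of I] by blast
  let ?e = "\<lambda>k::nat. if k = 0 then ?q else v"
  have lc: "lincomb 2 ?e c = c 0 *s ?q + c 1 *s v" for c by (simp add: lincomb_def numeral_2_eq_2)
  interpret linear_secant_cone 2 ?e "Cone I" v
  proof (rule linear_secant_coneI[OF vC])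
    show "v = lincomb 2 ?e (\<lambda>k. if k = 0 then 0 else 1)" by (simp add: lc)
    fix c assume l0: "lincomb 2 ?e c = 0"
    have "c 1 = 0"
    proof (rule ccontr)
      assume c1: "c 1 \<noteq> 0"
      have "c 1 *s v = (- c 0) *s ?q" using l0 by (simp add: lc add_eq_0_iff2)
      then have "inverse (c 1) *s (c 1 *s v) = inverse (c 1) *s ((- c 0) *s ?q)" by simp
      then have "v = (inverse (c 1) * (- c 0)) *s ?q" using c1 by (simp del: mult_minus_right)
      then show False using coneD[OF Cone_cone[OF subset_refl] q] vC by metis
    qed
    then show "\<forall>i<2. c i = 0" using l0 q0 by (auto simp: lc less_2_cases_iff)
  next
    fix s1 t1 s1' t1' \<mu>1 assume 1: "(s1, t1) \<noteq> (0, 0)" "(s1', t1') \<noteq> (0, 0)" "contr s1 t1 s1' t1' \<mu>1 v" "apolar s1 t1 s1' t1' v"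
    have "t * s1 - s * t1 = 0" using unique_annihilator[OF v(2) st(2) 1(4,1,2)] by simp
    then have "t1 * s - s1 * t = 0" by (simp add: algebra_simps)
    then obtain c where c: "c \<noteq> 0" "s1 = c * s" "t1 = c * t" by (rule proportional[OF st(1) 1(1)])
    have "t * s1' - s * t1' = 0"
      using unique_annihilator[OF v(2) st(2) _ 1(2,1)] 1(4) apolar_sym by auto
    then have "t1' * s - s1' * t = 0" by (simp add: algebra_simps)
    then obtain c' where c': "c' \<noteq> 0" "s1' = c' * s" "t1' = c' * t" by (rule proportional[OF st(1) 1(2)])
    have "rn \<mu>1 s1 t1 = (c * c') *s ?q"
    proof (rule secant_point_eqI[OF 1(3)])
      fix i assume i: "i \<in> I"
      then show "x i 0 ((c * c') *s ?q) = s1 * ctr s1' t1' v i 0"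
        using secant_point_coords(1)[OF \<mu> i, of 0] a_pos[OF i] by (simp add: x_scale c c' ctr_scale_point)
    next
      fix i l assume il: "i \<in> I" "l < a i"
      then show "x i (Suc l) ((c * c') *s ?q) = t1 * ctr s1' t1' v i l"
        using secant_point_coords(2)[OF \<mu> il] by (simp add: x_scale c c' ctr_scale_point)
    qed
    then have "rn \<mu>1 s1 t1 = lincomb 2 ?e (\<lambda>k. if k = 0 then c * c' else 0)" by (simp add: lc)
    then show "\<exists>c. rn \<mu>1 s1 t1 = lincomb 2 ?e c" by blast
  qed simp
  show "pt v \<in> SL_double_point (cpts (Cone I))" "support_is_zero_locus (secant_locus (cpts (Cone I)) (pt v))"
    by (rule double_point_section; use q dir_deriv_tangent[OF _ st(1) \<mu>] in simp)+
qed

text \<open>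
  Over \<open>B\<close> the blocks of degree at least \<open>2\<close> lie over one point \<open>(s : t)\<close>, and the conjugate of a
  base point \<open>(s1 : t1)\<close> different from it is \<open>(s : t)\<close>. The lines are \<open>{\<delta> \<otimes> z}\<close> with
  \<open>\<delta> i = ctr s t v i 0\<close> for the blocks of degree \<open>1\<close>, and a line over \<open>(s : t)\<close>.
\<close>

lemma stratum_line_pair:
  assumes v: "v \<in> B0" "v \<notin> A0" "v \<notin> Cone I"
  shows "pt v \<in> SL_line_pair (cpts (Cone I))" "support_is_zero_locus (secant_locus (cpts (Cone I)) (pt v))"
proof -
  obtain s t where st: "(s, t) \<noteq> (0, 0)" "v \<in> fibre Ige2 s t" using v(1) by (auto simp: Cone_def)
  let ?\<delta> = "\<lambda>i. ctr s t v i 0"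
  let ?e = "\<lambda>k::nat. if k = 0 then v else mk (\<lambda>i l. if i \<in> Ione \<and> Suc l = k then ?\<delta> i else 0)"
  have xe: "x i l (lincomb 3 ?e c) = c 0 * x i l v + (if i \<in> Ione then c (Suc l) * ?\<delta> i else 0)"
    if "i \<in> I" "l \<le> a i" for i l c
  proof (cases "i \<in> Ione")
    case True
    then have "l = 0 \<or> l = 1" using that by (auto simp: Ione_def)
    then show ?thesis using that True by (auto simp: x_lincomb x_mk numeral_3_eq_3)
  next
    case False
    then show ?thesis using that by (simp add: x_lincomb x_mk numeral_3_eq_3)
  qed
  have blocks: "i \<in> Ige2 \<longleftrightarrow> i \<notin> Ione" if "i \<in> I" for i
    using that a_pos[OF that] by (auto simp: Ige2_def Ione_def)
  have v2: "ctr s t v i l = 0" if "i \<in> I" "i \<notin> Ione" "l < a i" for i l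
    using st(2) that blocks by (auto simp: fibre_def)
  obtain i0 where i0: "i0 \<in> Ione" "?\<delta> i0 \<noteq> 0"
  proof (rule ccontr)
    assume n: "\<not> thesis"
    have "v \<in> fibre I s t"
      unfolding fibre_def
    proof (intro CollectI ballI allI impI)
      fix i l assume il: "i \<in> I" "l < a i"
      show "ctr s t v i l = 0"
      proof (cases "i \<in> Ione")
        case True
        then show ?thesis using il n that by (auto simp: Ione_def)
      qed (use v2 il in blast)
    qed
    then show False using v(3) fibre_subset_Cone[OF st(1), of I] by blast
  qed
  then have i0I: "i0 \<in> I" "a i0 = 1" by (auto simp: Ione_def)
  obtain j0 l0 where j0: "j0 \<in> I" "j0 \<notin> Ione" "l0 \<le> a j0" "x j0 l0 v \<noteq> 0"
    using v(2) by (auto simp: A0_def Ige2_def Ione_def)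
  interpret linear_secant_cone 3 ?e "Cone I" v
  proof (rule linear_secant_coneI[OF v(3)])
    show "v = lincomb 3 ?e (\<lambda>k. if k = 0 then 1 else 0)" by (rule vec_eqI) (simp add: xe)
    fix c assume l0: "lincomb 3 ?e c = 0"
    have "c 0 * x j0 l0 v = 0" using xe[OF j0(1,3), of c] j0(2) l0 x_0[OF j0(1,3)] by simp
    then have c0: "c 0 = 0" using j0(4) by simp
    have "c 1 * ?\<delta> i0 = 0" "c 2 * ?\<delta> i0 = 0"
      using xe[OF i0I(1), of 0 c] xe[OF i0I(1), of 1 c] i0(1) i0I l0 c0 x_0[OF i0I(1), of 0] x_0[OF i0I(1), of 1]
      by (simp_all add: numeral_2_eq_2)
    then show "\<forall>i<3. c i = 0" using c0 i0(2) by (auto simp: less_Suc_eq numeral_3_eq_3 numeral_2_eq_2)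
  next
    fix s1 t1 s1' t1' \<mu> assume 1: "(s1, t1) \<noteq> (0, 0)" "(s1', t1') \<noteq> (0, 0)" "contr s1 t1 s1' t1' \<mu> v" "apolar s1 t1 s1' t1' v"
    have "\<exists>\<kappa>. \<forall>l\<le>a j0. x j0 l v = \<kappa> * s ^ (a j0 - l) * t ^ l"
      by (rule fibre_block[OF st(1)]) (use v2 j0 in blast)
    then obtain \<kappa> where \<kappa>: "\<And>l. l \<le> a j0 \<Longrightarrow> x j0 l v = \<kappa> * s ^ (a j0 - l) * t ^ l" by blast
    have \<kappa>0: "\<kappa> \<noteq> 0" using \<kappa>[OF j0(3)] j0(4) by auto
    have j2: "2 \<le> a j0" using j0 blocks by (auto simp: Ige2_def)
    have prod: "(t1 * s - s1 * t) * (t1' * s - s1' * t) * (\<kappa> * s ^ (a j0 - Suc (Suc l)) * t ^ l) = 0"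
      if l: "Suc l < a j0" for l
    proof -
      have d: "a j0 - l = Suc (Suc (a j0 - Suc (Suc l)))" "a j0 - Suc l = Suc (a j0 - Suc (Suc l))" using l by simp_all
      have "t1 * t1' * x j0 l v + - (t1 * s1' + s1 * t1') * x j0 (Suc l) v + s1 * s1' * x j0 (Suc (Suc l)) v = 0"
        using 1(4) j0(1) l unfolding apolar_iff by blast
      then show ?thesis using \<kappa>[of l] \<kappa>[of "Suc l"] \<kappa>[of "Suc (Suc l)"] l unfolding d by (simp add: algebra_simps)
    qed
    have "(t1 * s - s1 * t) * (t1' * s - s1' * t) = 0"
    proof (cases "s = 0")
      case True
      then show ?thesis using prod[of "a j0 - 2"] j2 \<kappa>0 st(1) by (simp add: numeral_2_eq_2 Suc_diff_Suc)
    next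
      case False
      then show ?thesis using prod[of 0] j2 \<kappa>0 by simp
    qed
    then consider "t1 * s - s1 * t = 0" | "t1' * s - s1' * t = 0" by auto
    then show "\<exists>c. rn \<mu> s1 t1 = lincomb 3 ?e c"
    proof cases
      case 2
      then obtain c where c: "c \<noteq> 0" "s1' = c * s" "t1' = c * t" by (rule proportional[OF st(1) 1(2)])
      have "rn \<mu> s1 t1 = lincomb 3 ?e (\<lambda>k. if k = 0 then 0 else if k = 1 then c * s1 else c * t1)"
      proof (rule secant_point_eqI[OF 1(3)], goal_cases)
        case (1 i)
        then show ?case using v2[of i 0] a_pos[of i] by (auto simp: xe c ctr_scale_point)
      next
        case (2 i l)
        then show ?case using v2[of i l] by (auto simp: xe c ctr_scale_point Ione_def)
      qed
      then show ?thesis by blast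
    next
      case 1
      then obtain c where c: "c \<noteq> 0" "s1 = c * s" "t1 = c * t" by (rule proportional[OF st(1) \<open>(s1, t1) \<noteq> (0, 0)\<close>])
      let ?\<rho> = "t1' * s - s1' * t"
      \<comment> \<open>The identity \<open>[v, u'] u = [u, u'] v + [v, u] u'\<close> for vectors in the plane, with determinants \<open>[_, _]\<close>.\<close>
      have "rn \<mu> s1 t1 = lincomb 3 ?e (\<lambda>k. if k = 0 then c * ?\<rho> else if k = 1 then c * s1' else c * t1')"
      proof (rule secant_point_eqI[OF \<open>contr s1 t1 s1' t1' \<mu> v\<close>], goal_cases)
        case (1 i)
        then show ?case using v2[of i 0] a_pos[of i] by (auto simp: xe c) (simp_all add: ctr_def algebra_simps)
      next
        case (2 i l)
        show ?case
        proof (cases "i \<in> Ione")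
          case True
          then have "l = 0" using 2 by (simp add: Ione_def)
          then show ?thesis using 2 True by (simp add: xe c) (simp add: ctr_def algebra_simps)
        next
          case False
          have "t * x i l v = s * x i (Suc l) v" using v2[OF 2(1) False 2(2)] by (simp add: ctr_def)
          then have "c * (t1' * (t * x i l v)) = c * (t1' * (s * x i (Suc l) v))" by simp
          then show ?thesis using 2 False by (simp add: xe c) (auto simp: ctr_def algebra_simps)
        qed
      qed
      then show ?thesis by blast
    qed
  qed simp
  have zeros: "lincomb 3 ?e c \<in> Cone I" if c: "c 0 * (c 0 + t * c 1 + (- s) * c 2) = 0" for c
  proof (cases "c 0 = 0")
    case True
    show ?thesis
    proof (cases "(c 1, c 2) = (0, 0)")
      case c12: True
      have "lincomb 3 ?e c = 0"
        by (rule vec_eqI) (use True c12 in \<open>auto simp: xe x_0 Ione_def le_Suc_eq numeral_2_eq_2\<close>)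
      then show ?thesis using zero_in_Cone by simp
    next
      case False
      have "lincomb 3 ?e c \<in> fibre I (c 1) (c 2)"
        unfolding fibre_def
      proof (intro CollectI ballI allI impI)
        fix i l assume il: "i \<in> I" "l < a i"
        show "ctr (c 1) (c 2) (lincomb 3 ?e c) i l = 0"
          using il True by (auto simp: ctr_def xe Ione_def numeral_2_eq_2)
      qed
      then show ?thesis using fibre_subset_Cone[OF False, of I] by blast
    qed
  next
    case False
    then have "c 0 + t * c 1 + (- s) * c 2 = 0" using c by (metis mult_eq_0_iff)
    then have c0: "c 0 = s * c 2 - t * c 1" by algebra
    have "lincomb 3 ?e c \<in> fibre I s t"
      unfolding fibre_def
    proof (intro CollectI ballI allI impI)
      fix i l assume il: "i \<in> I" "l < a i"
      show "ctr s t (lincomb 3 ?e c) i l = 0"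
      proof (cases "i \<in> Ione")
        case True
        then have "l = 0" using il by (simp add: Ione_def)
        then have "ctr s t (lincomb 3 ?e c) i l = (c 0 + t * c 1 - s * c 2) * ?\<delta> i"
          using il True by (simp add: ctr_def xe algebra_simps numeral_2_eq_2)
        then show ?thesis by (simp add: c0)
      next
        case False
        then have "ctr s t (lincomb 3 ?e c) i l = c 0 * ctr s t v i l"
          using il by (simp add: ctr_def xe algebra_simps)
        then show ?thesis using v2 False il by simp
      qed
    qed
    then show ?thesis using fibre_subset_Cone[OF st(1), of I] by blast
  qed
  have ts: "(t, - s) \<noteq> (0, 0)" using st(1) by auto
  show "pt v \<in> SL_line_pair (cpts (Cone I))" "support_is_zero_locus (secant_locus (cpts (Cone I)) (pt v))"
    using line_pair_section[OF refl ts zeros] by blast+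
qed

text \<open>
  Over \<open>U\<close>, with blocks \<open>\<beta> j *s w\<close> of degree \<open>2\<close>, the conjugate of \<open>(s : t)\<close> with respect to \<open>w\<close> is
  \<open>(t w\<^sub>0 - s w\<^sub>1 : t w\<^sub>1 - s w\<^sub>2)\<close>. As it is linear in \<open>(s : t)\<close>, the secant points form a conic.
\<close>

lemma stratum_conic:
  assumes v: "v \<in> U0" "v \<notin> B0"
  shows "pt v \<in> SL_conic (cpts (Cone I))" "support_is_zero_locus (secant_locus (cpts (Cone I)) (pt v))"
proof -
  have vC: "v \<notin> Cone I" using v Cone_subset_B0 by blast
  obtain \<beta> w where w: "\<And>i l. i \<in> Itwo \<Longrightarrow> l \<le> 2 \<Longrightarrow> x i l v = \<beta> i * w l"
    and z: "\<And>i l. i \<in> Ige3 \<Longrightarrow> l \<le> a i \<Longrightarrow> x i l v = 0" using v(1) by (auto simp: U0_def)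
  have B0I: "v \<in> B0" if st: "(s, t) \<noteq> (0, 0)" and e: "\<And>i l. i \<in> Itwo \<Longrightarrow> l < 2 \<Longrightarrow> t * (\<beta> i * w l) = s * (\<beta> i * w (Suc l))" for s t
  proof -
    have "v \<in> fibre Ige2 s t"
      unfolding fibre_def
    proof (intro CollectI ballI allI impI)
      fix i l assume il: "i \<in> Ige2" "l < a i"
      from il(1) show "ctr s t v i l = 0"
      proof (cases rule: Ige2_cases)
        case 1
        then show ?thesis using w[of i l] w[of i "Suc l"] e[of i l] il by (simp add: ctr_def)
      next
        case 2
        then show ?thesis using z[of i l] z[of i "Suc l"] il by (simp add: ctr_def)
      qed
    qed
    then show ?thesis using fibre_subset_Cone[OF st, of Ige2] by blast
  qed
  obtain j where j: "j \<in> Itwo" "\<beta> j \<noteq> 0" using B0I[of 1 0] v(2) by force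
  have jI: "j \<in> I" "a j = 2" using j(1) by (auto simp: Itwo_def)
  define d where "d = (w 1)\<^sup>2 - w 0 * w 2"
  have d: "d \<noteq> 0"
  proof
    assume "d = 0"
    then have "w 0 * w 2 = (w 1)\<^sup>2" by (simp add: d_def)
    then obtain s t where st: "(s, t) \<noteq> (0, 0)" "t * w 0 = s * w 1" "t * w 1 = s * w 2"
      using conic_parameter by blast
    have "v \<in> B0"
    proof (rule B0I[OF st(1)])
      fix i l :: nat assume "l < 2"
      then consider "l = 0" | "l = 1" by linarith
      then show "t * (\<beta> i * w l) = s * (\<beta> i * w (Suc l))"
        using st(2,3) by cases (simp_all add: mult.left_commute numeral_2_eq_2)
    qed
    then show False using v(2) by blast
  qed
  \<comment> \<open>The plane \<open>W\<close> consists of the vectors with blocks \<open>d * \<beta> i *s y\<close> in degree \<open>2\<close> and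
    \<open>(p i y\<^sub>0 + r i y\<^sub>1, p i y\<^sub>1 + r i y\<^sub>2)\<close> in degree \<open>1\<close>. For \<open>y = (s\<^sup>2, s t, t\<^sup>2)\<close> the latter is
    \<open>(p i s + r i t) (s, t)\<close>, where the factor is the contraction of \<open>v\<close> at the conjugate of \<open>(s : t)\<close>.\<close>
  define p r where "p = (\<lambda>i. w 1 * x i 1 v - w 2 * x i 0 v)" and "r = (\<lambda>i. w 1 * x i 0 v - w 0 * x i 1 v)"
  let ?e = "\<lambda>k. mk (\<lambda>i l. if i \<in> Itwo then (if l = k then d * \<beta> i else 0)
      else if i \<in> Ione then (if l = k then p i else if Suc l = k then r i else 0) else 0)"
  have x2: "x i l (lincomb 3 ?e c) = d * \<beta> i * c l" if "i \<in> Itwo" "l \<le> 2" for i l c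
  proof -
    have "i \<in> I" "l \<le> a i" using that by (auto simp: Itwo_def)
    moreover have "l = 0 \<or> l = 1 \<or> l = 2" using that by auto
    ultimately show ?thesis using that by (auto simp: x_lincomb x_mk numeral_3_eq_3 numeral_2_eq_2)
  qed
  have x1: "x i l (lincomb 3 ?e c) = p i * c l + r i * c (Suc l)" if "i \<in> Ione" "l \<le> 1" for i l c
  proof -
    have "i \<in> I" "l \<le> a i" "i \<notin> Itwo" using that by (auto simp: Itwo_def Ione_def)
    moreover have "l = 0 \<or> l = 1" using that by auto
    ultimately show ?thesis using that by (auto simp: x_lincomb x_mk numeral_3_eq_3 numeral_2_eq_2)
  qed
  have x3: "x i l (lincomb 3 ?e c) = 0" if "i \<in> Ige3" "l \<le> a i" for i l c
  proof -
    have "i \<in> I" "i \<notin> Itwo" "i \<notin> Ione" using that by (auto simp: Itwo_def Ione_def Ige3_def)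
    then show ?thesis using that by (simp add: x_lincomb x_mk)
  qed
  interpret linear_secant_cone 3 ?e "Cone I" v
  proof (rule linear_secant_coneI[OF vC])
    show "v = lincomb 3 ?e (\<lambda>l. w l / d)"
    proof (rule vec_eqI)
      fix i l assume il: "i \<in> I" "l \<le> a i"
      from il(1) show "x i l v = x i l (lincomb 3 ?e (\<lambda>l. w l / d))"
      proof (cases rule: index_cases)
        case 1
        then consider "l = 0" | "l = 1" using il by linarith
        then show ?thesis
        proof cases
          case l: 1
          have "p i * w 0 + r i * w 1 = d * x i 0 v"
            by (simp add: p_def r_def d_def algebra_simps power2_eq_square)
          then have "(p i * w 0 + r i * w 1) / d = x i 0 v" using d by simp
          then show ?thesis using x1[OF 1(1), of 0] l by (simp add: add_divide_distrib)
        next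
          case l: 2
          have "p i * w 1 + r i * w 2 = d * x i 1 v"
            by (simp add: p_def r_def d_def algebra_simps power2_eq_square)
          then have "(p i * w 1 + r i * w 2) / d = x i 1 v" using d by simp
          then show ?thesis using x1[OF 1(1), of 1] l by (simp add: add_divide_distrib numeral_2_eq_2)
        qed
      next
        case 2
        from 2(1) show ?thesis
        proof (cases rule: Ige2_cases)
          case 1
          then show ?thesis using w[of i l] x2[of i l] il d by simp
        next
          case 2
          then show ?thesis using z[of i l] x3[of i l] il by simp
        qed
      qed
    qed
    fix c assume l0: "lincomb 3 ?e c = 0"
    have "c l = 0" if "l \<le> 2" for l using x2[OF j(1) that, of c] x_0[OF jI(1)] jI(2) that l0 d j(2) by simp
    then show "\<forall>i<3. c i = 0" by simp
  next
    fix s t s' t' \<mu> assume 1: "(s, t) \<noteq> (0, 0)" "(s', t') \<noteq> (0, 0)" "contr s t s' t' \<mu> v" "apolar s t s' t' v"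
    define z1 z2 where z12: "z1 = t * w 0 - s * w 1" "z2 = t * w 1 - s * w 2"
    have "t * t' * x j 0 v + - (t * s' + s * t') * x j (Suc 0) v + s * s' * x j (Suc (Suc 0)) v = 0"
      using 1(4) jI unfolding apolar_iff by auto
    then have "\<beta> j * (t' * z1 - s' * z2) = 0"
      using w[OF j(1), of 0] w[OF j(1), of 1] w[OF j(1), of 2] by (simp add: z12 algebra_simps numeral_2_eq_2)
    then have e: "t' * z1 - s' * z2 = 0" using j(2) by simp
    have "(z1, z2) \<noteq> (0, 0)"
    proof
      assume "(z1, z2) = (0, 0)"
      then have "d * s = 0" "d * t = 0" unfolding d_def power2_eq_square z12 by (simp_all, algebra+)
      then show False using d 1(1) by simp
    qed
    then obtain \<rho> where \<rho>: "\<rho> \<noteq> 0" "s' = \<rho> * z1" "t' = \<rho> * z2"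
      using proportional[OF _ 1(2) e] by blast
    have "rn \<mu> s t = lincomb 3 ?e (\<lambda>k. if k = 0 then \<rho> * s * s else if k = 1 then \<rho> * s * t else \<rho> * t * t)"
      (is "_ = lincomb 3 ?e ?c")
    proof -
      have c1: "ctr s' t' v i 0 = \<rho> * (p i * s + r i * t)" for i
        unfolding ctr_def \<rho> z12 p_def r_def by (simp add: algebra_simps)
      have c2: "ctr s' t' v i 0 = \<rho> * d * \<beta> i * s" "ctr s' t' v i 1 = \<rho> * d * \<beta> i * t" if i: "i \<in> Itwo" for i
        using w[OF i, of 0] w[OF i, of 1] w[OF i, of 2]
        by (simp_all add: ctr_def \<rho> z12 d_def algebra_simps power2_eq_square numeral_2_eq_2)
      have c3: "ctr s' t' v i l = 0" if "i \<in> Ige3" "l < a i" for i l using z that by (simp add: ctr_def)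
      show ?thesis
      proof (rule secant_point_eqI[OF 1(3)], goal_cases)
        case (1 i)
        then show ?case
        proof (cases rule: index_cases)
          case 1
          then show ?thesis using x1[OF 1(1), of 0 ?c] c1[of i] by (simp add: algebra_simps)
        next
          case 2
          from 2(1) show ?thesis
          proof (cases rule: Ige2_cases)
            case 1
            then show ?thesis using x2[OF 1(1), of 0 ?c] c2[OF 1(1)] by (simp add: algebra_simps)
          next
            case 2
            then show ?thesis using x3[OF 2(1), of 0 ?c] c3[OF 2(1), of 0] by simp
          qed
        qed
      next
        case (2 i l)
        from 2(1) show ?case
        proof (cases rule: index_cases)
          case 1
          then have "l = 0" using 2 by simp
          then show ?thesis using x1[OF 1(1), of 1 ?c] c1[of i] by (simp add: algebra_simps)
        next
          case i: 2
          from i(1) show ?thesis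
          proof (cases rule: Ige2_cases)
            case 1
            then consider "l = 0" | "l = 1" using 2 by linarith
            then show ?thesis
              using x2[OF 1(1), of 1 ?c] x2[OF 1(1), of 2 ?c] c2[OF 1(1)]
              by cases (simp_all add: algebra_simps numeral_2_eq_2)
          next
            case i3: 2
            then show ?thesis using x3[OF i3(1), of "Suc l" ?c] c3[OF i3(1), of l] 2 by simp
          qed
        qed
      qed
    qed
    then show "\<exists>c. rn \<mu> s t = lincomb 3 ?e c" by blast
  qed simp
  have zeros: "lincomb 3 ?e c \<in> Cone I" if c: "c 0 * c 2 = (c 1)\<^sup>2" for c
  proof -
    obtain s t where st: "(s, t) \<noteq> (0, 0)" "t * c 0 = s * c 1" "t * c 1 = s * c 2"
      using conic_parameter[OF c] by blast
    have e: "t * (k * c 0) = s * (k * c 1)" "t * (k * c 1) = s * (k * c 2)" for k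
      using st(2,3) by (simp_all add: mult.left_commute)
    have "lincomb 3 ?e c \<in> fibre I s t"
      unfolding fibre_def
    proof (intro CollectI ballI allI impI)
      fix i l assume il: "i \<in> I" "l < a i"
      from il(1) show "ctr s t (lincomb 3 ?e c) i l = 0"
      proof (cases rule: index_cases)
        case 1
        then have "l = 0" using il by simp
        moreover have "t * (p i * c 0 + r i * c 1) = s * (p i * c 1 + r i * c 2)"
          using st(2,3) by algebra
        ultimately show ?thesis using x1[OF 1(1), of 0 c] x1[OF 1(1), of 1 c]
          by (simp add: ctr_def numeral_2_eq_2)
      next
        case 2
        from 2(1) show ?thesis
        proof (cases rule: Ige2_cases)
          case 1
          then consider "l = 0" | "l = 1" using il by linarith
          then show ?thesis
            using x2[OF 1(1), of 0 c] x2[OF 1(1), of 1 c] x2[OF 1(1), of 2 c] e[of "d * \<beta> i"]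
            by cases (simp_all add: ctr_def numeral_2_eq_2)
        next
          case 2
          then show ?thesis using x3[OF 2(1), of l c] x3[OF 2(1), of "Suc l" c] il by (simp add: ctr_def)
        qed
      qed
    qed
    then show ?thesis using fibre_subset_Cone[OF st(1), of I] by blast
  qed
  show "pt v \<in> SL_conic (cpts (Cone I))" "support_is_zero_locus (secant_locus (cpts (Cone I)) (pt v))"
    using conic_section[OF refl zeros] by blast+
qed

text \<open>
  The vectors \<open>(x i 0 v)\<^sub>i\<close> and \<open>(x i 1 v)\<^sub>i\<close>, with \<open>i\<close> in the blocks of degree \<open>1\<close>, are linearly
  independent. The \<open>2 \<times> 2\<close> matrices acting on this pair parametrize the space \<open>W\<close>, and those of rank
  \<open>1\<close> give its points in \<open>X\<close>.
\<close>

lemma stratum_quadric: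
  assumes v: "v \<in> A0" "v \<notin> Cone I"
  shows "pt v \<in> SL_quadric (cpts (Cone I))" "support_is_zero_locus (secant_locus (cpts (Cone I)) (pt v))"
proof -
  have v0: "x i l v = 0" if "i \<in> Ige2" "l \<le> a i" for i l using v(1) that by (simp add: A0_def)
  \<comment> \<open>The matrix with a single entry \<open>1\<close>, in row \<open>k div 2\<close> and column \<open>k mod 2\<close>, acts on \<open>v\<close>.\<close>
  let ?e = "\<lambda>k. mk (\<lambda>i l. if i \<in> Ione \<and> k div 2 = l then x i (k mod 2) v else 0)"
  have xe: "x i 0 (lincomb 4 ?e c) = c 0 * x i 0 v + c 1 * x i 1 v"
    "x i 1 (lincomb 4 ?e c) = c 2 * x i 0 v + c 3 * x i 1 v" if "i \<in> Ione" for i c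
  proof -
    have sum4: "(\<Sum>k<4. f k) = f 0 + f 1 + f 2 + f 3" for f :: "nat \<Rightarrow> 'k"
      by (simp add: eval_nat_numeral)
    show "x i 0 (lincomb 4 ?e c) = c 0 * x i 0 v + c 1 * x i 1 v"
      "x i 1 (lincomb 4 ?e c) = c 2 * x i 0 v + c 3 * x i 1 v"
      using that by (simp_all add: x_lincomb x_mk Ione_def sum4)
  qed
  have xz: "x i l (lincomb 4 ?e c) = 0" if "i \<in> Ige2" "l \<le> a i" for i l c
    using that by (simp add: x_lincomb x_mk Ione_def Ige2_def)
  have ind: "c = 0 \<and> c' = 0" if c: "\<And>i. i \<in> Ione \<Longrightarrow> c * x i 0 v + c' * x i 1 v = 0" for c c'
  proof (rule ccontr)
    assume n: "\<not> ?thesis"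
    then have st: "(- c', c) \<noteq> (0, 0)" by auto
    have "v \<in> fibre I (- c') c"
      unfolding fibre_def
    proof (intro CollectI ballI allI impI)
      fix i l assume il: "i \<in> I" "l < a i"
      from il(1) show "ctr (- c') c v i l = 0"
      proof (cases rule: index_cases)
        case 1
        then show ?thesis using c[OF 1(1)] il by (simp add: ctr_def)
      next
        case 2
        then show ?thesis using v0[of i l] v0[of i "Suc l"] il by (simp add: ctr_def)
      qed
    qed
    then show False using v(2) fibre_subset_Cone[OF st, of I] by blast
  qed
  have eqI: "u = lincomb 4 ?e c"
    if "\<And>i. i \<in> Ione \<Longrightarrow> x i 0 u = c 0 * x i 0 v + c 1 * x i 1 v"
      "\<And>i. i \<in> Ione \<Longrightarrow> x i 1 u = c 2 * x i 0 v + c 3 * x i 1 v"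
      "\<And>i l. i \<in> Ige2 \<Longrightarrow> l \<le> a i \<Longrightarrow> x i l u = 0" for u c
  proof (rule vec_eqI)
    fix i l assume il: "i \<in> I" "l \<le> a i"
    from il(1) show "x i l u = x i l (lincomb 4 ?e c)"
    proof (cases rule: index_cases)
      case 1
      then consider "l = 0" | "l = 1" using il by linarith
      then show ?thesis using that(1,2)[OF 1(1)] xe[OF 1(1), of c] by cases simp_all
    next
      case 2
      then show ?thesis using that(3) xz il by simp
    qed
  qed
  interpret linear_secant_cone 4 ?e "Cone I" v
  proof (rule linear_secant_coneI[OF v(2)])
    show "v = lincomb 4 ?e (\<lambda>k. if k = 0 \<or> k = 3 then 1 else 0)" by (rule eqI) (use v0 in auto)
    fix c assume l0: "lincomb 4 ?e c = 0"
    have "c 0 = 0 \<and> c 1 = 0"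
      by (rule ind) (use xe(1)[of _ c] l0 x_0[of _ 0] in \<open>auto simp: Ione_def\<close>)
    moreover have "c 2 = 0 \<and> c 3 = 0"
      by (rule ind) (use xe(2)[of _ c] l0 x_0[of _ 1] in \<open>auto simp: Ione_def\<close>)
    ultimately show "\<forall>i<4. c i = 0" by (auto simp: eval_nat_numeral less_Suc_eq)
  next
    fix s t s' t' \<mu> assume 1: "(s, t) \<noteq> (0, 0)" "(s', t') \<noteq> (0, 0)" "contr s t s' t' \<mu> v" "apolar s t s' t' v"
    have "rn \<mu> s t = lincomb 4 ?e (\<lambda>k. if k = 0 then s * t' else if k = 1 then - (s * s') else if k = 2 then t * t' else - (t * s'))"
    proof (rule eqI)
      fix i assume i: "i \<in> Ione"
      then have i': "i \<in> I" "0 < a i" by (auto simp: Ione_def)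
      show "x i 0 (rn \<mu> s t) = (if (0::nat) = 0 then s * t' else if (0::nat) = 1 then - (s * s') else if (0::nat) = 2 then t * t' else - (t * s')) * x i 0 v +
          (if (1::nat) = 0 then s * t' else if (1::nat) = 1 then - (s * s') else if (1::nat) = 2 then t * t' else - (t * s')) * x i 1 v"
        using secant_point_coords(1)[OF 1(3) i'] by (simp add: ctr_def algebra_simps)
      show "x i 1 (rn \<mu> s t) = (if (2::nat) = 0 then s * t' else if (2::nat) = 1 then - (s * s') else if (2::nat) = 2 then t * t' else - (t * s')) * x i 0 v +
          (if (3::nat) = 0 then s * t' else if (3::nat) = 1 then - (s * s') else if (3::nat) = 2 then t * t' else - (t * s')) * x i 1 v"
        using secant_point_coords(2)[OF 1(3) i'] by (simp add: ctr_def algebra_simps)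
    next
      fix i l assume il: "i \<in> Ige2" "l \<le> a i"
      then have i: "i \<in> I" "2 \<le> a i" by (auto simp: Ige2_def)
      have c: "ctr s' t' v i m = 0" if "m < a i" for m using v0[OF il(1), of m] v0[OF il(1), of "Suc m"] that by (simp add: ctr_def)
      show "x i l (rn \<mu> s t) = 0"
      proof (cases l)
        case 0
        then show ?thesis using secant_point_coords(1)[OF 1(3) i(1), of 0] c[of 0] i by simp
      next
        case (Suc m)
        then show ?thesis using secant_point_coords(2)[OF 1(3) i(1), of m] c[of m] il by simp
      qed
    qed
    then show "\<exists>c. rn \<mu> s t = lincomb 4 ?e c" by blast
  qed simp
  have zeros: "lincomb 4 ?e c \<in> Cone I" if c: "c 0 * c 3 = c 1 * c 2" for c
  proof -
    obtain s t where st: "(s, t) \<noteq> (0, 0)" "t * c 0 = s * c 2" "t * c 1 = s * c 3"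
      using proportional_rows[OF c] by blast
    have "lincomb 4 ?e c \<in> fibre I s t"
      unfolding fibre_def
    proof (intro CollectI ballI allI impI)
      fix i l assume il: "i \<in> I" "l < a i"
      from il(1) show "ctr s t (lincomb 4 ?e c) i l = 0"
      proof (cases rule: index_cases)
        case 1
        then have l: "l = 0" using il by simp
        have "t * (c 0 * x i 0 v + c 1 * x i 1 v) = s * (c 2 * x i 0 v + c 3 * x i 1 v)"
          using st(2,3) by algebra
        then show ?thesis using xe[OF 1(1), of c] l by (simp add: ctr_def)
      next
        case 2
        then show ?thesis using xz[OF 2(1), of l c] xz[OF 2(1), of "Suc l" c] il by (simp add: ctr_def)
      qed
    qed
    then show ?thesis using fibre_subset_Cone[OF st(1), of I] by blast
  qed
  show "pt v \<in> SL_quadric (cpts (Cone I))" "support_is_zero_locus (secant_locus (cpts (Cone I)) (pt v))"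
    using smooth_quadric_section[OF refl zeros] by blast+
qed

end

section \<open>Joins, scrolls and the classification\<close>

context scroll_coords
begin

lemma lin_hull_S1: "lin_hull (cpts (Cone I \<inter> A0)) = cpts A0"
proof -
  have c: "cone (Cone I \<inter> A0)"
    using Cone_cone[of I] cone_subspace[OF A0_subspace] by (auto simp: cone_def)
  have "vec.span (Cone I \<inter> A0) = A0"
  proof
    show "vec.span (Cone I \<inter> A0) \<subseteq> A0" by (rule vec.span_minimal) (auto simp: A0_subspace)
    show "A0 \<subseteq> vec.span (Cone I \<inter> A0)"
    proof
      fix v assume v: "v \<in> A0"
      have "x i l v *s b i l \<in> vec.span (Cone I \<inter> A0)" if il: "i \<in> I" "l \<le> a i" for i l
      proof (cases "i \<in> Ige2")
        case True
        then show ?thesis using v il by (simp add: A0_def vec.span_zero)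
      next
        case False
        then have i: "a i = 1" using il a_pos[OF il(1)] by (auto simp: Ige2_def)
        then have "l = 0 \<or> l = a i" using il(2) by auto
        then have "b i l \<in> Cone I" using b_ends_in_Cone[OF il(1)] by auto
        moreover have "b i l \<in> A0"
          using il i by (auto simp: A0_def Ige2_def x_b)
        ultimately show ?thesis by (simp add: vec.span_base vec.span_scale)
      qed
      then have "(\<Sum>i\<in>I. \<Sum>l\<le>a i. x i l v *s b i l) \<in> vec.span (Cone I \<inter> A0)"
        by (intro vec.span_sum) auto
      then show "v \<in> vec.span (Cone I \<inter> A0)" using expand[of v] by simp
    qed
  qed
  then show ?thesis
    unfolding lin_hull_def by (simp add: span_Union_cpts[OF c] proj_eq_cpts[OF A0_subspace])
qed

lemma b_one:
  assumes "i \<in> Ione" shows "b i 0 \<in> Cone I \<inter> A0" "b i 1 \<in> Cone I \<inter> A0"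
proof -
  have i: "i \<in> I" "a i = 1" using assms by (auto simp: Ione_def)
  then show "b i 0 \<in> Cone I \<inter> A0" "b i 1 \<in> Cone I \<inter> A0"
    using b_ends_in_Cone[OF i(1)] by (auto simp: A0_def Ige2_def x_b)
qed

lemma lin_hull_self: "v \<noteq> 0 \<Longrightarrow> pt v \<in> lin_hull {pt v, pt w}" "w \<noteq> 0 \<Longrightarrow> pt w \<in> lin_hull {pt v, pt w}"
  by (rule in_lin_hull_pair[of _ 1 _ 0]; simp) (rule in_lin_hull_pair[of _ 0 _ 1]; simp)

text \<open>
  A vector whose blocks of degree at least \<open>2\<close> lie over \<open>(s : t)\<close> is the sum of a vector over
  \<open>(s : t)\<close> and a vector in the blocks of degree \<open>1\<close> over any other point.
\<close>

lemma join_S1_X: "join (cpts (Cone I \<inter> A0)) (cpts (Cone I)) = cpts B0"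
proof (cases "Ione = {}")
  case True
  then have I2: "Ige2 = I" using a_pos by (fastforce simp: Ione_def Ige2_def)
  then have "A0 = {0}" by (auto simp: A0_def x_0 intro: vec_eqI)
  then have "cpts (Cone I \<inter> A0) = {}" by (auto simp: cpts_def)
  then show ?thesis by (simp add: join_def I2)
next
  case False
  then obtain i0 where i0: "i0 \<in> Ione" by blast
  then have i0I: "i0 \<in> I" "a i0 = 1" by (auto simp: Ione_def)
  let ?Y = "\<Union>{lin_hull {y, z} |y z. y \<in> cpts (Cone I \<inter> A0) \<and> z \<in> cpts (Cone I) \<and> y \<noteq> z}"
  have b0: "pt (b i0 0) \<in> cpts (Cone I \<inter> A0)" "pt (b i0 1) \<in> cpts (Cone I \<inter> A0)"
    using b_one[OF i0] b_coords[OF i0I(1)] i0I(2) by (auto simp: cpts_def)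
  have ne: "cpts (Cone I \<inter> A0) \<noteq> {}" "cpts (Cone I) \<noteq> {}" using b0 by (auto simp: cpts_def)
  have "zclosure ?Y = cpts B0"
  proof (rule zclosure_eq_cpts)
    show "cone B0" by (rule Cone_cone[OF index_sets(3)])
    show "?Y \<subseteq> cpts B0"
    proof
      fix q assume "q \<in> ?Y"
      then obtain v w where vw: "v \<in> A0" "w \<in> Cone I" "q \<in> lin_hull {pt v, pt w}" by (auto simp: cpts_def)
      obtain u \<sigma> \<tau> where u: "q = pt u" "u \<noteq> 0" "u = \<sigma> *s v + \<tau> *s w" using vw(3) by (rule lin_hull_pairE)
      obtain s t where st: "(s, t) \<noteq> (0, 0)" "w \<in> fibre I s t" using vw(2) by (auto simp: Cone_def)
      have "v \<in> fibre Ige2 s t" using vw(1) by (auto simp: A0_def fibre_def ctr_def)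
      moreover have "w \<in> fibre Ige2 s t" using st(2) index_sets(3) by (auto simp: fibre_def)
      ultimately have "u \<in> fibre Ige2 s t"
        unfolding u(3) by (intro vec.subspace_add vec.subspace_scale fibre_subspace index_sets)
      then show "q \<in> cpts B0" using u fibre_subset_Cone[OF st(1), of Ige2] by (auto simp: cpts_def)
    qed
    show "\<exists>f. polyfun f \<and> f v \<noteq> 0 \<and> (\<forall>w\<in>B0. f w = 0)" if "v \<notin> B0" for v
      using Cone_quadrics[OF index_sets(3)] that polyfun_meval unfolding cut_out_by_quadrics_def by blast
    show "pt v \<in> zclosure ?Y" if v: "v \<in> B0" "v \<noteq> 0" for v
    proof -
      have "?Y \<subseteq> points" by (auto simp: lin_hull_def proj_def)
      moreover have "pt v \<in> ?Y"
      proof (cases "v \<in> Cone I")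
        case True
        then have X: "pt v \<in> cpts (Cone I)" using v(2) by (auto simp: cpts_def)
        obtain s where s: "s = b i0 0 \<or> s = b i0 (a i0)" "s \<in> Cone I" "s \<noteq> 0" "pt s \<noteq> pt v"
          by (rule another_point[OF i0I(1), of v])
        then have "pt s \<in> cpts (Cone I \<inter> A0)" using b0 i0I(2) by auto
        moreover have "pt v \<in> lin_hull {pt s, pt v}" by (rule lin_hull_self(2)[OF v(2)])
        ultimately show ?thesis using X s(4) by blast
      next
        case False
        obtain s t where st: "(s, t) \<noteq> (0, 0)" "v \<in> fibre Ige2 s t" using v(1) by (auto simp: Cone_def)
        obtain s1 t1 where st1: "t1 * s - s1 * t = 1" using independent_direction[OF st(1)] by blast
        then have st1': "(s1, t1) \<noteq> (0, 0)" by auto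
        define \<xi> where "\<xi> = rn (\<lambda>i. if i \<in> Ione then - ctr s t v i 0 else 0) s1 t1"
        have \<xi>C: "\<xi> \<in> Cone I" unfolding \<xi>_def using rn_in_fibre[of I] fibre_subset_Cone[OF st1', of I] by blast
        have \<xi>A: "\<xi> \<in> A0" by (auto simp: \<xi>_def A0_def x_rn Ige2_def Ione_def)
        have "v - \<xi> \<in> fibre I s t"
          unfolding fibre_def
        proof (intro CollectI ballI allI impI)
          fix i l assume il: "i \<in> I" "l < a i"
          from il(1) show "ctr s t (v - \<xi>) i l = 0"
          proof (cases rule: index_cases)
            case 1
            have m1: "t * s1 - s * t1 = - 1" using st1 by (simp add: algebra_simps)
            have "ctr s t \<xi> i 0 = (t * s1 - s * t1) * (- ctr s t v i 0)"
              using 1 il by (simp add: \<xi>_def ctr_rn)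
            then show ?thesis using 1 il by (simp add: ctr_diff m1)
          next
            case 2
            then have "i \<notin> Ione" by (auto simp: Ige2_def Ione_def)
            then have "ctr s t \<xi> i l = 0" using il by (simp add: \<xi>_def ctr_rn)
            moreover have "ctr s t v i l = 0" using st(2) 2 il by (auto simp: fibre_def)
            ultimately show ?thesis using il by (simp add: ctr_diff)
          qed
        qed
        then have yC: "v - \<xi> \<in> Cone I" using fibre_subset_Cone[OF st(1), of I] by blast
        have nz: "\<xi> \<noteq> 0" "v - \<xi> \<noteq> 0" using False yC \<xi>C by auto
        have "pt \<xi> \<noteq> pt (v - \<xi>)"
        proof
          assume "pt \<xi> = pt (v - \<xi>)"
          then obtain c where "v - \<xi> = c *s \<xi>" using pt_eq_iff[OF nz(1)] by blast
          then have "v = (c + 1) *s \<xi>" by (simp add: vec.scale_left_distrib diff_eq_eq)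
          then show False using False coneD[OF Cone_cone[OF subset_refl] \<xi>C] by simp
        qed
        moreover have "pt \<xi> \<in> cpts (Cone I \<inter> A0)" "pt (v - \<xi>) \<in> cpts (Cone I)"
          using nz \<xi>C \<xi>A yC by (auto simp: cpts_def)
        moreover have "pt v \<in> lin_hull {pt \<xi>, pt (v - \<xi>)}"
          by (rule in_lin_hull_pair[OF v(2), of 1 _ 1]) simp
        ultimately show ?thesis by blast
      qed
      ultimately show ?thesis using zclosure_subset by blast
    qed
  qed
  then show ?thesis using ne by (simp add: join_def)
qed

definition D0 :: "('k ^ 'v) set" where
  "D0 = {v \<in> U0. \<forall>i\<in>Ione. \<forall>l\<le>a i. x i l v = 0}"

lemma U0I:
  assumes "\<And>i l. i \<in> Ige3 \<Longrightarrow> l \<le> a i \<Longrightarrow> x i l v = 0" "\<And>i l. i \<in> Itwo \<Longrightarrow> l \<le> 2 \<Longrightarrow> x i l v = \<beta> i * w l"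
  shows "v \<in> U0"
  using assms unfolding U0_def by blast

lemma U0E:
  assumes "v \<in> U0"
  obtains \<beta> w where "\<And>i l. i \<in> Ige3 \<Longrightarrow> l \<le> a i \<Longrightarrow> x i l v = 0" "\<And>i l. i \<in> Itwo \<Longrightarrow> l \<le> 2 \<Longrightarrow> x i l v = \<beta> i * w l"
  using assms unfolding U0_def by blast

lemma cone_U0: "cone U0"
  unfolding cone_def
proof (intro ballI allI)
  fix v c assume "v \<in> U0"
  then obtain \<beta> w where "\<And>i l. i \<in> Ige3 \<Longrightarrow> l \<le> a i \<Longrightarrow> x i l v = 0"
    "\<And>i l. i \<in> Itwo \<Longrightarrow> l \<le> 2 \<Longrightarrow> x i l v = \<beta> i * w l" by (rule U0E) blast
  then show "c *s v \<in> U0"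
    by (intro U0I[of _ "\<lambda>i. c * \<beta> i" w]) (auto simp: x_scale Ige3_def Itwo_def)
qed

lemma D0_cone: "cone D0"
  using cone_U0 index_sets(1) by (auto simp: cone_def D0_def x_scale subset_iff)

lemma U0_decompose:
  assumes "v \<in> U0"
  obtains y z where "y \<in> A0" "z \<in> D0" "v = y + z"
proof -
  define y where "y = mk (\<lambda>i l. if i \<in> Ione then x i l v else 0)"
  obtain \<beta> w where w: "\<And>i l. i \<in> Ige3 \<Longrightarrow> l \<le> a i \<Longrightarrow> x i l v = 0"
    "\<And>i l. i \<in> Itwo \<Longrightarrow> l \<le> 2 \<Longrightarrow> x i l v = \<beta> i * w l" using assms by (rule U0E) blast
  have y: "y \<in> A0" by (auto simp: y_def A0_def x_mk Ige2_def Ione_def)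
  have "v - y \<in> U0"
    by (rule U0I[of _ \<beta> w]) (use w in \<open>auto simp: y_def x_diff x_mk Ige3_def Itwo_def Ione_def\<close>)
  then have "v - y \<in> D0" by (auto simp: D0_def y_def x_diff x_mk Ione_def)
  then show thesis using that[OF y] by simp
qed

lemma A0_add_D0: "y \<in> A0 \<Longrightarrow> z \<in> D0 \<Longrightarrow> y + z \<in> U0"
proof -
  assume y: "y \<in> A0" and "z \<in> D0"
  then have "z \<in> U0" by (simp add: D0_def)
  then obtain \<beta> w where w: "\<And>i l. i \<in> Ige3 \<Longrightarrow> l \<le> a i \<Longrightarrow> x i l z = 0"
    "\<And>i l. i \<in> Itwo \<Longrightarrow> l \<le> 2 \<Longrightarrow> x i l z = \<beta> i * w l" by (rule U0E) blast
  show ?thesis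
    by (rule U0I[of _ \<beta> w]) (use w y in \<open>auto simp: x_add A0_def Ige3_def Ige2_def Itwo_def\<close>)
qed

lemma A0_Int_D0: "v \<in> A0 \<Longrightarrow> v \<in> D0 \<Longrightarrow> v = 0"
proof (rule vec_eqI)
  fix i l assume v: "v \<in> A0" "v \<in> D0" and il: "i \<in> I" "l \<le> a i"
  from il(1) show "x i l v = x i l 0"
    by (cases rule: index_cases) (use v il in \<open>auto simp: A0_def D0_def x_0\<close>)
qed

text \<open>The blocks of degree \<open>2\<close> form a matrix of rank at most \<open>1\<close>, a closed condition.\<close>

lemma U0_closed:
  assumes "v \<notin> U0"
  shows "\<exists>f. polyfun f \<and> f v \<noteq> 0 \<and> (\<forall>w\<in>U0. f w = 0)"
proof (cases "\<forall>i\<in>Ige3. \<forall>l\<le>a i. x i l v = 0")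
  case False
  then obtain i l where il: "i \<in> Ige3" "l \<le> a i" "x i l v \<noteq> 0" by blast
  then have "polyfun (x i l)" using index_sets(4) by (intro polyfun_linear_form x_lin) auto
  then show ?thesis using il by (intro exI[of _ "x i l"]) (auto simp: U0_def)
next
  case True
  let ?m = "\<lambda>i l j m w. x i l w * x j m w - x i m w * x j l w"
  have "\<exists>i\<in>Itwo. \<exists>j\<in>Itwo. \<exists>l\<le>2. \<exists>m\<le>2. ?m i l j m v \<noteq> 0"
  proof (rule ccontr)
    assume n: "\<not> ?thesis"
    have "v \<in> U0"
    proof (cases "\<exists>j\<in>Itwo. \<exists>m\<le>2. x j m v \<noteq> 0")
      case False
      then show ?thesis using True by (intro U0I[of _ "\<lambda>i. 0" "\<lambda>l. 0"]) auto
    next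
      case j: True
      then obtain j m where jm: "j \<in> Itwo" "m \<le> 2" "x j m v \<noteq> 0" by blast
      show ?thesis
      proof (rule U0I[of _ "\<lambda>i. x i m v / x j m v" "\<lambda>l. x j l v"])
        fix i l :: nat assume il: "i \<in> Itwo" "l \<le> 2"
        then have "?m i l j m v = 0" using n jm by blast
        then show "x i l v = x i m v / x j m v * x j l v" using jm(3) by (simp add: field_simps)
      qed (use True in blast)
    qed
    then show False using assms by blast
  qed
  then obtain i j l m where ij: "i \<in> Itwo" "j \<in> Itwo" "l \<le> 2" "m \<le> 2" "?m i l j m v \<noteq> 0" by blast
  have "polyfun (?m i l j m)"
    using ij by (intro polyfun_diff polyfun.mult polyfun_linear_form x_lin) (auto simp: Itwo_def)
  moreover have "?m i l j m w = 0" if w: "w \<in> U0" for w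
    using w ij by (elim U0E) simp
  ultimately show ?thesis using ij(5) by blast
qed

lemma join_A_Delta: "join (cpts A0) (cpts D0) = cpts U0"
proof (cases "cpts A0 = {} \<or> cpts D0 = {}")
  case True
  show ?thesis
  proof (cases "cpts A0 = {}")
    case A: True
    then have "A0 \<subseteq> {0}" by (auto simp: cpts_def)
    then have "U0 \<subseteq> D0" by (auto elim!: U0_decompose)
    then have "U0 = D0" by (auto simp: D0_def)
    then show ?thesis using A by (simp add: join_def)
  next
    case False
    then have D: "cpts D0 = {}" using True by blast
    then have "D0 \<subseteq> {0}" by (auto simp: cpts_def)
    then have "U0 \<subseteq> A0" by (auto elim!: U0_decompose)
    then have "U0 = A0" using A0_subset_U0 by blast
    then show ?thesis using D False by (simp add: join_def)
  qed
next
  case ne: False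
  let ?Y = "\<Union>{lin_hull {y, z} |y z. y \<in> cpts A0 \<and> z \<in> cpts D0 \<and> y \<noteq> z}"
  have distinct: "p \<noteq> q" if p: "p \<in> cpts A0" and q: "q \<in> cpts D0" for p q
  proof
    assume "p = q"
    obtain u where "u \<noteq> 0" "u \<in> A0" "p = pt u" using p by (auto simp: cpts_def)
    then have u: "u \<noteq> 0" "u \<in> A0" "pt u \<in> cpts D0" using q \<open>p = q\<close> by simp_all
    then have "u \<in> D0" using pt_in_cpts_iff[OF D0_cone] by blast
    then show False using u A0_Int_D0 by blast
  qed
  have "zclosure ?Y = cpts U0"
  proof (rule zclosure_eq_cpts[OF cone_U0 _ U0_closed])
    show "?Y \<subseteq> cpts U0"
    proof
      fix q assume "q \<in> ?Y"
      then obtain v w where vw: "v \<in> A0" "w \<in> D0" "q \<in> lin_hull {pt v, pt w}" by (auto simp: cpts_def)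
      obtain u \<sigma> \<tau> where u: "q = pt u" "u \<noteq> 0" "u = \<sigma> *s v + \<tau> *s w" using vw(3) by (rule lin_hull_pairE)
      have "u \<in> U0" unfolding u(3)
        by (intro A0_add_D0 coneD[OF D0_cone] vec.subspace_scale[OF A0_subspace] vw)
      then show "q \<in> cpts U0" using u by (auto simp: cpts_def)
    qed
    show "pt v \<in> zclosure ?Y" if v: "v \<in> U0" "v \<noteq> 0" for v
    proof -
      have "?Y \<subseteq> points" by (auto simp: lin_hull_def proj_def)
      moreover have "pt v \<in> ?Y"
      proof -
        obtain y z where yz: "y \<in> A0" "z \<in> D0" "v = y + z" using v(1) by (rule U0_decompose)
        obtain y' z' where yz': "y' \<noteq> 0" "y' \<in> A0" "z' \<noteq> 0" "z' \<in> D0" "pt v \<in> lin_hull {pt y', pt z'}"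
        proof (cases "y = 0 \<or> z = 0")
          case False
          then show thesis using that[of y z] yz in_lin_hull_pair[OF v(2), of 1 y 1 z] by simp
        next
          case True
          then show thesis
          proof
            assume "y = 0"
            moreover obtain y' where "y' \<noteq> 0" "y' \<in> A0" using ne by (auto simp: cpts_def)
            ultimately show thesis using that[of y' z] yz v(2) lin_hull_self(2)[of z y'] by simp
          next
            assume "z = 0"
            moreover obtain z' where "z' \<noteq> 0" "z' \<in> D0" using ne by (auto simp: cpts_def)
            ultimately show thesis using that[of y z'] yz v(2) lin_hull_self(1)[of y z'] by simp
          qed
        qed
        have "pt y' \<in> cpts A0" "pt z' \<in> cpts D0" using yz'(1-4) unfolding cpts_def by blast+
        then have "lin_hull {pt y', pt z'} \<in> {lin_hull {y, z} |y z. y \<in> cpts A0 \<and> z \<in> cpts D0 \<and> y \<noteq> z}"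
          using distinct by (intro CollectI exI[of _ "pt y'"] exI[of _ "pt z'"]) simp
        then show ?thesis using yz'(5) by (rule UnionI)
      qed
      ultimately show ?thesis using zclosure_subset by blast
    qed
  qed
  then show ?thesis using ne by (simp add: join_def)
qed

lemma scroll_eq_cpts:
  assumes J: "J \<subseteq> I" and \<phi>: "\<And>i u. i \<in> J \<Longrightarrow> u \<noteq> 0 \<Longrightarrow>
     \<phi> i (pt u) = pt (\<Sum>l\<le>a i. ((u $ 1) ^ (a i - l) * (u $ 2) ^ l) *s b i l)"
  shows "scroll J \<phi> = cpts {v \<in> Cone I. \<forall>i\<in>I - J. \<forall>l\<le>a i. x i l v = 0}"
proof -
  let ?\<nu> = "\<lambda>s t i. \<Sum>l\<le>a i. (s ^ (a i - l) * t ^ l) *s b i l"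
  let ?F = "\<lambda>s t. {v \<in> fibre I s t. \<forall>i\<in>I - J. \<forall>l\<le>a i. x i l v = 0}"
  have x\<nu>: "x j m (?\<nu> s t i) = (if i = j then s ^ (a j - m) * t ^ m else 0)"
    if "i \<in> I" "j \<in> I" "m \<le> a j" for i j m s t
  proof -
    have "x j m (?\<nu> s t i) = (\<Sum>l\<le>a i. s ^ (a i - l) * t ^ l * x j m (b i l))"
      using that by (simp add: linear_form_sum[OF x_lin] linear_form_scale[OF x_lin])
    also have "\<dots> = (\<Sum>l\<le>a i. if l = m then (if i = j then s ^ (a i - l) * t ^ l else 0) else 0)"
      using that by (intro sum.cong refl) (auto simp: x_b)
    finally show ?thesis using that by auto
  qed
  have rn\<nu>: "rn \<mu> s t = (\<Sum>i\<in>I. \<mu> i *s ?\<nu> s t i)" for \<mu> s t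
    by (simp add: rn_def mk_def vec.scale_sum_right mult.assoc)
  have span: "vec.span (?\<nu> s t ` J) = ?F s t" if st: "(s, t) \<noteq> (0, 0)" for s t
  proof
    show "vec.span (?\<nu> s t ` J) \<subseteq> ?F s t"
    proof (rule vec.span_minimal)
      show "?\<nu> s t ` J \<subseteq> ?F s t"
      proof clarify
        fix i assume i: "i \<in> J"
        then have iI: "i \<in> I" using J by blast
        have "?\<nu> s t i = rn (\<lambda>j. if j = i then 1 else 0) s t"
          by (rule vec_eqI) (use iI in \<open>auto simp: x\<nu> x_rn\<close>)
        then have "?\<nu> s t i \<in> fibre I s t" using rn_in_fibre[of I] by simp
        then show "?\<nu> s t i \<in> fibre I s t \<and> (\<forall>j\<in>I - J. \<forall>l\<le>a j. x j l (?\<nu> s t i) = 0)"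
          using x\<nu>[OF iI] i by auto
      qed
      show "vec.subspace (?F s t)"
        using fibre_subspace[of I s t] by (auto simp: vec.subspace_def x_simps)
    qed
    show "?F s t \<subseteq> vec.span (?\<nu> s t ` J)"
    proof
      fix v assume v: "v \<in> ?F s t"
      then obtain \<mu> where \<mu>: "v = rn \<mu> s t" using fibre_rn[OF st] by blast
      have "\<mu> i *s ?\<nu> s t i \<in> vec.span (?\<nu> s t ` J)" if i: "i \<in> I" for i
      proof (cases "i \<in> J")
        case True
        then show ?thesis by (intro vec.span_scale vec.span_base) blast
      next
        case False
        have "\<mu> i *s ?\<nu> s t i = 0"
        proof (rule vec_eqI)
          fix j l assume jl: "j \<in> I" "l \<le> a j"
          have "x i l v = 0" if "i = j" using v False jl that by blast
          then show "x j l (\<mu> i *s ?\<nu> s t i) = x j l 0"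
            using jl i x\<nu>[OF i jl, of s t] unfolding \<mu> by (auto simp: x_scale x_0 x_rn)
        qed
        then show ?thesis by (simp only: vec.span_zero)
      qed
      then show "v \<in> vec.span (?\<nu> s t ` J)" unfolding \<mu> rn\<nu> by (intro vec.span_sum) blast
    qed
  qed
  have fib: "lin_hull ((\<lambda>i. \<phi> i (pt u)) ` J) = cpts (?F (u $ 1) (u $ 2))" if u: "u \<noteq> 0" for u :: "'k ^ 2"
  proof -
    have eq: "(\<lambda>i. \<phi> i (pt u)) ` J = pt ` (?\<nu> (u $ 1) (u $ 2) ` J)" using \<phi> u by (auto simp: image_image)
    have st: "(u $ 1, u $ 2) \<noteq> (0, 0)" using u by (auto simp: vec_eq_iff forall_2)
    show ?thesis unfolding eq lin_hull_pt span[OF st] by (rule refl)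
  qed
  have "scroll J \<phi> = (\<Union>u\<in>{u :: 'k ^ 2. u \<noteq> 0}. cpts (?F (u $ 1) (u $ 2)))"
    using fib by (auto simp: scroll_def points_def)
  also have "\<dots> = cpts {v \<in> Cone I. \<forall>i\<in>I - J. \<forall>l\<le>a i. x i l v = 0}"
  proof
    show "(\<Union>u\<in>{u :: 'k ^ 2. u \<noteq> 0}. cpts (?F (u $ 1) (u $ 2))) \<subseteq> cpts {v \<in> Cone I. \<forall>i\<in>I - J. \<forall>l\<le>a i. x i l v = 0}"
    proof clarify
      fix u :: "'k ^ 2" and p assume u: "u \<noteq> 0" "p \<in> cpts (?F (u $ 1) (u $ 2))"
      have "(u $ 1, u $ 2) \<noteq> (0, 0)" using u(1) by (auto simp: vec_eq_iff forall_2)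
      then show "p \<in> cpts {v \<in> Cone I. \<forall>i\<in>I - J. \<forall>l\<le>a i. x i l v = 0}"
        using u(2) fibre_subset_Cone by (fastforce simp: cpts_def)
    qed
    show "cpts {v \<in> Cone I. \<forall>i\<in>I - J. \<forall>l\<le>a i. x i l v = 0} \<subseteq> (\<Union>u\<in>{u :: 'k ^ 2. u \<noteq> 0}. cpts (?F (u $ 1) (u $ 2)))"
    proof
      fix p assume "p \<in> cpts {v \<in> Cone I. \<forall>i\<in>I - J. \<forall>l\<le>a i. x i l v = 0}"
      then obtain v where v: "v \<noteq> 0" "p = pt v" "v \<in> Cone I" "\<forall>i\<in>I - J. \<forall>l\<le>a i. x i l v = 0"
        by (auto simp: cpts_def)
      then obtain s t where st: "(s, t) \<noteq> (0, 0)" "v \<in> fibre I s t" by (auto simp: Cone_def)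
      define u :: "'k ^ 2" where "u = (\<chi> k. if k = 1 then s else t)"
      have u: "u $ 1 = s" "u $ 2 = t" by (simp_all add: u_def)
      then have "u \<noteq> 0" using st(1) by auto
      moreover have "p \<in> cpts (?F (u $ 1) (u $ 2))" unfolding u using v st(2) by (auto simp: cpts_def)
      ultimately show "p \<in> (\<Union>u\<in>{u :: 'k ^ 2. u \<noteq> 0}. cpts (?F (u $ 1) (u $ 2)))" by blast
    qed
  qed
  finally show ?thesis .
qed

text \<open>The points of \<open>C\<^sub>\<beta>\<close> with parameters \<open>(1 : 0)\<close>, \<open>(0 : 1)\<close> and \<open>(1 : 1)\<close> span its plane.\<close>

lemma conic_planes_eq: "conic_planes Itwo b = cpts D0"
proof -
  let ?P = "\<lambda>\<beta> l. \<Sum>j\<in>Itwo. \<beta> j *s b j l"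
  let ?\<theta> = "\<lambda>\<beta> s t. \<Sum>j\<in>Itwo. \<beta> j *s (s\<^sup>2 *s b j 0 + (s * t) *s b j 1 + t\<^sup>2 *s b j 2)"
  let ?E = "\<lambda>\<beta> y0 y1 y2. y0 *s ?P \<beta> 0 + y1 *s ?P \<beta> 1 + y2 *s ?P \<beta> 2"
  have \<theta>: "?\<theta> \<beta> s t = ?E \<beta> (s\<^sup>2) (s * t) (t\<^sup>2)" for \<beta> s t
    by (simp add: vec.scale_sum_right sum.distrib vec.scale_right_distrib mult.commute)
  have xP: "x i l (?P \<beta> m) = (if i \<in> Itwo \<and> l = m then \<beta> i else 0)"
    if "i \<in> I" "l \<le> a i" "m \<le> 2" for i l m \<beta>
  proof -
    have "x i l (?P \<beta> m) = (\<Sum>j\<in>Itwo. \<beta> j * x i l (b j m))"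
      using that by (simp add: linear_form_sum[OF x_lin] linear_form_scale[OF x_lin])
    also have "\<dots> = (\<Sum>j\<in>Itwo. if j = i then (if l = m then \<beta> j else 0) else 0)"
      using that by (intro sum.cong refl) (auto simp: x_b Itwo_def)
    also have "\<dots> = (if i \<in> Itwo \<and> l = m then \<beta> i else 0)"
      using finI by (simp add: Itwo_def)
    finally show ?thesis .
  qed
  have xE: "x i l (?E \<beta> (w 0) (w 1) (w 2)) = (if i \<in> Itwo then \<beta> i * w l else 0)"
    if "i \<in> I" "l \<le> a i" for i l \<beta> w
  proof -
    have "l = 0 \<or> l = 1 \<or> l = 2" if "i \<in> Itwo" using that \<open>l \<le> a i\<close> by (auto simp: Itwo_def)
    then show ?thesis using that by (cases "i \<in> Itwo") (auto simp: x_simps xP)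
  qed
  have hull: "lin_hull (conic Itwo b \<beta>) = cpts (range (\<lambda>w. ?E \<beta> (w 0) (w 1) (w (2::nat))))" for \<beta>
  proof -
    let ?S = "{?\<theta> \<beta> s t | s t. (s, t) \<noteq> (0, 0)}" and ?R = "range (\<lambda>w. ?E \<beta> (w 0) (w 1) (w (2::nat)))"
    have "conic Itwo b \<beta> = pt ` ?S" by (auto simp: conic_def)
    moreover have "vec.span ?S = ?R"
    proof
      show "vec.span ?S \<subseteq> ?R"
      proof (rule vec.span_minimal)
        show "?S \<subseteq> ?R"
        proof
          fix u assume "u \<in> ?S"
          then obtain s t where u: "u = ?\<theta> \<beta> s t" by blast
          show "u \<in> ?R" unfolding u \<theta>
            by (rule range_eqI[of _ _ "\<lambda>l. if l = 0 then s\<^sup>2 else if l = 1 then s * t else t\<^sup>2"]) simp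
        qed
        show "vec.subspace ?R"
        proof (unfold vec.subspace_def, intro conjI ballI allI)
          show "0 \<in> ?R" by (rule range_eqI[of _ _ "\<lambda>l. 0"]) simp
          fix y z assume "y \<in> ?R" "z \<in> ?R"
          then obtain w w' :: "nat \<Rightarrow> 'k" where "y = ?E \<beta> (w 0) (w 1) (w 2)" "z = ?E \<beta> (w' 0) (w' 1) (w' 2)" by auto
          then show "y + z \<in> ?R"
            by (intro range_eqI[of _ _ "\<lambda>l. w l + w' l"]) (simp add: vec.scale_left_distrib)
        next
          fix c y assume "y \<in> ?R"
          then obtain w :: "nat \<Rightarrow> 'k" where "y = ?E \<beta> (w 0) (w 1) (w 2)" by auto
          then show "c *s y \<in> ?R"
            by (intro range_eqI[of _ _ "\<lambda>l. c * w l"]) (simp add: vec.scale_right_distrib)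
        qed
      qed
      show "?R \<subseteq> vec.span ?S"
      proof clarify
        fix w :: "nat \<Rightarrow> 'k"
        have S: "?\<theta> \<beta> s t \<in> vec.span ?S" if "(s, t) \<noteq> (0, 0)" for s t
          by (rule vec.span_base) (use that in blast)
        have eq: "?P \<beta> 0 = ?\<theta> \<beta> 1 0" "?P \<beta> 2 = ?\<theta> \<beta> 0 1" unfolding \<theta> by simp_all
        have P02: "?P \<beta> 0 \<in> vec.span ?S" "?P \<beta> 2 \<in> vec.span ?S"
          unfolding eq by (rule S; simp)+
        have "?\<theta> \<beta> 1 1 - ?P \<beta> 0 - ?P \<beta> 2 \<in> vec.span ?S"
          by (intro vec.span_diff P02 S) simp
        moreover have "?\<theta> \<beta> 1 1 - ?P \<beta> 0 - ?P \<beta> 2 = ?P \<beta> 1" unfolding \<theta> by simp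
        ultimately have "?P \<beta> 1 \<in> vec.span ?S" by (simp only:)
        then show "?E \<beta> (w 0) (w 1) (w 2) \<in> vec.span ?S"
          by (intro vec.span_add vec.span_scale P02)
      qed
    qed
    ultimately show ?thesis by (simp only: lin_hull_pt)
  qed
  show ?thesis
  proof
    show "conic_planes Itwo b \<subseteq> cpts D0"
    proof
      fix p assume "p \<in> conic_planes Itwo b"
      then obtain \<beta> where "p \<in> lin_hull (conic Itwo b \<beta>)" by (auto simp: conic_planes_def)
      then obtain w where w: "p = pt (?E \<beta> (w 0) (w 1) (w (2::nat)))" "?E \<beta> (w 0) (w 1) (w 2) \<noteq> 0"
        unfolding hull cpts_def by blast
      have "?E \<beta> (w 0) (w 1) (w 2) \<in> U0"
      proof (rule U0I[of _ \<beta> w])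
        fix i l assume "i \<in> Ige3" "l \<le> a i"
        then show "x i l (?E \<beta> (w 0) (w 1) (w 2)) = 0" by (subst xE) (auto simp: Ige3_def Itwo_def)
      next
        fix i l :: nat assume "i \<in> Itwo" "l \<le> 2"
        then show "x i l (?E \<beta> (w 0) (w 1) (w 2)) = \<beta> i * w l" by (subst xE) (auto simp: Itwo_def)
      qed
      moreover have "x i l (?E \<beta> (w 0) (w 1) (w 2)) = 0" if "i \<in> Ione" "l \<le> a i" for i l
        using that by (subst xE) (auto simp: Ione_def Itwo_def)
      ultimately have "?E \<beta> (w 0) (w 1) (w 2) \<in> D0" by (simp only: D0_def) blast
      then show "p \<in> cpts D0" using w unfolding cpts_def by blast
    qed
    show "cpts D0 \<subseteq> conic_planes Itwo b"
    proof
      fix p assume "p \<in> cpts D0"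
      then obtain v where v: "v \<noteq> 0" "p = pt v" "v \<in> D0" by (auto simp: cpts_def)
      then have "v \<in> U0" by (simp add: D0_def)
      then obtain \<beta> w where w: "\<And>i l. i \<in> Ige3 \<Longrightarrow> l \<le> a i \<Longrightarrow> x i l v = 0"
        "\<And>i l. i \<in> Itwo \<Longrightarrow> l \<le> 2 \<Longrightarrow> x i l v = \<beta> i * w l" by (rule U0E) blast
      have vE: "v = ?E \<beta> (w 0) (w 1) (w 2)"
      proof (rule vec_eqI)
        fix i l assume il: "i \<in> I" "l \<le> a i"
        show "x i l v = x i l (?E \<beta> (w 0) (w 1) (w 2))"
          unfolding xE[OF il]
        proof (cases rule: index_cases[OF il(1)])
          case 1
          then show "x i l v = (if i \<in> Itwo then \<beta> i * w l else 0)"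
            using v(3) il by (auto simp: D0_def Itwo_def)
        next
          case 2
          from 2(1) show "x i l v = (if i \<in> Itwo then \<beta> i * w l else 0)"
            by (cases rule: Ige2_cases) (use w il in \<open>auto simp: Itwo_def\<close>)
        qed
      qed
      have "\<exists>j\<in>Itwo. \<beta> j \<noteq> 0"
      proof (rule ccontr)
        assume "\<not> ?thesis"
        then have "?P \<beta> l = 0" for l by (intro sum.neutral) simp
        then show False using v(1) vE by simp
      qed
      moreover have "p \<in> lin_hull (conic Itwo b \<beta>)" unfolding hull using v(1,2) vE unfolding cpts_def by blast
      ultimately show "p \<in> conic_planes Itwo b" unfolding conic_planes_def by blast
    qed
  qed
qed

text \<open>
  Each stratum has the asserted type of secant locus, and the strata exhaust the points off \<open>X\<close>; as
  the types exclude each other, this determines them.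
\<close>

lemma classification:
  assumes v: "v \<noteq> 0" "v \<notin> Cone I"
  defines "X \<equiv> cpts (Cone I)"
  shows "(pt v \<in> SL_empty X \<longleftrightarrow> v \<notin> SecC) \<and>
    (pt v \<in> SL_two_points X \<longleftrightarrow> v \<in> SecC \<and> v \<notin> TanC) \<and>
    (pt v \<in> SL_double_point X \<longleftrightarrow> v \<in> TanC \<and> v \<notin> B0 \<union> U0) \<and>
    (pt v \<in> SL_line_pair X \<longleftrightarrow> v \<in> B0 \<and> v \<notin> A0) \<and>
    (pt v \<in> SL_conic X \<longleftrightarrow> v \<in> U0 \<and> v \<notin> B0) \<and>
    (pt v \<in> SL_quadric X \<longleftrightarrow> v \<in> A0)"
proof -
  let ?J = "secant_locus X (pt v)"
  note incl = A0_subset_B0 A0_subset_U0 B0_subset_TanC U0_subset_TanC TanC_SecC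
  have sup: "support_is_zero_locus ?J"
    using stratum_empty(2)[OF _ v(1)] stratum_two_points(2)[of v] stratum_double_point(2)[of v]
      stratum_line_pair(2)[OF _ _ v(2)] stratum_conic(2)[of v] stratum_quadric(2)[OF _ v(2)]
    unfolding X_def by blast
  note rank = SL_empty_rank[of "pt v" X] SL_two_points_rank[of "pt v" X] SL_double_point_rank[OF _ sup]
    SL_line_pair_rank[of "pt v" X] SL_conic_rank[of "pt v" X] SL_quadric_rank[of "pt v" X]
  have excl: "\<not> (pt v \<in> SL_line_pair X \<and> pt v \<in> SL_conic X)" using SL_line_pair_not_conic by blast
  have cover: "(v \<notin> SecC \<longrightarrow> pt v \<in> SL_empty X) \<and> (v \<in> SecC \<and> v \<notin> TanC \<longrightarrow> pt v \<in> SL_two_points X) \<and>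
     (v \<in> TanC \<and> v \<notin> B0 \<union> U0 \<longrightarrow> pt v \<in> SL_double_point X) \<and> (v \<in> B0 \<and> v \<notin> A0 \<longrightarrow> pt v \<in> SL_line_pair X) \<and>
     (v \<in> U0 \<and> v \<notin> B0 \<longrightarrow> pt v \<in> SL_conic X) \<and> (v \<in> A0 \<longrightarrow> pt v \<in> SL_quadric X)"
    unfolding X_def using stratum_empty(1)[OF _ v(1)] stratum_two_points(1) stratum_double_point(1)
      stratum_line_pair(1)[OF _ _ v(2)] stratum_conic(1) stratum_quadric(1)[OF _ v(2)] by blast
  consider "v \<notin> SecC" | "v \<in> SecC" "v \<notin> TanC" | "v \<in> TanC" "v \<notin> B0 \<union> U0" | "v \<in> B0" "v \<notin> A0"
    | "v \<in> U0" "v \<notin> B0" | "v \<in> A0" by blast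
  then show ?thesis
  proof cases
    case 1
    then have "pt v \<in> SL_empty X" using cover by blast
    moreover from this have "support_rank ?J = 0" by (rule rank)
    ultimately show ?thesis using rank(2-6) 1 incl by auto
  next
    case 2
    then have "pt v \<in> SL_two_points X" using cover by blast
    moreover from this have "support_rank ?J = 2" by (rule rank)
    ultimately show ?thesis using rank(1,3-6) 2 incl by auto
  next
    case 3
    then have "pt v \<in> SL_double_point X" using cover by blast
    moreover from this have "support_rank ?J = 1" by (rule rank)
    ultimately show ?thesis using rank(1,2,4-6) 3 incl by auto
  next
    case 4
    then have "pt v \<in> SL_line_pair X" using cover by blast
    moreover from this have "support_rank ?J = 3" by (rule rank)
    ultimately show ?thesis using rank(1-3,6) excl 4 incl by auto
  next
    case 5
    then have "pt v \<in> SL_conic X" using cover by blast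
    moreover from this have "support_rank ?J = 3" by (rule rank)
    ultimately show ?thesis using rank(1-3,6) excl 5 incl by auto
  next
    case 6
    then have "pt v \<in> SL_quadric X" using cover by blast
    moreover from this have "support_rank ?J = 4" by (rule rank)
    ultimately show ?thesis using rank(1-5) 6 incl by auto
  qed
qed

lemma secant_stratification:
  defines "X \<equiv> cpts (Cone I)" and "A \<equiv> cpts A0" and "B \<equiv> cpts B0" and "U \<equiv> cpts U0"
  shows "X \<subseteq> B \<and> A \<subseteq> B \<inter> U \<and> B \<union> U \<subseteq> Tan X \<and>
    SL_empty X = points - Sec X \<and>
    SL_two_points X = Sec X - Tan X \<and>
    SL_double_point X = Tan X - (B \<union> U) \<and>
    SL_line_pair X = B - (A \<union> X) \<and>
    SL_conic X = U - B \<and>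
    SL_quadric X = A - X"
proof -
  note incl = A0_subset_B0 A0_subset_U0 B0_subset_TanC U0_subset_TanC TanC_SecC Cone_subset_B0
  have mono: "cpts S \<subseteq> cpts T" if "S \<subseteq> T" for S T :: "('k ^ 'v) set" using that by (auto simp: cpts_def)
  have SLX: "p \<in> points \<and> p \<notin> X" if "p \<in> SL_empty X \<or> p \<in> SL_two_points X \<or> p \<in> SL_double_point X \<or>
      p \<in> SL_line_pair X \<or> p \<in> SL_conic X \<or> p \<in> SL_quadric X" for p
    using that by (auto simp: SL_empty_def SL_two_points_def SL_double_point_def SL_line_pair_def SL_conic_def SL_quadric_def)
  have pts: "S = T" if "S \<subseteq> points" "T \<subseteq> points" "\<And>v. v \<noteq> 0 \<Longrightarrow> pt v \<in> S \<longleftrightarrow> pt v \<in> T" for S T :: "('k ^ 'v) set set"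
    using that by (auto simp: points_def)
  have mem: "pt v \<in> X \<longleftrightarrow> v \<in> Cone I" "pt v \<in> A \<longleftrightarrow> v \<in> A0" "pt v \<in> B \<longleftrightarrow> v \<in> B0" "pt v \<in> U \<longleftrightarrow> v \<in> U0"
    "pt v \<in> Sec X \<longleftrightarrow> v \<in> SecC" "pt v \<in> Tan X \<longleftrightarrow> v \<in> TanC" if "v \<noteq> 0" for v
    unfolding X_def A_def B_def U_def Sec_eq Tan_eq
    using pt_in_cpts_iff[OF _ that] Cone_cone index_sets(3) cone_subspace[OF A0_subspace] cone_U0 cone_SecC cone_TanC
    by auto
  have sub: "X \<subseteq> points" "A \<subseteq> points" "B \<subseteq> points" "U \<subseteq> points" "Sec X \<subseteq> points" "Tan X \<subseteq> points"
    unfolding X_def A_def B_def U_def Sec_eq Tan_eq by (rule cpts_points)+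
  have cls: "v \<notin> Cone I \<Longrightarrow> (pt v \<in> SL_empty X \<longleftrightarrow> v \<notin> SecC) \<and>
    (pt v \<in> SL_two_points X \<longleftrightarrow> v \<in> SecC \<and> v \<notin> TanC) \<and>
    (pt v \<in> SL_double_point X \<longleftrightarrow> v \<in> TanC \<and> v \<notin> B0 \<union> U0) \<and>
    (pt v \<in> SL_line_pair X \<longleftrightarrow> v \<in> B0 \<and> v \<notin> A0) \<and>
    (pt v \<in> SL_conic X \<longleftrightarrow> v \<in> U0 \<and> v \<notin> B0) \<and>
    (pt v \<in> SL_quadric X \<longleftrightarrow> v \<in> A0)" if "v \<noteq> 0" for v
    using classification[OF that] unfolding X_def by blast
  have onX: "v \<in> Cone I \<Longrightarrow> pt v \<notin> SL_empty X \<and> pt v \<notin> SL_two_points X \<and> pt v \<notin> SL_double_point X \<and>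
      pt v \<notin> SL_line_pair X \<and> pt v \<notin> SL_conic X \<and> pt v \<notin> SL_quadric X" if "v \<noteq> 0" for v
    using SLX[of "pt v"] mem(1)[OF that] by blast
  have "X \<subseteq> B" "A \<subseteq> B \<inter> U" "B \<union> U \<subseteq> Tan X"
    unfolding X_def A_def B_def U_def Tan_eq using mono incl by blast+
  moreover have "SL_empty X = points - Sec X"
  proof (rule pts)
    show "pt v \<in> SL_empty X \<longleftrightarrow> pt v \<in> points - Sec X" if "v \<noteq> 0" for v
      using cls[OF that] onX[OF that] mem[OF that] incl pt_in_points[OF that] by blast
  qed (use SLX sub in blast)+
  moreover have "SL_two_points X = Sec X - Tan X"
  proof (rule pts)
    show "pt v \<in> SL_two_points X \<longleftrightarrow> pt v \<in> Sec X - Tan X" if "v \<noteq> 0" for v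
      using cls[OF that] onX[OF that] mem[OF that] incl by blast
  qed (use SLX sub in blast)+
  moreover have "SL_double_point X = Tan X - (B \<union> U)"
  proof (rule pts)
    show "pt v \<in> SL_double_point X \<longleftrightarrow> pt v \<in> Tan X - (B \<union> U)" if "v \<noteq> 0" for v
      using cls[OF that] onX[OF that] mem[OF that] incl by blast
  qed (use SLX sub in blast)+
  moreover have "SL_line_pair X = B - (A \<union> X)"
  proof (rule pts)
    show "pt v \<in> SL_line_pair X \<longleftrightarrow> pt v \<in> B - (A \<union> X)" if "v \<noteq> 0" for v
      using cls[OF that] onX[OF that] mem[OF that] incl by blast
  qed (use SLX sub in blast)+
  moreover have "SL_conic X = U - B"
  proof (rule pts)
    show "pt v \<in> SL_conic X \<longleftrightarrow> pt v \<in> U - B" if "v \<noteq> 0" for v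
      using cls[OF that] onX[OF that] mem[OF that] incl by blast
  qed (use SLX sub in blast)+
  moreover have "SL_quadric X = A - X"
  proof (rule pts)
    show "pt v \<in> SL_quadric X \<longleftrightarrow> pt v \<in> A - X" if "v \<noteq> 0" for v
      using cls[OF that] onX[OF that] mem[OF that] incl by blast
  qed (use SLX sub in blast)+
  ultimately show ?thesis by blast
qed

end

text \<open>
  The \<open>b i l\<close> span \<open>K\<^sup>V\<close> and there are at most \<open>CARD('v)\<close> of them, so that they are a basis without
  repetitions.
\<close>

lemma scroll_coords_exists:
  fixes b :: "nat \<Rightarrow> nat \<Rightarrow> 'k::alg_closed_field ^ 'v::finite"
  assumes I: "finite I" "I \<noteq> {}" "\<And>i. i \<in> I \<Longrightarrow> 1 \<le> a i"
    and card: "CARD('v) = (\<Sum>i\<in>I. a i + 1)"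
    and span: "vec.span (\<Union>i\<in>I. b i ` {..a i}) = UNIV"
  shows "\<exists>x. scroll_coords I a b x"
proof -
  let ?S = "SIGMA i:I. {..a i}"
  let ?f = "\<lambda>(i, l). b i l"
  let ?B = "?f ` ?S"
  have fin: "finite ?S" using I(1) by simp
  have B: "?B = (\<Union>i\<in>I. b i ` {..a i})" by force
  have cS: "card ?S = CARD('v)" using I(1) by (simp add: card)
  have dim: "vec.dim (UNIV :: ('k ^ 'v) set) = CARD('v)" by (simp add: vec.dim_UNIV card_cart_basis)
  have le: "card ?B \<le> CARD('v)" using card_image_le[OF fin, of ?f] cS by simp
  have "vec.dim (UNIV :: ('k ^ 'v) set) \<le> card ?B"
    using span fin by (intro vec.dim_le_card) (auto simp: B[symmetric])
  then have "card ?B = card ?S" using le cS dim by simp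
  then have inj: "inj_on ?f ?S" by (rule eq_card_imp_inj_on[OF fin])
  have ind: "vec.independent ?B"
    by (rule vec.card_le_dim_spanning[of _ UNIV]) (use span fin le dim in \<open>auto simp: B[symmetric]\<close>)
  have spB: "vec.span ?B = UNIV" using span B by simp
  define x where "x = (\<lambda>i l v. vec.representation ?B v (b i l))"
  have "scroll_coords I a b x"
  proof
    show "linear_form (x i l)" if "i \<in> I" "l \<le> a i" for i l
      using ind spB by (simp add: x_def linear_form_def vec.representation_add vec.representation_scale)
    show "x i l (b j m) = (if i = j \<and> l = m then 1 else 0)" if "i \<in> I" "l \<le> a i" "j \<in> I" "m \<le> a j" for i l j m
    proof -
      have "b j m \<in> ?B" using that by force
      then have "x i l (b j m) = (if b j m = b i l then 1 else 0)"
        using vec.representation_basis[OF ind] by (auto simp: x_def)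
      moreover have "b j m = b i l \<longleftrightarrow> i = j \<and> l = m"
        using inj_onD[OF inj, of "(j, m)" "(i, l)"] that by auto
      ultimately show ?thesis by simp
    qed
    show "v = (\<Sum>i\<in>I. \<Sum>l\<le>a i. x i l v *s b i l)" for v
    proof -
      have "v = (\<Sum>w\<in>?B. vec.representation ?B v w *s w)"
        using vec.sum_representation_eq[OF ind, of v ?B] spB fin by simp
      also have "\<dots> = (\<Sum>(i, l)\<in>?S. x i l v *s b i l)"
        by (subst sum.reindex[OF inj]) (simp add: x_def case_prod_beta)
      also have "\<dots> = (\<Sum>i\<in>I. \<Sum>l\<le>a i. x i l v *s b i l)"
        using I(1) by (simp add: sum.Sigma)
      finally show ?thesis .
    qed
  qed (use I in auto)
  then show ?thesis by blast
qed

lemma initial_segment: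
  fixes S :: "nat set"
  assumes "finite S" "0 \<notin> S" "\<And>i j. i \<in> S \<Longrightarrow> 1 \<le> j \<Longrightarrow> j \<le> i \<Longrightarrow> j \<in> S"
  shows "S = {1..card S}"
proof (cases "S = {}")
  case False
  have "S = {1..Max S}"
  proof (intro subset_antisym subsetI)
    fix i assume "i \<in> S"
    then show "i \<in> {1..Max S}" using assms(1,2) by (cases i) auto
  next
    fix i assume "i \<in> {1..Max S}"
    then show "i \<in> S" using assms(3)[of "Max S" i] Max_in[OF assms(1) False] by simp
  qed
  then show ?thesis by (metis card_atLeastAtMost diff_Suc_1 Suc_eq_plus1 One_nat_def)
qed simp

theorem theorem4p2:
  fixes n k m :: nat and a :: "nat \<Rightarrow> nat"
    and \<Lambda> :: "nat \<Rightarrow> ('k::alg_closed_field ^ 'v::finite) set"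
    and b :: "nat \<Rightarrow> nat \<Rightarrow> 'k ^ 'v"
    and \<phi> :: "nat \<Rightarrow> ('k ^ 2) set \<Rightarrow> ('k ^ 'v) set"
    and X S1 \<Delta> A B U :: "('k ^ 'v) set set"
  assumes "n \<ge> 1"
    and "\<forall>i\<in>{1..n}. 1 \<le> a i"
    and "\<forall>i\<in>{1..n}. \<forall>j\<in>{1..n}. i \<le> j \<longrightarrow> a i \<le> a j"
    and "(\<Sum>i=1..n. a i) \<ge> 3"
    and "CARD('v) = (\<Sum>i=1..n. a i) + n"
    and "\<forall>i\<in>{1..n}. rational_normal_curve (a i) (\<Lambda> i) (b i) (\<phi> i)"
    and "\<forall>i\<in>{1..n}. \<Lambda> i \<inter> vec.span (\<Union>j\<in>{1..n} - {i}. \<Lambda> j) = {0}"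
    and "vec.span (\<Union>i\<in>{1..n}. \<Lambda> i) = UNIV"
    and "k = card {i\<in>{1..n}. a i = 1}"
    and "m = card {i\<in>{1..n}. a i \<le> 2}"
    and "X = scroll {1..n} \<phi>"
    and "S1 = scroll {1..k} \<phi>"
    and "\<Delta> = conic_planes {k<..m} b"
    and "A = lin_hull S1"
    and "B = join S1 X"
    and "U = join A \<Delta>"
  shows "X \<subseteq> B \<and> A \<subseteq> B \<inter> U \<and> B \<union> U \<subseteq> Tan X \<and>
    SL_empty X = points - Sec X \<and>
    SL_two_points X = Sec X - Tan X \<and>
    SL_double_point X = Tan X - (B \<union> U) \<and>
    SL_line_pair X = B - (A \<union> X) \<and>
    SL_conic X = U - B \<and>
    SL_quadric X = A - X"
proof -
  note [simp del] = One_nat_def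
  let ?I = "{1..n}"
  have \<Lambda>: "vec.span (b i ` {..a i}) = \<Lambda> i" if "i \<in> ?I" for i
    using assms(6) that by (simp add: rational_normal_curve_def)
  have "vec.span (\<Union>i\<in>?I. b i ` {..a i}) = UNIV"
  proof -
    have "\<Lambda> i \<subseteq> vec.span (\<Union>i\<in>?I. b i ` {..a i})" if "i \<in> ?I" for i
      unfolding \<Lambda>[OF that, symmetric] using that by (intro vec.span_mono) blast
    then have "vec.span (\<Union>i\<in>?I. \<Lambda> i) \<subseteq> vec.span (\<Union>i\<in>?I. b i ` {..a i})"
      by (intro vec.span_minimal UN_least vec.subspace_span)
    then show ?thesis using assms(8) by blast
  qed
  moreover have "CARD('v) = (\<Sum>i\<in>?I. a i + 1)" using assms(5) unfolding sum.distrib by simp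
  ultimately obtain x where "scroll_coords ?I a b x"
    using scroll_coords_exists[of ?I a b] assms(1,2) by fastforce
  then interpret scroll_coords ?I a b x .
  have \<phi>: "\<phi> i (pt u) = pt (\<Sum>l\<le>a i. ((u $ 1) ^ (a i - l) * (u $ 2) ^ l) *s b i l)"
    if "i \<in> ?I" "u \<noteq> 0" for i u
    using assms(6) that by (simp add: rational_normal_curve_def)
  have k: "Ione = {1..k}"
  proof -
    have "{i \<in> ?I. a i = 1} = {1..card {i \<in> ?I. a i = 1}}"
    proof (rule initial_segment)
      fix i j assume "i \<in> {i \<in> ?I. a i = 1}" "1 \<le> j" "j \<le> i"
      moreover from this have "j \<in> ?I" "i \<in> ?I" by auto
      then have "1 \<le> a j" "a j \<le> a i" using assms(2,3) \<open>j \<le> i\<close> by blast+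
      ultimately show "j \<in> {i \<in> ?I. a i = 1}" by auto
    qed auto
    then show ?thesis unfolding Ione_def assms(9) .
  qed
  have m: "{i \<in> ?I. a i \<le> 2} = {1..m}"
  proof -
    have "{i \<in> ?I. a i \<le> 2} = {1..card {i \<in> ?I. a i \<le> 2}}"
    proof (rule initial_segment)
      fix i j assume "i \<in> {i \<in> ?I. a i \<le> 2}" "1 \<le> j" "j \<le> i"
      moreover from this have "j \<in> ?I" "i \<in> ?I" by auto
      then have "a j \<le> a i" using assms(3) \<open>j \<le> i\<close> by blast
      ultimately show "j \<in> {i \<in> ?I. a i \<le> 2}" by auto
    qed auto
    then show ?thesis unfolding assms(10) .
  qed
  have "{k<..m} = {1..m} - {1..k}" by auto
  also have "\<dots> = Itwo"
  proof (intro subset_antisym subsetI)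
    fix i assume i: "i \<in> {1..m} - {1..k}"
    then have "i \<in> {i \<in> ?I. a i \<le> 2}" "i \<notin> Ione" unfolding m k by blast+
    then have i: "i \<in> ?I" "a i \<le> 2" "a i \<noteq> 1" by (simp_all add: Ione_def)
    then have "1 \<le> a i" using assms(2) by blast
    then show "i \<in> Itwo" using i unfolding Itwo_def by auto
  next
    fix i assume "i \<in> Itwo"
    then have "i \<in> {i \<in> ?I. a i \<le> 2}" "i \<notin> Ione" by (simp_all add: Itwo_def Ione_def)
    then show "i \<in> {1..m} - {1..k}" unfolding m k by blast
  qed
  finally have "\<Delta> = cpts D0" using assms(13) conic_planes_eq by simp
  moreover have X: "X = cpts (Cone ?I)"
    using scroll_eq_cpts[of ?I \<phi>] \<phi> assms(11) by simp
  moreover have S1: "S1 = cpts (Cone ?I \<inter> A0)"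
  proof -
    have "?I - Ione = Ige2" using assms(2) by (force simp: Ione_def Ige2_def)
    then have "{v \<in> Cone ?I. \<forall>i\<in>?I - Ione. \<forall>l\<le>a i. x i l v = 0} = Cone ?I \<inter> A0" by (auto simp: A0_def)
    then show ?thesis using scroll_eq_cpts[OF index_sets(1), of \<phi>] \<phi> index_sets(1) assms(12) k by auto
  qed
  moreover have "A = cpts A0" using lin_hull_S1 S1 assms(14) by simp
  moreover have "B = cpts B0" using join_S1_X S1 X assms(15) by simp
  ultimately show ?thesis
    using secant_stratification join_A_Delta assms(16) by simp
qed

end
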